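(* Let $G$ be a finite group with identity $e$, and let $R$ be an $\mathbb{N}\times G$-graded $k$-algebra such that $R_{0,e}=k$, $R_{0,g}=0$ for $g\ne e$, and $R_i=\bigoplus_{g\in G}R_{i,g}$ is finite dimensional for all $i\ge0$. If $R$ is a $d$-Koszul Calabi-Yau algebra of dimension $p$ (Calabi-Yau as an $\mathbb{N}\times G$-graded algebra), then $R\#kG^*$ is also a $d$-Koszul Calabi-Yau algebra of dimension $p$ (as an $\mathbb{N}$-graded algebra).
   Context: $k$ is an algebraically closed field of characteristic zero. $kG^*=(kG)^*$ is the dual Hopf algebra of the group algebra, with basis $\{p_g\}_{g\in G}$ dual to $G$. The $\mathbb{N}\times G$-graded algebra $R$ is an $\mathbb{N}$-graded $kG^*$-module algebra, $p_g$ acting as the projection onto $\bigoplus_i R_{i,g}$. The smash product $R\#kG^*$ is $R\otimes kG^*$ with product $(a\#h)(b\#h')=a(h_{(1)}\cdot b)\#h_{(2)}h'$, $\mathbb{N}$-graded by $(R\#kG^* )_n=R_n\#kG^*$. Homogeneous and $d$-Koszul algebras: let $B=\bigoplus_{n\ge0}B_n$ be a graded algebra with $B_0$ semisimple, all $B_i$ finite dimensional and $B_iB_j=B_{i+j}$. $B$ is homogeneous if $B\cong T_{B_0}(B_1)/I$ with $I$ generated by elements of $B_1\otimes_{B_0}\cdots\otimes_{B_0}B_1$ ($d$ factors, $d\ge2$). A homogeneous algebra $B$ is $d$-Koszul if the trivial module $B_0$ has a graded projective resolution $\cdots\to P^{-n}\to\cdots\to P^0\to B_0\to0$ with $P^{-n}$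 generated in degree $\frac n2d$ for $n$ even and $\frac{n-1}2d+1$ for $n$ odd. Calabi-Yau: with $B^e=B\otimes B^{op}$, a positively graded algebra $B$ is (graded) Calabi-Yau of dimension $p$ if (i) $B$ is homologically smooth, i.e. $B$ has, as a $B^e$-module, a finite-length projective resolution by finitely generated modules; and (ii) there are graded $B$-$B$-bimodule isomorphisms $\operatorname{Ext}^i_{B^e}(B,B^e)=0$ for $i\ne p$ and $\operatorname{Ext}^p_{B^e}(B,B^e)\cong B(l)$ for some integer $l$, where $(l)$ denotes degree shift. An $\mathbb{N}\times G$-graded algebra $R$ is called Calabi-Yau of dimension $p$ if moreover the isomorphism $\operatorname{Ext}^p_{R^e}(R,R^e)\cong R(l)$ can be chosen to be also an isomorphism of $G$-graded spaces. Here the $G$-grading on $\operatorname{Ext}^p_{R^e}(R,R^e)$ is the one induced from a resolution $P$ of $R$ by finitely generated projective $\mathbb{N}\times G$-graded bimodules: $f\in\operatorname{Hom}_{R^e}(P,R\otimes R)$ (outer bimodule structure on $R\otimes R$) has $G$-degree $g$ if for each $h\in G$ it sends elements of $G$-degree $h$ into the sum of those $R_{*,a}\otimes R_{*,b}$ with $b\,h^{-1}a=g$ (for abelian $G$ this is the usual degree of a homogeneous map). *)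

theory Defs
  imports
    "HOL-Computational_Algebra.Polynomial"
    "HOL-Library.Function_Algebras"
    "HOL-Library.Product_Plus"
    "HOL-Library.Groups_Big_Fun"
begin

text \<open>
  Conventions. An algebra lives on a whole type and is given by a record; modules are additive
  subgroups (carriers) of a type. Addition is always that of the type; on functions it is pointwise.
\<close>

section \<open>Algebras and gradings\<close>

record ('k, 'b) alg =
  alg_scale :: "'k \<Rightarrow> 'b \<Rightarrow> 'b"
  alg_mult :: "'b \<Rightarrow> 'b \<Rightarrow> 'b"  (infixl \<open>\<cdot>\<index>\<close> 70)
  alg_one :: 'b

definition algebra :: "('k::field, 'b::ab_group_add) alg \<Rightarrow> bool" where
  "algebra A \<longleftrightarrow>
     vector_space (alg_scale A) \<and>
     monoid (alg_mult A) (alg_one A) \<and>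
     (\<forall>x y z. (x + y) \<cdot>\<^bsub>A\<^esub> z = x \<cdot>\<^bsub>A\<^esub> z + y \<cdot>\<^bsub>A\<^esub> z \<and> z \<cdot>\<^bsub>A\<^esub> (x + y) = z \<cdot>\<^bsub>A\<^esub> x + z \<cdot>\<^bsub>A\<^esub> y) \<and>
     (\<forall>c x y. alg_scale A c x \<cdot>\<^bsub>A\<^esub> y = alg_scale A c (x \<cdot>\<^bsub>A\<^esub> y) \<and>
              x \<cdot>\<^bsub>A\<^esub> alg_scale A c y = alg_scale A c (x \<cdot>\<^bsub>A\<^esub> y))"

definition add_subgroup :: "'v::ab_group_add set \<Rightarrow> bool" where
  "add_subgroup H \<longleftrightarrow> 0 \<in> H \<and> (\<forall>x\<in>H. \<forall>y\<in>H. x - y \<in> H)"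

definition families :: "('i \<Rightarrow> 'v::ab_group_add set) \<Rightarrow> ('i \<Rightarrow> 'v) set" where
  "families D = {f. (\<forall>i. f i \<in> D i) \<and> finite {i. f i \<noteq> 0}}"

definition direct_sum :: "'v::ab_group_add set \<Rightarrow> ('i \<Rightarrow> 'v set) \<Rightarrow> bool" where
  "direct_sum V D \<longleftrightarrow> (\<forall>i. add_subgroup (D i)) \<and> bij_betw Sum_any (families D) V"

definition sum_space :: "('i \<Rightarrow> 'v::ab_group_add set) \<Rightarrow> 'v set" where
  "sum_space D = Sum_any ` families D"

definition component :: "('i \<Rightarrow> 'v::ab_group_add set) \<Rightarrow> 'i \<Rightarrow> 'v \<Rightarrow> 'v" where
  "component D i x = inv_into (families D) Sum_any x i"

definition graded_algebra ::
    "('k::field, 'b::ab_group_add) alg \<Rightarrow> ('i::monoid_add \<Rightarrow> 'b set) \<Rightarrow> bool" where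
  "graded_algebra A D \<longleftrightarrow>
     algebra A \<and>
     (\<forall>i. module.subspace (alg_scale A) (D i)) \<and>
     direct_sum UNIV D \<and>
     alg_one A \<in> D 0 \<and>
     (\<forall>i j. \<forall>a\<in>D i. \<forall>b\<in>D j. a \<cdot>\<^bsub>A\<^esub> b \<in> D (i + j))"

definition finite_dim :: "('k::field, 'b::ab_group_add) alg \<Rightarrow> 'b set \<Rightarrow> bool" where
  "finite_dim A V \<longleftrightarrow> (\<exists>X. finite X \<and> V = module.span (alg_scale A) X)"

text \<open>
  The two coarsenings of a grading by \<open>nat \<times> 'g\<close>. The group \<open>'g\<close> is arbitrary: \<^class>\<open>group_add\<close>
  is the additively written class of not necessarily commutative groups, so the identity is \<open>0\<close>
  and the order of summands matters.
\<close>

definition N_part :: "(nat \<times> 'g \<Rightarrow> 'v::ab_group_add set) \<Rightarrow> nat \<Rightarrow> 'v set" where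
  "N_part D n = sum_space (\<lambda>g. D (n, g))"

definition G_part :: "(nat \<times> 'g \<Rightarrow> 'v::ab_group_add set) \<Rightarrow> 'g \<Rightarrow> 'v set" where
  "G_part D g = sum_space (\<lambda>n. D (n, g))"


section \<open>Modules and bimodules\<close>

record ('b, 'm) lmod =
  carrier :: "'m set"
  lact :: "'b \<Rightarrow> 'm \<Rightarrow> 'm"

record ('b, 'm) bimod = "('b, 'm) lmod" +
  ract :: "'m \<Rightarrow> 'b \<Rightarrow> 'm"

definition left_module ::
    "('k::field, 'b::ab_group_add) alg \<Rightarrow> ('b, 'm::ab_group_add, 'z) lmod_scheme \<Rightarrow> bool" where
  "left_module A M \<longleftrightarrow>
     add_subgroup (carrier M) \<and>
     (\<forall>a. \<forall>x\<in>carrier M. lact M a x \<in> carrier M) \<and>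
     (\<forall>a. \<forall>x\<in>carrier M. \<forall>y\<in>carrier M. lact M a (x + y) = lact M a x + lact M a y) \<and>
     (\<forall>a b. \<forall>x\<in>carrier M. lact M (a + b) x = lact M a x + lact M b x) \<and>
     (\<forall>a b. \<forall>x\<in>carrier M. lact M (a \<cdot>\<^bsub>A\<^esub> b) x = lact M a (lact M b x)) \<and>
     (\<forall>x\<in>carrier M. lact M (alg_one A) x = x)"

text \<open>Modules over \<open>A \<otimes> A\<^sup>o\<^sup>p\<close>, that is, bimodules on which the ground field acts centrally.\<close>

definition bimodule ::
    "('k::field, 'b::ab_group_add) alg \<Rightarrow> ('b, 'm::ab_group_add) bimod \<Rightarrow> bool" where
  "bimodule A M \<longleftrightarrow>
     left_module A M \<and>
     (\<forall>a. \<forall>x\<in>carrier M. ract M x a \<in> carrier M) \<and>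
     (\<forall>a. \<forall>x\<in>carrier M. \<forall>y\<in>carrier M. ract M (x + y) a = ract M x a + ract M y a) \<and>
     (\<forall>a b. \<forall>x\<in>carrier M. ract M x (a + b) = ract M x a + ract M x b) \<and>
     (\<forall>a b. \<forall>x\<in>carrier M. ract M x (a \<cdot>\<^bsub>A\<^esub> b) = ract M (ract M x a) b) \<and>
     (\<forall>x\<in>carrier M. ract M x (alg_one A) = x) \<and>
     (\<forall>a b. \<forall>x\<in>carrier M. ract M (lact M a x) b = lact M a (ract M x b)) \<and>
     (\<forall>c. \<forall>x\<in>carrier M. lact M (alg_scale A c (alg_one A)) x = ract M x (alg_scale A c (alg_one A)))"

definition lmod_hom ::
    "('b, 'm::ab_group_add, 'y) lmod_scheme \<Rightarrow> ('b, 'n::ab_group_add, 'z) lmod_scheme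
      \<Rightarrow> ('m \<Rightarrow> 'n) \<Rightarrow> bool" where
  "lmod_hom M N f \<longleftrightarrow>
     f ` carrier M \<subseteq> carrier N \<and>
     (\<forall>x\<in>carrier M. \<forall>y\<in>carrier M. f (x + y) = f x + f y) \<and>
     (\<forall>a. \<forall>x\<in>carrier M. f (lact M a x) = lact N a (f x))"

definition bimod_hom ::
    "('b, 'm::ab_group_add) bimod \<Rightarrow> ('b, 'n::ab_group_add) bimod \<Rightarrow> ('m \<Rightarrow> 'n) \<Rightarrow> bool" where
  "bimod_hom M N f \<longleftrightarrow>
     lmod_hom M N f \<and> (\<forall>a. \<forall>x\<in>carrier M. f (ract M x a) = ract N (f x) a)"

definition graded_left_module ::
    "('k::field, 'b::ab_group_add) alg \<Rightarrow> ('i::monoid_add \<Rightarrow> 'b set)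
      \<Rightarrow> ('b, 'm::ab_group_add, 'z) lmod_scheme \<Rightarrow> ('i \<Rightarrow> 'm set) \<Rightarrow> bool" where
  "graded_left_module A D M gr \<longleftrightarrow>
     left_module A M \<and> direct_sum (carrier M) gr \<and>
     (\<forall>i j. \<forall>a\<in>D i. \<forall>x\<in>gr j. lact M a x \<in> gr (i + j))"

definition graded_bimodule ::
    "('k::field, 'b::ab_group_add) alg \<Rightarrow> ('i::monoid_add \<Rightarrow> 'b set)
      \<Rightarrow> ('b, 'm::ab_group_add) bimod \<Rightarrow> ('i \<Rightarrow> 'm set) \<Rightarrow> bool" where
  "graded_bimodule A D M gr \<longleftrightarrow>
     bimodule A M \<and> graded_left_module A D M gr \<and>
     (\<forall>i j. \<forall>a\<in>D i. \<forall>x\<in>gr j. ract M x a \<in> gr (j + i))"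

definition generated_in ::
    "('b, 'm::ab_group_add, 'z) lmod_scheme \<Rightarrow> 'm set \<Rightarrow> bool" where
  "generated_in M X \<longleftrightarrow> carrier M = add_subgroup hull {lact M a x |a x. x \<in> X}"

definition fin_gen_bimodule :: "('b, 'm::ab_group_add) bimod \<Rightarrow> bool" where
  "fin_gen_bimodule M \<longleftrightarrow>
     (\<exists>X. finite X \<and> X \<subseteq> carrier M \<and>
        carrier M = add_subgroup hull {lact M a (ract M x b) |a b x. x \<in> X})"


section \<open>The tensor square\<close>

text \<open>
  The tensor product \<open>A \<otimes> A\<close> over the field \<open>'k\<close> is realised as the span, in the dual of the space
  of bilinear forms on \<open>A\<close>, of the evaluation functionals \<open>x \<otimes> y: \<beta> \<mapsto> \<beta> x y\<close>. Since bilinear forms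
  separate the elements of the tensor product this is the usual tensor product. Scalars can be
  absorbed into \<open>x\<close>, so the additive subgroup generated by the \<open>x \<otimes> y\<close> is their linear span.
\<close>

type_synonym ('k, 'b) tens = "('b \<Rightarrow> 'b \<Rightarrow> 'k) \<Rightarrow> 'k"

definition bilinear_form ::
    "('k::field, 'b::ab_group_add) alg \<Rightarrow> ('b \<Rightarrow> 'b \<Rightarrow> 'k) \<Rightarrow> bool" where
  "bilinear_form A \<beta> \<longleftrightarrow>
     (\<forall>y. Vector_Spaces.linear (alg_scale A) (*) (\<lambda>x. \<beta> x y)) \<and>
     (\<forall>x. Vector_Spaces.linear (alg_scale A) (*) (\<lambda>y. \<beta> x y))"

definition tensor ::
    "('k::field, 'b::ab_group_add) alg \<Rightarrow> 'b \<Rightarrow> 'b \<Rightarrow> ('k, 'b) tens" where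
  "tensor A x y = (\<lambda>\<beta>. if bilinear_form A \<beta> then \<beta> x y else 0)"

definition tensor_square :: "('k::field, 'b::ab_group_add) alg \<Rightarrow> ('k, 'b) tens set" where
  "tensor_square A = add_subgroup hull {tensor A x y |x y. True}"

text \<open>For linear \<open>f\<close> and \<open>g\<close>, the map \<open>f \<otimes> g\<close>.\<close>

definition tensor_map ::
    "('k::field, 'b::ab_group_add) alg \<Rightarrow> ('b \<Rightarrow> 'b) \<Rightarrow> ('b \<Rightarrow> 'b)
      \<Rightarrow> ('k, 'b) tens \<Rightarrow> ('k, 'b) tens" where
  "tensor_map A f g t = (\<lambda>\<beta>. if bilinear_form A \<beta> then t (\<lambda>x y. \<beta> (f x) (g y)) else 0)"

text \<open>Outer structure \<open>a (x \<otimes> y) b = a x \<otimes> y b\<close>, inner structure \<open>a (x \<otimes> y) b = x b \<otimes> a y\<close>.\<close>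

definition outer_bimodule ::
    "('k::field, 'b::ab_group_add) alg \<Rightarrow> ('b, ('k, 'b) tens) bimod" where
  "outer_bimodule A =
     \<lparr>carrier = tensor_square A,
      lact = (\<lambda>a. tensor_map A (\<lambda>x. a \<cdot>\<^bsub>A\<^esub> x) id),
      ract = (\<lambda>t b. tensor_map A id (\<lambda>y. y \<cdot>\<^bsub>A\<^esub> b) t)\<rparr>"

definition inner_bimodule ::
    "('k::field, 'b::ab_group_add) alg \<Rightarrow> ('b, ('k, 'b) tens) bimod" where
  "inner_bimodule A =
     \<lparr>carrier = tensor_square A,
      lact = (\<lambda>a. tensor_map A id (\<lambda>y. a \<cdot>\<^bsub>A\<^esub> y)),
      ract = (\<lambda>t b. tensor_map A (\<lambda>x. x \<cdot>\<^bsub>A\<^esub> b) id t)\<rparr>"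


section \<open>Projectivity and resolutions\<close>

text \<open>
  Projective means direct summand of a free module. Any module is a quotient of the free
  module on its own elements, so bases contained in the type of the module suffice.
\<close>

definition free_left_module ::
    "('k::field, 'b::ab_group_add) alg \<Rightarrow> 'x set \<Rightarrow> ('b, 'x \<Rightarrow> 'b) lmod" where
  "free_left_module A X =
     \<lparr>carrier = {v. finite {x. v x \<noteq> 0} \<and> {x. v x \<noteq> 0} \<subseteq> X},
      lact = (\<lambda>a v x. a \<cdot>\<^bsub>A\<^esub> v x)\<rparr>"

definition projective_left_module ::
    "('k::field, 'b::ab_group_add) alg \<Rightarrow> ('b, 'm::ab_group_add) lmod \<Rightarrow> bool" where
  "projective_left_module A M \<longleftrightarrow> left_module A M \<and>
     (\<exists>(X :: 'm set) \<iota> \<pi>. lmod_hom M (free_left_module A X) \<iota> \<and>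
        lmod_hom (free_left_module A X) M \<pi> \<and> (\<forall>x\<in>carrier M. \<pi> (\<iota> x) = x))"

definition free_bimodule ::
    "('k::field, 'b::ab_group_add) alg \<Rightarrow> 'x set \<Rightarrow> ('b, 'x \<Rightarrow> ('k, 'b) tens) bimod" where
  "free_bimodule A X =
     \<lparr>carrier = {v. (\<forall>x. v x \<in> tensor_square A) \<and> finite {x. v x \<noteq> 0} \<and> {x. v x \<noteq> 0} \<subseteq> X},
      lact = (\<lambda>a v x. lact (outer_bimodule A) a (v x)),
      ract = (\<lambda>v b x. ract (outer_bimodule A) (v x) b)\<rparr>"

definition projective_bimodule ::
    "('k::field, 'b::ab_group_add) alg \<Rightarrow> ('b, 'm::ab_group_add) bimod \<Rightarrow> bool" where
  "projective_bimodule A M \<longleftrightarrow> bimodule A M \<and>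
     (\<exists>(X :: 'm set) \<iota> \<pi>. bimod_hom M (free_bimodule A X) \<iota> \<and>
        bimod_hom (free_bimodule A X) M \<pi> \<and> (\<forall>x\<in>carrier M. \<pi> (\<iota> x) = x))"

text \<open>Exactness of \<open>\<cdots> \<rightarrow> C 2 \<rightarrow> C 1 \<rightarrow> C 0 \<rightarrow> T \<rightarrow> 0\<close> with \<open>\<delta> n: C (n + 1) \<rightarrow> C n\<close>.\<close>

definition exact_over ::
    "(nat \<Rightarrow> 'm::ab_group_add set) \<Rightarrow> (nat \<Rightarrow> 'm \<Rightarrow> 'm) \<Rightarrow> ('m \<Rightarrow> 'n::ab_group_add) \<Rightarrow> 'n set \<Rightarrow> bool"
    where
  "exact_over C \<delta> \<epsilon> T \<longleftrightarrow>
     \<epsilon> ` C 0 = T \<and>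
     \<delta> 0 ` C 1 = {x \<in> C 0. \<epsilon> x = 0} \<and>
     (\<forall>n. \<delta> (Suc n) ` C (Suc (Suc n)) = {x \<in> C (Suc n). \<delta> n x = 0})"

definition regular_bimodule :: "('k::field, 'b::ab_group_add) alg \<Rightarrow> ('b, 'b) bimod" where
  "regular_bimodule A = \<lparr>carrier = UNIV, lact = alg_mult A, ract = alg_mult A\<rparr>"

definition bimodule_resolution ::
    "('k::field, 'b::ab_group_add) alg \<Rightarrow> (nat \<Rightarrow> ('b, 'm::ab_group_add) bimod)
      \<Rightarrow> (nat \<Rightarrow> 'm \<Rightarrow> 'm) \<Rightarrow> ('m \<Rightarrow> 'b) \<Rightarrow> bool" where
  "bimodule_resolution A P \<delta> \<epsilon> \<longleftrightarrow>
     (\<forall>n. projective_bimodule A (P n) \<and> fin_gen_bimodule (P n) \<and>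
          bimod_hom (P (Suc n)) (P n) (\<delta> n)) \<and>
     bimod_hom (P 0) (regular_bimodule A) \<epsilon> \<and>
     exact_over (\<lambda>n. carrier (P n)) \<delta> \<epsilon> UNIV"

definition graded_bimodule_resolution ::
    "('k::field, 'b::ab_group_add) alg \<Rightarrow> ('i::monoid_add \<Rightarrow> 'b set)
      \<Rightarrow> (nat \<Rightarrow> ('b, 'm::ab_group_add) bimod) \<Rightarrow> (nat \<Rightarrow> 'i \<Rightarrow> 'm set)
      \<Rightarrow> (nat \<Rightarrow> 'm \<Rightarrow> 'm) \<Rightarrow> ('m \<Rightarrow> 'b) \<Rightarrow> bool" where
  "graded_bimodule_resolution A D P gr \<delta> \<epsilon> \<longleftrightarrow>
     bimodule_resolution A P \<delta> \<epsilon> \<and>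
     (\<forall>n. graded_bimodule A D (P n) (gr n)) \<and>
     (\<forall>n i. \<delta> n ` gr (Suc n) i \<subseteq> gr n i) \<and>
     (\<forall>i. \<epsilon> ` gr 0 i \<subseteq> D i)"


section \<open>Homogeneous and Koszul algebras\<close>

text \<open>
  The tensor algebra of the bimodule \<open>B\<^sub>1\<close> over \<open>B\<^sub>0\<close>, where \<open>B = A\<close> with grading \<open>D\<close>: the algebra
  generated by letters from \<open>B\<^sub>0\<close> and \<open>B\<^sub>1\<close> subject to linearity in each letter, to the relations
  \<open>[a] [x] = [a x]\<close> and \<open>[x] [a] = [x a]\<close> for \<open>a \<in> B\<^sub>0\<close>, and to \<open>[1] = 1\<close>. As for the tensor square,
  this quotient of the free algebra is realised by evaluation functionals, now on the linear
  forms on words that satisfy these relations. Multiplication is concatenation of words.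
\<close>

type_synonym ('k, 'b) word_tens = "('b list \<Rightarrow> 'k) \<Rightarrow> 'k"

definition word_form ::
    "('k::field, 'b::ab_group_add) alg \<Rightarrow> (nat \<Rightarrow> 'b set) \<Rightarrow> ('b list \<Rightarrow> 'k) \<Rightarrow> bool" where
  "word_form A D \<beta> \<longleftrightarrow>
     (\<forall>u v. \<forall>i\<in>{0, 1}. \<forall>x\<in>D i. \<forall>y\<in>D i. \<forall>c.
        \<beta> (u @ [alg_scale A c x + y] @ v) = c * \<beta> (u @ [x] @ v) + \<beta> (u @ [y] @ v)) \<and>
     (\<forall>u v. \<forall>a\<in>D 0. \<forall>x\<in>D 0 \<union> D 1.
        \<beta> (u @ [a, x] @ v) = \<beta> (u @ [a \<cdot>\<^bsub>A\<^esub> x] @ v) \<and>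
        \<beta> (u @ [x, a] @ v) = \<beta> (u @ [x \<cdot>\<^bsub>A\<^esub> a] @ v)) \<and>
     (\<forall>u v. \<beta> (u @ [alg_one A] @ v) = \<beta> (u @ v))"

definition word_tensor ::
    "('k::field, 'b::ab_group_add) alg \<Rightarrow> (nat \<Rightarrow> 'b set) \<Rightarrow> 'b list \<Rightarrow> ('k, 'b) word_tens" where
  "word_tensor A D w = (\<lambda>\<beta>. if word_form A D \<beta> then \<beta> w else 0)"

definition tensor_algebra ::
    "('k::field, 'b::ab_group_add) alg \<Rightarrow> (nat \<Rightarrow> 'b set) \<Rightarrow> ('k, 'b) word_tens set" where
  "tensor_algebra A D = add_subgroup hull {word_tensor A D w |w. w \<in> lists (D 0 \<union> D 1)}"

definition tensor_algebra_mult ::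
    "('k::field, 'b::ab_group_add) alg \<Rightarrow> (nat \<Rightarrow> 'b set)
      \<Rightarrow> ('k, 'b) word_tens \<Rightarrow> ('k, 'b) word_tens \<Rightarrow> ('k, 'b) word_tens" where
  "tensor_algebra_mult A D s t =
     (\<lambda>\<beta>. if word_form A D \<beta> then s (\<lambda>u. t (\<lambda>v. \<beta> (u @ v))) else 0)"

text \<open>
  For \<open>n \<ge> 1\<close> this is the \<open>n\<close>-fold tensor power of \<open>B\<^sub>1\<close> over \<open>B\<^sub>0\<close>, the leading letter from \<open>B\<^sub>0\<close>
  being absorbed; for \<open>n = 0\<close> it is \<open>B\<^sub>0\<close>.
\<close>

definition tensor_power ::
    "('k::field, 'b::ab_group_add) alg \<Rightarrow> (nat \<Rightarrow> 'b set) \<Rightarrow> nat \<Rightarrow> ('k, 'b) word_tens set" where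
  "tensor_power A D n =
     add_subgroup hull {word_tensor A D (a # w) |a w. a \<in> D 0 \<and> w \<in> lists (D 1) \<and> length w = n}"

definition tensor_algebra_ideal ::
    "('k::field, 'b::ab_group_add) alg \<Rightarrow> (nat \<Rightarrow> 'b set)
      \<Rightarrow> ('k, 'b) word_tens set \<Rightarrow> ('k, 'b) word_tens set" where
  "tensor_algebra_ideal A D X =
     add_subgroup hull {tensor_algebra_mult A D (tensor_algebra_mult A D s x) t |s x t.
        s \<in> tensor_algebra A D \<and> x \<in> X \<and> t \<in> tensor_algebra A D}"

definition left_ideal_in :: "('k::field, 'b::ab_group_add) alg \<Rightarrow> 'b set \<Rightarrow> 'b set \<Rightarrow> bool" where
  "left_ideal_in A B L \<longleftrightarrow> L \<subseteq> B \<and> add_subgroup L \<and> (\<forall>a\<in>B. \<forall>x\<in>L. a \<cdot>\<^bsub>A\<^esub> x \<in> L)"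

text \<open>The subring \<open>B\<close> is semisimple: every left ideal is a direct summand of the left module \<open>B\<close>.\<close>

definition semisimple_subring :: "('k::field, 'b::ab_group_add) alg \<Rightarrow> 'b set \<Rightarrow> bool" where
  "semisimple_subring A B \<longleftrightarrow>
     (\<forall>L. left_ideal_in A B L \<longrightarrow>
        (\<exists>L'. left_ideal_in A B L' \<and> L \<inter> L' = {0} \<and> {x + y |x y. x \<in> L \<and> y \<in> L'} = B))"

text \<open>
  The isomorphism of graded algebras between \<open>A\<close> and the tensor algebra modulo the ideal generated
  by \<open>X\<close> is given as a surjective homomorphism \<open>\<phi>\<close> of graded algebras with that ideal as kernel.
\<close>

definition homogeneous ::
    "nat \<Rightarrow> ('k::field, 'b::ab_group_add) alg \<Rightarrow> (nat \<Rightarrow> 'b set) \<Rightarrow> bool" where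
  "homogeneous d A D \<longleftrightarrow>
     graded_algebra A D \<and>
     semisimple_subring A (D 0) \<and>
     (\<forall>i. finite_dim A (D i)) \<and>
     (\<forall>i j. D (i + j) = add_subgroup hull {a \<cdot>\<^bsub>A\<^esub> b |a b. a \<in> D i \<and> b \<in> D j}) \<and>
     2 \<le> d \<and>
     (\<exists>X \<phi>. X \<subseteq> tensor_power A D d \<and>
        (\<forall>s\<in>tensor_algebra A D. \<forall>t\<in>tensor_algebra A D.
            \<phi> (s + t) = \<phi> s + \<phi> t \<and>
            \<phi> (tensor_algebra_mult A D s t) = \<phi> s \<cdot>\<^bsub>A\<^esub> \<phi> t) \<and>
        (\<forall>c. \<forall>t\<in>tensor_algebra A D. \<phi> (\<lambda>\<beta>. c * t \<beta>) = alg_scale A c (\<phi> t)) \<and>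
        \<phi> (word_tensor A D []) = alg_one A \<and>
        (\<forall>n. \<phi> ` tensor_power A D n \<subseteq> D n) \<and>
        \<phi> ` tensor_algebra A D = UNIV \<and>
        {t \<in> tensor_algebra A D. \<phi> t = 0} = tensor_algebra_ideal A D X)"

definition trivial_module ::
    "('k::field, 'b::ab_group_add) alg \<Rightarrow> (nat \<Rightarrow> 'b set) \<Rightarrow> ('b, 'b) lmod" where
  "trivial_module A D = \<lparr>carrier = D 0, lact = (\<lambda>a x. component D 0 a \<cdot>\<^bsub>A\<^esub> x)\<rparr>"

definition koszul_degree :: "nat \<Rightarrow> nat \<Rightarrow> nat" where
  "koszul_degree d n = (if even n then n div 2 * d else (n - 1) div 2 * d + 1)"

text \<open>
  The terms of the resolution are submodules of a countable power of \<open>A\<close>. This is no restriction: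
  generation in the given, strictly increasing, degrees makes the resolution minimal, so its
  terms are finitely generated projective.
\<close>

definition koszul ::
    "nat \<Rightarrow> ('k::field, 'b::ab_group_add) alg \<Rightarrow> (nat \<Rightarrow> 'b set) \<Rightarrow> bool" where
  "koszul d A D \<longleftrightarrow>
     homogeneous d A D \<and>
     (\<exists>(P :: nat \<Rightarrow> ('b, nat \<Rightarrow> 'b) lmod) gr \<delta> \<epsilon>.
        (\<forall>n. projective_left_module A (P n) \<and> graded_left_module A D (P n) (gr n) \<and>
             generated_in (P n) (gr n (koszul_degree d n)) \<and>
             lmod_hom (P (Suc n)) (P n) (\<delta> n) \<and>
             (\<forall>i. \<delta> n ` gr (Suc n) i \<subseteq> gr n i)) \<and>
        lmod_hom (P 0) (trivial_module A D) \<epsilon> \<and>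
        (\<forall>i. \<epsilon> ` gr 0 i \<subseteq> (if i = 0 then D 0 else {0})) \<and>
        exact_over (\<lambda>n. carrier (P n)) \<delta> \<epsilon> (D 0))"


section \<open>Calabi-Yau algebras\<close>

text \<open>
  A finitely generated projective bimodule is a direct summand of a finite power of the tensor
  square, so terms carried by \<open>nat \<Rightarrow> ('k, 'b) tens\<close> suffice.
\<close>

definition homologically_smooth :: "('k::field, 'b::ab_group_add) alg \<Rightarrow> bool" where
  "homologically_smooth A \<longleftrightarrow>
     (\<exists>(P :: nat \<Rightarrow> ('b, nat \<Rightarrow> ('k, 'b) tens) bimod) \<delta> \<epsilon> N.
        bimodule_resolution A P \<delta> \<epsilon> \<and> (\<forall>n>N. carrier (P n) = {0}))"

text \<open>
  The complex of bimodule homomorphisms from \<open>P\<close> to the outer bimodule. Homomorphisms are extended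
  by \<open>0\<close> off the carrier, so that they form an additive subgroup of a function type.
\<close>

definition dual_module ::
    "('k::field, 'b::ab_group_add) alg \<Rightarrow> ('b, 'm::ab_group_add) bimod \<Rightarrow> ('m \<Rightarrow> ('k, 'b) tens) set"
    where
  "dual_module A M = {f. bimod_hom M (outer_bimodule A) f \<and> (\<forall>x. x \<notin> carrier M \<longrightarrow> f x = 0)}"

definition codifferential ::
    "(nat \<Rightarrow> ('b, 'm::ab_group_add) bimod) \<Rightarrow> (nat \<Rightarrow> 'm \<Rightarrow> 'm) \<Rightarrow> nat
      \<Rightarrow> ('m \<Rightarrow> 'v::zero) \<Rightarrow> 'm \<Rightarrow> 'v" where
  "codifferential P \<delta> n f = (\<lambda>x. if x \<in> carrier (P (Suc n)) then f (\<delta> n x) else 0)"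

definition cocycles ::
    "('k::field, 'b::ab_group_add) alg \<Rightarrow> (nat \<Rightarrow> ('b, 'm::ab_group_add) bimod)
      \<Rightarrow> (nat \<Rightarrow> 'm \<Rightarrow> 'm) \<Rightarrow> nat \<Rightarrow> ('m \<Rightarrow> ('k, 'b) tens) set" where
  "cocycles A P \<delta> n = {f \<in> dual_module A (P n). codifferential P \<delta> n f = 0}"

definition coboundaries ::
    "('k::field, 'b::ab_group_add) alg \<Rightarrow> (nat \<Rightarrow> ('b, 'm::ab_group_add) bimod)
      \<Rightarrow> (nat \<Rightarrow> 'm \<Rightarrow> 'm) \<Rightarrow> nat \<Rightarrow> ('m \<Rightarrow> ('k, 'b) tens) set" where
  "coboundaries A P \<delta> n =
     (case n of 0 \<Rightarrow> {0} | Suc m \<Rightarrow> codifferential P \<delta> m ` dual_module A (P m))"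

text \<open>
  An isomorphism of bimodules from the \<open>n\<close>-th cohomology, with bimodule structure coming from the
  inner structure on the tensor square, onto \<open>A\<close>; it is given on cocycles.
\<close>

definition ext_iso ::
    "('k::field, 'b::ab_group_add) alg \<Rightarrow> (nat \<Rightarrow> ('b, 'm::ab_group_add) bimod)
      \<Rightarrow> (nat \<Rightarrow> 'm \<Rightarrow> 'm) \<Rightarrow> nat \<Rightarrow> (('m \<Rightarrow> ('k, 'b) tens) \<Rightarrow> 'b) \<Rightarrow> bool" where
  "ext_iso A P \<delta> n \<phi> \<longleftrightarrow>
     (\<forall>f\<in>cocycles A P \<delta> n. \<forall>g\<in>cocycles A P \<delta> n. \<phi> (f + g) = \<phi> f + \<phi> g) \<and>
     (\<forall>a b. \<forall>f\<in>cocycles A P \<delta> n.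
        \<phi> (\<lambda>x. lact (inner_bimodule A) a (ract (inner_bimodule A) (f x) b)) = a \<cdot>\<^bsub>A\<^esub> \<phi> f \<cdot>\<^bsub>A\<^esub> b) \<and>
     \<phi> ` cocycles A P \<delta> n = UNIV \<and>
     {f \<in> cocycles A P \<delta> n. \<phi> f = 0} = coboundaries A P \<delta> n"

definition tensor_degree ::
    "('k::field, 'b::ab_group_add) alg \<Rightarrow> (nat \<Rightarrow> 'b set) \<Rightarrow> int \<Rightarrow> ('k, 'b) tens set" where
  "tensor_degree A D m =
     add_subgroup hull {tensor A x y |x y i j. x \<in> D i \<and> y \<in> D j \<and> int i + int j = m}"

definition has_degree ::
    "('k::field, 'b::ab_group_add) alg \<Rightarrow> (nat \<Rightarrow> 'b set) \<Rightarrow> (nat \<Rightarrow> 'm set)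
      \<Rightarrow> ('m \<Rightarrow> ('k, 'b) tens) \<Rightarrow> int \<Rightarrow> bool" where
  "has_degree A D gr f m \<longleftrightarrow> (\<forall>n. f ` gr n \<subseteq> tensor_degree A D (int n + m))"

definition shifted :: "(nat \<Rightarrow> 'b::zero set) \<Rightarrow> int \<Rightarrow> int \<Rightarrow> 'b set" where
  "shifted D l m = (if 0 \<le> m + l then D (nat (m + l)) else {0})"

text \<open>
  The cohomology of the dual of \<open>P\<close>, together with its gradings, does not depend on the choice of
  the graded resolution \<open>P\<close> by finitely generated projectives.
\<close>

definition calabi_yau ::
    "nat \<Rightarrow> ('k::field, 'b::ab_group_add) alg \<Rightarrow> (nat \<Rightarrow> 'b set) \<Rightarrow> bool" where
  "calabi_yau p A D \<longleftrightarrow>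
     graded_algebra A D \<and>
     homologically_smooth A \<and>
     (\<exists>(P :: nat \<Rightarrow> ('b, nat \<Rightarrow> ('k, 'b) tens) bimod) gr \<delta> \<epsilon>.
        graded_bimodule_resolution A D P gr \<delta> \<epsilon> \<and>
        (\<forall>i. i \<noteq> p \<longrightarrow> cocycles A P \<delta> i = coboundaries A P \<delta> i) \<and>
        (\<exists>l \<phi>. ext_iso A P \<delta> p \<phi> \<and>
           (\<forall>f\<in>cocycles A P \<delta> p. \<forall>m. has_degree A D (gr p) f m \<longrightarrow> \<phi> f \<in> shifted D l m)))"

text \<open>The condition \<open>b - h + a = g\<close> reads \<open>b h\<^sup>-\<^sup>1 a = g\<close> in multiplicative notation.\<close>

definition has_G_degree ::
    "('k::field, 'b::ab_group_add) alg \<Rightarrow> ('g::group_add \<Rightarrow> 'b set) \<Rightarrow> ('g \<Rightarrow> 'm set)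
      \<Rightarrow> ('m \<Rightarrow> ('k, 'b) tens) \<Rightarrow> 'g \<Rightarrow> bool" where
  "has_G_degree A D gr f g \<longleftrightarrow>
     (\<forall>h. f ` gr h \<subseteq> add_subgroup hull {tensor A x y |x y a b. x \<in> D a \<and> y \<in> D b \<and> b - h + a = g})"

definition calabi_yau_G ::
    "nat \<Rightarrow> ('k::field, 'b::ab_group_add) alg \<Rightarrow> (nat \<times> 'g::group_add \<Rightarrow> 'b set) \<Rightarrow> bool" where
  "calabi_yau_G p A D \<longleftrightarrow>
     graded_algebra A D \<and>
     homologically_smooth A \<and>
     (\<exists>(P :: nat \<Rightarrow> ('b, nat \<Rightarrow> ('k, 'b) tens) bimod) gr \<delta> \<epsilon>.
        graded_bimodule_resolution A D P gr \<delta> \<epsilon> \<and>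
        (\<forall>i. i \<noteq> p \<longrightarrow> cocycles A P \<delta> i = coboundaries A P \<delta> i) \<and>
        (\<exists>l \<phi>. ext_iso A P \<delta> p \<phi> \<and>
           (\<forall>f\<in>cocycles A P \<delta> p. \<forall>m.
              has_degree A (N_part D) (N_part (gr p)) f m \<longrightarrow> \<phi> f \<in> shifted (N_part D) l m) \<and>
           (\<forall>f\<in>cocycles A P \<delta> p. \<forall>g.
              has_G_degree A (G_part D) (G_part (gr p)) f g \<longrightarrow> \<phi> f \<in> G_part D g)))"


section \<open>The smash product with the dual group algebra\<close>

text \<open>
  The dual of the group algebra is the space of functions \<open>'g \<Rightarrow> 'k\<close> with pointwise product, and
  \<open>R \<otimes> kG*\<close> is the space of functions \<open>'g \<Rightarrow> 'r\<close>, \<open>s\<close> standing for the sum of all \<open>s g # p\<^sub>g\<close>.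
\<close>

definition dual_basis :: "'g \<Rightarrow> 'g \<Rightarrow> 'k::field" where
  "dual_basis g = (\<lambda>x. if x = g then 1 else 0)"

definition dual_action ::
    "('k::field, 'r::ab_group_add) alg \<Rightarrow> (nat \<times> 'g::{finite, group_add} \<Rightarrow> 'r set)
      \<Rightarrow> ('g \<Rightarrow> 'k) \<Rightarrow> 'r \<Rightarrow> 'r" where
  "dual_action R D h b = (\<Sum>g\<in>UNIV. alg_scale R (h g) (component (G_part D) g b))"

definition smash_tensor ::
    "('k::field, 'r::ab_group_add) alg \<Rightarrow> 'r \<Rightarrow> ('g \<Rightarrow> 'k) \<Rightarrow> 'g \<Rightarrow> 'r" where
  "smash_tensor R a h = (\<lambda>g. alg_scale R (h g) a)"

text \<open>
  The product \<open>(a # h) (b # h') = a (h\<^sub>1 b) # h\<^sub>2 h'\<close> extended bilinearly; the comultiplication sends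
  \<open>p\<^sub>g\<close> to the sum of \<open>p\<^sub>u \<otimes> p\<^sub>v\<close> over all factorisations of \<open>g\<close>, written \<open>u + v = g\<close>.
\<close>

definition smash_mult ::
    "('k::field, 'r::ab_group_add) alg \<Rightarrow> (nat \<times> 'g::{finite, group_add} \<Rightarrow> 'r set)
      \<Rightarrow> ('g \<Rightarrow> 'r) \<Rightarrow> ('g \<Rightarrow> 'r) \<Rightarrow> 'g \<Rightarrow> 'r" where
  "smash_mult R D s t =
     (\<Sum>g\<in>UNIV. \<Sum>h\<in>UNIV. \<Sum>(u, v)\<in>{(u, v). u + v = g}.
        smash_tensor R (s g \<cdot>\<^bsub>R\<^esub> dual_action R D (dual_basis u) (t h)) (dual_basis v * dual_basis h))"

definition smash ::
    "('k::field, 'r::ab_group_add) alg \<Rightarrow> (nat \<times> 'g::{finite, group_add} \<Rightarrow> 'r set)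
      \<Rightarrow> ('k, 'g \<Rightarrow> 'r) alg" where
  "smash R D =
     \<lparr>alg_scale = (\<lambda>c s g. alg_scale R c (s g)),
      alg_mult = smash_mult R D,
      alg_one = smash_tensor R (alg_one R) 1\<rparr>"

definition smash_grading ::
    "(nat \<times> 'g \<Rightarrow> 'r::ab_group_add set) \<Rightarrow> nat \<Rightarrow> ('g \<Rightarrow> 'r) set" where
  "smash_grading D n = {s. \<forall>g. s g \<in> N_part D n}"

end

theory Submission
  imports Defs "HOL-Library.Countable_Set"
begin

text \<open>
  Write \<open>S = R # kG\<^sup>*\<close>. Taking the smash product with \<open>kG\<^sup>*\<close> is an exact functor that turns an
  \<open>\<nat> \<times> G\<close>-graded \<open>R\<close>-bimodule \<open>M\<close> into an \<open>S\<close>-bimodule \<open>M # kG\<^sup>*\<close>, takes finitely generated projectives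
  to finitely generated projectives, and \<open>R\<close> to \<open>S\<close>. Applied to a graded resolution of \<open>R\<close> it gives a
  resolution of \<open>S\<close>. It is of finite length after truncation: comparison with a finite resolution shows
  that the kernel of a high differential is a direct summand. A homomorphism from
  \<open>M # kG\<^sup>*\<close> to \<open>S \<otimes> S\<close> is the same as a \<open>G\<close>-indexed family of homomorphisms \<open>M \<rightarrow> R \<otimes> R\<close>; under this
  correspondence the idempotents of \<open>kG\<^sup>*\<close> act through the \<open>G\<close>-degrees of the members of the family,
  so an isomorphism \<open>Ext\<^sup>p(R, R\<^sup>e) \<rightarrow> R\<close>, applied to each member, is an isomorphism of \<open>S\<close>-bimodules exactly
  because it respects the \<open>G\<close>-grading.

  For the Koszul property no \<open>G\<close>-grading on the resolution is needed: \<open>S\<close> is a finite free right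
  \<open>R\<close>-module, and \<open>S \<otimes>\<^sub>R P\<close> resolves \<open>S \<otimes>\<^sub>R k = S\<^sub>0\<close> with generators in the same degrees. Every element of
  the tensor algebra of \<open>S\<close> is a sum of products \<open>t\<^sub>h p\<^sub>h\<close> with \<open>t\<^sub>h\<close> from the tensor algebra of \<open>R\<close>, hence
  relations generating the ideal for \<open>R\<close> also generate it for \<open>S\<close>.
\<close>

section \<open>Additive maps and direct sums\<close>

text \<open>Everything is computed from one commutation rule, p_g r = \<Sum> r_(g-k) p_k over all k,
  with r_u the component of degree u. It gives the product of \<open>S\<close>, both actions on a
  smash bimodule and the action on an induced module; the order of the group elements in each index
  comes from it, since the group need not be commutative. The twisted condition b - h + a = g on
  degrees is what is left when this rule is applied to both tensor factors: the index of the right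
  idempotent cancels (see \<open>restrict_G_degree\<close>). Two obstacles shape the rest.
  Smoothness supplies a finite resolution without grading, while the smash product needs a graded
  one, so the ungraded resolution only serves to show where the graded one can be cut. And tensors
  are encoded as functionals on forms, so a map out of a tensor square or a tensor algebra cannot
  simply be prescribed on generators; it is defined with the coordinate forms of a vector space
  basis, and then shown to have the expected values on generators.\<close>

lemma add_subgroup_hull [simp]: "add_subgroup (add_subgroup hull X)"
  by (rule hull_in) (auto simp: add_subgroup_def)

lemma add_subgroup_zero: "add_subgroup H \<Longrightarrow> 0 \<in> H"
  by (simp add: add_subgroup_def)

lemma add_subgroup_diff: "add_subgroup H \<Longrightarrow> x \<in> H \<Longrightarrow> y \<in> H \<Longrightarrow> x - y \<in> H"
  by (simp add: add_subgroup_def)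

lemma add_subgroup_uminus: "add_subgroup H \<Longrightarrow> x \<in> H \<Longrightarrow> - x \<in> H"
  using add_subgroup_diff[of H 0 x] add_subgroup_zero by force

lemma add_subgroup_add: "add_subgroup H \<Longrightarrow> x \<in> H \<Longrightarrow> y \<in> H \<Longrightarrow> x + y \<in> H"
  using add_subgroup_diff[of H x "- y"] add_subgroup_uminus[of H y] by force

lemma add_subgroup_sum: "add_subgroup H \<Longrightarrow> (\<And>i. i \<in> I \<Longrightarrow> f i \<in> H) \<Longrightarrow> sum f I \<in> H"
  by (induction I rule: infinite_finite_induct) (auto intro: add_subgroup_zero add_subgroup_add)

lemma add_subgroup_Sum_any:
  fixes f :: "'i \<Rightarrow> 'v::ab_group_add"
  shows "add_subgroup H \<Longrightarrow> (\<And>i. f i \<in> H) \<Longrightarrow> Sum_any f \<in> H"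
  unfolding Sum_any.expand_set by (rule add_subgroup_sum)

lemma add_subgroup_UNIV [simp]: "add_subgroup UNIV"
  by (simp add: add_subgroup_def)

text \<open>Closure under differences together with 0 is the whole of \<open>add_subgroup\<close>,
  so one case for differences replaces those for sums and negatives. The membership premises let
  \<open>P\<close> speak of maps that are additive only on the hull.\<close>

lemma hull_induct_diff [consumes 1, case_names zero diff base]:
  assumes "x \<in> add_subgroup hull X" and "P 0"
    and "\<And>x y. x \<in> add_subgroup hull X \<Longrightarrow> y \<in> add_subgroup hull X \<Longrightarrow> P x \<Longrightarrow> P y \<Longrightarrow> P (x - y)"
    and "\<And>x. x \<in> X \<Longrightarrow> P x"
  shows "P x"
proof -
  have "x \<in> {x \<in> add_subgroup hull X. P x}"
  proof (rule subsetD[OF _ assms(1)], rule hull_minimal)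
    show "X \<subseteq> {x \<in> add_subgroup hull X. P x}"
      using assms(4) hull_subset[of X] by blast
    show "add_subgroup {x \<in> add_subgroup hull X. P x}"
      using assms(2,3) add_subgroup_hull[of X] unfolding add_subgroup_def by auto
  qed
  then show ?thesis by simp
qed

text \<open>Modules are carriers inside a type and the maps between them are total functions, so
  additivity is asked on the carrier alone.\<close>

definition additive_on :: "'v::ab_group_add set \<Rightarrow> ('v \<Rightarrow> 'w::ab_group_add) \<Rightarrow> bool" where
  "additive_on H f \<longleftrightarrow> (\<forall>x\<in>H. \<forall>y\<in>H. f (x + y) = f x + f y)"

lemma additive_on_subset: "additive_on H f \<Longrightarrow> K \<subseteq> H \<Longrightarrow> additive_on K f"
  by (auto simp: additive_on_def)

context
  fixes H :: "'v::ab_group_add set" and f :: "'v \<Rightarrow> 'w::ab_group_add"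
  assumes H: "add_subgroup H" and f: "additive_on H f"
begin

lemma additive_on_zero: "f 0 = 0"
  using f add_subgroup_zero[OF H] unfolding additive_on_def by (metis add_cancel_left_left)

lemma additive_on_diff: "x \<in> H \<Longrightarrow> y \<in> H \<Longrightarrow> f (x - y) = f x - f y"
  using f add_subgroup_diff[OF H] unfolding additive_on_def by (metis add_diff_cancel diff_add_cancel)

lemma additive_on_sum: "(\<And>i. i \<in> I \<Longrightarrow> u i \<in> H) \<Longrightarrow> f (sum u I) = (\<Sum>i\<in>I. f (u i))"
proof (induction I rule: infinite_finite_induct)
  case (insert i I)
  then show ?case
    using f add_subgroup_sum[OF H, of I u] by (simp add: additive_on_def)
qed (auto simp: additive_on_zero)

lemma additive_on_Sum_any:
  assumes "\<And>i. u i \<in> H" and "finite {i. u i \<noteq> 0}"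
  shows "f (Sum_any u) = Sum_any (\<lambda>i. f (u i))"
proof -
  have "Sum_any (\<lambda>i. f (u i)) = (\<Sum>i\<in>{i. u i \<noteq> 0}. f (u i))"
    using assms(2) by (rule Sum_any.expand_superset) (auto simp: additive_on_zero)
  then show ?thesis
    using assms by (simp add: Sum_any.expand_set additive_on_sum)
qed

end

lemma additive_on_comp:
  "additive_on H f \<Longrightarrow> f ` H \<subseteq> K \<Longrightarrow> additive_on K g \<Longrightarrow> additive_on H (\<lambda>x. g (f x))"
  by (auto simp: additive_on_def image_subset_iff)

lemma additive_on_add: "additive_on H f \<Longrightarrow> additive_on H g \<Longrightarrow> additive_on H (\<lambda>x. f x + g x)"
  by (auto simp: additive_on_def)

lemma additive_on_sum_fun: "(\<And>i. i \<in> I \<Longrightarrow> additive_on H (f i)) \<Longrightarrow> additive_on H (\<lambda>x. \<Sum>i\<in>I. f i x)"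
  by (auto simp: additive_on_def sum.distrib)

lemma additive_on_hull_eq:
  assumes "additive_on (add_subgroup hull X) f" "additive_on (add_subgroup hull X) g"
    and "\<And>x. x \<in> X \<Longrightarrow> f x = g x" "x \<in> add_subgroup hull X"
  shows "f x = g x"
  using assms(4)
proof (induction rule: hull_induct_diff)
  case zero
  show ?case
    using assms(1,2)[THEN additive_on_zero[OF add_subgroup_hull]] by simp
next
  case (diff x y)
  then show ?case
    using assms(1,2)[THEN additive_on_diff[OF add_subgroup_hull]] by simp
qed (use assms(3) in auto)

lemma additive_on_hull_mem:
  assumes "additive_on (add_subgroup hull X) f" "add_subgroup K"
    and "\<And>x. x \<in> X \<Longrightarrow> f x \<in> K" "x \<in> add_subgroup hull X"
  shows "f x \<in> K"
  using assms(4)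
proof (induction rule: hull_induct_diff)
  case zero
  show ?case
    using additive_on_zero[OF add_subgroup_hull assms(1)] add_subgroup_zero[OF assms(2)] by simp
next
  case (diff x y)
  then show ?case
    using additive_on_diff[OF add_subgroup_hull assms(1)] add_subgroup_diff[OF assms(2)] by simp
qed (use assms(3) in auto)

text \<open>One argument is handled after the other: additivity in \<open>y\<close> is asked at
  generators \<open>x\<close> only, because the hull in \<open>x\<close> is reached afterwards with
  \<open>y\<close> already arbitrary.\<close>

lemma biadditive_hull_mem:
  assumes "\<And>y. y \<in> add_subgroup hull Y \<Longrightarrow> additive_on (add_subgroup hull X) (\<lambda>x. f x y)"
    and "\<And>x. x \<in> X \<Longrightarrow> additive_on (add_subgroup hull Y) (f x)"
    and "add_subgroup K" "\<And>x y. x \<in> X \<Longrightarrow> y \<in> Y \<Longrightarrow> f x y \<in> K"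
    and "x \<in> add_subgroup hull X" "y \<in> add_subgroup hull Y"
  shows "f x y \<in> K"
proof (rule additive_on_hull_mem[of X "\<lambda>x. f x y"])
  show "f x y \<in> K" if "x \<in> X" for x
    using assms(2)[OF that] assms(3) assms(4)[OF that] assms(6) by (rule additive_on_hull_mem)
qed (use assms in auto)

section \<open>Finitely supported sums and internal direct sums\<close>

lemma finite_support_add:
  fixes f g :: "'i \<Rightarrow> 'v::ab_group_add"
  assumes "finite {i. f i \<noteq> 0}" "finite {i. g i \<noteq> 0}"
  shows "finite {i. f i + g i \<noteq> 0}"
  using finite_UnI[OF assms] by (rule rev_finite_subset) auto

lemma finite_support_diff:
  fixes f g :: "'i \<Rightarrow> 'v::ab_group_add"
  assumes "finite {i. f i \<noteq> 0}" "finite {i. g i \<noteq> 0}"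
  shows "finite {i. f i - g i \<noteq> 0}"
  using finite_UnI[OF assms] by (rule rev_finite_subset) auto

lemma Sum_any_finite: "Sum_any f = sum f (UNIV :: 'a::finite set)"
  by (rule Sum_any.expand_superset) auto

lemma Sum_any_fun:
  fixes u :: "'i \<Rightarrow> 'a \<Rightarrow> 'v::ab_group_add"
  assumes "finite {i. u i \<noteq> 0}"
  shows "Sum_any u x = Sum_any (\<lambda>i. u i x)"
  using additive_on_Sum_any[of UNIV "\<lambda>f. f x" u] assms by (simp add: additive_on_def)

lemma sum_fun: "sum u I x = (\<Sum>i\<in>I. u i x)"
  for u :: "'i \<Rightarrow> 'a \<Rightarrow> 'v::ab_group_add"
  using additive_on_sum[of UNIV "\<lambda>f. f x" I u] by (simp add: additive_on_def)

lemma families_add: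
  assumes "\<And>i. add_subgroup (D i)" "f \<in> families D" "g \<in> families D"
  shows "(\<lambda>i. f i + g i) \<in> families D" "(\<lambda>i. f i - g i) \<in> families D"
  using assms finite_support_add[of f g] finite_support_diff[of f g]
  by (auto simp: families_def add_subgroup_add add_subgroup_diff)

lemma Sum_any_diff:
  fixes f g :: "'i \<Rightarrow> 'v::ab_group_add"
  assumes "finite {i. f i \<noteq> 0}" "finite {i. g i \<noteq> 0}"
  shows "Sum_any (\<lambda>i. f i - g i) = Sum_any f - Sum_any g"
proof -
  have "Sum_any (\<lambda>i. f i - g i + g i) = Sum_any (\<lambda>i. f i - g i) + Sum_any g"
    using assms by (intro Sum_any.distrib finite_support_diff)
  then show ?thesis by simp
qed

lemma families_single:
  assumes "\<And>i. add_subgroup (D i)" "x \<in> D j"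
  shows "(\<lambda>i. if i = j then x else 0) \<in> families D"
  using assms by (auto simp: families_def add_subgroup_zero)

lemma sum_space_mem:
  assumes "\<And>i. add_subgroup (D i)" "x \<in> D j"
  shows "x \<in> sum_space D"
  unfolding sum_space_def
  by (rule image_eqI[OF _ families_single[of D x j]]) (use assms in \<open>auto simp: Sum_any.delta\<close>)

lemma add_subgroup_sum_space:
  assumes "\<And>i. add_subgroup (D i)"
  shows "add_subgroup (sum_space D)"
  unfolding add_subgroup_def
proof (intro conjI ballI)
  show "0 \<in> sum_space D"
    by (rule sum_space_mem[where j = undefined]) (auto simp: assms add_subgroup_zero)
next
  fix x y assume "x \<in> sum_space D" "y \<in> sum_space D"
  then obtain f g where fg: "f \<in> families D" "g \<in> families D" "x = Sum_any f" "y = Sum_any g"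
    by (auto simp: sum_space_def)
  have "x - y = Sum_any (\<lambda>i. f i - g i)"
    using fg Sum_any_diff[of f g] by (simp add: families_def)
  then show "x - y \<in> sum_space D"
    using families_add(2)[OF assms fg(1,2)] by (auto simp: sum_space_def)
qed

lemma sum_space_hull:
  assumes "\<And>i. add_subgroup (D i)"
  shows "sum_space D = add_subgroup hull (\<Union>i. D i)"
proof (intro equalityI subsetI)
  fix x assume "x \<in> sum_space D"
  then obtain f where f: "f \<in> families D" and x: "x = Sum_any f"
    by (auto simp: sum_space_def)
  have "f i \<in> add_subgroup hull (\<Union>i. D i)" for i
    using f by (intro hull_inc) (auto simp: families_def)
  then show "x \<in> add_subgroup hull (\<Union>i. D i)"
    unfolding x by (intro add_subgroup_Sum_any) auto
next
  fix x assume "x \<in> add_subgroup hull (\<Union>i. D i)"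
  moreover have "add_subgroup hull (\<Union>i. D i) \<subseteq> sum_space D"
    by (rule hull_minimal) (auto intro: sum_space_mem assms add_subgroup_sum_space)
  ultimately show "x \<in> sum_space D" by blast
qed

context
  fixes V :: "'v::ab_group_add set" and D :: "'i \<Rightarrow> 'v set"
  assumes ds: "direct_sum V D"
begin

lemma direct_sum_add_subgroup: "add_subgroup (D i)"
  using ds by (simp add: direct_sum_def)

lemma direct_sum_sum_space: "V = sum_space D"
  using ds by (auto simp: direct_sum_def sum_space_def bij_betw_def)

lemma direct_sum_hull: "V = add_subgroup hull (\<Union>i. D i)"
  using direct_sum_sum_space sum_space_hull[of D] direct_sum_add_subgroup by simp

lemma direct_sum_carrier: "add_subgroup V"
  by (subst direct_sum_hull) simp

lemma direct_sum_subset: "x \<in> D i \<Longrightarrow> x \<in> V"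
  by (subst direct_sum_hull) (auto intro: hull_inc)

lemma component_families: "x \<in> V \<Longrightarrow> (\<lambda>i. component D i x) \<in> families D"
  and Sum_any_component: "x \<in> V \<Longrightarrow> Sum_any (\<lambda>i. component D i x) = x"
proof -
  assume "x \<in> V"
  then have "x \<in> Sum_any ` families D"
    using ds by (simp add: direct_sum_def bij_betw_def)
  moreover have "(\<lambda>i. component D i x) = inv_into (families D) Sum_any x"
    by (simp add: component_def)
  ultimately show "(\<lambda>i. component D i x) \<in> families D" "Sum_any (\<lambda>i. component D i x) = x"
    using inv_into_into f_inv_into_f by (metis, metis)
qed

lemma component_in: "x \<in> V \<Longrightarrow> component D i x \<in> D i"
  and component_finite: "x \<in> V \<Longrightarrow> finite {i. component D i x \<noteq> 0}"
  using component_families by (auto simp: families_def)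

lemma component_Sum_any: "f \<in> families D \<Longrightarrow> component D i (Sum_any f) = f i"
proof -
  assume "f \<in> families D"
  moreover have "inj_on Sum_any (families D)"
    using ds by (simp add: direct_sum_def bij_betw_def)
  ultimately show ?thesis
    by (simp add: component_def)
qed

lemma component_hom: "x \<in> D j \<Longrightarrow> component D i x = (if i = j then x else 0)"
  using component_Sum_any[OF families_single[of D x j], of i] direct_sum_add_subgroup
  by (simp add: Sum_any.delta)

lemma component_additive: "additive_on V (component D i)"
  unfolding additive_on_def
proof (intro ballI)
  fix x y assume xy: "x \<in> V" "y \<in> V"
  let ?f = "\<lambda>i. component D i x + component D i y"
  have "?f \<in> families D"
    by (intro families_add component_families direct_sum_add_subgroup xy)
  moreover have "Sum_any ?f = x + y"
    using xy by (subst Sum_any.distrib) (auto simp: component_finite Sum_any_component)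
  ultimately show "component D i (x + y) = component D i x + component D i y"
    using component_Sum_any[of ?f i] by simp
qed

end

text \<open>Coordinate maps \<open>c\<close> that split every element and are correct on homogeneous
  ones invert the summation map, which is the bijectivity that \<open>direct_sum\<close> asks for.
  The same uniqueness identifies \<open>component\<close>, defined by an inverse of summation, with
  \<open>c\<close>.\<close>

lemma direct_sumI:
  assumes "\<And>i. add_subgroup (D i)" and "\<And>i. D i \<subseteq> V" and V: "add_subgroup V"
    and c1: "\<And>x. x \<in> V \<Longrightarrow> (\<lambda>i. c i x) \<in> families D"
    and c2: "\<And>x. x \<in> V \<Longrightarrow> Sum_any (\<lambda>i. c i x) = x"
    and c3: "\<And>i. additive_on V (c i)"
    and c4: "\<And>i j x. x \<in> D j \<Longrightarrow> c i x = (if i = j then x else 0)"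
  shows "direct_sum V D" and "\<And>x i. x \<in> V \<Longrightarrow> component D i x = c i x"
proof -
  have c5: "c i (Sum_any f) = f i" if f: "f \<in> families D" for f i
  proof -
    have "f j \<in> V" for j
      using f assms(2) by (auto simp: families_def)
    then have "c i (Sum_any f) = Sum_any (\<lambda>j. c i (f j))"
      using f by (intro additive_on_Sum_any[OF V c3]) (auto simp: families_def)
    moreover have "c i (f j) = (if i = j then f j else 0)" for j
      using f by (intro c4) (auto simp: families_def)
    ultimately show ?thesis by (simp add: Sum_any.delta')
  qed
  have "bij_betw Sum_any (families D) V"
    unfolding bij_betw_def
  proof (intro conjI equalityI subsetI)
    show "inj_on Sum_any (families D)"
      by (rule inj_onI) (metis c5 ext)
  next
    fix x assume "x \<in> Sum_any ` families D"
    then obtain f where "f \<in> families D" "x = Sum_any f" by blast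
    then show "x \<in> V"
      using assms(2) by (auto simp: families_def intro!: add_subgroup_Sum_any[OF V])
  next
    fix x assume "x \<in> V"
    then show "x \<in> Sum_any ` families D"
      using c1 c2 by (metis image_eqI)
  qed
  then show ds: "direct_sum V D"
    using assms(1) by (simp add: direct_sum_def)
  show "component D i x = c i x" if "x \<in> V" for x i
    using component_Sum_any[OF ds c1[OF that], of i] c2[OF that] by simp
qed

text \<open>A bijection \<open>e\<close> from pairs to the index set groups the summands into
  blocks. The component in a block is the sum of the components of its members, and this meets the
  criterion \<open>direct_sumI\<close>. Both coarsenings of a grading by pairs are
  instances.\<close>

lemma direct_sum_coarsen:
  fixes e :: "'j \<Rightarrow> 'a \<Rightarrow> 'i" and D :: "'i \<Rightarrow> 'v::ab_group_add set"
  assumes ds: "direct_sum V D" and e: "bij (\<lambda>(j, a). e j a)"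
  shows "direct_sum V (\<lambda>j. sum_space (\<lambda>a. D (e j a)))"
    and "\<And>x j. x \<in> V \<Longrightarrow>
      component (\<lambda>j. sum_space (\<lambda>a. D (e j a))) j x = Sum_any (\<lambda>a. component D (e j a) x)"
proof -
  note sub = direct_sum_add_subgroup[OF ds]
  have inj: "e j a = e j' a' \<longleftrightarrow> j = j' \<and> a = a'" for j j' a a'
    using bij_is_inj[OF e] by (force simp: inj_def)
  have fin: "finite {(j, a). component D (e j a) x \<noteq> 0}" if "x \<in> V" for x
  proof -
    have "finite ((\<lambda>(j, a). e j a) -` {i. component D i x \<noteq> 0})"
      using component_finite[OF ds that] bij_is_inj[OF e] by (rule finite_vimageI)
    then show ?thesis
      by (rule rev_finite_subset) auto
  qed
  have fin1: "finite {a. component D (e j a) x \<noteq> 0}" if "x \<in> V" for x j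
    by (rule finite_subset[OF _ finite_imageI[OF fin[OF that], of snd]]) force
  let ?c = "\<lambda>j x. Sum_any (\<lambda>a. component D (e j a) x)"
  let ?S = "\<lambda>j. sum_space (\<lambda>a. D (e j a))"
  have 1: "(\<lambda>j. ?c j x) \<in> families ?S" if x: "x \<in> V" for x
    unfolding families_def
  proof (intro CollectI conjI allI)
    fix j show "?c j x \<in> ?S j"
      unfolding sum_space_def
      by (rule imageI) (use component_in[OF ds x] fin1[OF x] in \<open>auto simp: families_def\<close>)
  next
    have "{j. ?c j x \<noteq> 0} \<subseteq> fst ` {(j, a). component D (e j a) x \<noteq> 0}"
      by (force elim: Sum_any.not_neutral_obtains_not_neutral)
    then show "finite {j. ?c j x \<noteq> 0}"
      using fin[OF x] by (meson finite_imageI finite_subset)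
  qed
  have 2: "Sum_any (\<lambda>j. ?c j x) = x" if x: "x \<in> V" for x
  proof -
    let ?A = "{(j, a). component D (e j a) x \<noteq> 0}"
    have "Sum_any (\<lambda>j. ?c j x) = Sum_any (\<lambda>(j, a). component D (e j a) x)"
    proof (rule Sum_any.cartesian_product)
      show "finite (fst ` ?A \<times> snd ` ?A)"
        using fin[OF x] by blast
    qed force
    also have "\<dots> = Sum_any (\<lambda>i. component D i x)"
      by (rule Sum_any.reindex_cong[OF e, symmetric]) auto
    finally show ?thesis
      using Sum_any_component[OF ds x] by simp
  qed
  have 3: "additive_on V (?c j)" for j
    using component_additive[OF ds] by (auto simp: additive_on_def Sum_any.distrib[symmetric] fin1)
  have 4: "?c i x = (if i = j then x else 0)" if x: "x \<in> ?S j" for i j x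
  proof -
    obtain f where f: "f \<in> families (\<lambda>a. D (e j a))" and xf: "x = Sum_any f"
      using x by (auto simp: sum_space_def)
    have "component D (e i a) x = (if i = j then f a else 0)" for a
    proof -
      have "component D (e i a) x = Sum_any (\<lambda>b. component D (e i a) (f b))"
        unfolding xf using f
        by (intro additive_on_Sum_any[OF direct_sum_carrier[OF ds] component_additive[OF ds]])
          (auto simp: families_def intro: direct_sum_subset[OF ds])
      moreover have "component D (e i a) (f b) = (if a = b then (if i = j then f b else 0) else 0)" for b
        using f component_hom[OF ds, of "f b" "e j b" "e i a"] by (auto simp: families_def inj)
      ultimately show ?thesis by (simp add: Sum_any.delta')
    qed
    then show ?thesis by (simp add: xf)
  qed
  have 5: "?S j \<subseteq> V" for j
    unfolding sum_space_hull[OF sub]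
    by (rule hull_minimal) (auto intro: direct_sum_subset[OF ds] direct_sum_carrier[OF ds])
  have 6: "add_subgroup (?S j)" for j
    by (rule add_subgroup_sum_space[OF sub])
  note * = direct_sumI[of ?S V ?c, OF 6 5 direct_sum_carrier[OF ds] 1 2 3 4]
  show "direct_sum V ?S"
    by (rule *(1))
  show "component ?S j x = ?c j x" if "x \<in> V" for x j
    by (rule *(2)) (use that in simp_all)
qed

section \<open>The two coarsenings of a grading by pairs\<close>

lemma direct_sum_N_part: "direct_sum V D \<Longrightarrow> direct_sum V (N_part D)"
  using direct_sum_coarsen(1)[of V D "\<lambda>n g. (n, g)"] by (simp add: N_part_def[abs_def] bij_def inj_def)

lemma direct_sum_G_part: "direct_sum V D \<Longrightarrow> direct_sum V (G_part D)"
proof -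
  assume "direct_sum V D"
  moreover have "bij (\<lambda>(g, n). (n, g))"
    by (rule bij_betw_byWitness[where f' = "\<lambda>(n, g). (g, n)"]) auto
  ultimately show ?thesis
    using direct_sum_coarsen(1)[of V D "\<lambda>g n. (n, g)"] by (simp add: G_part_def[abs_def])
qed

lemma N_part_hull: "direct_sum V D \<Longrightarrow> N_part D n = add_subgroup hull (\<Union>g. D (n, g))"
  unfolding N_part_def by (rule sum_space_hull) (rule direct_sum_add_subgroup)

lemma G_part_hull: "direct_sum V D \<Longrightarrow> G_part D g = add_subgroup hull (\<Union>n. D (n, g))"
  unfolding G_part_def by (rule sum_space_hull) (rule direct_sum_add_subgroup)

lemma G_part_mem: "direct_sum V D \<Longrightarrow> x \<in> D (n, g) \<Longrightarrow> x \<in> G_part D g"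
  by (auto simp: G_part_hull intro: hull_inc)

lemma N_part_mem: "direct_sum V D \<Longrightarrow> x \<in> D (n, g) \<Longrightarrow> x \<in> N_part D n"
  by (auto simp: N_part_hull intro: hull_inc)

text \<open>Each generator from \<open>D (n, h)\<close> is homogeneous for the group as well, so its
  component is itself or 0; in particular taking components by group elements does not disturb the
  numerical degree.\<close>

lemma G_component_N_part:
  assumes ds: "direct_sum V D" and x: "x \<in> N_part D n"
  shows "component (G_part D) g x \<in> N_part D n"
proof -
  note dG = direct_sum_G_part[OF ds] and N = N_part_hull[OF ds]
  have sub: "add_subgroup hull (\<Union>g. D (n, g)) \<subseteq> V"
    by (rule hull_minimal) (auto intro: direct_sum_subset[OF ds] direct_sum_carrier[OF ds])
  show ?thesis
  proof (rule additive_on_hull_mem[where f = "component (G_part D) g"])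
    show "additive_on (add_subgroup hull (\<Union>g. D (n, g))) (component (G_part D) g)"
      using component_additive[OF dG] sub by (rule additive_on_subset)
    show "x \<in> add_subgroup hull (\<Union>g. D (n, g))"
      using x by (simp add: N)
  next
    fix y assume "y \<in> (\<Union>g. D (n, g))"
    then obtain h where h: "y \<in> D (n, h)" by blast
    then show "component (G_part D) g y \<in> N_part D n"
      using component_hom[OF dG G_part_mem[OF ds h], of g] N_part_mem[OF ds h]
        add_subgroup_zero[OF direct_sum_add_subgroup[OF direct_sum_N_part[OF ds]], of n]
      by (auto split: if_splits)
  next
    show "add_subgroup (N_part D n)"
      by (rule direct_sum_add_subgroup[OF direct_sum_N_part[OF ds]])
  qed
qed

text \<open>Both sides are additive in \<open>x\<close>, so it suffices to compare them on
  homogeneous elements, where \<open>component\<close> is the identity or 0.\<close>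

lemma component_natural:
  assumes ds: "direct_sum V D" "direct_sum W E" and f: "additive_on V f" "\<And>i. f ` D i \<subseteq> E i"
    and x: "x \<in> V"
  shows "f (component D i x) = component E i (f x)"
proof -
  have fV: "f ` V \<subseteq> W"
  proof safe
    fix x assume x: "x \<in> V"
    show "f x \<in> W"
    proof (rule additive_on_hull_mem[where f = f])
      show "additive_on (add_subgroup hull (\<Union>i. D i)) f" "x \<in> add_subgroup hull (\<Union>i. D i)"
        using f(1) x direct_sum_hull[OF ds(1)] by simp_all
      show "f y \<in> W" if "y \<in> (\<Union>i. D i)" for y
        using that f(2) direct_sum_subset[OF ds(2)] by blast
    qed (rule direct_sum_carrier[OF ds(2)])
  qed
  have cV: "component D i ` V \<subseteq> V"
    using component_in[OF ds(1)] direct_sum_subset[OF ds(1)] by blast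
  show ?thesis
  proof (rule additive_on_hull_eq[where f = "\<lambda>x. f (component D i x)" and g = "\<lambda>x. component E i (f x)"])
    show "x \<in> add_subgroup hull (\<Union>i. D i)"
      using x direct_sum_hull[OF ds(1)] by simp
    show "additive_on (add_subgroup hull (\<Union>i. D i)) (\<lambda>x. f (component D i x))"
      using additive_on_comp[OF component_additive[OF ds(1)] cV f(1)] direct_sum_hull[OF ds(1)] by simp
    show "additive_on (add_subgroup hull (\<Union>i. D i)) (\<lambda>x. component E i (f x))"
      using additive_on_comp[OF f(1) fV component_additive[OF ds(2)]] direct_sum_hull[OF ds(1)] by simp
  next
    fix y assume "y \<in> (\<Union>i. D i)"
    then obtain j where "y \<in> D j" by blast
    moreover from this have "f y \<in> E j" using f(2) by blast
    ultimately show "f (component D i y) = component E i (f y)"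
      by (simp add: component_hom[OF ds(1)] component_hom[OF ds(2)]
          additive_on_zero[OF direct_sum_carrier[OF ds(1)] f(1)])
  qed
qed

lemma G_part_map:
  assumes ds: "direct_sum V D" "direct_sum W E" and f: "additive_on V f" "\<And>i. f ` D i \<subseteq> E i"
  shows "f ` G_part D g \<subseteq> G_part E g" "f ` N_part D n \<subseteq> N_part E n"
proof -
  have *: "f ` (add_subgroup hull X) \<subseteq> add_subgroup hull Y" if "X \<subseteq> V" "f ` X \<subseteq> Y" for X Y
  proof safe
    fix x assume x: "x \<in> add_subgroup hull X"
    show "f x \<in> add_subgroup hull Y"
    proof (rule additive_on_hull_mem[where f = f, OF _ add_subgroup_hull _ x])
      show "additive_on (add_subgroup hull X) f"
        using f(1) by (rule additive_on_subset) (simp add: hull_minimal that direct_sum_carrier[OF ds(1)])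
      show "f y \<in> add_subgroup hull Y" if "y \<in> X" for y
        using that \<open>f ` X \<subseteq> Y\<close> by (intro hull_inc) blast
    qed
  qed
  show "f ` G_part D g \<subseteq> G_part E g"
    unfolding G_part_hull[OF ds(1)] G_part_hull[OF ds(2)]
  proof (rule *)
    show "(\<Union>n. D (n, g)) \<subseteq> V"
      by (auto intro: direct_sum_subset[OF ds(1)])
    show "f ` (\<Union>n. D (n, g)) \<subseteq> (\<Union>n. E (n, g))"
      unfolding image_UN by (rule UN_mono[OF subset_refl f(2)])
  qed
  show "f ` N_part D n \<subseteq> N_part E n"
    unfolding N_part_hull[OF ds(1)] N_part_hull[OF ds(2)]
  proof (rule *)
    show "(\<Union>g. D (n, g)) \<subseteq> V"
      by (auto intro: direct_sum_subset[OF ds(1)])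
    show "f ` (\<Union>g. D (n, g)) \<subseteq> (\<Union>g. E (n, g))"
      unfolding image_UN by (rule UN_mono[OF subset_refl f(2)])
  qed
qed

lemma sum_component:
  fixes D :: "'g::finite \<Rightarrow> 'v::ab_group_add set"
  assumes "direct_sum V D" and "x \<in> V"
  shows "(\<Sum>g\<in>UNIV. component D g x) = x"
  using Sum_any_component[OF assms] by (simp add: Sum_any_finite)

section \<open>Algebras and modules\<close>

locale alg_loc =
  fixes A :: "('k::field, 'b::ab_group_add) alg"
  assumes alg: "algebra A"
begin

sublocale vs: vector_space "alg_scale A"
  using alg by (simp add: algebra_def)

lemma mult_assoc: "(x \<cdot>\<^bsub>A\<^esub> y) \<cdot>\<^bsub>A\<^esub> z = x \<cdot>\<^bsub>A\<^esub> (y \<cdot>\<^bsub>A\<^esub> z)"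
  and one_mult [simp]: "alg_one A \<cdot>\<^bsub>A\<^esub> x = x"
  and mult_one [simp]: "x \<cdot>\<^bsub>A\<^esub> alg_one A = x"
  using alg by (auto simp: algebra_def monoid_def semigroup_def monoid_axioms_def)

lemma distrib_right: "(x + y) \<cdot>\<^bsub>A\<^esub> z = x \<cdot>\<^bsub>A\<^esub> z + y \<cdot>\<^bsub>A\<^esub> z"
  and distrib_left: "z \<cdot>\<^bsub>A\<^esub> (x + y) = z \<cdot>\<^bsub>A\<^esub> x + z \<cdot>\<^bsub>A\<^esub> y"
  and scale_mult: "alg_scale A c x \<cdot>\<^bsub>A\<^esub> y = alg_scale A c (x \<cdot>\<^bsub>A\<^esub> y)"
  and mult_scale: "x \<cdot>\<^bsub>A\<^esub> alg_scale A c y = alg_scale A c (x \<cdot>\<^bsub>A\<^esub> y)"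
  using alg by (auto simp: algebra_def)

lemma additive_mult_left: "additive_on UNIV (\<lambda>x. x \<cdot>\<^bsub>A\<^esub> y)"
  and additive_mult_right: "additive_on UNIV (\<lambda>y. x \<cdot>\<^bsub>A\<^esub> y)"
  by (auto simp: additive_on_def distrib_left distrib_right)

lemma zero_mult [simp]: "0 \<cdot>\<^bsub>A\<^esub> x = 0" and mult_zero [simp]: "x \<cdot>\<^bsub>A\<^esub> 0 = 0"
  using additive_on_zero[OF _ additive_mult_left] additive_on_zero[OF _ additive_mult_right] by auto

lemma sum_mult: "sum f I \<cdot>\<^bsub>A\<^esub> x = (\<Sum>i\<in>I. f i \<cdot>\<^bsub>A\<^esub> x)"
  and mult_sum: "x \<cdot>\<^bsub>A\<^esub> sum f I = (\<Sum>i\<in>I. x \<cdot>\<^bsub>A\<^esub> f i)"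
  using additive_on_sum[OF _ additive_mult_left] additive_on_sum[OF _ additive_mult_right] by auto

end

abbreviation alg_linear ::
    "('k::field, 'a::ab_group_add) alg \<Rightarrow> ('k, 'b::ab_group_add) alg \<Rightarrow> ('a \<Rightarrow> 'b) \<Rightarrow> bool" where
  "alg_linear A B \<equiv> Vector_Spaces.linear (alg_scale A) (alg_scale B)"

lemma alg_linear_iff:
  assumes "algebra A" "algebra B"
  shows "alg_linear A B f \<longleftrightarrow>
    (\<forall>x y. f (x + y) = f x + f y) \<and> (\<forall>c x. f (alg_scale A c x) = alg_scale B c (f x))"
  using assms by (simp add: Vector_Spaces.linear_iff algebra_def)

lemma alg_linear_zero_fun: "algebra A \<Longrightarrow> algebra B \<Longrightarrow> alg_linear A B (\<lambda>x. 0)"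
  by (simp add: alg_linear_iff vector_space.scale_eq_0_iff algebra_def)

lemma alg_linear_sum:
  assumes "algebra A" "algebra B" "\<And>i. i \<in> I \<Longrightarrow> alg_linear A B (f i)"
  shows "alg_linear A B (\<lambda>x. \<Sum>i\<in>I. f i x)"
  using assms(3)
proof (induction I rule: infinite_finite_induct)
  case (insert i I)
  interpret B: alg_loc B using assms by unfold_locales
  show ?case
    using insert assms(1,2) by (simp add: alg_linear_iff B.vs.scale_right_distrib ac_simps)
qed (auto simp: alg_linear_zero_fun assms)

lemma alg_linear_compose: "alg_linear A B f \<Longrightarrow> alg_linear B C g \<Longrightarrow> alg_linear A C (\<lambda>x. g (f x))"
  by (simp add: Vector_Spaces.linear_iff)

context alg_loc
begin

lemma linear_id: "alg_linear A A id" "alg_linear A A (\<lambda>x. x)"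
  and linear_mult_left: "alg_linear A A (\<lambda>x. a \<cdot>\<^bsub>A\<^esub> x)"
  and linear_mult_right: "alg_linear A A (\<lambda>x. x \<cdot>\<^bsub>A\<^esub> a)"
  and linear_scale: "alg_linear A A (alg_scale A c)"
  by (auto simp: alg_linear_iff alg distrib_left distrib_right scale_mult mult_scale
      vs.scale_right_distrib mult.commute)

end

context
  fixes A :: "('k::field, 'b::ab_group_add) alg" and M :: "('b, 'm::ab_group_add, 'z) lmod_scheme"
  assumes M: "left_module A M"
begin

lemma lmod_subgroup: "add_subgroup (carrier M)"
  and lact_closed: "x \<in> carrier M \<Longrightarrow> lact M a x \<in> carrier M"
  and lact_add: "x \<in> carrier M \<Longrightarrow> y \<in> carrier M \<Longrightarrow> lact M a (x + y) = lact M a x + lact M a y"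
  and lact_add_left: "x \<in> carrier M \<Longrightarrow> lact M (a + b) x = lact M a x + lact M b x"
  and lact_mult: "x \<in> carrier M \<Longrightarrow> lact M (a \<cdot>\<^bsub>A\<^esub> b) x = lact M a (lact M b x)"
  and lact_one: "x \<in> carrier M \<Longrightarrow> lact M (alg_one A) x = x"
  using M by (auto simp: left_module_def)

lemma additive_lact: "additive_on (carrier M) (lact M a)"
  and additive_lact_left: "x \<in> carrier M \<Longrightarrow> additive_on UNIV (\<lambda>a. lact M a x)"
  by (auto simp: additive_on_def lact_add lact_add_left)

lemma lact_zero: "lact M a 0 = 0" and lact_zero_left: "x \<in> carrier M \<Longrightarrow> lact M 0 x = 0"
  using additive_on_zero[OF lmod_subgroup additive_lact] additive_on_zero[OF _ additive_lact_left]
  by auto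

lemma lact_sum: "(\<And>i. i \<in> I \<Longrightarrow> f i \<in> carrier M) \<Longrightarrow> lact M a (sum f I) = (\<Sum>i\<in>I. lact M a (f i))"
  and lact_sum_left: "x \<in> carrier M \<Longrightarrow> lact M (sum u I) x = (\<Sum>i\<in>I. lact M (u i) x)"
  using additive_on_sum[OF lmod_subgroup additive_lact] additive_on_sum[OF _ additive_lact_left]
  by auto

end

lemma bimodule_lmod: "bimodule A M \<Longrightarrow> left_module A M"
  by (simp add: bimodule_def)

lemma left_moduleI:
  assumes "add_subgroup (carrier M)"
    and "\<And>a x. x \<in> carrier M \<Longrightarrow> lact M a x \<in> carrier M"
    and "\<And>a. additive_on (carrier M) (lact M a)"
    and "\<And>x. x \<in> carrier M \<Longrightarrow> additive_on UNIV (\<lambda>a. lact M a x)"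
    and "\<And>a b x. x \<in> carrier M \<Longrightarrow> lact M (a \<cdot>\<^bsub>A\<^esub> b) x = lact M a (lact M b x)"
    and "\<And>x. x \<in> carrier M \<Longrightarrow> lact M (alg_one A) x = x"
  shows "left_module A M"
  using assms by (simp add: left_module_def additive_on_def)

lemma bimoduleI:
  assumes "left_module A M"
    and "\<And>a x. x \<in> carrier M \<Longrightarrow> ract M x a \<in> carrier M"
    and "\<And>a. additive_on (carrier M) (\<lambda>x. ract M x a)"
    and "\<And>x. x \<in> carrier M \<Longrightarrow> additive_on UNIV (ract M x)"
    and "\<And>a b x. x \<in> carrier M \<Longrightarrow> ract M x (a \<cdot>\<^bsub>A\<^esub> b) = ract M (ract M x a) b"
    and "\<And>x. x \<in> carrier M \<Longrightarrow> ract M x (alg_one A) = x"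
    and "\<And>a b x. x \<in> carrier M \<Longrightarrow> ract M (lact M a x) b = lact M a (ract M x b)"
    and "\<And>c x. x \<in> carrier M \<Longrightarrow>
      lact M (alg_scale A c (alg_one A)) x = ract M x (alg_scale A c (alg_one A))"
  shows "bimodule A M"
  using assms by (simp add: bimodule_def additive_on_def)

context
  fixes A :: "('k::field, 'b::ab_group_add) alg" and M :: "('b, 'm::ab_group_add) bimod"
  assumes M: "bimodule A M"
begin

lemma ract_closed: "x \<in> carrier M \<Longrightarrow> ract M x a \<in> carrier M"
  and ract_add: "x \<in> carrier M \<Longrightarrow> y \<in> carrier M \<Longrightarrow> ract M (x + y) a = ract M x a + ract M y a"
  and ract_add_right: "x \<in> carrier M \<Longrightarrow> ract M x (a + b) = ract M x a + ract M x b"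
  and ract_mult: "x \<in> carrier M \<Longrightarrow> ract M x (a \<cdot>\<^bsub>A\<^esub> b) = ract M (ract M x a) b"
  and ract_one: "x \<in> carrier M \<Longrightarrow> ract M x (alg_one A) = x"
  and ract_lact: "x \<in> carrier M \<Longrightarrow> ract M (lact M a x) b = lact M a (ract M x b)"
  and bimod_central: "x \<in> carrier M \<Longrightarrow>
    lact M (alg_scale A c (alg_one A)) x = ract M x (alg_scale A c (alg_one A))"
  using M unfolding bimodule_def by blast+

lemma additive_ract: "additive_on (carrier M) (\<lambda>x. ract M x a)"
  and additive_ract_right: "x \<in> carrier M \<Longrightarrow> additive_on UNIV (ract M x)"
  by (auto simp: additive_on_def ract_add ract_add_right)

lemma ract_zero: "ract M 0 a = 0" and ract_zero_right: "x \<in> carrier M \<Longrightarrow> ract M x 0 = 0"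
  using additive_on_zero[OF lmod_subgroup[OF bimodule_lmod[OF M]] additive_ract]
    additive_on_zero[OF _ additive_ract_right]
  by auto

lemma ract_sum: "(\<And>i. i \<in> I \<Longrightarrow> f i \<in> carrier M) \<Longrightarrow> ract M (sum f I) a = (\<Sum>i\<in>I. ract M (f i) a)"
  and ract_sum_right: "x \<in> carrier M \<Longrightarrow> ract M x (sum u I) = (\<Sum>i\<in>I. ract M x (u i))"
  using additive_on_sum[OF lmod_subgroup[OF bimodule_lmod[OF M]] additive_ract]
    additive_on_sum[OF _ additive_ract_right]
  by auto

end

lemma lmod_homD:
  assumes "lmod_hom M N f"
  shows "x \<in> carrier M \<Longrightarrow> f x \<in> carrier N" and "additive_on (carrier M) f"
    and "x \<in> carrier M \<Longrightarrow> f (lact M a x) = lact N a (f x)"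
  using assms by (auto simp: lmod_hom_def additive_on_def)

lemma bimod_homD:
  assumes "bimod_hom M N f"
  shows "x \<in> carrier M \<Longrightarrow> f x \<in> carrier N" and "additive_on (carrier M) f"
    and "x \<in> carrier M \<Longrightarrow> f (lact M a x) = lact N a (f x)"
    and "x \<in> carrier M \<Longrightarrow> f (ract M x a) = ract N (f x) a"
  using assms by (auto simp: bimod_hom_def lmod_hom_def additive_on_def)

lemma bimod_homI:
  assumes "\<And>x. x \<in> carrier M \<Longrightarrow> f x \<in> carrier N" and "additive_on (carrier M) f"
    and "\<And>a x. x \<in> carrier M \<Longrightarrow> f (lact M a x) = lact N a (f x)"
    and "\<And>a x. x \<in> carrier M \<Longrightarrow> f (ract M x a) = ract N (f x) a"
  shows "bimod_hom M N f"
  using assms by (auto simp: bimod_hom_def lmod_hom_def additive_on_def)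

lemma bimod_hom_compose: "bimod_hom L M f \<Longrightarrow> bimod_hom M N g \<Longrightarrow> bimod_hom L N (\<lambda>x. g (f x))"
proof (rule bimod_homI)
  assume f: "bimod_hom L M f" and g: "bimod_hom M N g"
  show "additive_on (carrier L) (\<lambda>x. g (f x))"
    using bimod_homD(1)[OF f]
    by (intro additive_on_comp[OF bimod_homD(2)[OF f] _ bimod_homD(2)[OF g]]) auto
  fix x a assume "x \<in> carrier L"
  then show "g (f x) \<in> carrier N" "g (f (lact L a x)) = lact N a (g (f x))"
      "g (f (ract L x a)) = ract N (g (f x)) a"
    by (simp_all add: bimod_homD[OF f] bimod_homD[OF g])
qed

lemma bimod_hom_add:
  assumes "bimodule A N" "bimod_hom M N f" "bimod_hom M N g"
  shows "bimod_hom M N (\<lambda>x. f x + g x)"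
  using bimod_homD[OF assms(2)] bimod_homD[OF assms(3)] bimodule_lmod[OF assms(1)] assms(1)
  by (intro bimod_homI)
    (auto simp: lact_add ract_add intro: additive_on_add add_subgroup_add lmod_subgroup)

lemma bimod_hom_diff:
  assumes "bimodule A N" "bimod_hom M N f" "bimod_hom M N g"
  shows "bimod_hom M N (\<lambda>x. f x - g x)"
proof (rule bimod_homI)
  note f = bimod_homD[OF assms(2)] and g = bimod_homD[OF assms(3)] and N = bimodule_lmod[OF assms(1)]
  show "additive_on (carrier M) (\<lambda>x. f x - g x)"
    using f(2) g(2) by (auto simp: additive_on_def)
  fix x a assume x: "x \<in> carrier M"
  show "f x - g x \<in> carrier N"
    using x f g by (auto intro: add_subgroup_diff lmod_subgroup[OF N])
  show "f (lact M a x) - g (lact M a x) = lact N a (f x - g x)"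
    using x f g by (simp add: additive_on_diff[OF lmod_subgroup[OF N] additive_lact[OF N]])
  show "f (ract M x a) - g (ract M x a) = ract N (f x - g x) a"
    using x f g additive_on_diff[OF lmod_subgroup[OF N] additive_ract[OF assms(1)], of "f x" "g x"]
    by simp
qed


section \<open>Tensor squares\<close>

text \<open>\<open>tensor_map\<close> stays within one algebra, whereas passing between
  \<open>R\<close> and \<open>S\<close> needs maps with different source and target. A tensor acts
  on forms, so the tensor product of two maps acts by pulling forms back along them.\<close>

definition tens_map ::
    "('k::field, 'b::ab_group_add) alg \<Rightarrow> ('a \<Rightarrow> 'b) \<Rightarrow> ('a \<Rightarrow> 'b) \<Rightarrow> ('k, 'a) tens \<Rightarrow> ('k, 'b) tens" where
  "tens_map B f g t = (\<lambda>\<beta>. if bilinear_form B \<beta> then t (\<lambda>x y. \<beta> (f x) (g y)) else 0)"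

lemma tensor_map_eq: "tensor_map A f g = tens_map A f g"
  by (simp add: tensor_map_def tens_map_def fun_eq_iff)

lemma tens_map_add: "tens_map B f g (s + t) = tens_map B f g s + tens_map B f g t"
  by (simp add: tens_map_def fun_eq_iff)

lemma additive_tens_map: "additive_on H (tens_map B f g)"
  by (simp add: additive_on_def tens_map_add)

lemma tens_map_zero [simp]: "tens_map B f g 0 = 0"
  by (simp add: tens_map_def fun_eq_iff)

lemma tens_map_sum: "tens_map B f g (sum t I) = (\<Sum>i\<in>I. tens_map B f g (t i))"
  using additive_on_sum[OF _ additive_tens_map, of UNIV I t] by simp

lemma bilinear_form_pull:
  assumes "alg_linear A B f" "alg_linear A B g" "bilinear_form B \<beta>"
  shows "bilinear_form A (\<lambda>x y. \<beta> (f x) (g y))"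
  using assms by (simp add: bilinear_form_def Vector_Spaces.linear_iff)

lemma tens_map_tensor:
  assumes "alg_linear A B f" "alg_linear A B g"
  shows "tens_map B f g (tensor A x y) = tensor B (f x) (g y)"
  using bilinear_form_pull[OF assms] by (auto simp: tens_map_def tensor_def fun_eq_iff)

text \<open>Unfolding gives nested pullbacks of one form. Linearity of the outer pair
  \<open>f'\<close>, \<open>g'\<close> makes the first pullback bilinear, so the inner map does not
  fall into its default value 0.\<close>

lemma tens_map_compose:
  assumes "alg_linear B C f'" "alg_linear B C g'"
  shows "tens_map C f' g' (tens_map B f g t) = tens_map C (\<lambda>x. f' (f x)) (\<lambda>y. g' (g y)) t"
  using bilinear_form_pull[OF assms] by (auto simp: tens_map_def fun_eq_iff)

lemma tensor_square_subgroup: "add_subgroup (tensor_square A)"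
  by (simp add: tensor_square_def)

lemma tensor_mem [simp]: "tensor A x y \<in> tensor_square A"
  unfolding tensor_square_def by (rule hull_inc) blast

text \<open>Pure tensors generate the tensor square as an additive group, scalars being absorbed
  into a factor, so additive maps are determined by their values there. This serves as the
  uniqueness half of the universal property.\<close>

lemma tensor_square_eqI:
  assumes "additive_on (tensor_square A) f" "additive_on (tensor_square A) g"
    and "\<And>x y. f (tensor A x y) = g (tensor A x y)" and "t \<in> tensor_square A"
  shows "f t = g t"
  using additive_on_hull_eq[of "{tensor A x y |x y. True}" f g t] assms
  unfolding tensor_square_def by blast

lemma tensor_square_ball_eqI:
  assumes "additive_on (tensor_square A) f" "additive_on (tensor_square A) g"
    and "\<And>x y. f (tensor A x y) = g (tensor A x y)"
  shows "\<forall>t\<in>tensor_square A. f t = g t"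
  using tensor_square_eqI[OF assms] by blast

lemma tensor_square_memI:
  assumes "additive_on (tensor_square A) f" "add_subgroup K"
    and "\<And>x y. f (tensor A x y) \<in> K" and "t \<in> tensor_square A"
  shows "f t \<in> K"
  using additive_on_hull_mem[of "{tensor A x y |x y. True}" f K t] assms
  unfolding tensor_square_def by blast

lemma tens_map_mem:
  assumes "alg_linear A B f" "alg_linear A B g" "t \<in> tensor_square A"
  shows "tens_map B f g t \<in> tensor_square B"
  by (rule tensor_square_memI[where f = "tens_map B f g", OF additive_tens_map tensor_square_subgroup _ assms(3)])
    (simp add: tens_map_tensor[OF assms(1,2)])

lemma tensor_add_left: "tensor A (x + y) z = tensor A x z + tensor A y z"
  and tensor_add_right: "tensor A z (x + y) = tensor A z x + tensor A z y"
  and tensor_scale: "tensor A (alg_scale A c x) y = tensor A x (alg_scale A c y)"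
  by (auto simp: tensor_def fun_eq_iff bilinear_form_def Vector_Spaces.linear_iff)

lemma tensor_sum_left: "tensor A (sum f I) y = (\<Sum>i\<in>I. tensor A (f i) y)"
  and tensor_sum_right: "tensor A x (sum f I) = (\<Sum>i\<in>I. tensor A x (f i))"
  using additive_on_sum[of UNIV "\<lambda>x. tensor A x y"] additive_on_sum[of UNIV "tensor A x"]
  by (simp_all add: additive_on_def tensor_add_left tensor_add_right)

lemma tensor_zero [simp]: "tensor A x 0 = 0"
  using tensor_sum_right[of A _ _ "{}"] by auto

lemma tens_map_sum_left:
  assumes "algebra A" "algebra B" "\<And>i. i \<in> I \<Longrightarrow> alg_linear A B (f i)" "alg_linear A B g"
    and "t \<in> tensor_square A"
  shows "tens_map B (\<lambda>x. \<Sum>i\<in>I. f i x) g t = (\<Sum>i\<in>I. tens_map B (f i) g t)"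
proof (rule tensor_square_eqI[where t = t])
  show "additive_on (tensor_square A) (\<lambda>t. \<Sum>i\<in>I. tens_map B (f i) g t)"
    by (intro additive_on_sum_fun additive_tens_map)
qed (use assms in \<open>auto simp: tens_map_tensor alg_linear_sum tensor_sum_left additive_tens_map\<close>)

lemma tens_map_sum_right:
  assumes "algebra A" "algebra B" "\<And>i. i \<in> I \<Longrightarrow> alg_linear A B (f i)" "alg_linear A B g"
    and "t \<in> tensor_square A"
  shows "tens_map B g (\<lambda>x. \<Sum>i\<in>I. f i x) t = (\<Sum>i\<in>I. tens_map B g (f i) t)"
proof (rule tensor_square_eqI[where t = t])
  show "additive_on (tensor_square A) (\<lambda>t. \<Sum>i\<in>I. tens_map B g (f i) t)"
    by (intro additive_on_sum_fun additive_tens_map)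
qed (use assms in \<open>auto simp: tens_map_tensor alg_linear_sum tensor_sum_right additive_tens_map\<close>)

lemma tens_map_zero_left:
  assumes "algebra A" "algebra B" "alg_linear A B g" "t \<in> tensor_square A"
  shows "tens_map B (\<lambda>x. 0) g t = 0" "tens_map B g (\<lambda>x. 0) t = 0"
  using tens_map_sum_left[of A B "{}" undefined g t] tens_map_sum_right[of A B "{}" undefined g t] assms
  by auto

context alg_loc
begin

lemma tens_map_id: "t \<in> tensor_square A \<Longrightarrow> tens_map A (\<lambda>x. x) (\<lambda>x. x) t = t"
  by (rule tensor_square_eqI[where f = "tens_map A (\<lambda>x. x) (\<lambda>x. x)" and g = "\<lambda>t. t"])
    (auto simp: tens_map_add tens_map_tensor[OF linear_id(2) linear_id(2)] additive_on_def)

lemma outer_simps [simp]: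
  "carrier (outer_bimodule A) = tensor_square A"
  "lact (outer_bimodule A) a t = tens_map A (\<lambda>x. a \<cdot>\<^bsub>A\<^esub> x) (\<lambda>x. x) t"
  "ract (outer_bimodule A) t a = tens_map A (\<lambda>x. x) (\<lambda>x. x \<cdot>\<^bsub>A\<^esub> a) t"
  by (simp_all add: outer_bimodule_def tensor_map_eq id_def)

lemma inner_simps [simp]:
  "carrier (inner_bimodule A) = tensor_square A"
  "lact (inner_bimodule A) a t = tens_map A (\<lambda>x. x) (\<lambda>x. a \<cdot>\<^bsub>A\<^esub> x) t"
  "ract (inner_bimodule A) t a = tens_map A (\<lambda>x. x \<cdot>\<^bsub>A\<^esub> a) (\<lambda>x. x) t"
  by (simp_all add: inner_bimodule_def tensor_map_eq id_def)

lemmas lin = linear_id linear_mult_left linear_mult_right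

lemma outer_bimodule: "bimodule A (outer_bimodule A)"
proof (intro bimoduleI left_moduleI)
  fix a b c t assume "t \<in> carrier (outer_bimodule A)"
  then have t: "t \<in> tensor_square A"
    by simp
  show "lact (outer_bimodule A) a t \<in> carrier (outer_bimodule A)"
    "ract (outer_bimodule A) t a \<in> carrier (outer_bimodule A)"
    using tens_map_mem[OF lin(3,2) t] tens_map_mem[OF lin(2,4) t] by simp_all
  show "lact (outer_bimodule A) (a \<cdot>\<^bsub>A\<^esub> b) t = lact (outer_bimodule A) a (lact (outer_bimodule A) b t)"
    "ract (outer_bimodule A) t (a \<cdot>\<^bsub>A\<^esub> b) = ract (outer_bimodule A) (ract (outer_bimodule A) t a) b"
    "ract (outer_bimodule A) (lact (outer_bimodule A) a t) b =
      lact (outer_bimodule A) a (ract (outer_bimodule A) t b)"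
    by (simp_all add: tens_map_compose lin mult_assoc)
  show "lact (outer_bimodule A) (alg_one A) t = t" "ract (outer_bimodule A) t (alg_one A) = t"
    using t by (simp_all add: tens_map_id)
  have "\<forall>t\<in>tensor_square A. tens_map A (alg_scale A c) (\<lambda>x. x) t = tens_map A (\<lambda>x. x) (alg_scale A c) t"
    by (rule tensor_square_ball_eqI)
      (simp_all add: additive_tens_map tens_map_tensor[OF linear_scale lin(2)]
        tens_map_tensor[OF lin(2) linear_scale] tensor_scale)
  then show "lact (outer_bimodule A) (alg_scale A c (alg_one A)) t =
      ract (outer_bimodule A) t (alg_scale A c (alg_one A))"
    using t by (simp add: scale_mult mult_scale)
  have "\<forall>t\<in>tensor_square A. tens_map A ((\<cdot>\<^bsub>A\<^esub>) (a + b)) (\<lambda>x. x) t =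
      tens_map A ((\<cdot>\<^bsub>A\<^esub>) a) (\<lambda>x. x) t + tens_map A ((\<cdot>\<^bsub>A\<^esub>) b) (\<lambda>x. x) t" for a b
    by (rule tensor_square_ball_eqI)
      (simp_all add: additive_tens_map tens_map_tensor[OF lin(3,2)] distrib_right tensor_add_left
        additive_on_add)
  then show "additive_on UNIV (\<lambda>a. lact (outer_bimodule A) a t)"
    using t by (simp add: additive_on_def)
  have "\<forall>t\<in>tensor_square A. tens_map A (\<lambda>x. x) (\<lambda>x. x \<cdot>\<^bsub>A\<^esub> (a + b)) t =
      tens_map A (\<lambda>x. x) (\<lambda>x. x \<cdot>\<^bsub>A\<^esub> a) t + tens_map A (\<lambda>x. x) (\<lambda>x. x \<cdot>\<^bsub>A\<^esub> b) t" for a b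
    by (rule tensor_square_ball_eqI)
      (simp_all only: additive_tens_map additive_on_add tens_map_tensor[OF lin(2,4)],
        simp only: distrib_left tensor_add_right)
  then show "additive_on UNIV (ract (outer_bimodule A) t)"
    using t by (simp add: additive_on_def)
next
  fix a
  show "additive_on (carrier (outer_bimodule A)) (lact (outer_bimodule A) a)"
    "additive_on (carrier (outer_bimodule A)) (\<lambda>t. ract (outer_bimodule A) t a)"
    by (simp_all add: additive_on_def tens_map_add)
qed (simp add: tensor_square_subgroup)

text \<open>The inner actions commute with the outer ones, so composing with them preserves outer
  bimodule maps. This is the source of the bimodule structure on the dual complex.\<close>

lemma inner_outer_hom:
  assumes f: "bimod_hom M (outer_bimodule A) f"
  shows "bimod_hom M (outer_bimodule A) (\<lambda>x. lact (inner_bimodule A) a (f x))"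
    and "bimod_hom M (outer_bimodule A) (\<lambda>x. ract (inner_bimodule A) (f x) a)"
proof -
  note mem = bimod_homD(1)[OF f, simplified]
  show "bimod_hom M (outer_bimodule A) (\<lambda>x. lact (inner_bimodule A) a (f x))"
    using bimod_homD[OF f] tens_map_mem[OF lin(2,3)]
    by (intro bimod_homI)
      (auto simp: additive_on_def tens_map_add tens_map_compose lin mult_assoc)
  show "bimod_hom M (outer_bimodule A) (\<lambda>x. ract (inner_bimodule A) (f x) a)"
    using bimod_homD[OF f] tens_map_mem[OF lin(4,2)]
    by (intro bimod_homI)
      (auto simp: additive_on_def tens_map_add tens_map_compose lin mult_assoc)
qed

end


section \<open>Free and projective bimodules\<close>

context alg_loc
begin

text \<open>Coordinates for a fixed vector space basis of the algebra, obtained by extending the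
  empty independent set. Products of two coordinates are the bilinear forms that read off the
  coefficients of a tensor.\<close>

definition coord :: "'b \<Rightarrow> 'b \<Rightarrow> 'k" where
  "coord b x = vs.representation (vs.extend_basis {}) x b"

lemma coord_linear: "Vector_Spaces.linear (alg_scale A) (*) (coord b)"
  unfolding coord_def by (rule vs.linear_representation) (simp_all add: vs.independent_extend_basis vs.independent_empty)

lemma coord_finite: "finite {b. coord b x \<noteq> 0}"
  by (simp add: coord_def vs.finite_representation)

lemma coord_sum: "(\<Sum>b | coord b x \<noteq> 0. alg_scale A (coord b x) b) = x"
  unfolding coord_def by (rule vs.sum_nonzero_representation_eq) (simp_all add: vs.independent_extend_basis vs.independent_empty)

lemma coord_bilinear: "bilinear_form A (\<lambda>x y. coord b x * coord c y)"
  using coord_linear[of b] coord_linear[of c] alg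
  by (auto simp: bilinear_form_def Vector_Spaces.linear_iff algebra_simps)

definition tens_coord :: "'b \<times> 'b \<Rightarrow> ('k, 'b) tens \<Rightarrow> 'k" where
  "tens_coord p t = t (\<lambda>x y. coord (fst p) x * coord (snd p) y)"

lemma tens_coord_tensor: "tens_coord p (tensor A x y) = coord (fst p) x * coord (snd p) y"
  by (simp add: tens_coord_def tensor_def coord_bilinear)

lemma tens_coord_diff: "tens_coord p (s - t) = tens_coord p s - tens_coord p t"
  and tens_coord_add: "tens_coord p (s + t) = tens_coord p s + tens_coord p t"
  and tens_coord_zero: "tens_coord p 0 = 0"
  by (simp_all add: tens_coord_def)

lemma tens_coord_finite: "t \<in> tensor_square A \<Longrightarrow> finite {p. tens_coord p t \<noteq> 0}"
  unfolding tensor_square_def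
proof (induction t rule: hull_induct_diff)
  case (diff s t)
  then show ?case
    unfolding tens_coord_diff by (intro finite_support_diff)
next
  case (base t)
  then obtain x y where "t = tensor A x y" by blast
  then have "{p. tens_coord p t \<noteq> 0} \<subseteq> {b. coord b x \<noteq> 0} \<times> {c. coord c y \<noteq> 0}"
    by (auto simp: tens_coord_tensor)
  then show ?case
    by (rule finite_subset) (simp add: coord_finite)
next
  case zero
  show ?case
    unfolding tens_coord_zero by simp
qed

text \<open>The bimodule map out of \<open>A \<otimes> A\<close> with \<open>1 \<otimes> 1 \<mapsto> m\<close>; the expansion in a basis makes it
  well defined on the functionals that represent tensors.\<close>

definition extend_tens :: "('b, 'm::ab_group_add) bimod \<Rightarrow> 'm \<Rightarrow> ('k, 'b) tens \<Rightarrow> 'm" where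
  "extend_tens M m t = Sum_any (\<lambda>p. lact M (alg_scale A (tens_coord p t) (fst p)) (ract M m (snd p)))"

context
  fixes M :: "('b, 'm::ab_group_add) bimod" and m
  assumes M: "bimodule A M" and m: "m \<in> carrier M"
begin

text \<open>The ground field acts centrally, so a scalar may pass from the left factor to the right
  one; this is the balancing condition behind \<open>extend_tens_tensor\<close>.\<close>

lemma lact_scale_ract:
  "lact M (alg_scale A c a) (ract M m b) = lact M a (ract M m (alg_scale A c b))"
proof -
  have "alg_scale A c a = a \<cdot>\<^bsub>A\<^esub> alg_scale A c (alg_one A)" "alg_scale A c b = b \<cdot>\<^bsub>A\<^esub> alg_scale A c (alg_one A)"
    by (simp_all add: mult_scale)
  then show ?thesis
    using m by (simp add: lact_mult[OF bimodule_lmod[OF M]] ract_mult[OF M] bimod_central[OF M] ract_closed[OF M])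
qed

lemma extend_tens_summand_finite:
  assumes "t \<in> tensor_square A"
  shows "finite {p. lact M (alg_scale A (tens_coord p t) (fst p)) (ract M m (snd p)) \<noteq> 0}"
  using m by (intro rev_finite_subset[OF tens_coord_finite[OF assms]])
    (auto simp: lact_zero_left[OF bimodule_lmod[OF M]] ract_closed[OF M])

lemma additive_extend_tens: "additive_on (tensor_square A) (extend_tens M m)"
  unfolding additive_on_def
proof (intro ballI)
  fix s t assume "s \<in> tensor_square A" "t \<in> tensor_square A"
  then show "extend_tens M m (s + t) = extend_tens M m s + extend_tens M m t"
    unfolding extend_tens_def
    using m by (simp add: Sum_any.distrib[symmetric] extend_tens_summand_finite tens_coord_add
        vs.scale_left_distrib lact_add_left[OF bimodule_lmod[OF M]] ract_closed[OF M])
qed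

lemma extend_tens_tensor: "extend_tens M m (tensor A x y) = lact M x (ract M m y)"
proof -
  note lm = bimodule_lmod[OF M]
  let ?X = "{b. coord b x \<noteq> 0}" and ?Y = "{c. coord c y \<noteq> 0}"
  have "extend_tens M m (tensor A x y) =
      (\<Sum>p\<in>?X \<times> ?Y. lact M (alg_scale A (tens_coord p (tensor A x y)) (fst p)) (ract M m (snd p)))"
    unfolding extend_tens_def
    by (rule Sum_any.expand_superset)
      (use m in \<open>auto simp: coord_finite tens_coord_tensor lact_zero_left[OF lm] ract_closed[OF M]\<close>)
  \<comment> \<open>The coefficient of a pair of basis elements is a product of two coordinates; one
    of them is moved to the right side, so that each side becomes a basis expansion of its
    own.\<close>
  also have "\<dots> = (\<Sum>b\<in>?X. \<Sum>c\<in>?Y. lact M (alg_scale A (coord b x) b) (ract M m (alg_scale A (coord c y) c)))"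
    unfolding sum.cartesian_product
    by (intro sum.cong refl)
      (auto simp: tens_coord_tensor lact_scale_ract[symmetric] mult.commute)
  also have "\<dots> = lact M (\<Sum>b\<in>?X. alg_scale A (coord b x) b) (ract M m (\<Sum>c\<in>?Y. alg_scale A (coord c y) c))"
    using m by (simp add: ract_sum_right[OF M] lact_sum_left[OF lm] lact_sum[OF lm] ract_closed[OF M]
        add_subgroup_sum[OF lmod_subgroup[OF lm]] del: vs.scale_eq_0_iff) (rule sum.swap)
  finally show ?thesis
    by (simp add: coord_sum)
qed

lemma extend_tens_mem: "t \<in> tensor_square A \<Longrightarrow> extend_tens M m t \<in> carrier M"
  by (rule tensor_square_memI[OF additive_extend_tens])
    (use m in \<open>auto simp: extend_tens_tensor lmod_subgroup[OF bimodule_lmod[OF M]]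
      lact_closed[OF bimodule_lmod[OF M]] ract_closed[OF M]\<close>)

lemma extend_tens_hom: "bimod_hom (outer_bimodule A) M (extend_tens M m)"
proof (rule bimod_homI)
  note lm = bimodule_lmod[OF M]
  fix a t assume "t \<in> carrier (outer_bimodule A)"
  then have t: "t \<in> tensor_square A" by simp
  have tm: "tens_map A ((\<cdot>\<^bsub>A\<^esub>) a) (\<lambda>x. x) ` tensor_square A \<subseteq> tensor_square A"
    "tens_map A (\<lambda>x. x) (\<lambda>x. x \<cdot>\<^bsub>A\<^esub> a) ` tensor_square A \<subseteq> tensor_square A"
    using tens_map_mem[OF lin(3,2)] tens_map_mem[OF lin(2,4)] by auto
  have ex: "extend_tens M m ` tensor_square A \<subseteq> carrier M"
    using extend_tens_mem by blast
  show "extend_tens M m t \<in> carrier M"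
    using t by (rule extend_tens_mem)
  show "extend_tens M m (lact (outer_bimodule A) a t) = lact M a (extend_tens M m t)"
    unfolding outer_simps
  proof (rule tensor_square_eqI[OF _ _ _ t])
    show "additive_on (tensor_square A) (\<lambda>t. extend_tens M m (tens_map A ((\<cdot>\<^bsub>A\<^esub>) a) (\<lambda>x. x) t))"
      by (rule additive_on_comp[OF additive_tens_map tm(1) additive_extend_tens])
    show "additive_on (tensor_square A) (\<lambda>t. lact M a (extend_tens M m t))"
      by (rule additive_on_comp[OF additive_extend_tens ex additive_lact[OF lm]])
  qed (use m in \<open>simp add: tens_map_tensor[OF lin(3,2)] extend_tens_tensor lact_mult[OF lm] ract_closed[OF M]\<close>)
  show "extend_tens M m (ract (outer_bimodule A) t a) = ract M (extend_tens M m t) a"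
    unfolding outer_simps
  proof (rule tensor_square_eqI[OF _ _ _ t])
    show "additive_on (tensor_square A) (\<lambda>t. extend_tens M m (tens_map A (\<lambda>x. x) (\<lambda>x. x \<cdot>\<^bsub>A\<^esub> a) t))"
      by (rule additive_on_comp[OF additive_tens_map tm(2) additive_extend_tens])
    show "additive_on (tensor_square A) (\<lambda>t. ract M (extend_tens M m t) a)"
      by (rule additive_on_comp[OF additive_extend_tens ex additive_ract[OF M]])
  qed (use m in \<open>simp add: tens_map_tensor[OF lin(2,4)] extend_tens_tensor ract_mult[OF M] ract_closed[OF M] ract_lact[OF M]\<close>)
qed (simp add: additive_extend_tens)

lemma extend_tens_unit: "extend_tens M m (tensor A (alg_one A) (alg_one A)) = m"
  using m by (simp add: extend_tens_tensor ract_one[OF M] lact_one[OF bimodule_lmod[OF M]])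

end

text \<open>As an outer bimodule the tensor square is generated by 1 \<otimes> 1, so a homomorphism
  is determined by its value there.\<close>

lemma extend_tens_unique:
  assumes M: "bimodule A M" and f: "bimod_hom (outer_bimodule A) M f" and t: "t \<in> tensor_square A"
  shows "f t = extend_tens M (f (tensor A (alg_one A) (alg_one A))) t"
proof (rule tensor_square_eqI[OF _ _ _ t])
  note fD = bimod_homD[OF f, simplified]
  have m: "f (tensor A (alg_one A) (alg_one A)) \<in> carrier M"
    by (rule fD) simp
  show "additive_on (tensor_square A) f" by (rule fD)
  show "additive_on (tensor_square A) (extend_tens M (f (tensor A (alg_one A) (alg_one A))))"
    by (rule additive_extend_tens[OF M m])
  fix x y
  have "f (tens_map A ((\<cdot>\<^bsub>A\<^esub>) x) (\<lambda>x. x) (tens_map A (\<lambda>x. x) (\<lambda>z. z \<cdot>\<^bsub>A\<^esub> y)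
      (tensor A (alg_one A) (alg_one A)))) = lact M x (ract M (f (tensor A (alg_one A) (alg_one A))) y)"
    using tens_map_mem[OF lin(2,4), of "tensor A (alg_one A) (alg_one A)" y] by (simp only: fD tensor_mem)
  then show "f (tensor A x y) = extend_tens M (f (tensor A (alg_one A) (alg_one A))) (tensor A x y)"
    by (simp add: extend_tens_tensor[OF M m] tens_map_tensor[OF lin(3,2)] tens_map_tensor[OF lin(2,4)])
qed

definition single :: "'x \<Rightarrow> ('k, 'b) tens \<Rightarrow> 'x \<Rightarrow> ('k, 'b) tens" where
  "single x t = (\<lambda>y. if y = x then t else 0)"

definition unit :: "'x \<Rightarrow> 'x \<Rightarrow> ('k, 'b) tens" where
  "unit x = single x (tensor A (alg_one A) (alg_one A))"

definition extend_free :: "('b, 'm::ab_group_add) bimod \<Rightarrow> ('x \<Rightarrow> 'm) \<Rightarrow> ('x \<Rightarrow> ('k, 'b) tens) \<Rightarrow> 'm" where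
  "extend_free M z v = (\<Sum>x | v x \<noteq> 0. extend_tens M (z x) (v x))"

lemma free_mem: "v \<in> carrier (free_bimodule A X) \<longleftrightarrow>
    (\<forall>x. v x \<in> tensor_square A) \<and> finite {x. v x \<noteq> 0} \<and> {x. v x \<noteq> 0} \<subseteq> X"
  and free_lact: "lact (free_bimodule A X) a v = (\<lambda>x. lact (outer_bimodule A) a (v x))"
  and free_ract: "ract (free_bimodule A X) v a = (\<lambda>x. ract (outer_bimodule A) (v x) a)"
  by (simp_all add: free_bimodule_def del: outer_simps)

lemma free_subgroup: "add_subgroup (carrier (free_bimodule A X))"
  unfolding add_subgroup_def
proof (intro conjI ballI)
  fix v w assume v: "v \<in> carrier (free_bimodule A X)" and w: "w \<in> carrier (free_bimodule A X)"
  show "v - w \<in> carrier (free_bimodule A X)"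
    unfolding free_mem
  proof (intro conjI allI)
    show "(v - w) x \<in> tensor_square A" for x
      using v w by (simp add: free_mem add_subgroup_diff[OF tensor_square_subgroup])
    show "finite {x. (v - w) x \<noteq> 0}"
      using v w finite_support_diff[of v w] by (simp add: free_mem)
    have "{x. (v - w) x \<noteq> 0} \<subseteq> {x. v x \<noteq> 0} \<union> {x. w x \<noteq> 0}"
      by auto
    then show "{x. (v - w) x \<noteq> 0} \<subseteq> X"
      using v w by (simp add: free_mem) blast
  qed
qed (simp add: free_mem add_subgroup_zero tensor_square_subgroup)

lemma single_mem: "t \<in> tensor_square A \<Longrightarrow> x \<in> X \<Longrightarrow> single x t \<in> carrier (free_bimodule A X)"
  by (simp add: free_mem single_def add_subgroup_zero tensor_square_subgroup subset_iff)

lemma unit_mem: "x \<in> X \<Longrightarrow> unit x \<in> carrier (free_bimodule A X)"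
  by (simp add: unit_def single_mem)

context
  fixes M :: "('b, 'm::ab_group_add) bimod" and z :: "'x \<Rightarrow> 'm" and X
  assumes M: "bimodule A M" and z: "\<And>x. x \<in> X \<Longrightarrow> z x \<in> carrier M"
begin

lemma extend_free_superset:
  assumes "v \<in> carrier (free_bimodule A X)" "finite F" "{x. v x \<noteq> 0} \<subseteq> F" "F \<subseteq> X"
  shows "extend_free M z v = (\<Sum>x\<in>F. extend_tens M (z x) (v x))"
  unfolding extend_free_def
  by (rule sum.mono_neutral_left)
    (use assms z in \<open>auto simp: additive_on_zero[OF tensor_square_subgroup additive_extend_tens[OF M]]\<close>)

lemma extend_free_hom: "bimod_hom (free_bimodule A X) M (extend_free M z)"
proof (rule bimod_homI)
  note lm = bimodule_lmod[OF M]
  show "additive_on (carrier (free_bimodule A X)) (extend_free M z)"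
    unfolding additive_on_def
  proof (intro ballI)
    fix v w assume v: "v \<in> carrier (free_bimodule A X)" and w: "w \<in> carrier (free_bimodule A X)"
    let ?F = "{x. v x \<noteq> 0} \<union> {x. w x \<noteq> 0}"
    have vw: "v + w \<in> carrier (free_bimodule A X)"
      using v w by (rule add_subgroup_add[OF free_subgroup])
    have F: "finite ?F" "?F \<subseteq> X"
      using v w by (auto simp: free_mem)
    have "{x. (v + w) x \<noteq> 0} \<subseteq> ?F"
      by auto
    then have "extend_free M z v = (\<Sum>x\<in>?F. extend_tens M (z x) (v x))"
      "extend_free M z w = (\<Sum>x\<in>?F. extend_tens M (z x) (w x))"
      "extend_free M z (v + w) = (\<Sum>x\<in>?F. extend_tens M (z x) (v x + w x))"
      using extend_free_superset[OF v F(1) _ F(2)] extend_free_superset[OF w F(1) _ F(2)]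
        extend_free_superset[OF vw F(1) _ F(2)] by auto
    moreover have "extend_tens M (z x) (v x + w x) = extend_tens M (z x) (v x) + extend_tens M (z x) (w x)"
      if "x \<in> ?F" for x
      using v w F that additive_extend_tens[OF M z, of x] unfolding additive_on_def free_mem by blast
    ultimately show "extend_free M z (v + w) = extend_free M z v + extend_free M z w"
      by (simp add: sum.distrib)
  qed
next
  note lm = bimodule_lmod[OF M]
  fix a v assume v: "v \<in> carrier (free_bimodule A X)"
  let ?F = "{x. v x \<noteq> 0}"
  have F: "finite ?F" "?F \<subseteq> X" and vt: "v x \<in> tensor_square A" for x
    using v by (auto simp: free_mem)
  have mem: "extend_tens M (z x) (v x) \<in> carrier M" if "x \<in> ?F" for x
    using F(2) that vt by (intro extend_tens_mem[OF M z]) auto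
  show "extend_free M z v \<in> carrier M"
    unfolding extend_free_def using mem by (rule add_subgroup_sum[OF lmod_subgroup[OF lm]])
  have l0: "lact (free_bimodule A X) a v x = 0" "ract (free_bimodule A X) v a x = 0" if "v x = 0" for x
    using that by (simp_all add: free_lact free_ract)
  have lv: "lact (free_bimodule A X) a v \<in> carrier (free_bimodule A X)"
    using F l0(1) tens_map_mem[OF lin(3,2) vt]
    by (auto simp: free_mem free_lact intro: rev_finite_subset[OF F(1)])
  have rv: "ract (free_bimodule A X) v a \<in> carrier (free_bimodule A X)"
    using F l0(2) tens_map_mem[OF lin(2,4) vt]
    by (auto simp: free_mem free_ract intro: rev_finite_subset[OF F(1)])
  have "extend_free M z (lact (free_bimodule A X) a v) =
      (\<Sum>x\<in>?F. extend_tens M (z x) (lact (outer_bimodule A) a (v x)))"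
    using extend_free_superset[OF lv F(1) _ F(2)] l0(1) unfolding free_lact by blast
  also have "\<dots> = (\<Sum>x\<in>?F. lact M a (extend_tens M (z x) (v x)))"
    by (rule sum.cong) (use F(2) vt bimod_homD(3)[OF extend_tens_hom[OF M z]] in auto)
  also have "\<dots> = lact M a (extend_free M z v)"
    unfolding extend_free_def by (rule lact_sum[OF lm mem, symmetric])
  finally show "extend_free M z (lact (free_bimodule A X) a v) = lact M a (extend_free M z v)" .
  have "extend_free M z (ract (free_bimodule A X) v a) =
      (\<Sum>x\<in>?F. extend_tens M (z x) (ract (outer_bimodule A) (v x) a))"
    using extend_free_superset[OF rv F(1) _ F(2)] l0(2) unfolding free_ract by blast
  also have "\<dots> = (\<Sum>x\<in>?F. ract M (extend_tens M (z x) (v x)) a)"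
    by (rule sum.cong) (use F(2) vt bimod_homD(4)[OF extend_tens_hom[OF M z]] in auto)
  also have "\<dots> = ract M (extend_free M z v) a"
    unfolding extend_free_def by (rule ract_sum[OF M mem, symmetric])
  finally show "extend_free M z (ract (free_bimodule A X) v a) = ract M (extend_free M z v) a" .
qed

lemma extend_free_unit:
  assumes x: "x \<in> X"
  shows "extend_free M z (unit x) = z x"
proof -
  have "extend_free M z (unit x) = (\<Sum>y\<in>{x}. extend_tens M (z y) (unit x y))"
    by (rule extend_free_superset[OF unit_mem[OF x]]) (auto simp: unit_def single_def x)
  moreover have "unit x x = tensor A (alg_one A) (alg_one A)"
    by (simp add: unit_def single_def)
  ultimately show ?thesis
    by (simp add: extend_tens_unit[OF M z[OF x]])
qed

end

lemma single_hom: "x \<in> X \<Longrightarrow> bimod_hom (outer_bimodule A) (free_bimodule A X) (single x)"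
  by (rule bimod_homI)
    (simp_all add: single_mem additive_on_def free_lact free_ract, auto simp: single_def fun_eq_iff)

text \<open>A vector is a finite sum of vectors with one nonzero coordinate, and on a single
  coordinate the map is an outer bimodule map, determined by its value at
  \<open>unit x\<close>.\<close>

lemma extend_free_unique:
  assumes M: "bimodule A M" and f: "bimod_hom (free_bimodule A X) M f"
    and v: "v \<in> carrier (free_bimodule A X)"
  shows "f v = extend_free M (\<lambda>x. f (unit x)) v"
proof -
  let ?F = "{x. v x \<noteq> 0}"
  have F: "finite ?F" "?F \<subseteq> X" and vt: "v x \<in> tensor_square A" for x
    using v by (auto simp: free_mem)
  have "v = (\<Sum>x\<in>?F. single x (v x))"
    using F(1) by (auto simp: fun_eq_iff sum_fun single_def)
  moreover have "f (\<Sum>x\<in>?F. single x (v x)) = (\<Sum>x\<in>?F. f (single x (v x)))"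
    by (rule additive_on_sum[OF free_subgroup bimod_homD(2)[OF f]])
      (use F(2) vt in \<open>auto intro: single_mem\<close>)
  ultimately have "f v = (\<Sum>x\<in>?F. f (single x (v x)))"
    by simp
  also have "\<dots> = (\<Sum>x\<in>?F. extend_tens M (f (unit x)) (v x))"
  proof (rule sum.cong)
    fix x assume "x \<in> ?F"
    then have "bimod_hom (outer_bimodule A) M (\<lambda>t. f (single x t))"
      using F(2) by (intro bimod_hom_compose[OF single_hom f]) auto
    from extend_tens_unique[OF M this vt]
    show "f (single x (v x)) = extend_tens M (f (unit x)) (v x)"
      by (simp add: unit_def)
  qed simp
  finally show ?thesis
    by (simp add: extend_free_def)
qed

text \<open>Preimages under \<open>g\<close> are chosen for the images of the basis vectors of a
  free cover of \<open>P\<close>; the choice extends to the free module and is restricted along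
  \<open>\<iota>\<close>. The three modules may live on different types, as is needed when
  resolutions are compared.\<close>

lemma projective_lift:
  fixes P :: "('b, 'm::ab_group_add) bimod"
  assumes P: "projective_bimodule A P" and M: "bimodule A M" and N: "bimodule A N"
    and f: "bimod_hom P N f" and g: "bimod_hom M N g" and sub: "f ` carrier P \<subseteq> g ` carrier M"
  obtains h where "bimod_hom P M h" and "\<And>x. x \<in> carrier P \<Longrightarrow> g (h x) = f x"
proof -
  obtain X :: "'m set" and \<iota> \<pi> where \<iota>: "bimod_hom P (free_bimodule A X) \<iota>"
    and \<pi>: "bimod_hom (free_bimodule A X) P \<pi>" and \<pi>\<iota>: "\<And>x. x \<in> carrier P \<Longrightarrow> \<pi> (\<iota> x) = x"
    using P unfolding projective_bimodule_def by blast
  have "\<forall>x. x \<in> X \<longrightarrow> (\<exists>m\<in>carrier M. g m = f (\<pi> (unit x)))"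
    using sub bimod_homD(1)[OF \<pi> unit_mem] by fastforce
  then obtain z where z: "\<And>x. x \<in> X \<Longrightarrow> z x \<in> carrier M" "\<And>x. x \<in> X \<Longrightarrow> g (z x) = f (\<pi> (unit x))"
    by metis
  let ?e = "extend_free M z"
  note e = extend_free_hom[OF M z(1)]
  have *: "g (?e v) = f (\<pi> v)" if v: "v \<in> carrier (free_bimodule A X)" for v
  proof -
    have "g (?e v) = extend_free N (\<lambda>x. g (?e (unit x))) v"
      by (rule extend_free_unique[OF N bimod_hom_compose[OF e g] v])
    also have "\<dots> = extend_free N (\<lambda>x. f (\<pi> (unit x))) v"
      unfolding extend_free_def[of N]
    proof (rule sum.cong)
      fix x assume "x \<in> {x. v x \<noteq> 0}"
      then have "x \<in> X"
        using v by (auto simp: free_mem)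
      then show "extend_tens N (g (?e (unit x))) (v x) = extend_tens N (f (\<pi> (unit x))) (v x)"
        by (simp add: extend_free_unit[OF M z(1)] z(2))
    qed simp
    also have "\<dots> = f (\<pi> v)"
      by (rule extend_free_unique[OF N bimod_hom_compose[OF \<pi> f] v, symmetric])
    finally show ?thesis .
  qed
  show ?thesis
  proof (rule that)
    show "bimod_hom P M (\<lambda>x. ?e (\<iota> x))"
      by (rule bimod_hom_compose[OF \<iota> e])
    show "g (?e (\<iota> x)) = f x" if "x \<in> carrier P" for x
      using that by (simp add: * bimod_homD(1)[OF \<iota>] \<pi>\<iota>)
  qed
qed

end

section \<open>Comparison and truncation of resolutions\<close>

text \<open>The augmentation takes the place of a differential below degree 0, so exactness becomes
  one equation between image and cycles in every degree.\<close>

definition cycles :: "(nat \<Rightarrow> ('b, 'm::ab_group_add) bimod) \<Rightarrow> (nat \<Rightarrow> 'm \<Rightarrow> 'm) \<Rightarrow> ('m \<Rightarrow> 'b::ab_group_add)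
    \<Rightarrow> nat \<Rightarrow> 'm set" where
  "cycles P \<delta> \<epsilon> n = (case n of 0 \<Rightarrow> {x \<in> carrier (P 0). \<epsilon> x = 0} | Suc m \<Rightarrow> {x \<in> carrier (P n). \<delta> m x = 0})"

lemma resolutionD:
  assumes "bimodule_resolution A P \<delta> \<epsilon>"
  shows "projective_bimodule A (P n)" "bimodule A (P n)" "fin_gen_bimodule (P n)"
    "bimod_hom (P (Suc n)) (P n) (\<delta> n)"
    "bimod_hom (P 0) (regular_bimodule A) \<epsilon>" "\<epsilon> ` carrier (P 0) = UNIV"
    "\<delta> n ` carrier (P (Suc n)) = cycles P \<delta> \<epsilon> n"
  using assms
  by (auto simp: bimodule_resolution_def projective_bimodule_def exact_over_def cycles_def split: nat.splits)

lemma cycles_subset: "cycles P \<delta> \<epsilon> n \<subseteq> carrier (P n)"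
  by (auto simp: cycles_def split: nat.splits)

lemma regular_simps [simp]:
  "carrier (regular_bimodule A) = UNIV" "lact (regular_bimodule A) = alg_mult A"
  "ract (regular_bimodule A) = alg_mult A"
  by (simp_all add: regular_bimodule_def)

context alg_loc
begin

lemma regular_bimodule: "bimodule A (regular_bimodule A)"
  by (intro bimoduleI left_moduleI)
    (auto simp: additive_mult_left additive_mult_right mult_assoc scale_mult mult_scale)

text \<open>The comparison theorem. That cycles go to cycles is carried along in the recursion
  because it makes the next lifting problem solvable: the image of \<open>\<delta> n\<close>
  consists of the cycles of degree n, and these must land in the image of
  \<open>\<delta>' n\<close>.\<close>

lemma chain_map_exists:
  fixes P :: "nat \<Rightarrow> ('b, 'm::ab_group_add) bimod" and P' :: "nat \<Rightarrow> ('b, 'n::ab_group_add) bimod"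
  assumes res: "bimodule_resolution A P \<delta> \<epsilon>" and res': "bimodule_resolution A P' \<delta>' \<epsilon>'"
  obtains u where "\<And>n. bimod_hom (P n) (P' n) (u n)" "\<And>x. x \<in> carrier (P 0) \<Longrightarrow> \<epsilon>' (u 0 x) = \<epsilon> x"
    "\<And>n x. x \<in> carrier (P (Suc n)) \<Longrightarrow> \<delta>' n (u (Suc n) x) = u n (\<delta> n x)"
proof -
  note R = resolutionD[OF res] and R' = resolutionD[OF res']
  let ?Q = "\<lambda>n f. bimod_hom (P n) (P' n) f \<and> f ` cycles P \<delta> \<epsilon> n \<subseteq> cycles P' \<delta>' \<epsilon>' n \<and>
    (n = 0 \<longrightarrow> (\<forall>x\<in>carrier (P 0). \<epsilon>' (f x) = \<epsilon> x))"
  have "\<exists>u. \<forall>n. ?Q n (u n) \<and> (\<forall>x\<in>carrier (P (Suc n)). \<delta>' n (u (Suc n) x) = u n (\<delta> n x))"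
  proof (rule dependent_nat_choice)
    obtain f where f: "bimod_hom (P 0) (P' 0) f" "\<And>x. x \<in> carrier (P 0) \<Longrightarrow> \<epsilon>' (f x) = \<epsilon> x"
      using projective_lift[OF R(1) R'(2) regular_bimodule R(5) R'(5)] R'(6) by blast
    then show "\<exists>f. ?Q 0 f"
      using bimod_homD(1)[OF f(1)] by (intro exI[of _ f]) (auto simp: cycles_def)
  next
    fix f n assume f: "?Q n f"
    have "bimod_hom (P (Suc n)) (P' n) (\<lambda>x. f (\<delta> n x))"
      using f by (intro bimod_hom_compose[OF R(4)]) simp
    moreover have "(\<lambda>x. f (\<delta> n x)) ` carrier (P (Suc n)) \<subseteq> \<delta>' n ` carrier (P' (Suc n))"
      unfolding R'(7) image_image[of f "\<delta> n", symmetric] R(7) using f by blast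
    ultimately obtain g where g: "bimod_hom (P (Suc n)) (P' (Suc n)) g"
      "\<And>x. x \<in> carrier (P (Suc n)) \<Longrightarrow> \<delta>' n (g x) = f (\<delta> n x)"
      using projective_lift[OF R(1) R'(2) R'(2) _ R'(4)] by metis
    moreover have "f 0 = 0"
      using f additive_on_zero[OF lmod_subgroup[OF bimodule_lmod[OF R(2)]] bimod_homD(2)] by blast
    ultimately have "?Q (Suc n) g"
      using bimod_homD(1)[OF g(1)] by (auto simp: cycles_def)
    then show "\<exists>g. ?Q (Suc n) g \<and> (\<forall>x\<in>carrier (P (Suc n)). \<delta>' n (g x) = f (\<delta> n x))"
      using g by blast
  qed
  then obtain u where u: "\<And>n. ?Q n (u n)"
    "\<And>n. \<forall>x\<in>carrier (P (Suc n)). \<delta>' n (u (Suc n) x) = u n (\<delta> n x)"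
    by metis
  show ?thesis
    by (rule that[of u]) (use u in auto)
qed

text \<open>A chain map that becomes 0 under the augmentation is null homotopic. Only one homotopy
  map is kept at a time, with its formula restricted to cycles: there the term
  \<open>h (\<delta> x)\<close> vanishes and the homotopy formula reads \<delta> h = \<phi>.\<close>

lemma null_homotopy:
  fixes P :: "nat \<Rightarrow> ('b, 'm::ab_group_add) bimod"
  assumes res: "bimodule_resolution A P \<delta> \<epsilon>"
    and \<phi>: "\<And>n. bimod_hom (P n) (P n) (\<phi> n)" "\<And>x. x \<in> carrier (P 0) \<Longrightarrow> \<epsilon> (\<phi> 0 x) = 0"
      "\<And>n x. x \<in> carrier (P (Suc n)) \<Longrightarrow> \<delta> n (\<phi> (Suc n) x) = \<phi> n (\<delta> n x)"
  shows "\<exists>h. bimod_hom (P n) (P (Suc n)) h \<and> (\<forall>x\<in>cycles P \<delta> \<epsilon> n. \<delta> n (h x) = \<phi> n x)"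
proof (induction n)
  note R = resolutionD[OF res]
  case 0
  have "\<phi> 0 ` carrier (P 0) \<subseteq> \<delta> 0 ` carrier (P (Suc 0))"
    using \<phi>(2) bimod_homD(1)[OF \<phi>(1)] unfolding R(7) by (auto simp: cycles_def)
  then obtain h where "bimod_hom (P 0) (P (Suc 0)) h" "\<And>x. x \<in> carrier (P 0) \<Longrightarrow> \<delta> 0 (h x) = \<phi> 0 x"
    using projective_lift[OF R(1) R(2) R(2) \<phi>(1) R(4)] by metis
  then show ?case
    using cycles_subset[of P \<delta> \<epsilon> 0] by blast
next
  note R = resolutionD[OF res]
  case (Suc n)
  then obtain h where h: "bimod_hom (P n) (P (Suc n)) h" "\<And>x. x \<in> cycles P \<delta> \<epsilon> n \<Longrightarrow> \<delta> n (h x) = \<phi> n x"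
    by blast
  \<comment> \<open>The part of \<open>\<phi>\<close> not yet accounted for by the homotopy one
    degree lower. Its values are cycles, hence can be lifted.\<close>
  let ?\<psi> = "\<lambda>x. \<phi> (Suc n) x - h (\<delta> n x)"
  note sub = lmod_subgroup[OF bimodule_lmod[OF R(2)]]
  have \<psi>: "bimod_hom (P (Suc n)) (P (Suc n)) ?\<psi>"
    by (rule bimod_hom_diff[OF R(2) \<phi>(1) bimod_hom_compose[OF R(4) h(1)]])
  have "\<delta> n (?\<psi> x) = 0" if x: "x \<in> carrier (P (Suc n))" for x
  proof -
    have "\<delta> n x \<in> cycles P \<delta> \<epsilon> n"
      using x R(7)[of n] by blast
    then have "\<delta> n (h (\<delta> n x)) = \<phi> n (\<delta> n x)"
      by (rule h(2))
    moreover have "\<delta> n (?\<psi> x) = \<delta> n (\<phi> (Suc n) x) - \<delta> n (h (\<delta> n x))"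
      using x by (intro additive_on_diff[OF sub bimod_homD(2)[OF R(4)]] bimod_homD(1)[OF \<phi>(1)]
          bimod_homD(1)[OF h(1)] bimod_homD(1)[OF R(4)])
    ultimately show ?thesis
      using \<phi>(3)[OF x] by simp
  qed
  then have "?\<psi> ` carrier (P (Suc n)) \<subseteq> \<delta> (Suc n) ` carrier (P (Suc (Suc n)))"
    using bimod_homD(1)[OF \<psi>] unfolding R(7) by (auto simp: cycles_def)
  then obtain g where g: "bimod_hom (P (Suc n)) (P (Suc (Suc n))) g"
    "\<And>x. x \<in> carrier (P (Suc n)) \<Longrightarrow> \<delta> (Suc n) (g x) = ?\<psi> x"
    using projective_lift[OF R(1) R(2) R(2) \<psi> R(4)] by metis
  moreover have "h 0 = 0"
    by (rule additive_on_zero[OF sub bimod_homD(2)[OF h(1)]])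
  ultimately show ?case
    by (intro exI[of _ g]) (auto simp: cycles_def)
qed

text \<open>The homotopy is applied to the identity minus the round trip through \<open>P'\<close>.
  Beyond \<open>N\<close> the round trip is 0, so there the identity itself is null homotopic and
  \<open>h\<close> splits \<open>\<delta> n\<close> over the cycles.\<close>

lemma bounded_retraction:
  fixes P :: "nat \<Rightarrow> ('b, 'm::ab_group_add) bimod" and P' :: "nat \<Rightarrow> ('b, 'n::ab_group_add) bimod"
  assumes res: "bimodule_resolution A P \<delta> \<epsilon>" and res': "bimodule_resolution A P' \<delta>' \<epsilon>'"
    and N: "\<And>n. n > N \<Longrightarrow> carrier (P' n) = {0}" and n: "n > N"
  obtains h where "bimod_hom (P n) (P (Suc n)) h" "\<And>x. x \<in> cycles P \<delta> \<epsilon> n \<Longrightarrow> \<delta> n (h x) = x"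
proof -
  note R = resolutionD[OF res] and R' = resolutionD[OF res']
  note sub = lmod_subgroup[OF bimodule_lmod[OF R(2)]]
  obtain u where u: "\<And>n. bimod_hom (P n) (P' n) (u n)" "\<And>x. x \<in> carrier (P 0) \<Longrightarrow> \<epsilon>' (u 0 x) = \<epsilon> x"
    "\<And>n x. x \<in> carrier (P (Suc n)) \<Longrightarrow> \<delta>' n (u (Suc n) x) = u n (\<delta> n x)"
    using chain_map_exists[OF res res'] by metis
  obtain w where w: "\<And>n. bimod_hom (P' n) (P n) (w n)" "\<And>x. x \<in> carrier (P' 0) \<Longrightarrow> \<epsilon> (w 0 x) = \<epsilon>' x"
    "\<And>n x. x \<in> carrier (P' (Suc n)) \<Longrightarrow> \<delta> n (w (Suc n) x) = w n (\<delta>' n x)"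
    using chain_map_exists[OF res' res] by metis
  let ?\<phi> = "\<lambda>n x. x - w n (u n x)"
  have id: "bimod_hom (P n) (P n) (\<lambda>x. x)" for n
    by (rule bimod_homI) (auto simp: additive_on_def)
  have \<phi>: "bimod_hom (P n) (P n) (?\<phi> n)" for n
    by (rule bimod_hom_diff[OF R(2) id bimod_hom_compose[OF u(1) w(1)]])
  have mem: "w n (u n x) \<in> carrier (P n)" "u n x \<in> carrier (P' n)" if "x \<in> carrier (P n)" for n x
    using that bimod_homD(1)[OF u(1)] bimod_homD(1)[OF w(1)] by blast+
  have \<phi>0: "\<epsilon> (?\<phi> 0 x) = 0" if x: "x \<in> carrier (P 0)" for x
    using additive_on_diff[OF sub bimod_homD(2)[OF R(5)] x mem(1)[OF x]] w(2)[OF mem(2)[OF x]] u(2)[OF x]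
    by simp
  have \<phi>S: "\<delta> n (?\<phi> (Suc n) x) = ?\<phi> n (\<delta> n x)" if x: "x \<in> carrier (P (Suc n))" for n x
    using additive_on_diff[OF sub bimod_homD(2)[OF R(4)] x mem(1)[OF x]] w(3)[OF mem(2)[OF x]] u(3)[OF x]
    by simp
  have "\<exists>h. bimod_hom (P n) (P (Suc n)) h \<and> (\<forall>x\<in>cycles P \<delta> \<epsilon> n. \<delta> n (h x) = ?\<phi> n x)"
  proof (rule null_homotopy[of P \<delta> \<epsilon> ?\<phi> n])
    show "bimod_hom (P n) (P n) (?\<phi> n)" for n
      by (rule \<phi>)
  qed (use res \<phi>0 \<phi>S in simp_all)
  then obtain h where h: "bimod_hom (P n) (P (Suc n)) h" "\<And>x. x \<in> cycles P \<delta> \<epsilon> n \<Longrightarrow> \<delta> n (h x) = ?\<phi> n x"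
    by blast
  have "w n 0 = 0"
    by (rule additive_on_zero[OF lmod_subgroup[OF bimodule_lmod[OF R'(2)]] bimod_homD(2)[OF w(1)]])
  then have "w n (u n x) = 0" if "x \<in> carrier (P n)" for x
    using mem(2)[OF that] N[OF n] by simp
  then have "\<delta> n (h x) = x" if "x \<in> cycles P \<delta> \<epsilon> n" for x
    using h(2)[OF that] subsetD[OF cycles_subset that] by simp
  then show ?thesis
    using h(1) by (rule that[rotated])
qed

end

section \<open>Submodules, images and zero modules\<close>

lemma submodule:
  assumes M: "bimodule A M" and "add_subgroup Z" "Z \<subseteq> carrier M"
    and "\<And>a x. x \<in> Z \<Longrightarrow> lact M a x \<in> Z" "\<And>a x. x \<in> Z \<Longrightarrow> ract M x a \<in> Z"
  shows "bimodule A (M\<lparr>carrier := Z\<rparr>)"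
  using assms unfolding bimodule_def left_module_def by (simp add: subset_iff)

lemma fin_gen_image:
  assumes M: "bimodule A M" "fin_gen_bimodule M" and f: "bimod_hom M N f" and N: "bimodule A N"
    and im: "f ` carrier M = carrier N"
  shows "fin_gen_bimodule N"
proof -
  obtain X where X: "finite X" "X \<subseteq> carrier M"
    and gen: "carrier M = add_subgroup hull {lact M a (ract M x b) |a b x. x \<in> X}"
    using M(2) unfolding fin_gen_bimodule_def by blast
  let ?G = "{lact N a (ract N y b) |a b y. y \<in> f ` X}"
  note lM = bimodule_lmod[OF M(1)] and lN = bimodule_lmod[OF N]
  have fX: "f ` X \<subseteq> carrier N"
    using X im by blast
  have "f x \<in> add_subgroup hull ?G" if "x \<in> carrier M" for x
  proof (rule additive_on_hull_mem[where f = f, OF _ add_subgroup_hull])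
    show "additive_on (add_subgroup hull {lact M a (ract M x b) |a b x. x \<in> X}) f"
      using bimod_homD(2)[OF f] gen by simp
    show "x \<in> add_subgroup hull {lact M a (ract M x b) |a b x. x \<in> X}"
      using that gen by simp
  next
    fix y assume "y \<in> {lact M a (ract M x b) |a b x. x \<in> X}"
    then obtain a b x where y: "y = lact M a (ract M x b)" and x: "x \<in> X" by blast
    have xM: "x \<in> carrier M" using x X by blast
    have "f y = lact N a (ract N (f x) b)"
      unfolding y by (simp add: bimod_homD(3,4)[OF f] ract_closed[OF M(1)] xM)
    then show "f y \<in> add_subgroup hull ?G"
      using x by (intro hull_inc) blast
  qed
  then have "carrier N \<subseteq> add_subgroup hull ?G"
    unfolding im[symmetric] by (rule image_subsetI)
  moreover have "add_subgroup hull ?G \<subseteq> carrier N"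
  proof (rule hull_minimal)
    show "?G \<subseteq> carrier N"
    proof clarify
      fix a b x assume "x \<in> X"
      then have "f x \<in> carrier N" using fX by blast
      then show "lact N a (ract N (f x) b) \<in> carrier N"
        by (intro lact_closed[OF lN] ract_closed[OF N])
    qed
  qed (rule lmod_subgroup[OF lN])
  ultimately show ?thesis
    unfolding fin_gen_bimodule_def using X(1) fX by (intro exI[of _ "f ` X"]) auto
qed

lemma direct_sum_zero: "direct_sum {0} (\<lambda>i. {0})"
  by (rule direct_sumI(1)[where c = "\<lambda>i x. 0"])
    (auto simp: add_subgroup_def families_def additive_on_def)

lemma direct_sum_restrict:
  assumes ds: "direct_sum V D" and Z: "add_subgroup Z" "Z \<subseteq> V" "\<And>i x. x \<in> Z \<Longrightarrow> component D i x \<in> Z"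
  shows "direct_sum Z (\<lambda>i. D i \<inter> Z)"
proof (rule direct_sumI(1)[where c = "component D"])
  show "add_subgroup (D i \<inter> Z)" for i
    using Z(1) direct_sum_add_subgroup[OF ds, of i] by (auto simp: add_subgroup_def)
  show "(\<lambda>i. component D i x) \<in> families (\<lambda>i. D i \<inter> Z)" if "x \<in> Z" for x
    using that Z(2,3) component_families[OF ds, of x] by (auto simp: families_def)
  show "Sum_any (\<lambda>i. component D i x) = x" if "x \<in> Z" for x
    using that Z(2) by (intro Sum_any_component[OF ds]) auto
  show "additive_on Z (component D i)" for i
    using component_additive[OF ds] Z(2) by (rule additive_on_subset)
  show "component D i x = (if i = j then x else 0)" if "x \<in> D j \<inter> Z" for i j x
    using that component_hom[OF ds] by blast
qed (use Z in auto)

lemma graded_bimoduleD: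
  assumes "graded_bimodule A D M gr"
  shows "bimodule A M" "direct_sum (carrier M) gr"
    "a \<in> D i \<Longrightarrow> x \<in> gr j \<Longrightarrow> lact M a x \<in> gr (i + j)"
    "a \<in> D i \<Longrightarrow> x \<in> gr j \<Longrightarrow> ract M x a \<in> gr (j + i)"
  using assms by (auto simp: graded_bimodule_def graded_left_module_def)

lemma graded_bimoduleI:
  assumes "bimodule A M" "direct_sum (carrier M) gr"
    "\<And>a x i j. a \<in> D i \<Longrightarrow> x \<in> gr j \<Longrightarrow> lact M a x \<in> gr (i + j)"
    "\<And>a x i j. a \<in> D i \<Longrightarrow> x \<in> gr j \<Longrightarrow> ract M x a \<in> gr (j + i)"
  shows "graded_bimodule A D M gr"
  using assms by (auto simp: graded_bimodule_def graded_left_module_def bimodule_lmod)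

lemma zero_bimodule:
  fixes A :: "('k::field, 'b::ab_group_add) alg" and M :: "('b, 'm::ab_group_add) bimod"
  assumes M: "bimodule A M"
  shows "bimodule A (M\<lparr>carrier := {0}\<rparr>)" "fin_gen_bimodule (M\<lparr>carrier := {0}\<rparr>)"
    "graded_bimodule A D (M\<lparr>carrier := {0}\<rparr>) (\<lambda>i. {0})"
    "projective_bimodule A (M\<lparr>carrier := {0}\<rparr>)"
proof -
  note lM = bimodule_lmod[OF M]
  have z: "lact M a 0 = 0" "ract M 0 a = 0" for a
    by (simp_all add: lact_zero[OF lM] ract_zero[OF M])
  show b: "bimodule A (M\<lparr>carrier := {0}\<rparr>)"
    using M by (rule submodule) (auto simp: add_subgroup_def z add_subgroup_zero[OF lmod_subgroup[OF lM]])
  have "add_subgroup hull {} = {0::'m}"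
    by (rule hull_unique) (auto simp: add_subgroup_def)
  then show "fin_gen_bimodule (M\<lparr>carrier := {0}\<rparr>)"
    unfolding fin_gen_bimodule_def by (intro exI[of _ "{}"]) simp
  show "graded_bimodule A D (M\<lparr>carrier := {0}\<rparr>) (\<lambda>i. {0})"
    using b by (intro graded_bimoduleI) (auto simp: direct_sum_zero z)
  show "projective_bimodule A (M\<lparr>carrier := {0}\<rparr>)"
    unfolding projective_bimodule_def
  proof (intro conjI b exI)
    show "bimod_hom (M\<lparr>carrier := {0}\<rparr>) (free_bimodule A {}) (\<lambda>x. 0)"
      by (rule bimod_homI)
        (auto simp: free_bimodule_def additive_on_def outer_bimodule_def tensor_map_def fun_eq_iff
          tensor_square_subgroup add_subgroup_zero)
    show "bimod_hom (free_bimodule A {}) (M\<lparr>carrier := {0}\<rparr>) (\<lambda>x. 0)"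
      by (rule bimod_homI) (auto simp: additive_on_def z)
  qed simp
qed

context alg_loc
begin

text \<open>The finite resolution \<open>P'\<close> carries no grading and is used only to see that
  the cycles \<open>Z\<close> in a high degree of the graded resolution split off. As a direct
  summand \<open>Z\<close> is finitely generated projective; as the kernel of a graded map it
  inherits the grading. The splitting itself need not respect degrees.\<close>

lemma graded_truncation:
  fixes P :: "nat \<Rightarrow> ('b, 'm::ab_group_add) bimod" and P' :: "nat \<Rightarrow> ('b, 'n::ab_group_add) bimod"
  assumes gres: "graded_bimodule_resolution A D P gr \<delta> \<epsilon>" and res': "bimodule_resolution A P' \<delta>' \<epsilon>'"
    and N: "\<And>n. n > N \<Longrightarrow> carrier (P' n) = {0}"
  obtains Q :: "nat \<Rightarrow> ('b, 'm) bimod" and gr' \<delta>' N'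
    where "graded_bimodule_resolution A D Q gr' \<delta>' \<epsilon>" "\<And>n. n > N' \<Longrightarrow> carrier (Q n) = {0}"
proof -
  have res: "bimodule_resolution A P \<delta> \<epsilon>" and gr: "\<And>n. graded_bimodule A D (P n) (gr n)"
    and \<delta>gr: "\<And>n i. \<delta> n ` gr (Suc n) i \<subseteq> gr n i" and \<epsilon>gr: "\<And>i. \<epsilon> ` gr 0 i \<subseteq> D i"
    using gres by (auto simp: graded_bimodule_resolution_def)
  note R = resolutionD[OF res]
  note sub = lmod_subgroup[OF bimodule_lmod[OF R(2)]]
  \<comment> \<open>The least degree to which \<open>bounded_retraction\<close> applies; its cycles
    are the kernel of \<open>\<delta> N\<close>.\<close>
  define m where "m = Suc N"
  define Z where "Z = cycles P \<delta> \<epsilon> m"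
  obtain h where h: "bimod_hom (P m) (P (Suc m)) h" "\<And>x. x \<in> Z \<Longrightarrow> \<delta> m (h x) = x"
  proof (rule bounded_retraction[OF res res' N, of N m])
    show "N < m" by (simp add: m_def)
  qed (auto simp: Z_def)
  have Z: "Z = {x \<in> carrier (P m). \<delta> N x = 0}" and ZP: "Z \<subseteq> carrier (P m)"
    by (auto simp: Z_def cycles_def m_def)
  note \<delta>N = R(4)[of N, folded m_def]
  have Zsub: "add_subgroup Z"
    using sub[of m] additive_on_zero[OF sub bimod_homD(2)[OF \<delta>N]] additive_on_diff[OF sub bimod_homD(2)[OF \<delta>N]]
    unfolding add_subgroup_def Z by auto
  have lZ: "lact (P m) a x \<in> Z" and rZ: "ract (P m) x a \<in> Z" if "x \<in> Z" for a x
    using that lact_closed[OF bimodule_lmod[OF R(2)]] ract_closed[OF R(2)] bimod_homD(3,4)[OF \<delta>N]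
      lact_zero[OF bimodule_lmod[OF R(2)]] ract_zero[OF R(2)]
    by (auto simp: Z)
  let ?Z = "(P m)\<lparr>carrier := Z\<rparr>"
  have Zb: "bimodule A ?Z"
    using R(2) Zsub ZP lZ rZ by (rule submodule)
  have \<delta>m: "\<delta> m x \<in> Z" if "x \<in> carrier (P (Suc m))" for x
    using that R(7)[of m] by (auto simp: Z_def)
  \<comment> \<open>Going up by \<open>h\<close> and down by the differential lands in
    \<open>Z\<close> and is the identity on \<open>Z\<close>, so it retracts \<open>P m\<close> onto
    \<open>Z\<close>.\<close>
  let ?r = "\<lambda>x. \<delta> m (h x)"
  have r: "bimod_hom (P m) ?Z ?r"
    using bimod_homD[OF bimod_hom_compose[OF h(1) R(4)]] bimod_homD(1)[OF h(1)] \<delta>m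
    by (intro bimod_homI) auto
  have Zfg: "fin_gen_bimodule ?Z"
  proof (rule fin_gen_image[OF R(2) R(3) r Zb])
    show "?r ` carrier (P m) = carrier ?Z"
      using bimod_homD(1)[OF r] h(2) ZP by (force simp: image_iff)
  qed
  have Zproj: "projective_bimodule A ?Z"
  proof -
    obtain X :: "'m set" and \<iota> \<pi> where \<iota>: "bimod_hom (P m) (free_bimodule A X) \<iota>"
      and \<pi>: "bimod_hom (free_bimodule A X) (P m) \<pi>" and \<pi>\<iota>: "\<And>x. x \<in> carrier (P m) \<Longrightarrow> \<pi> (\<iota> x) = x"
      using R(1)[of m] unfolding projective_bimodule_def by blast
    have inc: "bimod_hom ?Z (P m) (\<lambda>x. x)"
      using ZP by (intro bimod_homI) (auto simp: additive_on_def)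
    show ?thesis
      unfolding projective_bimodule_def
    proof (intro conjI Zb exI ballI)
      show "bimod_hom ?Z (free_bimodule A X) (\<lambda>x. \<iota> x)"
        by (rule bimod_hom_compose[OF inc \<iota>])
      show "bimod_hom (free_bimodule A X) ?Z (\<lambda>v. ?r (\<pi> v))"
        by (rule bimod_hom_compose[OF \<pi> r])
      show "?r (\<pi> (\<iota> x)) = x" if "x \<in> carrier ?Z" for x
        using that ZP \<pi>\<iota> h(2) by auto
    qed
  qed
  have Zgr: "graded_bimodule A D ?Z (\<lambda>i. gr m i \<inter> Z)"
  proof (rule graded_bimoduleI[OF Zb])
    have "component (gr m) i x \<in> Z" if x: "x \<in> Z" for i x
    proof -
      have "\<delta> N (component (gr m) i x) = component (gr N) i (\<delta> N x)"
        using x ZP \<delta>gr[of N] unfolding m_def[symmetric]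
        by (intro component_natural[OF graded_bimoduleD(2)[OF gr] graded_bimoduleD(2)[OF gr] bimod_homD(2)[OF \<delta>N]]) auto
      also have "\<dots> = 0"
        using x by (simp add: Z additive_on_zero[OF sub component_additive[OF graded_bimoduleD(2)[OF gr]]])
      finally show ?thesis
        using x ZP direct_sum_subset[OF graded_bimoduleD(2)[OF gr] component_in[OF graded_bimoduleD(2)[OF gr]]]
        by (auto simp: Z)
    qed
    then show "direct_sum (carrier ?Z) (\<lambda>i. gr m i \<inter> Z)"
      using direct_sum_restrict[OF graded_bimoduleD(2)[OF gr] Zsub ZP] by simp
  qed (use graded_bimoduleD(3,4)[OF gr] lZ rZ in auto)
  \<comment> \<open>The resolution is kept up to degree \<open>m\<close> and closed by the inclusion
    of \<open>Z\<close>, placed in degree \<open>Suc m\<close>; all later terms are 0.\<close>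
  define Q where "Q n = (if n \<le> m then P n else if n = Suc m then ?Z else (P m)\<lparr>carrier := {0}\<rparr>)" for n
  define gr' where "gr' n = (if n \<le> m then gr n else if n = Suc m then (\<lambda>i. gr m i \<inter> Z) else (\<lambda>i. {0}))" for n
  define d where "d n = (if n < m then \<delta> n else if n = m then (\<lambda>x. x) else (\<lambda>x. 0))" for n
  show ?thesis
  proof (rule that)
    show "carrier (Q n) = {0}" if "n > Suc m" for n
      using that by (simp add: Q_def)
    have Q: "projective_bimodule A (Q n)" "fin_gen_bimodule (Q n)" "graded_bimodule A D (Q n) (gr' n)" for n
      using R(1,3) gr Zproj Zfg Zgr zero_bimodule[OF R(2)] by (auto simp: Q_def gr'_def)
    have dQ: "bimod_hom (Q (Suc n)) (Q n) (d n)" for n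
    proof -
      consider "n < m" | "n = m" | "n > m" by linarith
      then show ?thesis
      proof cases
        case 1
        then show ?thesis using R(4) by (simp add: Q_def d_def)
      next
        case 2
        then show ?thesis
          using ZP by (intro bimod_homI) (auto simp: Q_def d_def additive_on_def)
      next
        case 3
        then show ?thesis
          using add_subgroup_zero[OF Zsub] lact_zero[OF bimodule_lmod[OF R(2)]] ract_zero[OF R(2)]
          by (intro bimod_homI) (auto simp: Q_def d_def additive_on_def)
      qed
    qed
    have ex: "d n ` carrier (Q (Suc n)) = cycles Q d \<epsilon> n" for n
    proof -
      consider "n < m" | "n = m" | "n = Suc m" | "n > Suc m" by linarith
      then show ?thesis
      proof cases
        case 1
        then have "cycles Q d \<epsilon> n = cycles P \<delta> \<epsilon> n"
          by (auto simp: cycles_def Q_def d_def split: nat.splits)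
        then show ?thesis using 1 R(7)[of n] by (simp add: Q_def d_def)
      next
        case 2
        then show ?thesis by (simp add: Q_def d_def cycles_def m_def Z)
      next
        case 3
        then show ?thesis using add_subgroup_zero[OF Zsub] by (auto simp: Q_def d_def cycles_def)
      next
        case 4
        then show ?thesis by (auto simp: Q_def d_def cycles_def split: nat.splits)
      qed
    qed
    have "bimodule_resolution A Q d \<epsilon>"
      unfolding bimodule_resolution_def exact_over_def
    proof (intro conjI allI)
      show "bimod_hom (Q 0) (regular_bimodule A) \<epsilon>" "\<epsilon> ` carrier (Q 0) = UNIV"
        using R(5,6) by (simp_all add: Q_def)
      show "d 0 ` carrier (Q 1) = {x \<in> carrier (Q 0). \<epsilon> x = 0}"
        using ex[of 0] by (simp add: cycles_def)
      show "d (Suc n) ` carrier (Q (Suc (Suc n))) = {x \<in> carrier (Q (Suc n)). d n x = 0}" for n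
        using ex[of "Suc n"] by (simp add: cycles_def)
    qed (use Q dQ in auto)
    moreover have "d n ` gr' (Suc n) i \<subseteq> gr' n i" for n i
      using \<delta>gr add_subgroup_zero[OF direct_sum_add_subgroup[OF graded_bimoduleD(2)[OF Q(3)[of n]], of i]]
      by (cases n m rule: linorder_cases) (auto simp: d_def gr'_def)
    moreover have "\<epsilon> ` gr' 0 i \<subseteq> D i" for i
      using \<epsilon>gr by (simp add: gr'_def)
    ultimately show "graded_bimodule_resolution A D Q gr' d \<epsilon>"
      using Q(3) by (simp add: graded_bimodule_resolution_def)
  qed
qed

end

section \<open>Smash products of graded bimodules\<close>

text \<open>Translations and reflected translations permute the group. Left and right versions are
  separate since the group need not be commutative.\<close>

lemma sum_shift:
  fixes f :: "'g::{finite, group_add} \<Rightarrow> 'v::comm_monoid_add"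
  shows "(\<Sum>g\<in>UNIV. f (g - h)) = (\<Sum>g\<in>UNIV. f g)" and "(\<Sum>g\<in>UNIV. f (h - g)) = (\<Sum>g\<in>UNIV. f g)"
    and "(\<Sum>g\<in>UNIV. f (g + h)) = (\<Sum>g\<in>UNIV. f g)" and "(\<Sum>g\<in>UNIV. f (h + g)) = (\<Sum>g\<in>UNIV. f g)"
proof -
  show "(\<Sum>g\<in>UNIV. f (g - h)) = (\<Sum>g\<in>UNIV. f g)"
    by (rule sum.reindex_bij_betw, rule bij_betw_byWitness[where f' = "\<lambda>g. g + h"]) (auto simp: algebra_simps)
  show "(\<Sum>g\<in>UNIV. f (h - g)) = (\<Sum>g\<in>UNIV. f g)"
    by (rule sum.reindex_bij_betw, rule bij_betw_byWitness[where f' = "\<lambda>g. - g + h"]) (auto simp: algebra_simps)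
  show "(\<Sum>g\<in>UNIV. f (g + h)) = (\<Sum>g\<in>UNIV. f g)"
    by (rule sum.reindex_bij_betw, rule bij_betw_byWitness[where f' = "\<lambda>g. g - h"]) (auto simp: algebra_simps)
  show "(\<Sum>g\<in>UNIV. f (h + g)) = (\<Sum>g\<in>UNIV. f g)"
    by (rule sum.reindex_bij_betw, rule bij_betw_byWitness[where f' = "\<lambda>g. - h + g"]) (auto simp: add.assoc[symmetric])
qed

text \<open>The element \<open>x # p\<^sub>k\<close>, in the description of a smash product as
  functions on the group.\<close>

definition pt :: "'g \<Rightarrow> 'v::zero \<Rightarrow> 'g \<Rightarrow> 'v" where
  "pt k x = (\<lambda>g. if g = k then x else 0)"

lemma pt_apply: "pt k x g = (if g = k then x else 0)"
  by (simp add: pt_def)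

lemma sum_pt: "(\<Sum>g\<in>UNIV. pt g (q g)) = q" for q :: "'g::finite \<Rightarrow> 'v::ab_group_add"
  by (simp add: fun_eq_iff sum_fun pt_apply)

section \<open>The smash product of a graded algebra\<close>

locale smash_loc =
  fixes R :: "('k::field, 'r::ab_group_add) alg"
    and D :: "nat \<times> 'g::{finite, group_add} \<Rightarrow> 'r set"
  assumes graded: "graded_algebra R D"
begin

sublocale alg_loc R
  using graded by unfold_locales (simp add: graded_algebra_def)

lemma ds: "direct_sum UNIV D"
  and one_mem: "alg_one R \<in> D 0"
  and D_subspace: "module.subspace (alg_scale R) (D i)"
  and D_mult: "a \<in> D i \<Longrightarrow> b \<in> D j \<Longrightarrow> a \<cdot>\<^bsub>R\<^esub> b \<in> D (i + j)"
  using graded unfolding graded_algebra_def by blast+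

lemmas dG = direct_sum_G_part[OF ds] and dN = direct_sum_N_part[OF ds]

text \<open>The action on \<open>R\<close> of the idempotent p_g of the dual group algebra.\<close>

definition pr :: "'g \<Rightarrow> 'r \<Rightarrow> 'r" where
  "pr g x = component (G_part D) g x"

lemma pr_additive: "additive_on UNIV (pr g)"
  using component_additive[OF dG] by (simp add: pr_def[abs_def])

lemma pr_add: "pr g (x + y) = pr g x + pr g y"
  using pr_additive by (simp add: additive_on_def)

lemma pr_zero [simp]: "pr g 0 = 0"
  using additive_on_zero[OF _ pr_additive] by simp

lemma pr_sum: "pr g (sum f I) = (\<Sum>i\<in>I. pr g (f i))"
  using additive_on_sum[OF _ pr_additive] by simp

lemma pr_mem: "pr g x \<in> G_part D g"
  unfolding pr_def by (rule component_in[OF dG UNIV_I])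

lemma pr_hom: "x \<in> G_part D h \<Longrightarrow> pr g x = (if g = h then x else 0)"
  unfolding pr_def by (rule component_hom[OF dG])

lemma pr_pr: "pr g (pr h x) = (if g = h then pr h x else 0)"
  by (rule pr_hom[OF pr_mem])

lemma sum_pr [simp]: "(\<Sum>g\<in>UNIV. pr g x) = x"
  unfolding pr_def by (rule sum_component[OF dG UNIV_I])

lemma pr_N_part: "x \<in> N_part D n \<Longrightarrow> pr g x \<in> N_part D n"
  unfolding pr_def by (rule G_component_N_part[OF ds])

lemma scale_natural: "additive_on UNIV (alg_scale R c)" "alg_scale R c ` D i \<subseteq> D i"
  using D_subspace[of i] by (simp_all add: additive_on_def vs.scale_right_distrib vs.subspace_def image_subset_iff)

lemma pr_scale: "pr g (alg_scale R c x) = alg_scale R c (pr g x)"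
  unfolding pr_def
  by (rule component_natural[OF dG dG scale_natural(1) _ UNIV_I, symmetric])
    (rule G_part_map(1)[OF ds ds scale_natural])

lemma pr_linear: "alg_linear R R (pr g)"
  by (simp add: alg_linear_iff alg pr_add pr_scale)

lemma pr_one: "pr g (alg_one R) = (if g = 0 then alg_one R else 0)"
  by (rule pr_hom, rule G_part_mem[OF ds, of _ 0]) (use one_mem in \<open>simp add: zero_prod_def\<close>)

lemma N_part_subspace: "module.subspace (alg_scale R) (N_part D n)"
proof -
  have "alg_scale R c ` N_part D n \<subseteq> N_part D n" for c
    by (rule G_part_map(2)[OF ds ds scale_natural])
  then show ?thesis
    using direct_sum_add_subgroup[OF dN, of n]
    by (auto simp: vs.subspace_def add_subgroup_zero add_subgroup_add)
qed

abbreviation smash_alg :: "('k, 'g \<Rightarrow> 'r) alg"  (\<open>S\<close>) where "S \<equiv> smash R D"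

text \<open>In the coproduct of p_g over the factorisations g = u + v, multiplication by p_h leaves
  only v = h, hence u = g - h. In terms of elements: p_g r is the sum over h of r_(g-h) p_h.\<close>

lemma smash_mult_apply: "(s \<cdot>\<^bsub>S\<^esub> t) h = (\<Sum>g\<in>UNIV. s g \<cdot>\<^bsub>R\<^esub> pr (g - h) (t h))"
proof -
  have da: "dual_action R D (dual_basis u) x = pr u x" for u x
    by (simp add: dual_action_def dual_basis_def pr_def if_distrib[of "\<lambda>c. alg_scale R c _"] cong: if_cong)
  have "{(u, v). u + v = g} = (\<lambda>v. (g - v, v)) ` UNIV" for g :: 'g
    by (auto simp: image_iff)
  moreover have "inj (\<lambda>v. (g - v, v))" for g :: 'g
    by (auto simp: inj_def)
  ultimately have split: "(\<Sum>(u, v)\<in>{(u, v). u + v = g}. F u v) = (\<Sum>v\<in>UNIV. F (g - v) v)"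
    for g :: 'g and F :: "'g \<Rightarrow> 'g \<Rightarrow> 'g \<Rightarrow> 'r"
    by (simp add: sum.reindex)
  have st: "smash_tensor R x (dual_basis v * dual_basis h') h = (if v = h then (if h' = h then x else 0) else 0)"
    for x v h'
    by (simp add: smash_tensor_def dual_basis_def)
  show ?thesis
    by (simp add: smash_def smash_mult_def split da sum_fun st)
qed

end

text \<open>Both actions copy the product formula of \<open>S\<close>: on the left p_g is moved past
  an element of \<open>M\<close>, on the right past the scalar. For the regular bimodule they are
  the product itself.\<close>

definition smash_bimod ::
    "(nat \<times> 'g::{finite, group_add} \<Rightarrow> 'r::ab_group_add set) \<Rightarrow> ('r, 'm::ab_group_add) bimod
      \<Rightarrow> (nat \<times> 'g \<Rightarrow> 'm set) \<Rightarrow> ('g \<Rightarrow> 'r, 'g \<Rightarrow> 'm) bimod" where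
  "smash_bimod D M gr =
     \<lparr>carrier = {q. \<forall>h. q h \<in> carrier M},
      lact = (\<lambda>s q h. \<Sum>g\<in>UNIV. lact M (s g) (component (G_part gr) (g - h) (q h))),
      ract = (\<lambda>q s h. \<Sum>g\<in>UNIV. ract M (q g) (component (G_part D) (g - h) (s h)))\<rparr>"

locale gbimod_loc = smash_loc R D
  for R :: "('k::field, 'r::ab_group_add) alg"
    and D :: "nat \<times> 'g::{finite, group_add} \<Rightarrow> 'r set" +
  fixes M :: "('r, 'm::ab_group_add) bimod" and gr :: "nat \<times> 'g \<Rightarrow> 'm set"
  assumes gbimod: "graded_bimodule R D M gr"
begin

lemmas bM = graded_bimoduleD(1)[OF gbimod]
lemmas lM = bimodule_lmod[OF bM]
lemmas dsM = graded_bimoduleD(2)[OF gbimod]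
lemmas dGM = direct_sum_G_part[OF dsM] and dNM = direct_sum_N_part[OF dsM]
lemmas subM = lmod_subgroup[OF lM]

definition mp :: "'g \<Rightarrow> 'm \<Rightarrow> 'm" where
  "mp g x = component (G_part gr) g x"

lemma mp_additive: "additive_on (carrier M) (mp g)"
  using component_additive[OF dGM] by (simp add: mp_def[abs_def])

lemma mp_zero [simp]: "mp g 0 = 0"
  by (rule additive_on_zero[OF subM mp_additive])

lemma mp_sum: "(\<And>i. i \<in> I \<Longrightarrow> f i \<in> carrier M) \<Longrightarrow> mp g (sum f I) = (\<Sum>i\<in>I. mp g (f i))"
  by (rule additive_on_sum[OF subM mp_additive])

lemma mp_G_part: "x \<in> carrier M \<Longrightarrow> mp g x \<in> G_part gr g"
  unfolding mp_def by (rule component_in[OF dGM])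

lemma mp_mem [simp]: "x \<in> carrier M \<Longrightarrow> mp g x \<in> carrier M"
  using direct_sum_subset[OF dGM mp_G_part] .

lemma mp_hom: "x \<in> G_part gr h \<Longrightarrow> mp g x = (if g = h then x else 0)"
  unfolding mp_def by (rule component_hom[OF dGM])

lemma mp_mp: "x \<in> carrier M \<Longrightarrow> mp g (mp h x) = (if g = h then mp h x else 0)"
  by (rule mp_hom[OF mp_G_part])

lemma sum_mp [simp]: "x \<in> carrier M \<Longrightarrow> (\<Sum>g\<in>UNIV. mp g x) = x"
  unfolding mp_def by (rule sum_component[OF dGM])

lemma mp_N_part: "x \<in> N_part gr n \<Longrightarrow> mp g x \<in> N_part gr n"
  unfolding mp_def by (rule G_component_N_part[OF dsM])

text \<open>Degree rules are given for homogeneous elements, while a coarsened degree is a generated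
  subgroup; this carries a rule from generators to hulls in both arguments.\<close>

lemma lact_hull_mem:
  assumes a: "a \<in> add_subgroup hull A" and x: "x \<in> add_subgroup hull X" and X: "X \<subseteq> carrier M"
    and K: "add_subgroup K" and AX: "\<And>a x. a \<in> A \<Longrightarrow> x \<in> X \<Longrightarrow> lact M a x \<in> K"
  shows "lact M a x \<in> K"
proof (rule biadditive_hull_mem[where f = "lact M" and X = A and Y = X])
  have sub: "add_subgroup hull X \<subseteq> carrier M"
    using X subM by (rule hull_minimal)
  show "additive_on (add_subgroup hull X) (lact M a)" for a
    by (rule additive_on_subset[OF additive_lact[OF lM] sub])
  show "additive_on (add_subgroup hull A) (\<lambda>a. lact M a x)" if "x \<in> add_subgroup hull X" for x
    by (rule additive_on_subset[OF additive_lact_left[OF lM subsetD[OF sub that]] subset_UNIV])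
qed (fact a x K AX)+

lemma ract_hull_mem:
  assumes a: "a \<in> add_subgroup hull A" and x: "x \<in> add_subgroup hull X" and X: "X \<subseteq> carrier M"
    and K: "add_subgroup K" and AX: "\<And>a x. a \<in> A \<Longrightarrow> x \<in> X \<Longrightarrow> ract M x a \<in> K"
  shows "ract M x a \<in> K"
proof (rule biadditive_hull_mem[where f = "\<lambda>a x. ract M x a" and X = A and Y = X])
  have sub: "add_subgroup hull X \<subseteq> carrier M"
    using X subM by (rule hull_minimal)
  show "additive_on (add_subgroup hull X) (\<lambda>x. ract M x a)" for a
    by (rule additive_on_subset[OF additive_ract[OF bM] sub])
  show "additive_on (add_subgroup hull A) (\<lambda>a. ract M x a)" if "x \<in> add_subgroup hull X" for x
    by (rule additive_on_subset[OF additive_ract_right[OF bM subsetD[OF sub that]] subset_UNIV])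
qed (fact a x K AX)+

lemma lact_G_part: "a \<in> G_part D u \<Longrightarrow> x \<in> G_part gr v \<Longrightarrow> lact M a x \<in> G_part gr (u + v)"
  and ract_G_part: "a \<in> G_part D u \<Longrightarrow> x \<in> G_part gr v \<Longrightarrow> ract M x a \<in> G_part gr (v + u)"
proof -
  assume "a \<in> G_part D u" "x \<in> G_part gr v"
  then have *: "a \<in> add_subgroup hull (\<Union>n. D (n, u))" "x \<in> add_subgroup hull (\<Union>n. gr (n, v))"
    by (simp_all add: G_part_hull[OF ds] G_part_hull[OF dsM])
  have X: "(\<Union>n. gr (n, v)) \<subseteq> carrier M"
    by (auto intro: direct_sum_subset[OF dsM])
  show "lact M a x \<in> G_part gr (u + v)"
  proof (rule lact_hull_mem[OF * X direct_sum_add_subgroup[OF dGM]])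
    fix a x assume "a \<in> (\<Union>n. D (n, u))" "x \<in> (\<Union>n. gr (n, v))"
    then obtain m n where mn: "a \<in> D (m, u)" "x \<in> gr (n, v)" by blast
    then show "lact M a x \<in> G_part gr (u + v)"
      using graded_bimoduleD(3)[OF gbimod mn] by (intro G_part_mem[OF dsM]) simp
  qed
  show "ract M x a \<in> G_part gr (v + u)"
  proof (rule ract_hull_mem[OF * X direct_sum_add_subgroup[OF dGM]])
    fix a x assume "a \<in> (\<Union>n. D (n, u))" "x \<in> (\<Union>n. gr (n, v))"
    then obtain m n where mn: "a \<in> D (m, u)" "x \<in> gr (n, v)" by blast
    then show "ract M x a \<in> G_part gr (v + u)"
      using graded_bimoduleD(4)[OF gbimod mn] by (intro G_part_mem[OF dsM]) simp
  qed
qed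

lemma lact_N_part: "a \<in> N_part D m \<Longrightarrow> x \<in> N_part gr n \<Longrightarrow> lact M a x \<in> N_part gr (m + n)"
  and ract_N_part: "a \<in> N_part D m \<Longrightarrow> x \<in> N_part gr n \<Longrightarrow> ract M x a \<in> N_part gr (n + m)"
proof -
  assume "a \<in> N_part D m" "x \<in> N_part gr n"
  then have *: "a \<in> add_subgroup hull (\<Union>g. D (m, g))" "x \<in> add_subgroup hull (\<Union>g. gr (n, g))"
    by (simp_all add: N_part_hull[OF ds] N_part_hull[OF dsM])
  have X: "(\<Union>g. gr (n, g)) \<subseteq> carrier M"
    by (auto intro: direct_sum_subset[OF dsM])
  show "lact M a x \<in> N_part gr (m + n)"
  proof (rule lact_hull_mem[OF * X direct_sum_add_subgroup[OF dNM]])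
    fix a x assume "a \<in> (\<Union>g. D (m, g))" "x \<in> (\<Union>g. gr (n, g))"
    then obtain g h where gh: "a \<in> D (m, g)" "x \<in> gr (n, h)" by blast
    then show "lact M a x \<in> N_part gr (m + n)"
      using graded_bimoduleD(3)[OF gbimod gh] by (intro N_part_mem[OF dsM]) simp
  qed
  show "ract M x a \<in> N_part gr (n + m)"
  proof (rule ract_hull_mem[OF * X direct_sum_add_subgroup[OF dNM]])
    fix a x assume "a \<in> (\<Union>g. D (m, g))" "x \<in> (\<Union>g. gr (n, g))"
    then obtain g h where gh: "a \<in> D (m, g)" "x \<in> gr (n, h)" by blast
    then show "ract M x a \<in> N_part gr (n + m)"
      using graded_bimoduleD(4)[OF gbimod gh] by (intro N_part_mem[OF dsM]) simp
  qed
qed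

lemma sum_delta_cond: "(\<And>g. P g \<longleftrightarrow> g = k) \<Longrightarrow> (\<Sum>g\<in>UNIV. if P g then f g else 0) = f k"
  for f :: "'g \<Rightarrow> 'v::ab_group_add"
  by simp

lemma mp_lact_pr: "x \<in> carrier M \<Longrightarrow> mp w (lact M (pr u r) (mp v x)) = (if w = u + v then lact M (pr u r) (mp v x) else 0)"
  and mp_ract_pr: "x \<in> carrier M \<Longrightarrow> mp w (ract M (mp v x) (pr u r)) = (if w = v + u then ract M (mp v x) (pr u r) else 0)"
  using mp_hom[OF lact_G_part[OF pr_mem mp_G_part]] mp_hom[OF ract_G_part[OF pr_mem mp_G_part]]
  by blast+

text \<open>Among the components of \<open>r\<close> only the one of degree w - v can take degree v
  to degree w.\<close>

lemma mp_lact_mp: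
  assumes x: "x \<in> carrier M"
  shows "mp w (lact M r (mp v x)) = lact M (pr (w - v) r) (mp v x)"
proof -
  have "lact M r (mp v x) = (\<Sum>u\<in>UNIV. lact M (pr u r) (mp v x))"
    using x by (simp add: lact_sum_left[OF lM, symmetric])
  then have "mp w (lact M r (mp v x)) = (\<Sum>u\<in>UNIV. if w = u + v then lact M (pr u r) (mp v x) else 0)"
    using x by (simp add: mp_sum lact_closed[OF lM] mp_lact_pr)
  also have "\<dots> = lact M (pr (w - v) r) (mp v x)"
    by (rule sum_delta_cond) (auto simp: algebra_simps)
  finally show ?thesis .
qed

text \<open>Here the scalar has degree u and the degree of the module element is solved for: u + v =
  w gives v = - u + w, with the inverse on the left.\<close>

lemma mp_lact:
  assumes x: "x \<in> carrier M"
  shows "mp w (lact M (pr u r) x) = lact M (pr u r) (mp (- u + w) x)"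
proof -
  have "lact M (pr u r) x = (\<Sum>v\<in>UNIV. lact M (pr u r) (mp v x))"
    using x by (simp add: lact_sum[OF lM, symmetric])
  then have "mp w (lact M (pr u r) x) = (\<Sum>v\<in>UNIV. if w = u + v then lact M (pr u r) (mp v x) else 0)"
    using x by (simp add: mp_sum lact_closed[OF lM] mp_lact_pr)
  also have "\<dots> = lact M (pr u r) (mp (- u + w) x)"
    by (rule sum_delta_cond) (auto simp: add.assoc[symmetric])
  finally show ?thesis .
qed

lemma mp_ract:
  assumes x: "x \<in> carrier M"
  shows "mp w (ract M x (pr u r)) = ract M (mp (w - u) x) (pr u r)"
proof -
  have "ract M x (pr u r) = (\<Sum>v\<in>UNIV. ract M (mp v x) (pr u r))"
    using x by (simp add: ract_sum[OF bM, symmetric])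
  then have "mp w (ract M x (pr u r)) = (\<Sum>v\<in>UNIV. if w = v + u then ract M (mp v x) (pr u r) else 0)"
    using x by (simp add: mp_sum ract_closed[OF bM] mp_ract_pr)
  also have "\<dots> = ract M (mp (w - u) x) (pr u r)"
    by (rule sum_delta_cond) (auto simp: algebra_simps)
  finally show ?thesis .
qed

abbreviation Q :: "('g \<Rightarrow> 'r, 'g \<Rightarrow> 'm) bimod" where "Q \<equiv> smash_bimod D M gr"

lemma Q_simps:
  "q \<in> carrier Q \<longleftrightarrow> (\<forall>h. q h \<in> carrier M)"
  "lact Q s q h = (\<Sum>g\<in>UNIV. lact M (s g) (mp (g - h) (q h)))"
  "ract Q q s h = (\<Sum>g\<in>UNIV. ract M (q g) (pr (g - h) (s h)))"
  by (simp_all add: smash_bimod_def pr_def mp_def)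

lemma lact_Q_closed: "q \<in> carrier Q \<Longrightarrow> lact Q s q \<in> carrier Q"
  and ract_Q_closed: "q \<in> carrier Q \<Longrightarrow> ract Q q s \<in> carrier Q"
  by (auto simp: Q_simps intro!: add_subgroup_sum[OF subM] lact_closed[OF lM] ract_closed[OF bM])

text \<open>Associativity comes down to the telescoping (g' - g) + (g - h) = g' - h: taking the
  component of degree g' - h of a product whose right factor has degree g - h selects the component
  of degree g' - g of the scalar.\<close>

lemma lact_Q_mult:
  assumes "q \<in> carrier Q"
  shows "lact Q (s \<cdot>\<^bsub>S\<^esub> t) q = lact Q s (lact Q t q)"
proof
  fix h
  have q: "q h \<in> carrier M" for h using assms by (simp add: Q_simps)
  have "lact Q s (lact Q t q) h =
      (\<Sum>g'\<in>UNIV. lact M (s g') (mp (g' - h) (\<Sum>g\<in>UNIV. lact M (t g) (mp (g - h) (q h)))))"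
    by (simp add: Q_simps)
  also have "\<dots> = (\<Sum>g'\<in>UNIV. \<Sum>g\<in>UNIV. lact M (s g') (lact M (pr (g' - g) (t g)) (mp (g - h) (q h))))"
    using q by (simp add: mp_sum lact_closed[OF lM] mp_lact_mp lact_sum[OF lM] diff_diff_eq2 diff_add_eq)
  also have "\<dots> = (\<Sum>g\<in>UNIV. \<Sum>g'\<in>UNIV. lact M (s g' \<cdot>\<^bsub>R\<^esub> pr (g' - g) (t g)) (mp (g - h) (q h)))"
    using q by (subst sum.swap) (simp add: lact_mult[OF lM])
  also have "\<dots> = lact Q (s \<cdot>\<^bsub>S\<^esub> t) q h"
    using q by (simp add: Q_simps smash_mult_apply lact_sum_left[OF lM])
  finally show "lact Q (s \<cdot>\<^bsub>S\<^esub> t) q h = lact Q s (lact Q t q) h" ..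
qed

end

section \<open>The regular bimodule and the algebra axioms of \<open>S\<close>\<close>

context smash_loc
begin

lemma regular_graded: "graded_bimodule R D (regular_bimodule R) D"
  by (rule graded_bimoduleI) (simp_all add: regular_bimodule ds D_mult)

sublocale reg: gbimod_loc R D "regular_bimodule R" D
  by unfold_locales (rule regular_graded)

lemma reg_mp: "reg.mp = pr"
  by (simp add: fun_eq_iff pr_def reg.mp_def)

text \<open>The product of \<open>S\<close> is the left action on the smash product of the regular
  bimodule, so associativity of \<open>S\<close> is an instance of
  \<open>lact_Q_mult\<close>.\<close>

lemma smash_mult_reg: "s \<cdot>\<^bsub>S\<^esub> t = lact reg.Q s t"
  by (simp add: fun_eq_iff smash_mult_apply reg.Q_simps reg_mp)

lemma pr_mult_pr: "pr w (r \<cdot>\<^bsub>R\<^esub> pr v x) = pr (w - v) r \<cdot>\<^bsub>R\<^esub> pr v x"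
  and pr_pr_mult: "pr w (pr u r \<cdot>\<^bsub>R\<^esub> x) = pr u r \<cdot>\<^bsub>R\<^esub> pr (- u + w) x"
  using reg.mp_lact_mp[of x w r v] reg.mp_lact[of x w u r] by (simp_all add: reg_mp)

end

lemma direct_sum_fun:
  fixes E :: "'i \<Rightarrow> 'v::ab_group_add set" and V :: "'v set"
  assumes ds: "direct_sum V E"
  shows "direct_sum {q :: 'g::finite \<Rightarrow> 'v. \<forall>h. q h \<in> V} (\<lambda>i. {q. \<forall>h. q h \<in> E i})"
    and "\<And>i q. (\<forall>h. q h \<in> V) \<Longrightarrow>
      component (\<lambda>i. {q :: 'g \<Rightarrow> 'v. \<forall>h. q h \<in> E i}) i q = (\<lambda>h. component E i (q h))"
proof -
  let ?V = "{q :: 'g \<Rightarrow> 'v. \<forall>h. q h \<in> V}" and ?E = "\<lambda>i. {q :: 'g \<Rightarrow> 'v. \<forall>h. q h \<in> E i}"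
  let ?c = "\<lambda>i q h. component E i (q h)"
  have 1: "add_subgroup (?E i)" for i
    using direct_sum_add_subgroup[OF ds, of i] by (simp add: add_subgroup_def)
  have 2: "?E i \<subseteq> ?V" for i
    using direct_sum_subset[OF ds] by blast
  have 3: "add_subgroup ?V"
    using direct_sum_carrier[OF ds] by (simp add: add_subgroup_def)
  have fin: "finite {i. ?c i q \<noteq> 0}" if "q \<in> ?V" for q
  proof -
    have "{i. ?c i q \<noteq> 0} = (\<Union>h. {i. component E i (q h) \<noteq> 0})"
      by (auto simp: fun_eq_iff)
    then show ?thesis
      using that component_finite[OF ds] by simp
  qed
  have 4: "(\<lambda>i. ?c i q) \<in> families ?E" if "q \<in> ?V" for q
    using that fin[OF that] component_in[OF ds] by (simp add: families_def)
  have 5: "Sum_any (\<lambda>i. ?c i q) = q" if "q \<in> ?V" for q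
    using that Sum_any_component[OF ds] by (simp add: fun_eq_iff Sum_any_fun[OF fin[OF that]])
  have 6: "additive_on ?V (?c i)" for i
    using component_additive[OF ds] by (simp add: additive_on_def fun_eq_iff)
  have 7: "?c i q = (if i = j then q else 0)" if "q \<in> ?E j" for i j q
    using that component_hom[OF ds, of _ j i] by (simp add: fun_eq_iff)
  note * = direct_sumI[of ?E ?V ?c, OF 1 2 3 4 5 6 7]
  show "direct_sum ?V ?E"
    by (rule *(1))
  show "component ?E i q = ?c i q" if "\<forall>h. q h \<in> V" for i q
    by (rule *(2)) (use that in simp_all)
qed

context smash_loc
begin

lemma smash_simps [simp]:
  "alg_scale S c s = (\<lambda>g. alg_scale R c (s g))" "alg_one S = (\<lambda>_. alg_one R)"
  by (simp_all add: smash_def smash_tensor_def)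

text \<open>A constant function stands for r # 1, because the idempotents p_g sum to 1.\<close>

lemma cst_mult: "(\<lambda>_. r) \<cdot>\<^bsub>S\<^esub> s = (\<lambda>h. r \<cdot>\<^bsub>R\<^esub> s h)"
proof
  fix h
  have "((\<lambda>_. r) \<cdot>\<^bsub>S\<^esub> s) h = r \<cdot>\<^bsub>R\<^esub> (\<Sum>g\<in>UNIV. pr (g - h) (s h))"
    by (simp add: smash_mult_apply mult_sum)
  then show "((\<lambda>_. r) \<cdot>\<^bsub>S\<^esub> s) h = r \<cdot>\<^bsub>R\<^esub> s h"
    using sum_shift(1)[of "\<lambda>g. pr g (s h)" h] by simp
qed

lemma algebra_smash: "algebra S"
  unfolding algebra_def
proof (intro conjI allI)
  show "vector_space (alg_scale S)"
    by unfold_locales (simp_all add: fun_eq_iff vs.scale_right_distrib vs.scale_left_distrib)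
  show "monoid (alg_mult S) (alg_one S)"
  proof
    fix s t u :: "'g \<Rightarrow> 'r"
    show "s \<cdot>\<^bsub>S\<^esub> t \<cdot>\<^bsub>S\<^esub> u = s \<cdot>\<^bsub>S\<^esub> (t \<cdot>\<^bsub>S\<^esub> u)"
      using reg.lact_Q_mult[of u s t] by (simp add: smash_mult_reg reg.Q_simps)
    show "alg_one S \<cdot>\<^bsub>S\<^esub> s = s"
      by (simp add: cst_mult)
    show "s \<cdot>\<^bsub>S\<^esub> alg_one S = s"
      by (simp add: fun_eq_iff smash_mult_apply pr_one if_distrib cong: if_cong)
  qed
  fix s t u :: "'g \<Rightarrow> 'r" and c
  show "(s + t) \<cdot>\<^bsub>S\<^esub> u = s \<cdot>\<^bsub>S\<^esub> u + t \<cdot>\<^bsub>S\<^esub> u" "u \<cdot>\<^bsub>S\<^esub> (s + t) = u \<cdot>\<^bsub>S\<^esub> s + u \<cdot>\<^bsub>S\<^esub> t"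
    by (simp_all add: fun_eq_iff smash_mult_apply distrib_left distrib_right pr_add sum.distrib)
  show "alg_scale S c s \<cdot>\<^bsub>S\<^esub> t = alg_scale S c (s \<cdot>\<^bsub>S\<^esub> t)" "s \<cdot>\<^bsub>S\<^esub> alg_scale S c t = alg_scale S c (s \<cdot>\<^bsub>S\<^esub> t)"
    by (simp_all add: fun_eq_iff smash_mult_apply scale_mult mult_scale pr_scale vs.scale_sum_right)
qed

sublocale sm: alg_loc S
  by unfold_locales (rule algebra_smash)

lemma graded_smash: "graded_algebra S (smash_grading D)"
  unfolding graded_algebra_def
proof (intro conjI allI ballI)
  show "module.subspace (alg_scale S) (smash_grading D n)" for n
    using N_part_subspace[of n] by (simp add: sm.vs.subspace_def vs.subspace_def smash_grading_def)
  show "direct_sum UNIV (smash_grading D)"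
    using direct_sum_fun(1)[OF dN] by (simp add: smash_grading_def[abs_def])
  have "alg_one R \<in> N_part D 0"
    by (rule N_part_mem[OF ds, of _ _ 0]) (use one_mem in \<open>simp add: zero_prod_def\<close>)
  then show "alg_one S \<in> smash_grading D 0"
    by (simp add: smash_grading_def)
  fix m n a b assume "a \<in> smash_grading D m" "b \<in> smash_grading D n"
  then show "a \<cdot>\<^bsub>S\<^esub> b \<in> smash_grading D (m + n)"
    using reg.lact_N_part pr_N_part
    by (auto simp: smash_grading_def smash_mult_apply intro!: add_subgroup_sum[OF direct_sum_add_subgroup[OF dN]])
qed (rule algebra_smash)

lemma cst_mult_idem: "(\<lambda>_. r) \<cdot>\<^bsub>S\<^esub> pt k (alg_one R) = pt k r"
  by (simp add: cst_mult pt_def fun_eq_iff)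

lemma cst_mult_cst: "(\<lambda>_. r) \<cdot>\<^bsub>S\<^esub> (\<lambda>_. r') = (\<lambda>_. r \<cdot>\<^bsub>R\<^esub> r')"
  by (simp add: cst_mult)

text \<open>Every \<open>s\<close> is the sum of the products (s k # 1)(1 # p_k). From
  \<open>R\<close> only homogeneous elements are offered as generators, since moving an idempotent
  past such an element gives a single term.\<close>

lemma smash_generate [case_names zero add mult cst idem]:
  assumes "P 0" "\<And>s t. P s \<Longrightarrow> P t \<Longrightarrow> P (s + t)" "\<And>s t. P s \<Longrightarrow> P t \<Longrightarrow> P (s \<cdot>\<^bsub>S\<^esub> t)"
    and "\<And>u r. P (\<lambda>_. pr u r)" "\<And>k. P (pt k (alg_one R))"
  shows "P s"
proof -
  have sum: "P (\<Sum>i\<in>I. f i)" if "\<And>i. P (f i)" for I :: "'g set" and f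
    using that assms(1,2) by (induction I rule: infinite_finite_induct) auto
  have "P (\<Sum>u\<in>UNIV. (\<lambda>_. pr u r))" for r
    by (rule sum) (rule assms(4))
  then have "P (\<lambda>_. r)" for r
    by (simp add: sum_fun[abs_def])
  then have "P (\<Sum>k\<in>UNIV. (\<lambda>_. s k) \<cdot>\<^bsub>S\<^esub> pt k (alg_one R))"
    by (intro sum assms(3,5))
  then show ?thesis
    by (simp add: cst_mult_idem sum_pt)
qed

end

section \<open>Smash bimodules: axioms, grading and generators\<close>

context gbimod_loc
begin

lemma Q_subgroup: "add_subgroup (carrier Q)"
  using subM by (simp add: add_subgroup_def Q_simps)

lemma sum_mp_shift: "x \<in> carrier M \<Longrightarrow> (\<Sum>g\<in>UNIV. mp (g - h) x) = x"
  using sum_shift(1)[of "\<lambda>g. mp g x" h] by simp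

lemma sum_pr_shift: "(\<Sum>g\<in>UNIV. pr (g - h) r) = r"
  using sum_shift(1)[of "\<lambda>g. pr g r" h] by simp

context
  fixes q :: "'g \<Rightarrow> 'm" assumes q: "\<And>h. q h \<in> carrier M"
begin

lemma lact_cst: "lact Q (\<lambda>_. r) q = (\<lambda>h. lact M r (q h))"
  using q by (simp add: fun_eq_iff Q_simps lact_sum[OF lM, symmetric] sum_mp_shift)

lemma lact_idem: "lact Q (pt k (alg_one R)) q = (\<lambda>h. mp (k - h) (q h))"
proof
  fix h
  have "lact Q (pt k (alg_one R)) q h = (\<Sum>g\<in>UNIV. if g = k then mp (g - h) (q h) else 0)"
    unfolding Q_simps using q by (intro sum.cong) (simp_all add: pt_apply lact_one[OF lM] lact_zero_left[OF lM])
  then show "lact Q (pt k (alg_one R)) q h = mp (k - h) (q h)"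
    by simp
qed

lemma ract_pt: "ract Q q (pt k r) = pt k (\<Sum>g\<in>UNIV. ract M (q g) (pr (g - k) r))"
  using q by (simp add: fun_eq_iff Q_simps pt_apply ract_zero_right[OF bM])

lemma ract_idem: "ract Q q (pt k (alg_one R)) = pt k (q k)"
proof -
  have "(\<Sum>g\<in>UNIV. ract M (q g) (pr (g - k) (alg_one R))) = (\<Sum>g\<in>UNIV. if g = k then q g else 0)"
    using q by (intro sum.cong) (simp_all add: pr_one ract_one[OF bM] ract_zero_right[OF bM])
  then show ?thesis
    by (simp add: ract_pt)
qed

text \<open>For r of degree u the commutation rule has the single term p_g r = r p_(-u+g), so the
  coefficient at h comes from g = u + h.\<close>

lemma ract_cst_pr: "ract Q q (\<lambda>_. pr u r) = (\<lambda>h. ract M (q (u + h)) (pr u r))"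
proof
  fix h
  have "ract Q q (\<lambda>_. pr u r) h = (\<Sum>g\<in>UNIV. if g - h = u then ract M (q g) (pr u r) else 0)"
    unfolding Q_simps using q by (intro sum.cong) (simp_all add: pr_pr ract_zero_right[OF bM])
  also have "\<dots> = ract M (q (u + h)) (pr u r)"
    by (rule sum_delta_cond) (auto simp: algebra_simps)
  finally show "ract Q q (\<lambda>_. pr u r) h = ract M (q (u + h)) (pr u r)" .
qed

end

lemma bimodule_Q: "bimodule S Q"
proof (intro bimoduleI left_moduleI)
  fix q s t c assume q: "q \<in> carrier Q"
  then have q': "q h \<in> carrier M" for h by (simp add: Q_simps)
  show "lact Q s q \<in> carrier Q" "ract Q q s \<in> carrier Q"
    using q by (rule lact_Q_closed, rule ract_Q_closed)
  show "lact Q (s \<cdot>\<^bsub>S\<^esub> t) q = lact Q s (lact Q t q)"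
    using q by (rule lact_Q_mult)
  show "lact Q (alg_one S) q = q"
    using q' by (simp add: lact_cst lact_one[OF lM])
  show "additive_on UNIV (\<lambda>a. lact Q a q)" "additive_on UNIV (ract Q q)"
    using q' by (simp_all add: additive_on_def fun_eq_iff Q_simps lact_add_left[OF lM] ract_add_right[OF bM]
        pr_add sum.distrib)
  show "ract Q q (alg_one S) = q"
    using ract_cst_pr[of q 0 "alg_one R"] q' by (simp add: pr_one ract_one[OF bM])
  have "ract Q q (s \<cdot>\<^bsub>S\<^esub> t) h = ract Q (ract Q q s) t h" for h
  proof -
    have "ract Q q (s \<cdot>\<^bsub>S\<^esub> t) h =
        (\<Sum>g\<in>UNIV. \<Sum>k\<in>UNIV. ract M (ract M (q g) (pr (g - k) (s k))) (pr (k - h) (t h)))"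
      using q' by (simp add: Q_simps smash_mult_apply pr_sum pr_mult_pr ract_sum_right[OF bM] ract_mult[OF bM]
          diff_diff_eq2 diff_add_eq)
    also have "\<dots> = ract Q (ract Q q s) t h"
      using q' by (subst sum.swap) (simp add: Q_simps ract_sum[OF bM] ract_closed[OF bM])
    finally show ?thesis .
  qed
  then show "ract Q q (s \<cdot>\<^bsub>S\<^esub> t) = ract Q (ract Q q s) t" ..
  have "ract Q (lact Q s q) t h = lact Q s (ract Q q t) h" for h
  proof -
    have "lact Q s (ract Q q t) h =
        (\<Sum>g\<in>UNIV. \<Sum>k\<in>UNIV. lact M (s g) (mp (g - h) (ract M (q k) (pr (k - h) (t h)))))"
      using q' by (simp add: Q_simps mp_sum ract_closed[OF bM] lact_sum[OF lM])
    also have "\<dots> = (\<Sum>k\<in>UNIV. \<Sum>g\<in>UNIV. ract M (lact M (s g) (mp (g - k) (q k))) (pr (k - h) (t h)))"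
      using q' by (subst sum.swap) (simp add: mp_ract ract_lact[OF bM] diff_diff_eq2 diff_add_eq)
    also have "\<dots> = ract Q (lact Q s q) t h"
      using q' by (simp add: Q_simps ract_sum[OF bM] lact_closed[OF lM])
    finally show ?thesis ..
  qed
  then show "ract Q (lact Q s q) t = lact Q s (ract Q q t)" ..
  have "ract Q q (\<lambda>_. alg_scale R c (alg_one R)) = (\<lambda>h. ract M (q h) (alg_scale R c (alg_one R)))"
    using ract_cst_pr[of q 0 "alg_scale R c (alg_one R)"] q' by (simp add: pr_scale pr_one)
  then show "lact Q (alg_scale S c (alg_one S)) q = ract Q q (alg_scale S c (alg_one S))"
    using q' by (simp add: lact_cst bimod_central[OF bM])
next
  fix s
  show "additive_on (carrier Q) (lact Q s)" "additive_on (carrier Q) (\<lambda>q. ract Q q s)"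
    using mp_additive by (simp_all add: additive_on_def fun_eq_iff Q_simps lact_add[OF lM] ract_add[OF bM] sum.distrib)
qed (rule Q_subgroup)

lemma graded_Q: "graded_bimodule S (smash_grading D) Q (smash_grading gr)"
proof (rule graded_bimoduleI[OF bimodule_Q])
  have "carrier Q = {q. \<forall>h. q h \<in> carrier M}"
    by (simp add: smash_bimod_def)
  then show "direct_sum (carrier Q) (smash_grading gr)"
    using direct_sum_fun(1)[OF dNM] by (simp add: smash_grading_def[abs_def])
  fix m n s q assume "s \<in> smash_grading D m" "q \<in> smash_grading gr n"
  then show "lact Q s q \<in> smash_grading gr (m + n)" "ract Q q s \<in> smash_grading gr (n + m)"
    using lact_N_part mp_N_part ract_N_part pr_N_part
    by (auto simp: smash_grading_def Q_simps intro!: add_subgroup_sum[OF direct_sum_add_subgroup[OF dNM]])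
qed

text \<open>Compatibility with a scalar survives sums and products of scalars, so on each side it is
  enough to test the generators from \<open>smash_generate\<close>.\<close>

lemma smash_bimod_homI:
  assumes N: "bimodule S N" and f: "\<And>q. q \<in> carrier Q \<Longrightarrow> f q \<in> carrier N" "additive_on (carrier Q) f"
    and lc: "\<And>u r q. q \<in> carrier Q \<Longrightarrow> f (lact Q (\<lambda>_. pr u r) q) = lact N (\<lambda>_. pr u r) (f q)"
    and li: "\<And>k q. q \<in> carrier Q \<Longrightarrow> f (lact Q (pt k (alg_one R)) q) = lact N (pt k (alg_one R)) (f q)"
    and rc: "\<And>u r q. q \<in> carrier Q \<Longrightarrow> f (ract Q q (\<lambda>_. pr u r)) = ract N (f q) (\<lambda>_. pr u r)"
    and ri: "\<And>k q. q \<in> carrier Q \<Longrightarrow> f (ract Q q (pt k (alg_one R))) = ract N (f q) (pt k (alg_one R))"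
  shows "bimod_hom Q N f"
proof (rule bimod_homI[OF f])
  note lN = bimodule_lmod[OF N] and lQ = bimodule_lmod[OF bimodule_Q]
  note f0 = additive_on_zero[OF Q_subgroup f(2)]
  have fadd: "f (x + y) = f x + f y" if "x \<in> carrier Q" "y \<in> carrier Q" for x y
    using f(2) that by (simp add: additive_on_def)
  have "\<forall>q\<in>carrier Q. f (lact Q s q) = lact N s (f q)" for s
  proof (induction s rule: smash_generate)
    case zero
    show ?case by (intro ballI) (simp only: f0 f(1) lact_zero_left[OF lQ] lact_zero_left[OF lN])
  next
    case (add s t)
    then show ?case
      by (intro ballI) (simp only: f(1) fadd lact_closed[OF lQ] lact_add_left[OF lQ] lact_add_left[OF lN])
  next
    case (mult s t)
    then show ?case
      by (simp add: f(1) lact_closed[OF lQ] lact_mult[OF lQ] lact_mult[OF lN])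
  qed (use lc li in auto)
  then show "f (lact Q s q) = lact N s (f q)" if "q \<in> carrier Q" for s q
    using that by blast
  have "\<forall>q\<in>carrier Q. f (ract Q q s) = ract N (f q) s" for s
  proof (induction s rule: smash_generate)
    case zero
    show ?case by (intro ballI) (simp only: f0 f(1) ract_zero_right[OF bimodule_Q] ract_zero_right[OF N])
  next
    case (add s t)
    then show ?case
      by (intro ballI)
        (simp only: f(1) fadd ract_closed[OF bimodule_Q] ract_add_right[OF bimodule_Q] ract_add_right[OF N])
  next
    case (mult s t)
    then show ?case
      by (simp add: f(1) ract_closed[OF bimodule_Q] ract_mult[OF bimodule_Q] ract_mult[OF N])
  qed (use rc ri in auto)
  then show "f (ract Q q s) = ract N (f q) s" if "q \<in> carrier Q" for s q
    using that by blast
qed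

lemma pt_mem: "x \<in> carrier M \<Longrightarrow> pt k x \<in> carrier Q"
  by (simp add: Q_simps pt_apply add_subgroup_zero[OF subM])

lemma cst_mem: "x \<in> carrier M \<Longrightarrow> (\<lambda>_. x) \<in> carrier Q"
  by (simp add: Q_simps)

lemma pt_generated:
  assumes x: "x \<in> carrier M"
  shows "pt k (lact M a (ract M x b)) = lact Q (\<lambda>_. a) (ract Q (\<lambda>_. x) (pt k b))"
proof -
  have "ract Q (\<lambda>_. x) (pt k b) = pt k (ract M x b)"
    using x by (simp add: ract_pt ract_sum_right[OF bM, symmetric] sum_pr_shift)
  moreover have "lact Q (\<lambda>_. a) (pt k (ract M x b)) = (\<lambda>h. lact M a (pt k (ract M x b) h))"
    using pt_mem[of "ract M x b" k] x by (intro lact_cst) (simp add: Q_simps ract_closed[OF bM])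
  moreover have "(\<lambda>h. lact M a (pt k (ract M x b) h)) = pt k (lact M a (ract M x b))"
    by (simp add: fun_eq_iff pt_apply lact_zero[OF lM])
  ultimately show ?thesis
    by simp
qed

text \<open>The generators are the x # 1 with x from a finite generating set of \<open>M\<close>;
  multiplication by b # p_k on the right reaches every single coefficient.\<close>

lemma fin_gen_Q:
  assumes "fin_gen_bimodule M"
  shows "fin_gen_bimodule Q"
proof -
  obtain X where X: "finite X" "X \<subseteq> carrier M"
    and gen: "carrier M = add_subgroup hull {lact M a (ract M x b) |a b x. x \<in> X}"
    using assms unfolding fin_gen_bimodule_def by blast
  let ?X = "(\<lambda>x _. x) ` X :: ('g \<Rightarrow> 'm) set"
  let ?H = "add_subgroup hull {lact Q a (ract Q x b) |a b x. x \<in> ?X}"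
  have XQ: "?X \<subseteq> carrier Q"
    using X(2) cst_mem by blast
  have pt: "pt k x \<in> ?H" if "x \<in> carrier M" for k x
  proof (rule additive_on_hull_mem[where f = "pt k" and X = "{lact M a (ract M x b) |a b x. x \<in> X}"])
    show "additive_on (add_subgroup hull {lact M a (ract M x b) |a b x. x \<in> X}) (pt k)"
      by (auto simp: additive_on_def pt_def fun_eq_iff)
    show "x \<in> add_subgroup hull {lact M a (ract M x b) |a b x. x \<in> X}"
      using that gen by simp
    fix y assume "y \<in> {lact M a (ract M x b) |a b x. x \<in> X}"
    then obtain a b x where y: "y = lact M a (ract M x b)" and x: "x \<in> X" by blast
    have "pt k y = lact Q (\<lambda>_. a) (ract Q (\<lambda>_. x) (pt k b))"
      unfolding y using x X(2) by (intro pt_generated) blast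
    then show "pt k y \<in> ?H"
      using x by (intro hull_inc) blast
  qed simp
  have "carrier Q = ?H"
  proof
    show "carrier Q \<subseteq> ?H"
    proof
      fix q assume "q \<in> carrier Q"
      then have "(\<Sum>k\<in>UNIV. pt k (q k)) \<in> ?H"
        by (intro add_subgroup_sum pt) (simp_all add: Q_simps)
      then show "q \<in> ?H" by (simp add: sum_pt)
    qed
    show "?H \<subseteq> carrier Q"
      by (rule hull_minimal[where S = add_subgroup, OF _ Q_subgroup]) (use XQ in \<open>blast intro: lact_Q_closed ract_Q_closed\<close>)
  qed
  then show ?thesis
    unfolding fin_gen_bimodule_def using X(1) XQ by (intro exI[of _ ?X]) simp
qed

end

section \<open>Homomorphisms into the tensor square\<close>

text \<open>A homomorphism \<open>f\<close> from \<open>M # kG\<^sup>*\<close> to \<open>S \<otimes> S\<close>, \<open>S = R # kG\<^sup>*\<close>, is determined by the family of its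
  restrictions \<open>F a: M \<rightarrow> R \<otimes> R\<close>, obtained from \<open>f (m # 1)\<close> by keeping the coefficient of \<open>p\<^sub>a\<close> in
  the left factor and summing the coefficients in the right factor; \<open>dual_lift\<close> is the inverse.\<close>

definition dual_restrict ::
    "('k::field, 'r::ab_group_add) alg \<Rightarrow> ('r, 'm::ab_group_add) bimod \<Rightarrow> 'g::finite
      \<Rightarrow> (('g \<Rightarrow> 'm) \<Rightarrow> ('k, 'g \<Rightarrow> 'r) tens) \<Rightarrow> 'm \<Rightarrow> ('k, 'r) tens" where
  "dual_restrict R M a f x =
     (if x \<in> carrier M then tens_map R (\<lambda>s. s a) (\<lambda>s. \<Sum>h\<in>UNIV. s h) (f (\<lambda>_. x)) else 0)"

text \<open>The indices h and k stand for the piece p_k q p_h of \<open>q\<close>, which is the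
  component of degree k - h of \<open>q h\<close> placed at h. Its image has to lie in p_k (S
  \<otimes> S) p_h: so the right factor is placed at p_h, and a left factor at p_a is cut down to
  degree k - a, where p_k fixes it. The value 0 off the carrier is the convention of
  \<open>dual_module\<close>.\<close>

definition dual_lift ::
    "('k::field, 'r::ab_group_add) alg \<Rightarrow> (nat \<times> 'g::{finite, group_add} \<Rightarrow> 'r set)
      \<Rightarrow> ('r, 'm::ab_group_add) bimod \<Rightarrow> (nat \<times> 'g \<Rightarrow> 'm set)
      \<Rightarrow> ('g \<Rightarrow> 'm \<Rightarrow> ('k, 'r) tens) \<Rightarrow> ('g \<Rightarrow> 'm) \<Rightarrow> ('k, 'g \<Rightarrow> 'r) tens" where
  "dual_lift R D M gr F q =
     (if \<forall>h. q h \<in> carrier M then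
        \<Sum>h\<in>UNIV. \<Sum>k\<in>UNIV. \<Sum>a\<in>UNIV.
          tens_map (smash R D) (\<lambda>x. pt a (component (G_part D) (k - a) x)) (pt h)
            (F a (component (G_part gr) (k - h) (q h)))
      else 0)"

lemma group_diff_cancel [simp]:
  "a - c = b - c \<longleftrightarrow> a = b" "c - a = c - b \<longleftrightarrow> a = b" for a b c :: "'a::group_add"
  by (metis diff_add_cancel, metis diff_add_cancel diff_conv_add_uminus add_left_cancel neg_equal_iff_equal)

lemma sum_pt_value: "(\<Sum>h\<in>UNIV. pt k x h) = x" for x :: "'v::ab_group_add" and k :: "'g::finite"
  by (simp add: pt_apply)

section \<open>The pieces of the tensor square of \<open>S\<close> cut out by idempotents\<close>

context smash_loc
begin

lemma lin_pt_pr: "alg_linear R S (\<lambda>x. pt a (pr k x))"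
  and lin_pt: "alg_linear R S (pt a)"
  and lin_ev: "alg_linear S R (\<lambda>s. s a)"
  and lin_sum: "alg_linear S R (\<lambda>s. \<Sum>h\<in>UNIV. s h)"
  and lin_sum_pt: "alg_linear S S (\<lambda>s. pt a (\<Sum>h\<in>UNIV. s h))"
  and lin_ev_pt: "alg_linear S S (\<lambda>s. pt a (pr k (s a)))"
  by (auto simp: alg_linear_iff alg algebra_smash pt_def fun_eq_iff pr_add pr_scale sum.distrib vs.scale_sum_right)

abbreviation TT :: "'g \<Rightarrow> 'g \<Rightarrow> 'g \<Rightarrow> ('k, 'r) tens \<Rightarrow> ('k, 'g \<Rightarrow> 'r) tens" where
  "TT h k a \<equiv> tens_map S (\<lambda>x. pt a (pr (k - a) x)) (pt h)"

lemma TT_mem: "t \<in> tensor_square R \<Longrightarrow> TT h k a t \<in> tensor_square S"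
  by (rule tens_map_mem[OF lin_pt_pr lin_pt])

lemma idem_mult: "pt k (alg_one R) \<cdot>\<^bsub>S\<^esub> s = (\<lambda>h. pr (k - h) (s h))"
  using reg.lact_idem[of s k] by (simp add: smash_mult_reg reg_mp)

lemma mult_idem: "s \<cdot>\<^bsub>S\<^esub> pt k (alg_one R) = pt k (s k)"
  using reg.ract_idem[of s k] by (simp add: fun_eq_iff smash_mult_apply reg.Q_simps)

lemma mult_cst_pr: "s \<cdot>\<^bsub>S\<^esub> (\<lambda>_. pr u r) = (\<lambda>h. s (u + h) \<cdot>\<^bsub>R\<^esub> pr u r)"
  using reg.ract_cst_pr[of s u r] by (simp add: fun_eq_iff smash_mult_apply reg.Q_simps)

text \<open>The left factor sits at p_a with degree k - a, so p_k fixes it and any other idempotent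
  asks for a different degree and gives 0.\<close>

lemma TT_left_idem:
  assumes "t \<in> tensor_square R"
  shows "lact (outer_bimodule S) (pt k' (alg_one R)) (TT h k a t) = (if k = k' then TT h k a t else 0)"
proof -
  have "lact (outer_bimodule S) (pt k' (alg_one R)) (TT h k a t) =
      tens_map S (\<lambda>x. pt k' (alg_one R) \<cdot>\<^bsub>S\<^esub> pt a (pr (k - a) x)) (pt h) t"
    by (simp add: tens_map_compose[OF sm.lin(3,2)])
  also have "(\<lambda>x. pt k' (alg_one R) \<cdot>\<^bsub>S\<^esub> pt a (pr (k - a) x)) = (if k = k' then (\<lambda>x. pt a (pr (k - a) x)) else (\<lambda>x. 0))"
    by (auto simp: idem_mult fun_eq_iff pt_apply pr_pr)
  finally show ?thesis
    using tens_map_zero_left(1)[OF alg algebra_smash lin_pt assms] by presburger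
qed

lemma TT_right_idem:
  assumes "t \<in> tensor_square R"
  shows "ract (outer_bimodule S) (TT h k a t) (pt h' (alg_one R)) = (if h = h' then TT h k a t else 0)"
proof -
  have "ract (outer_bimodule S) (TT h k a t) (pt h' (alg_one R)) =
      tens_map S (\<lambda>x. pt a (pr (k - a) x)) (\<lambda>y. pt h y \<cdot>\<^bsub>S\<^esub> pt h' (alg_one R)) t"
    by (simp add: tens_map_compose[OF sm.lin(2,4)])
  also have "(\<lambda>y. pt h y \<cdot>\<^bsub>S\<^esub> pt h' (alg_one R)) = (if h = h' then pt h else (\<lambda>y. 0))"
    by (auto simp: mult_idem fun_eq_iff pt_apply)
  finally show ?thesis
    using tens_map_zero_left(2)[OF alg algebra_smash lin_pt_pr assms] by presburger
qed

text \<open>An element of degree u carries p_k to p_(u+k); the cut of the left factor follows, as u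
  + (k - a) = (u + k) - a.\<close>

lemma TT_left_cst:
  "lact (outer_bimodule S) (\<lambda>_. pr u r) (TT h k a t) = TT h (u + k) a (lact (outer_bimodule R) (pr u r) t)"
proof -
  have "pr (u + k - a) (pr u r \<cdot>\<^bsub>R\<^esub> x) = pr u r \<cdot>\<^bsub>R\<^esub> pr (k - a) x" for x
    by (simp add: pr_pr_mult add_diff_eq[symmetric] add.assoc[symmetric])
  then have "(\<lambda>x. (\<lambda>_. pr u r) \<cdot>\<^bsub>S\<^esub> pt a (pr (k - a) x)) = (\<lambda>x. pt a (pr (u + k - a) (pr u r \<cdot>\<^bsub>R\<^esub> x)))"
    by (simp add: cst_mult fun_eq_iff pt_apply)
  then show ?thesis
    by (simp add: tens_map_compose[OF sm.lin(3,2)] tens_map_compose[OF lin_pt_pr lin_pt])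
qed

lemma TT_right_cst:
  "ract (outer_bimodule S) (TT h k a t) (\<lambda>_. pr u r) = TT (- u + h) k a (ract (outer_bimodule R) t (pr u r))"
proof -
  have "(\<lambda>y. pt h y \<cdot>\<^bsub>S\<^esub> (\<lambda>_. pr u r)) = (\<lambda>y. pt (- u + h) (y \<cdot>\<^bsub>R\<^esub> pr u r))"
    by (auto simp: mult_cst_pr fun_eq_iff pt_apply add.assoc[symmetric])
  then show ?thesis
    by (simp add: tens_map_compose[OF sm.lin(2,4)] tens_map_compose[OF lin_pt_pr lin_pt])
qed

text \<open>Summing coefficients sends r # p_h to r. It respects right multiplication by
  \<open>R\<close> because moving p_g past an element only splits that element into its components,
  which add up again.\<close>

lemma sum_mult_cst: "(\<Sum>h\<in>UNIV. (s \<cdot>\<^bsub>S\<^esub> (\<lambda>_. r)) h) = (\<Sum>h\<in>UNIV. s h) \<cdot>\<^bsub>R\<^esub> r"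
proof -
  have "(\<Sum>h\<in>UNIV. (s \<cdot>\<^bsub>S\<^esub> (\<lambda>_. r)) h) = (\<Sum>g\<in>UNIV. \<Sum>h\<in>UNIV. s g \<cdot>\<^bsub>R\<^esub> pr (g - h) r)"
    unfolding smash_mult_apply by (rule sum.swap)
  also have "\<dots> = (\<Sum>g\<in>UNIV. s g \<cdot>\<^bsub>R\<^esub> (\<Sum>h\<in>UNIV. pr (g - h) r))"
    by (simp add: mult_sum)
  finally show ?thesis
    using sum_shift(2)[of "\<lambda>g. pr g r"] by (simp add: sum_mult)
qed

end

section \<open>Lifting and restriction are mutually inverse\<close>

context gbimod_loc
begin

abbreviation restrict where "restrict \<equiv> dual_restrict R M"
abbreviation lift where "lift \<equiv> dual_lift R D M gr"

lemma lift_eq: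
  "q \<in> carrier Q \<Longrightarrow>
    lift F q = (\<Sum>h\<in>UNIV. \<Sum>k\<in>UNIV. \<Sum>a\<in>UNIV. TT h k a (F a (mp (k - h) (q h))))"
  by (simp add: dual_lift_def Q_simps pr_def mp_def)

context
  fixes F :: "'g \<Rightarrow> 'm \<Rightarrow> ('k, 'r) tens"
  assumes F: "\<And>a. bimod_hom M (outer_bimodule R) (F a)"
begin

lemma F_mem: "x \<in> carrier M \<Longrightarrow> F a x \<in> tensor_square R"
  using bimod_homD(1)[OF F] by simp

lemmas F_add = bimod_homD(2)[OF F]

lemma F_zero: "F a 0 = 0"
  by (rule additive_on_zero[OF subM F_add])

text \<open>Four kinds of generators have to be tested. An idempotent selects one value of k or of h
  in the defining sum; a homogeneous element of \<open>R\<close> translates k or h, and the sum over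
  the group absorbs the translation.\<close>

lemma lift_hom: "bimod_hom Q (outer_bimodule S) (lift F)"
proof (rule smash_bimod_homI[OF sm.outer_bimodule])
  fix q assume q: "q \<in> carrier Q"
  then have q': "q h \<in> carrier M" for h by (simp add: Q_simps)
  show "lift F q \<in> carrier (outer_bimodule S)"
    using q q' by (simp add: lift_eq add_subgroup_sum[OF tensor_square_subgroup] TT_mem F_mem)
  note oS = bimodule_lmod[OF sm.outer_bimodule]
  have TTm: "TT h k a (F a (mp (k - h) (q h))) \<in> carrier (outer_bimodule S)" for h k a
    using q' by (simp add: TT_mem F_mem)
  have sums: "lact (outer_bimodule S) s (lift F q) =
      (\<Sum>h\<in>UNIV. \<Sum>k\<in>UNIV. \<Sum>a\<in>UNIV. lact (outer_bimodule S) s (TT h k a (F a (mp (k - h) (q h)))))"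
    "ract (outer_bimodule S) (lift F q) s =
      (\<Sum>h\<in>UNIV. \<Sum>k\<in>UNIV. \<Sum>a\<in>UNIV. ract (outer_bimodule S) (TT h k a (F a (mp (k - h) (q h)))) s)" for s
    using q by (simp_all add: lift_eq tens_map_sum)
  show "lift F (lact Q (pt k' (alg_one R)) q) = lact (outer_bimodule S) (pt k' (alg_one R)) (lift F q)" for k'
  proof -
    have F1: "TT h k a (F a (mp (k - h) (mp (k' - h) (q h)))) =
        (if k = k' then TT h k a (F a (mp (k - h) (q h))) else 0)" for a h k
      using q' by (simp add: mp_mp F_zero)
    have "(\<lambda>h. mp (k' - h) (q h)) \<in> carrier Q"
      using q' by (simp add: Q_simps(1))
    then show ?thesis
      unfolding sums TT_left_idem[OF F_mem[OF mp_mem[OF q']]]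
      by (simp only: lact_idem[OF q'] lift_eq F1)
  qed
  show "lift F (ract Q q (pt h' (alg_one R))) = ract (outer_bimodule S) (lift F q) (pt h' (alg_one R))" for h'
  proof -
    have "F a (mp (k - h) (pt h' (q h') h)) = (if h = h' then F a (mp (k - h) (q h)) else 0)" for a h k
      by (simp add: pt_apply F_zero)
    then have F1: "TT h k a (F a (mp (k - h) (pt h' (q h') h))) =
        (if h = h' then TT h k a (F a (mp (k - h) (q h))) else 0)" for a h k
      by simp
    show ?thesis
      unfolding sums TT_right_idem[OF F_mem[OF mp_mem[OF q']]]
      by (simp only: ract_idem[OF q'] lift_eq[OF pt_mem[OF q']] F1)
  qed
  show "lift F (lact Q (\<lambda>_. pr u r) q) = lact (outer_bimodule S) (\<lambda>_. pr u r) (lift F q)" for u r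
  proof -
    have F1: "F a (mp (u + k - h) (lact M (pr u r) (q h))) = lact (outer_bimodule R) (pr u r) (F a (mp (k - h) (q h)))" for a h k
      using q' by (simp add: mp_lact bimod_homD(3)[OF F] add_diff_eq[symmetric] add.assoc[symmetric] del: outer_simps)
    have "lift F (lact Q (\<lambda>_. pr u r) q) =
        (\<Sum>h\<in>UNIV. \<Sum>k\<in>UNIV. \<Sum>a\<in>UNIV. TT h k a (F a (mp (k - h) (lact M (pr u r) (q h)))))"
      using lact_Q_closed[OF q, of "\<lambda>_. pr u r"] by (simp only: lift_eq lact_cst[OF q'])
    also have "\<dots> = (\<Sum>h\<in>UNIV. \<Sum>k\<in>UNIV. \<Sum>a\<in>UNIV. TT h (u + k) a (F a (mp (u + k - h) (lact M (pr u r) (q h)))))"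
      by (intro sum.cong refl sum_shift(4)[symmetric])
    also have "\<dots> = lact (outer_bimodule S) (\<lambda>_. pr u r) (lift F q)"
      unfolding sums TT_left_cst F1 ..
    finally show ?thesis .
  qed
  show "lift F (ract Q q (\<lambda>_. pr u r)) = ract (outer_bimodule S) (lift F q) (\<lambda>_. pr u r)" for u r
  proof -
    have F1: "F a (mp (k - h) (ract M (q (u + h)) (pr u r))) =
        ract (outer_bimodule R) (F a (mp (k - (u + h)) (q (u + h)))) (pr u r)" for a h k
    proof -
      have "k - h - u = k - (u + h)"
        by (simp only: diff_conv_add_uminus minus_add add.assoc)
      then show ?thesis
        using q' by (simp add: mp_ract bimod_homD(4)[OF F] del: outer_simps)
    qed
    let ?H = "\<lambda>h. \<Sum>k\<in>UNIV. \<Sum>a\<in>UNIV. TT (- u + h) k a (ract (outer_bimodule R) (F a (mp (k - h) (q h))) (pr u r))"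
    have "lift F (ract Q q (\<lambda>_. pr u r)) =
        (\<Sum>h\<in>UNIV. \<Sum>k\<in>UNIV. \<Sum>a\<in>UNIV. TT h k a (F a (mp (k - h) (ract M (q (u + h)) (pr u r)))))"
      using ract_Q_closed[OF q, of "\<lambda>_. pr u r"] by (simp only: lift_eq ract_cst_pr[OF q'])
    also have "\<dots> = (\<Sum>h\<in>UNIV. ?H (u + h))"
      unfolding F1 by (simp add: add.assoc[symmetric])
    also have "\<dots> = (\<Sum>h\<in>UNIV. ?H h)"
      by (rule sum_shift(4))
    also have "\<dots> = ract (outer_bimodule S) (lift F q) (\<lambda>_. pr u r)"
      unfolding sums TT_right_cst ..
    finally show ?thesis .
  qed
next
  have "F a (mp g (x + y)) = F a (mp g x) + F a (mp g y)" if "x \<in> carrier M" "y \<in> carrier M" for a g x y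
    using that F_add[of a] mp_additive[of g] by (simp add: additive_on_def)
  then show "additive_on (carrier Q) (lift F)"
    using add_subgroup_add[OF Q_subgroup]
    by (simp add: additive_on_def lift_eq Q_simps(1) tens_map_add sum.distrib)
qed

text \<open>Three sums collapse: evaluation at a keeps only the matching left index, the sum over h
  reassembles \<open>x\<close> from its components, and the sum over k reassembles the left tensor
  factor.\<close>

lemma restrict_lift:
  assumes x: "x \<in> carrier M"
  shows "restrict a (lift F) x = F a x"
proof -
  have "restrict a (lift F) x =
      (\<Sum>h\<in>UNIV. \<Sum>k\<in>UNIV. \<Sum>a'\<in>UNIV.
        tens_map R (\<lambda>s. s a) (\<lambda>s. \<Sum>h\<in>UNIV. s h) (TT h k a' (F a' (mp (k - h) x))))"
    using x by (simp add: dual_restrict_def lift_eq cst_mem tens_map_sum)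
  also have "\<dots> = (\<Sum>h\<in>UNIV. \<Sum>k\<in>UNIV. tens_map R (pr (k - a)) (\<lambda>y. y) (F a (mp (k - h) x)))"
  proof (intro sum.cong refl)
    fix h k
    have "tens_map R (\<lambda>s. s a) (\<lambda>s. \<Sum>h\<in>UNIV. s h) (TT h k a' (F a' (mp (k - h) x))) =
        (if a' = a then tens_map R (pr (k - a)) (\<lambda>y. y) (F a (mp (k - h) x)) else 0)" for a'
    proof -
      have "(\<lambda>x. pt a' (pr (k - a') x) a) = (if a' = a then pr (k - a) else (\<lambda>x. 0))"
        by (auto simp: pt_apply fun_eq_iff)
      then show ?thesis
        using x by (simp add: sum_pt_value tens_map_compose[OF lin_ev lin_sum] tens_map_zero_left(1)[OF alg alg lin(2) F_mem])
    qed
    then show "(\<Sum>a'\<in>UNIV. tens_map R (\<lambda>s. s a) (\<lambda>s. \<Sum>h\<in>UNIV. s h) (TT h k a' (F a' (mp (k - h) x)))) =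
        tens_map R (pr (k - a)) (\<lambda>y. y) (F a (mp (k - h) x))"
      by simp
  qed
  also have "\<dots> = (\<Sum>k\<in>UNIV. \<Sum>h\<in>UNIV. tens_map R (pr (k - a)) (\<lambda>y. y) (F a (mp (k - h) x)))"
    by (rule sum.swap)
  also have "\<dots> = (\<Sum>k\<in>UNIV. tens_map R (pr (k - a)) (\<lambda>y. y) (F a x))"
  proof (rule sum.cong[OF refl])
    fix k
    have "(\<Sum>h\<in>UNIV. F a (mp (k - h) x)) = F a (\<Sum>h\<in>UNIV. mp (k - h) x)"
      using x by (intro additive_on_sum[OF subM F_add, symmetric]) simp
    also have "(\<Sum>h\<in>UNIV. mp (k - h) x) = x"
      using x sum_shift(2)[of "\<lambda>g. mp g x" k] by simp
    finally show "(\<Sum>h\<in>UNIV. tens_map R (pr (k - a)) (\<lambda>y. y) (F a (mp (k - h) x))) =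
        tens_map R (pr (k - a)) (\<lambda>y. y) (F a x)"
      by (simp flip: tens_map_sum)
  qed
  also have "\<dots> = tens_map R (\<lambda>y. \<Sum>k\<in>UNIV. pr (k - a) y) (\<lambda>y. y) (F a x)"
    using x by (simp add: tens_map_sum_left[OF alg alg pr_linear lin(2) F_mem])
  also have "\<dots> = F a x"
    using x by (simp add: sum_pr_shift tens_map_id F_mem)
  finally show ?thesis .
qed

end

lemma restrict_hom:
  assumes f: "bimod_hom Q (outer_bimodule S) f"
  shows "bimod_hom M (outer_bimodule R) (restrict a f)"
proof (rule bimod_homI)
  have mem: "f (\<lambda>_. x) \<in> tensor_square S" if "x \<in> carrier M" for x
    using bimod_homD(1)[OF f cst_mem[OF that]] by simp
  then show "restrict a f x \<in> carrier (outer_bimodule R)" if "x \<in> carrier M" for x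
    using that tens_map_mem[OF lin_ev lin_sum] by (simp add: dual_restrict_def)
  show "additive_on (carrier M) (restrict a f)"
    unfolding additive_on_def
  proof (intro ballI)
    fix x y assume xy: "x \<in> carrier M" "y \<in> carrier M"
    have "(\<lambda>_. x + y) = (\<lambda>_. x) + (\<lambda>_::'g. y)"
      by (simp add: fun_eq_iff)
    then have "f (\<lambda>_. x + y) = f (\<lambda>_. x) + f (\<lambda>_. y)"
      using bimod_homD(2)[OF f] xy[THEN cst_mem] by (simp only: additive_on_def)
    then show "restrict a f (x + y) = restrict a f x + restrict a f y"
      using xy add_subgroup_add[OF subM] by (simp only: dual_restrict_def tens_map_add if_True)
  qed
  fix x r assume x: "x \<in> carrier M"
  have "f (\<lambda>_. lact M r x) = lact (outer_bimodule S) (\<lambda>_. r) (f (\<lambda>_. x))"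
    using bimod_homD(3)[OF f cst_mem[OF x], of "\<lambda>_. r"] x by (simp add: lact_cst)
  then show "restrict a f (lact M r x) = lact (outer_bimodule R) r (restrict a f x)"
    using x by (simp add: dual_restrict_def lact_closed[OF lM] tens_map_compose[OF lin_ev lin_sum]
        tens_map_compose[OF lin(3,2)] cst_mult)
  have "ract Q (\<lambda>_. x) (\<lambda>_. r) = (\<lambda>_. ract M x r)"
    using x by (simp add: fun_eq_iff Q_simps ract_sum_right[OF bM, symmetric] sum_pr_shift)
  then have "f (\<lambda>_. ract M x r) = ract (outer_bimodule S) (f (\<lambda>_. x)) (\<lambda>_. r)"
    using bimod_homD(4)[OF f cst_mem[OF x], of "\<lambda>_. r"] by simp
  then show "restrict a f (ract M x r) = ract (outer_bimodule R) (restrict a f x) r"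
    using x by (simp add: dual_restrict_def ract_closed[OF bM] tens_map_compose[OF lin_ev lin_sum]
        tens_map_compose[OF lin(2,4)] sum_mult_cst)
qed

text \<open>If m has degree k - h, then m # p_h = p_k (m # 1) = (m # p_h) p_h, so \<open>f\<close>
  on this element is determined by \<open>f\<close> on m # 1. Such elements add up to
  \<open>q\<close>.\<close>

lemma lift_restrict:
  assumes f: "bimod_hom Q (outer_bimodule S) f" and q: "q \<in> carrier Q"
  shows "lift (\<lambda>a. restrict a f) q = f q"
proof -
  have q': "q h \<in> carrier M" for h using q by (simp add: Q_simps)
  have fm: "f p \<in> tensor_square S" if "p \<in> carrier Q" for p
    using bimod_homD(1)[OF f that] by simp
  have *: "(\<Sum>a\<in>UNIV. TT h k a (restrict a f (mp (k - h) (q h)))) = f (pt h (mp (k - h) (q h)))" for h k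
  proof -
    let ?x = "mp (k - h) (q h)"
    have x: "?x \<in> carrier M" using q' by simp
    note px = pt_mem[OF x, of h] and cx = cst_mem[OF x]
    have "(\<Sum>a\<in>UNIV. TT h k a (restrict a f ?x)) =
        (\<Sum>a\<in>UNIV. tens_map S (\<lambda>s. pt a (pr (k - a) (s a))) (\<lambda>s. pt h (\<Sum>h'\<in>UNIV. s h')) (f (\<lambda>_. ?x)))"
      using x by (simp add: dual_restrict_def tens_map_compose[OF lin_pt_pr lin_pt])
    also have "\<dots> = tens_map S (\<lambda>s. \<Sum>a\<in>UNIV. pt a (pr (k - a) (s a))) (\<lambda>s. pt h (\<Sum>h'\<in>UNIV. s h')) (f (\<lambda>_. ?x))"
      by (rule tens_map_sum_left[OF algebra_smash algebra_smash lin_ev_pt lin_sum_pt fm[OF cx], symmetric])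
    also have "\<dots> = tens_map S (\<lambda>s. s) (\<lambda>s. pt h (\<Sum>h'\<in>UNIV. s h'))
        (lact (outer_bimodule S) (pt k (alg_one R)) (f (\<lambda>_. ?x)))"
      by (simp add: tens_map_compose[OF sm.lin(2) lin_sum_pt] idem_mult sum_pt)
    also have "lact (outer_bimodule S) (pt k (alg_one R)) (f (\<lambda>_. ?x)) = f (lact Q (pt k (alg_one R)) (\<lambda>_. ?x))"
      by (rule bimod_homD(3)[OF f cx, symmetric])
    \<comment> \<open>\<open>?x\<close> has degree k - h, so p_k retains just the index h of the
      constant family.\<close>
    also have "lact Q (pt k (alg_one R)) (\<lambda>_. ?x) = pt h ?x"
      using q' by (simp only: lact_idem x) (auto simp: mp_mp pt_def fun_eq_iff)
    \<comment> \<open>Inserting p_h on the right concentrates the right tensor factor at h; summing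
      its coefficients and putting the sum back at h then changes nothing.\<close>
    also have "f (pt h ?x) = f (ract Q (pt h ?x) (pt h (alg_one R)))"
      using px by (simp add: ract_idem Q_simps(1)) (simp add: pt_apply)
    also have "\<dots> = ract (outer_bimodule S) (f (pt h ?x)) (pt h (alg_one R))"
      by (rule bimod_homD(4)[OF f px])
    also have "tens_map S (\<lambda>s. s) (\<lambda>s. pt h (\<Sum>h'\<in>UNIV. s h')) \<dots> =
        tens_map S (\<lambda>s. s) (\<lambda>s. s \<cdot>\<^bsub>S\<^esub> pt h (alg_one R)) (f (pt h ?x))"
      by (simp add: tens_map_compose[OF sm.lin(2) lin_sum_pt] mult_idem pt_apply)
    also have "\<dots> = f (ract Q (pt h ?x) (pt h (alg_one R)))"
      using bimod_homD(4)[OF f px, of "pt h (alg_one R)"] by simp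
    also have "\<dots> = f (pt h ?x)"
      using px by (simp add: ract_idem Q_simps(1)) (simp add: pt_apply)
    finally show ?thesis .
  qed
  have "lift (\<lambda>a. restrict a f) q = (\<Sum>h\<in>UNIV. \<Sum>k\<in>UNIV. f (pt h (mp (k - h) (q h))))"
    using q by (simp add: lift_eq *)
  also have "\<dots> = f (\<Sum>h\<in>UNIV. \<Sum>k\<in>UNIV. pt h (mp (k - h) (q h)))"
    using q' by (simp add: additive_on_sum[OF Q_subgroup bimod_homD(2)[OF f]] pt_mem add_subgroup_sum[OF Q_subgroup])
  also have "(\<Sum>h\<in>UNIV. \<Sum>k\<in>UNIV. pt h (mp (k - h) (q h))) = q"
  proof -
    have "(\<Sum>k\<in>UNIV. pt h (mp (k - h) (q h))) = pt h (q h)" for h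
      using q' by (simp add: fun_eq_iff sum_fun pt_apply sum_mp_shift)
    then show ?thesis by (simp add: sum_pt)
  qed
  finally show ?thesis .
qed

section \<open>Smash products of projective bimodules\<close>

lemma ract_cst_pt: "x \<in> carrier M \<Longrightarrow> ract Q (\<lambda>_. x) (pt k r) = pt k (ract M x r)"
  by (simp add: ract_pt ract_sum_right[OF bM, symmetric] sum_pr_shift)

lemma lact_pt_pt: "x \<in> carrier M \<Longrightarrow> lact Q (pt a r) (pt h x) = pt h (lact M r (mp (a - h) x))"
proof (rule ext)
  fix h' assume x: "x \<in> carrier M"
  have "lact Q (pt a r) (pt h x) h' = (\<Sum>g\<in>UNIV. if g = a then lact M r (mp (g - h') (pt h x h')) else 0)"
    unfolding Q_simps using pt_mem[OF x]
    by (intro sum.cong) (simp_all add: pt_apply lact_zero_left[OF lM] x add_subgroup_zero[OF subM])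
  then show "lact Q (pt a r) (pt h x) h' = pt h (lact M r (mp (a - h) x)) h'"
    by (simp add: pt_apply lact_zero[OF lM])
qed

text \<open>In every summand the degrees (k - a) + (a - h) add up to k - h, and as a varies all
  components of \<open>x\<close> occur.\<close>

lemma sum_lact_mp:
  assumes x: "x \<in> carrier M"
  shows "(\<Sum>a\<in>UNIV. lact M (pr (k - a) r) (mp (a - h) x)) = mp (k - h) (lact M r x)"
proof -
  have "mp (k - h) (lact M r x) = (\<Sum>v\<in>UNIV. mp (k - h) (lact M r (mp v x)))"
    using x by (simp add: mp_sum[symmetric] lact_closed[OF lM] lact_sum[OF lM, symmetric])
  also have "\<dots> = (\<Sum>a\<in>UNIV. lact M (pr (k - h - (a - h)) r) (mp (a - h) x))"
    using x sum_shift(1)[of "\<lambda>v. lact M (pr (k - h - v) r) (mp v x)" h] by (simp add: mp_lact_mp)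
  finally show ?thesis
    by (simp add: diff_diff_eq2 diff_add_eq)
qed

text \<open>Compares extension over \<open>S\<close> with extension over \<open>R\<close>: the
  pieces \<open>TT h k a t\<close> together go to the part, at index h and of degree k - h, of the
  image of \<open>t\<close>. This is how the dual basis identity of \<open>M\<close> passes to the
  smash product.\<close>

lemma extend_tens_TT:
  assumes w: "w \<in> carrier M" and t: "t \<in> tensor_square R"
  shows "(\<Sum>a\<in>UNIV. sm.extend_tens Q (\<lambda>_. w) (TT h k a t)) = pt h (mp (k - h) (extend_tens M w t))"
proof -
  note eQ = sm.additive_extend_tens[OF bimodule_Q cst_mem[OF w]]
  have "\<forall>t\<in>tensor_square R. (\<Sum>a\<in>UNIV. sm.extend_tens Q (\<lambda>_. w) (TT h k a t)) = pt h (mp (k - h) (extend_tens M w t))"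
  proof (rule tensor_square_ball_eqI)
    show "additive_on (tensor_square R) (\<lambda>t. \<Sum>a\<in>UNIV. sm.extend_tens Q (\<lambda>_. w) (TT h k a t))"
      using TT_mem by (intro additive_on_sum_fun additive_on_comp[OF additive_tens_map _ eQ]) blast
    have "additive_on (tensor_square R) (\<lambda>t. mp (k - h) (extend_tens M w t))"
      using extend_tens_mem[OF bM w] by (intro additive_on_comp[OF additive_extend_tens[OF bM w] _ mp_additive]) blast
    then show "additive_on (tensor_square R) (\<lambda>t. pt h (mp (k - h) (extend_tens M w t)))"
      by (simp add: additive_on_def pt_def fun_eq_iff)
    fix x y
    have "(\<Sum>a\<in>UNIV. sm.extend_tens Q (\<lambda>_. w) (TT h k a (tensor R x y))) =
        (\<Sum>a\<in>UNIV. pt h (lact M (pr (k - a) x) (mp (a - h) (ract M w y))))"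
      using w by (simp add: tens_map_tensor[OF lin_pt_pr lin_pt] sm.extend_tens_tensor[OF bimodule_Q cst_mem]
          ract_cst_pt lact_pt_pt ract_closed[OF bM])
    also have "\<dots> = pt h (\<Sum>a\<in>UNIV. lact M (pr (k - a) x) (mp (a - h) (ract M w y)))"
      by (auto simp: fun_eq_iff pt_apply sum_fun)
    also have "\<dots> = pt h (mp (k - h) (lact M x (ract M w y)))"
      using w by (simp add: sum_lact_mp ract_closed[OF bM])
    finally show "(\<Sum>a\<in>UNIV. sm.extend_tens Q (\<lambda>_. w) (TT h k a (tensor R x y))) =
        pt h (mp (k - h) (extend_tens M w (tensor R x y)))"
      by (simp add: extend_tens_tensor[OF bM w])
  qed
  then show ?thesis
    using t by blast
qed

text \<open>The coordinate functions of \<open>M\<close> in a free bimodule lift to coordinate functions of \<open>M # kG\<^sup>*\<close>.\<close>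

lemma projective_Q:
  assumes "projective_bimodule R M"
  shows "projective_bimodule S Q"
proof -
  obtain X :: "'m set" and \<iota> \<pi> where \<iota>: "bimod_hom M (free_bimodule R X) \<iota>"
    and \<pi>: "bimod_hom (free_bimodule R X) M \<pi>" and \<pi>\<iota>: "\<And>x. x \<in> carrier M \<Longrightarrow> \<pi> (\<iota> x) = x"
    using assms unfolding projective_bimodule_def by blast
  let ?X = "(\<lambda>x _. x) ` X :: ('g \<Rightarrow> 'm) set"
  \<comment> \<open>Any group element serves: the basis over \<open>S\<close> consists of constant
    families, which are read off at one index.\<close>
  let ?e = "undefined :: 'g"
  define w where "w x = \<pi> (unit x)" for x
  have w: "w x \<in> carrier M" if "x \<in> X" for x
    unfolding w_def by (rule bimod_homD(1)[OF \<pi> unit_mem[OF that]])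
  have \<iota>m: "\<iota> y x \<in> tensor_square R" "finite {x. \<iota> y x \<noteq> 0}" "{x. \<iota> y x \<noteq> 0} \<subseteq> X" if "y \<in> carrier M" for x y
    using bimod_homD(1)[OF \<iota> that] by (auto simp: free_mem)
  have \<iota>x: "bimod_hom M (outer_bimodule R) (\<lambda>y. \<iota> y x)" for x
  proof (rule bimod_homI)
    show "additive_on (carrier M) (\<lambda>y. \<iota> y x)"
      using bimod_homD(2)[OF \<iota>] by (simp add: additive_on_def)
  qed (use \<iota>m bimod_homD(3,4)[OF \<iota>] in \<open>simp_all add: free_lact free_ract\<close>)
  \<comment> \<open>The same coordinate function of \<open>M\<close> is used for every index of the
    left factor.\<close>
  define L where "L x = lift (\<lambda>_ y. \<iota> y x)" for x
  have L: "bimod_hom Q (outer_bimodule S) (L x)" for x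
    unfolding L_def by (rule lift_hom[OF \<iota>x])
  define I where "I q z = (if z \<in> ?X then L (z ?e) q else 0)" for q and z :: "'g \<Rightarrow> 'm"
  \<comment> \<open>A finite set of basis elements sufficient for all pieces of \<open>q\<close> at
    once, so that sums over it and over the group can be interchanged.\<close>
  define supp where "supp q = (\<Union>h. \<Union>k. {x. \<iota> (mp (k - h) (q h)) x \<noteq> 0})" for q
  have supp: "finite (supp q)" "supp q \<subseteq> X" if "q \<in> carrier Q" for q
  proof -
    have "mp (k - h) (q h) \<in> carrier M" for k h
      using that by (simp add: Q_simps(1))
    then show "finite (supp q)" "supp q \<subseteq> X"
      using \<iota>m(2,3) unfolding supp_def by (simp, blast)
  qed
  have L0: "L x q = 0" if "x \<notin> supp q" "q \<in> carrier Q" for x q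
    using that by (simp add: L_def lift_eq supp_def)
  have I_supp: "{z. I q z \<noteq> 0} \<subseteq> (\<lambda>x _. x) ` supp q" if "q \<in> carrier Q" for q
    using L0[OF _ that] by (auto simp: I_def split: if_splits)
  have I_mem: "I q \<in> carrier (free_bimodule S ?X)" if "q \<in> carrier Q" for q
    unfolding sm.free_mem
  proof (intro conjI allI)
    show "I q z \<in> tensor_square S" for z
      using bimod_homD(1)[OF L that] by (simp add: I_def add_subgroup_zero[OF tensor_square_subgroup])
    show "finite {z. I q z \<noteq> 0}"
      using I_supp[OF that] supp(1)[OF that] by (meson finite_imageI finite_subset)
    show "{z. I q z \<noteq> 0} \<subseteq> ?X"
      by (auto simp: I_def split: if_splits)
  qed
  have I_hom: "bimod_hom Q (free_bimodule S ?X) I"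
  proof (rule bimod_homI)
    show "additive_on (carrier Q) I"
      using bimod_homD(2)[OF L] by (simp add: additive_on_def I_def fun_eq_iff)
    fix q s assume q: "q \<in> carrier Q"
    show "I (lact Q s q) = lact (free_bimodule S ?X) s (I q)" "I (ract Q q s) = ract (free_bimodule S ?X) (I q) s"
      using bimod_homD(3)[OF L q] bimod_homD(4)[OF L q] by (simp_all add: sm.free_lact sm.free_ract I_def fun_eq_iff)
  qed (rule I_mem)
  let ?z = "\<lambda>z :: 'g \<Rightarrow> 'm. (\<lambda>_ :: 'g. w (z ?e))"
  have z: "?z z \<in> carrier Q" if "z \<in> ?X" for z
    using that w by (auto simp: Q_simps(1))
  have "sm.extend_free Q ?z (I q) = q" if q: "q \<in> carrier Q" for q
  proof -
    have q': "q h \<in> carrier M" for h using q by (simp add: Q_simps)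
    have wX: "w x \<in> carrier M" if "x \<in> supp q" for x
      using supp(2)[OF q] that w by blast
    have inj: "inj_on (\<lambda>x _. x) A" for A :: "'m set"
      by (auto simp: inj_on_def fun_eq_iff)
    have "sm.extend_free Q ?z (I q) = (\<Sum>z\<in>(\<lambda>x _. x) ` supp q. sm.extend_tens Q (?z z) (I q z))"
      using supp[OF q] I_supp[OF q] by (intro sm.extend_free_superset[OF bimodule_Q z I_mem[OF q]]) auto
    also have "\<dots> = (\<Sum>x\<in>supp q. sm.extend_tens Q (\<lambda>_. w x) (L x q))"
      using supp(2)[OF q] by (simp add: sum.reindex[OF inj] I_def subset_iff)
    also have "\<dots> = (\<Sum>x\<in>supp q. \<Sum>h\<in>UNIV. \<Sum>k\<in>UNIV. pt h (mp (k - h) (extend_tens M (w x) (\<iota> (mp (k - h) (q h)) x))))"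
    proof (rule sum.cong[OF refl])
      fix x assume "x \<in> supp q"
      note wx = wX[OF this]
      have tt: "TT h k a (\<iota> (mp (k - h) (q h)) x) \<in> tensor_square S" for h k a
        using q' \<iota>m(1) by (intro TT_mem) simp
      show "sm.extend_tens Q (\<lambda>_. w x) (L x q) =
          (\<Sum>h\<in>UNIV. \<Sum>k\<in>UNIV. pt h (mp (k - h) (extend_tens M (w x) (\<iota> (mp (k - h) (q h)) x))))"
        using q' \<iota>m(1)
        by (simp add: L_def lift_eq[OF q] additive_on_sum[OF tensor_square_subgroup sm.additive_extend_tens[OF bimodule_Q cst_mem[OF wx]]]
            tt add_subgroup_sum[OF tensor_square_subgroup] extend_tens_TT[OF wx])
    qed
    also have "\<dots> = (\<Sum>h\<in>UNIV. \<Sum>k\<in>UNIV. \<Sum>x\<in>supp q. pt h (mp (k - h) (extend_tens M (w x) (\<iota> (mp (k - h) (q h)) x))))"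
      by (simp add: sum.swap[where A = "supp q"])
    also have "\<dots> = (\<Sum>h\<in>UNIV. \<Sum>k\<in>UNIV. pt h (mp (k - h) (q h)))"
    proof (intro sum.cong refl)
      fix h k
      let ?y = "mp (k - h) (q h)"
      have y: "?y \<in> carrier M" using q' by simp
      have "(\<Sum>x\<in>supp q. pt h (mp (k - h) (extend_tens M (w x) (\<iota> ?y x)))) =
          pt h (\<Sum>x\<in>supp q. mp (k - h) (extend_tens M (w x) (\<iota> ?y x)))"
        by (auto simp: fun_eq_iff pt_apply sum_fun)
      also have "(\<Sum>x\<in>supp q. mp (k - h) (extend_tens M (w x) (\<iota> ?y x))) =
          mp (k - h) (\<Sum>x\<in>supp q. extend_tens M (w x) (\<iota> ?y x))"
        by (rule mp_sum[symmetric], rule extend_tens_mem[OF bM wX \<iota>m(1)[OF y]])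
      also have "(\<Sum>x\<in>supp q. extend_tens M (w x) (\<iota> ?y x)) = extend_free M w (\<iota> ?y)"
      proof (rule extend_free_superset[OF bM _ bimod_homD(1)[OF \<iota> y] supp(1)[OF q] _ supp(2)[OF q], symmetric])
        show "{x. \<iota> ?y x \<noteq> 0} \<subseteq> supp q"
          by (auto simp: supp_def)
      qed (rule w)
      also have "extend_free M w (\<iota> ?y) = \<pi> (\<iota> ?y)"
        using extend_free_unique[OF bM \<pi> bimod_homD(1)[OF \<iota> y]] by (simp add: w_def[abs_def])
      also have "mp (k - h) (\<pi> (\<iota> ?y)) = ?y"
        using \<pi>\<iota>[OF y] q' by (simp add: mp_mp)
      finally show "(\<Sum>x\<in>supp q. pt h (mp (k - h) (extend_tens M (w x) (\<iota> ?y x)))) = pt h ?y" .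
    qed
    also have "\<dots> = (\<Sum>h\<in>UNIV. pt h (q h))"
    proof (rule sum.cong[OF refl])
      fix h show "(\<Sum>k\<in>UNIV. pt h (mp (k - h) (q h))) = pt h (q h)"
        using q' by (simp add: fun_eq_iff sum_fun pt_apply sum_mp_shift)
    qed
    finally show ?thesis
      by (simp add: sum_pt)
  qed
  moreover have "bimod_hom (free_bimodule S ?X) Q (sm.extend_free Q ?z)"
    by (rule sm.extend_free_hom[OF bimodule_Q z])
  ultimately show ?thesis
    unfolding projective_bimodule_def using bimodule_Q I_hom by blast
qed

end

section \<open>Smash products of resolutions\<close>

lemma smash_bimod_simps:
  "q \<in> carrier (smash_bimod D M gr) \<longleftrightarrow> (\<forall>h. q h \<in> carrier M)"
  "lact (smash_bimod D M gr) s q = (\<lambda>h. \<Sum>g\<in>UNIV. lact M (s g) (component (G_part gr) (g - h) (q h)))"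
  "ract (smash_bimod D M gr) q s = (\<lambda>h. \<Sum>g\<in>UNIV. ract M (q g) (component (G_part D) (g - h) (s h)))"
  by (simp_all add: smash_bimod_def)

text \<open>The left action on a smash bimodule cuts its argument into components; this is where
  \<open>f\<close> has to respect the grading by the group.\<close>

lemma bimod_hom_smash:
  assumes M: "graded_bimodule R D M gr" and N: "graded_bimodule R D N gr'"
    and f: "bimod_hom M N f" "\<And>i. f ` gr i \<subseteq> gr' i"
  shows "bimod_hom (smash_bimod D M gr) (smash_bimod D N gr') (\<lambda>q h. f (q h))"
    and "x \<in> carrier M \<Longrightarrow> f (component (G_part gr) g x) = component (G_part gr') g (f x)"
proof -
  note m = graded_bimoduleD(1,2)[OF M] and n = graded_bimoduleD(1,2)[OF N]
  note lM = bimodule_lmod[OF m(1)]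
  note F = bimod_homD[OF f(1)]
  have comp: "f (component (G_part gr) g x) = component (G_part gr') g (f x)" if "x \<in> carrier M" for g x
    by (rule component_natural[OF direct_sum_G_part[OF m(2)] direct_sum_G_part[OF n(2)] F(2) _ that])
      (rule G_part_map(1)[OF m(2) n(2) F(2) f(2)])
  then show "x \<in> carrier M \<Longrightarrow> f (component (G_part gr) g x) = component (G_part gr') g (f x)" .
  have cm: "component (G_part gr) g x \<in> carrier M" if "x \<in> carrier M" for g x
    using direct_sum_subset[OF direct_sum_G_part[OF m(2)]] component_in[OF direct_sum_G_part[OF m(2)] that] .
  show "bimod_hom (smash_bimod D M gr) (smash_bimod D N gr') (\<lambda>q h. f (q h))"
  proof (rule bimod_homI)
    show "additive_on (carrier (smash_bimod D M gr)) (\<lambda>q h. f (q h))"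
      using F(2) by (simp add: additive_on_def smash_bimod_simps fun_eq_iff)
    fix q s assume "q \<in> carrier (smash_bimod D M gr)"
    then have q: "q h \<in> carrier M" for h by (simp add: smash_bimod_simps)
    then show "(\<lambda>h. f (q h)) \<in> carrier (smash_bimod D N gr')"
      by (simp add: smash_bimod_simps F(1))
    show "(\<lambda>h. f (lact (smash_bimod D M gr) s q h)) = lact (smash_bimod D N gr') s (\<lambda>h. f (q h))"
      using q by (simp add: smash_bimod_simps fun_eq_iff comp[symmetric] F(3)[OF cm, symmetric] cm
          additive_on_sum[OF lmod_subgroup[OF lM] F(2)] lact_closed[OF lM])
    show "(\<lambda>h. f (ract (smash_bimod D M gr) q s h)) = ract (smash_bimod D N gr') (\<lambda>h. f (q h)) s"
      using q by (simp add: smash_bimod_simps fun_eq_iff F(4)[symmetric]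
          additive_on_sum[OF lmod_subgroup[OF lM] F(2)] ract_closed[OF m(1)])
  qed
qed

lemma (in alg_loc) zero_dual: "0 \<in> dual_module A M"
proof -
  have "bimod_hom M (outer_bimodule A) 0"
    by (rule bimod_homI)
      (simp_all add: additive_on_def add_subgroup_zero[OF tensor_square_subgroup] flip: zero_fun_def)
  then show ?thesis
    by (simp add: dual_module_def)
qed

locale smash_res = smash_loc R D
  for R :: "('k::field, 'r::ab_group_add) alg"
    and D :: "nat \<times> 'g::{finite, group_add} \<Rightarrow> 'r set" +
  fixes P :: "nat \<Rightarrow> ('r, 'm::ab_group_add) bimod" and gr :: "nat \<Rightarrow> nat \<times> 'g \<Rightarrow> 'm set"
    and \<delta> :: "nat \<Rightarrow> 'm \<Rightarrow> 'm" and \<epsilon> :: "'m \<Rightarrow> 'r"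
  assumes gres: "graded_bimodule_resolution R D P gr \<delta> \<epsilon>"
begin

lemma res: "bimodule_resolution R P \<delta> \<epsilon>" and grP: "graded_bimodule R D (P n) (gr n)"
  and \<delta>gr: "\<delta> n ` gr (Suc n) i \<subseteq> gr n i" and \<epsilon>gr: "\<epsilon> ` gr 0 i \<subseteq> D i"
  using gres unfolding graded_bimodule_resolution_def by blast+

lemmas resD = resolutionD[OF res]

lemma gb: "gbimod_loc R D (P n) (gr n)"
  by unfold_locales (rule grP)

abbreviation SP where "SP n \<equiv> smash_bimod D (P n) (gr n)"
abbreviation S\<delta> where "S\<delta> n \<equiv> \<lambda>q h. \<delta> n (q h)"
abbreviation S\<epsilon> where "S\<epsilon> \<equiv> \<lambda>q h. \<epsilon> (q h)"

lemma regular_smash: "smash_bimod D (regular_bimodule R) D = regular_bimodule S"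
  by (simp add: smash_bimod_def regular_bimodule_def fun_eq_iff smash_mult_apply pr_def)

text \<open>Images and kernels of maps applied coefficientwise are formed coefficientwise, so
  exactness is inherited from \<open>P\<close>.\<close>

lemma smash_resolution:
  "graded_bimodule_resolution S (smash_grading D) SP (\<lambda>n. smash_grading (gr n)) S\<delta> S\<epsilon>"
  unfolding graded_bimodule_resolution_def bimodule_resolution_def exact_over_def
proof (intro conjI allI)
  fix n
  show "projective_bimodule S (SP n)"
    by (rule gbimod_loc.projective_Q[OF gb resD(1)])
  show "fin_gen_bimodule (SP n)"
    by (rule gbimod_loc.fin_gen_Q[OF gb resD(3)])
  show "bimod_hom (SP (Suc n)) (SP n) (S\<delta> n)"
    by (rule bimod_hom_smash(1)[OF grP grP resD(4) \<delta>gr])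
  show "bimod_hom (SP 0) (regular_bimodule S) S\<epsilon>"
    using bimod_hom_smash(1)[OF grP regular_graded resD(5) \<epsilon>gr] by (simp add: regular_smash)
  show "graded_bimodule S (smash_grading D) (SP n) (smash_grading (gr n))"
    by (rule gbimod_loc.graded_Q[OF gb])
  \<comment> \<open>A preimage is chosen for each group element separately.\<close>
  have img: "(\<lambda>q h. f (q h)) ` {q. \<forall>h. q h \<in> A} = {q. \<forall>h::'g. q h \<in> f ` A}" for f :: "'m \<Rightarrow> 'a" and A
  proof (intro equalityI subsetI)
    fix q assume "q \<in> {q. \<forall>h::'g. q h \<in> f ` A}"
    then have "\<forall>h. \<exists>x. x \<in> A \<and> q h = f x" by blast
    then obtain p where "\<And>h. p h \<in> A" "\<And>h. q h = f (p h)" by metis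
    then show "q \<in> (\<lambda>q h. f (q h)) ` {q. \<forall>h. q h \<in> A}"
      by (intro image_eqI[of _ _ p]) auto
  qed auto
  have car: "carrier (SP n) = {q. \<forall>h. q h \<in> carrier (P n)}" for n
    by (auto simp: smash_bimod_simps)
  show "S\<epsilon> ` carrier (SP 0) = UNIV"
    unfolding car img resD(6) by simp
  show "S\<delta> 0 ` carrier (SP 1) = {q \<in> carrier (SP 0). S\<epsilon> q = 0}"
    unfolding car img using resD(7)[of 0] by (auto simp: cycles_def fun_eq_iff)
  show "S\<delta> (Suc n) ` carrier (SP (Suc (Suc n))) = {q \<in> carrier (SP (Suc n)). S\<delta> n q = 0}"
    unfolding car img resD(7) by (auto simp: cycles_def fun_eq_iff)
  show "S\<delta> n ` smash_grading (gr (Suc n)) i \<subseteq> smash_grading (gr n) i" for i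
    using G_part_map(2)[OF graded_bimoduleD(2)[OF grP] graded_bimoduleD(2)[OF grP] bimod_homD(2)[OF resD(4)] \<delta>gr]
    by (simp add: smash_grading_def image_subset_iff)
  show "S\<epsilon> ` smash_grading (gr 0) i \<subseteq> smash_grading D i" for i
    using G_part_map(2)[OF graded_bimoduleD(2)[OF grP] ds bimod_homD(2)[OF resD(5)] \<epsilon>gr]
    by (simp add: smash_grading_def image_subset_iff)
qed


section \<open>The dual complex\<close>

abbreviation restrict where "restrict n \<equiv> dual_restrict R (P n)"
abbreviation lift where "lift n \<equiv> dual_lift R D (P n) (gr n)"

lemma restrict_dual: "f \<in> dual_module S (SP n) \<Longrightarrow> restrict n a f \<in> dual_module R (P n)"
  using gbimod_loc.restrict_hom[OF gb] by (auto simp: dual_module_def dual_restrict_def)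

lemma lift_dual: "(\<And>a. F a \<in> dual_module R (P n)) \<Longrightarrow> lift n F \<in> dual_module S (SP n)"
  using gbimod_loc.lift_hom[OF gb, of n F] by (auto simp: dual_module_def dual_lift_def smash_bimod_simps)

lemma restrict_lift:
  assumes "\<And>a. F a \<in> dual_module R (P n)"
  shows "restrict n a (lift n F) = F a"
proof
  fix x
  show "restrict n a (lift n F) x = F a x"
    using gbimod_loc.restrict_lift[OF gb, of n F x a] assms
    by (cases "x \<in> carrier (P n)") (auto simp: dual_module_def dual_restrict_def)
qed

lemma lift_restrict:
  assumes "f \<in> dual_module S (SP n)"
  shows "lift n (\<lambda>a. restrict n a f) = f"
proof
  fix q
  show "lift n (\<lambda>a. restrict n a f) q = f q"
    using gbimod_loc.lift_restrict[OF gb, of n f q] assms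
    by (cases "q \<in> carrier (SP n)") (auto simp: dual_module_def dual_lift_def smash_bimod_simps)
qed

lemma codiff_dual:
  assumes "f \<in> dual_module S (SP n)" shows "codifferential SP S\<delta> n f \<in> dual_module S (SP (Suc n))"
proof -
  have res': "bimodule_resolution S SP S\<delta> S\<epsilon>"
    using smash_resolution by (simp add: graded_bimodule_resolution_def)
  have *: "bimod_hom (SP (Suc n)) (outer_bimodule S) (\<lambda>q. f (S\<delta> n q))"
    using assms by (intro bimod_hom_compose[OF resolutionD(4)[OF res']]) (simp add: dual_module_def)
  have lQ: "bimodule S (SP (Suc n))"
    by (rule resolutionD(2)[OF res'])
  show ?thesis
    unfolding dual_module_def
  proof (intro CollectI conjI bimod_homI)
    show "additive_on (carrier (SP (Suc n))) (codifferential SP S\<delta> n f)"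
      using bimod_homD(2)[OF *] add_subgroup_add[OF lmod_subgroup[OF bimodule_lmod[OF lQ]]]
      by (simp add: additive_on_def codifferential_def)
  qed (use bimod_homD[OF *] lact_closed[OF bimodule_lmod[OF lQ]] ract_closed[OF lQ]
      in \<open>auto simp: codifferential_def\<close>)
qed

lemma restrict_codiff:
  "restrict (Suc n) a (codifferential SP S\<delta> n f) = codifferential P \<delta> n (restrict n a f)"
  using bimod_homD(1)[OF resD(4)]
  by (auto simp: fun_eq_iff dual_restrict_def codifferential_def smash_bimod_simps)

text \<open>The differential preserves degrees and therefore commutes with the components that enter
  \<open>lift\<close>.\<close>

lemma lift_codiff:
  "lift (Suc n) (\<lambda>a. codifferential P \<delta> n (F a)) = codifferential SP S\<delta> n (lift n F)"
proof
  fix q :: "'g \<Rightarrow> 'm"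
  have "codifferential P \<delta> n (F a) (component (G_part (gr (Suc n))) g (q h)) =
      F a (component (G_part (gr n)) g (\<delta> n (q h)))" if "\<forall>h. q h \<in> carrier (P (Suc n))" for a g h
  proof -
    have qh: "q h \<in> carrier (P (Suc n))" using that by blast
    note dG = direct_sum_G_part[OF graded_bimoduleD(2)[OF grP]]
    have "component (G_part (gr (Suc n))) g (q h) \<in> carrier (P (Suc n))"
      by (rule direct_sum_subset[OF dG component_in[OF dG qh]])
    then show ?thesis
      using bimod_hom_smash(2)[OF grP grP resD(4) \<delta>gr qh, of g] by (simp add: codifferential_def)
  qed
  then show "lift (Suc n) (\<lambda>a. codifferential P \<delta> n (F a)) q = codifferential SP S\<delta> n (lift n F) q"
    using bimod_homD(1)[OF resD(4)] by (simp add: dual_lift_def codifferential_def[of SP] smash_bimod_simps)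
qed

lemma lift_zero: "lift n (\<lambda>a x. 0) = 0"
  by (simp add: fun_eq_iff dual_lift_def flip: zero_fun_def)

lemma restrict_zero: "restrict n a 0 = 0"
  by (simp add: fun_eq_iff dual_restrict_def flip: zero_fun_def)

text \<open>Restriction and lifting identify the dual complex of the smash resolution with a
  product, over the group, of copies of the dual complex of \<open>P\<close>; cocycles are
  recognised member by member.\<close>

lemma cocycles_restrict:
  "f \<in> cocycles S SP S\<delta> n \<longleftrightarrow>
    f \<in> dual_module S (SP n) \<and> (\<forall>a. restrict n a f \<in> cocycles R P \<delta> n)"
proof (intro iffI conjI allI)
  assume f: "f \<in> cocycles S SP S\<delta> n"
  then show "f \<in> dual_module S (SP n)" by (simp add: cocycles_def)
  show "restrict n a f \<in> cocycles R P \<delta> n" for a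
    using f restrict_dual[of f n a] restrict_codiff[of n a f, symmetric]
    by (simp add: cocycles_def restrict_zero)
next
  assume f: "f \<in> dual_module S (SP n) \<and> (\<forall>a. restrict n a f \<in> cocycles R P \<delta> n)"
  have "codifferential SP S\<delta> n f = lift (Suc n) (\<lambda>a. codifferential P \<delta> n (restrict n a f))"
    using lift_restrict[of f n] f by (simp add: lift_codiff)
  also have "\<dots> = lift (Suc n) (\<lambda>a x. 0)"
    using f by (simp add: cocycles_def zero_fun_def)
  finally show "f \<in> cocycles S SP S\<delta> n"
    using f by (simp add: cocycles_def lift_zero)
qed

text \<open>In positive degree, cochains bounding the members are chosen and assembled by
  \<open>lift\<close>; in degree 0 the vanishing of all members forces \<open>f\<close> to
  vanish.\<close>

lemma coboundaries_restrict:
  "f \<in> coboundaries S SP S\<delta> n \<longleftrightarrow>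
    f \<in> dual_module S (SP n) \<and> (\<forall>a. restrict n a f \<in> coboundaries R P \<delta> n)"
proof (cases n)
  case 0
  have "f = 0" if "f \<in> dual_module S (SP 0)" "\<forall>a. restrict 0 a f = 0"
  proof -
    have "f = lift 0 (\<lambda>a. restrict 0 a f)"
      by (rule lift_restrict[OF that(1), symmetric])
    then show ?thesis
      using that(2) lift_zero[of 0] by (simp add: zero_fun_def)
  qed
  moreover have "0 \<in> dual_module S (SP 0)"
    by (rule sm.zero_dual)
  ultimately show ?thesis
    using 0 restrict_zero[of 0] by (auto simp: coboundaries_def)
next
  case (Suc m)
  show ?thesis
  proof (intro iffI conjI allI)
    assume f: "f \<in> coboundaries S SP S\<delta> n"
    then obtain g where g: "g \<in> dual_module S (SP m)" "f = codifferential SP S\<delta> m g"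
      by (auto simp: coboundaries_def Suc)
    show "f \<in> dual_module S (SP n)"
      unfolding g Suc by (rule codiff_dual[OF g(1)])
    show "restrict n a f \<in> coboundaries R P \<delta> n" for a
      using restrict_dual[OF g(1)] by (simp add: g(2) Suc restrict_codiff coboundaries_def)
  next
    assume f: "f \<in> dual_module S (SP n) \<and> (\<forall>a. restrict n a f \<in> coboundaries R P \<delta> n)"
    then have "\<forall>a. \<exists>g. g \<in> dual_module R (P m) \<and> restrict n a f = codifferential P \<delta> m g"
      by (auto simp: coboundaries_def Suc)
    then obtain G where G: "\<And>a. G a \<in> dual_module R (P m)" "\<And>a. restrict n a f = codifferential P \<delta> m (G a)"
      by metis
    have "f = lift n (\<lambda>a. restrict n a f)"
      using f lift_restrict by simp
    also have "\<dots> = codifferential SP S\<delta> m (lift m G)"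
      unfolding Suc G(2)[unfolded Suc] by (rule lift_codiff)
    finally show "f \<in> coboundaries S SP S\<delta> n"
      using lift_dual[OF G(1)] by (simp add: coboundaries_def Suc)
  qed
qed

end

section \<open>The inner actions on cocycles\<close>

lemma codifferential_eq_0_iff:
  "codifferential P \<delta> n f = 0 \<longleftrightarrow> (\<forall>x\<in>carrier (P (Suc n)). f (\<delta> n x) = 0)"
proof -
  have "codifferential P \<delta> n f = 0 \<longleftrightarrow> (\<forall>x. codifferential P \<delta> n f x = 0)"
    unfolding fun_eq_iff zero_fun_apply ..
  then show ?thesis
    unfolding codifferential_def by auto
qed

context alg_loc
begin

lemma lact_inner_dual:
  "f \<in> dual_module A M \<Longrightarrow> (\<lambda>x. lact (inner_bimodule A) a (f x)) \<in> dual_module A M"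
  and ract_inner_dual:
  "f \<in> dual_module A M \<Longrightarrow> (\<lambda>x. ract (inner_bimodule A) (f x) a) \<in> dual_module A M"
  using inner_outer_hom[of M f] by (auto simp: dual_module_def)

lemma inner_cocycle:
  assumes "f \<in> cocycles A P \<delta> n"
  shows "(\<lambda>x. lact (inner_bimodule A) a (f x)) \<in> cocycles A P \<delta> n"
    and "(\<lambda>x. ract (inner_bimodule A) (f x) a) \<in> cocycles A P \<delta> n"
  using assms lact_inner_dual[of f "P n" a] ract_inner_dual[of f "P n" a]
  by (auto simp: cocycles_def codifferential_eq_0_iff)

lemma add_dual:
  assumes "f \<in> dual_module A M" "g \<in> dual_module A M"
  shows "f + g \<in> dual_module A M" "f - g \<in> dual_module A M"
proof -
  have f: "bimod_hom M (outer_bimodule A) f" and g: "bimod_hom M (outer_bimodule A) g"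
    using assms by (auto simp: dual_module_def)
  have *: "f + g = (\<lambda>x. f x + g x)" "f - g = (\<lambda>x. f x - g x)"
    by (simp_all add: fun_eq_iff)
  have "bimod_hom M (outer_bimodule A) (f + g)" "bimod_hom M (outer_bimodule A) (f - g)"
    unfolding * by (rule bimod_hom_add[OF outer_bimodule f g], rule bimod_hom_diff[OF outer_bimodule f g])
  then show "f + g \<in> dual_module A M" "f - g \<in> dual_module A M"
    using assms by (simp_all add: dual_module_def)
qed

lemma cocycles_subgroup: "add_subgroup (cocycles A P \<delta> n)"
  unfolding add_subgroup_def
proof (intro conjI ballI)
  show "0 \<in> cocycles A P \<delta> n"
    by (simp add: cocycles_def zero_dual codifferential_eq_0_iff)
  fix f g assume "f \<in> cocycles A P \<delta> n" "g \<in> cocycles A P \<delta> n"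
  then show "f - g \<in> cocycles A P \<delta> n"
    using add_dual(2)[of f "P n" g] by (simp add: cocycles_def codifferential_eq_0_iff)
qed

lemma cocycle_mem:
  assumes "f \<in> cocycles A P \<delta> n" shows "f x \<in> tensor_square A"
  using assms bimod_homD(1)[of "P n" "outer_bimodule A" f x]
  by (cases "x \<in> carrier (P n)") (auto simp: cocycles_def dual_module_def add_subgroup_zero[OF tensor_square_subgroup])

text \<open>\<open>ext_iso\<close> states linearity for both sides at once; acting by 1 on one side
  isolates the other.\<close>

lemma ext_iso_inner:
  assumes \<phi>: "ext_iso A P \<delta> n \<phi>" and f: "f \<in> cocycles A P \<delta> n"
  shows "\<phi> (\<lambda>x. lact (inner_bimodule A) a (f x)) = a \<cdot>\<^bsub>A\<^esub> \<phi> f"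
    and "\<phi> (\<lambda>x. ract (inner_bimodule A) (f x) a) = \<phi> f \<cdot>\<^bsub>A\<^esub> a"
proof -
  have *: "\<phi> (\<lambda>x. lact (inner_bimodule A) a (ract (inner_bimodule A) (f x) b)) = a \<cdot>\<^bsub>A\<^esub> \<phi> f \<cdot>\<^bsub>A\<^esub> b" for a b
    using \<phi> f by (simp only: ext_iso_def)
  have id: "tens_map A (\<lambda>x. x) (\<lambda>x. x) (f x) = f x" for x
    by (rule tens_map_id[OF cocycle_mem[OF f]])
  show "\<phi> (\<lambda>x. lact (inner_bimodule A) a (f x)) = a \<cdot>\<^bsub>A\<^esub> \<phi> f"
    using *[of a "alg_one A"] by (simp add: id)
  show "\<phi> (\<lambda>x. ract (inner_bimodule A) (f x) a) = \<phi> f \<cdot>\<^bsub>A\<^esub> a"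
    using *[of "alg_one A" a] by (simp add: tens_map_compose[OF lin(2,2)])
qed

lemma ext_isoI:
  assumes "\<And>f g. f \<in> cocycles A P \<delta> n \<Longrightarrow> g \<in> cocycles A P \<delta> n \<Longrightarrow> \<phi> (f + g) = \<phi> f + \<phi> g"
    and l: "\<And>a f. f \<in> cocycles A P \<delta> n \<Longrightarrow> \<phi> (\<lambda>x. lact (inner_bimodule A) a (f x)) = a \<cdot>\<^bsub>A\<^esub> \<phi> f"
    and r: "\<And>a f. f \<in> cocycles A P \<delta> n \<Longrightarrow> \<phi> (\<lambda>x. ract (inner_bimodule A) (f x) a) = \<phi> f \<cdot>\<^bsub>A\<^esub> a"
    and "\<phi> ` cocycles A P \<delta> n = UNIV"
    and "{f \<in> cocycles A P \<delta> n. \<phi> f = 0} = coboundaries A P \<delta> n"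
  shows "ext_iso A P \<delta> n \<phi>"
  unfolding ext_iso_def
proof (intro conjI ballI allI)
  fix a b f assume f: "f \<in> cocycles A P \<delta> n"
  show "\<phi> (\<lambda>x. lact (inner_bimodule A) a (ract (inner_bimodule A) (f x) b)) = a \<cdot>\<^bsub>A\<^esub> \<phi> f \<cdot>\<^bsub>A\<^esub> b"
    using l[OF inner_cocycle(2)[OF f]] r[OF f] by (simp only: mult_assoc)
qed (use assms in auto)

end

section \<open>The isomorphism from cohomology in degree p onto \<open>S\<close>\<close>

context smash_res
begin

lemma restrict_add: "restrict n a (f + g) = restrict n a f + restrict n a g"
  by (simp add: fun_eq_iff dual_restrict_def tens_map_add)

lemma dual_mem:
  assumes "f \<in> dual_module S (SP n)" shows "f q \<in> tensor_square S"
  using assms bimod_homD(1)[of "SP n" "outer_bimodule S" f q]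
  by (cases "q \<in> carrier (SP n)") (auto simp: dual_module_def add_subgroup_zero[OF tensor_square_subgroup])

text \<open>Evaluating a product of \<open>S\<close> at a gives the product formula, so under the
  right action the members behave as the coefficients of an element of \<open>S\<close>.\<close>

lemma restrict_ract_inner:
  assumes f: "f \<in> dual_module S (SP n)"
  shows "restrict n a (\<lambda>q. ract (inner_bimodule S) (f q) t) =
    (\<Sum>g\<in>UNIV. (\<lambda>x. ract (inner_bimodule R) (restrict n g f x) (pr (g - a) (t a))))"
proof
  fix x
  show "restrict n a (\<lambda>q. ract (inner_bimodule S) (f q) t) x =
    (\<Sum>g\<in>UNIV. (\<lambda>x. ract (inner_bimodule R) (restrict n g f x) (pr (g - a) (t a)))) x"
  proof (cases "x \<in> carrier (P n)")
    case True
    have lg: "alg_linear S R (\<lambda>s. s g \<cdot>\<^bsub>R\<^esub> pr (g - a) (t a))" for g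
      by (rule alg_linear_compose[OF lin_ev lin(4)])
    have "restrict n a (\<lambda>q. ract (inner_bimodule S) (f q) t) x =
        tens_map R (\<lambda>s. \<Sum>g\<in>UNIV. s g \<cdot>\<^bsub>R\<^esub> pr (g - a) (t a)) (\<lambda>s. \<Sum>h\<in>UNIV. s h) (f (\<lambda>_. x))"
      using True by (simp add: dual_restrict_def tens_map_compose[OF lin_ev lin_sum] smash_mult_apply)
    also have "\<dots> = (\<Sum>g\<in>UNIV. tens_map R (\<lambda>s. s g \<cdot>\<^bsub>R\<^esub> pr (g - a) (t a)) (\<lambda>s. \<Sum>h\<in>UNIV. s h) (f (\<lambda>_. x)))"
      by (rule tens_map_sum_left[OF algebra_smash alg lg lin_sum dual_mem[OF f]])
    finally show ?thesis
      using True by (simp add: sum_fun dual_restrict_def tens_map_compose[OF lin(4,2)])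
  qed (simp add: dual_restrict_def sum_fun)
qed

lemma restrict_idem_inner:
  assumes "x \<in> carrier (P n)"
  shows "restrict n a (\<lambda>q. lact (inner_bimodule S) (pt k (alg_one R)) (f q)) x =
    tens_map R (\<lambda>s. s a) (\<lambda>s. \<Sum>h\<in>UNIV. pr (k - h) (s h)) (f (\<lambda>_. x))"
  using assms by (simp add: dual_restrict_def tens_map_compose[OF lin_ev lin_sum] idem_mult)

lemma lin_sum_pr: "alg_linear S R (\<lambda>s. \<Sum>h\<in>UNIV. pr (k - h) (s h))"
  by (intro alg_linear_sum[OF algebra_smash alg] alg_linear_compose[OF lin_ev pr_linear])

text \<open>On the left, s is the sum of (s k # 1) p_k. The first factor acts through the inner
  action of \<open>R\<close>; the effect of the idempotents is not visible here and is determined by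
  degrees in \<open>\<phi>_idem\<close>.\<close>

lemma restrict_lact_inner:
  assumes f: "f \<in> dual_module S (SP n)"
  shows "restrict n a (\<lambda>q. lact (inner_bimodule S) s (f q)) =
    (\<Sum>k\<in>UNIV. (\<lambda>x. lact (inner_bimodule R) (s k)
      (restrict n a (\<lambda>q. lact (inner_bimodule S) (pt k (alg_one R)) (f q)) x)))"
proof
  fix x
  show "restrict n a (\<lambda>q. lact (inner_bimodule S) s (f q)) x =
    (\<Sum>k\<in>UNIV. (\<lambda>x. lact (inner_bimodule R) (s k)
      (restrict n a (\<lambda>q. lact (inner_bimodule S) (pt k (alg_one R)) (f q)) x))) x"
  proof (cases "x \<in> carrier (P n)")
    case True
    have lk: "alg_linear S R (\<lambda>y. s k \<cdot>\<^bsub>R\<^esub> (\<Sum>h\<in>UNIV. pr (k - h) (y h)))" for k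
      by (rule alg_linear_compose[OF lin_sum_pr lin(3)])
    have "(\<Sum>h\<in>UNIV. (s \<cdot>\<^bsub>S\<^esub> y) h) = (\<Sum>k\<in>UNIV. s k \<cdot>\<^bsub>R\<^esub> (\<Sum>h\<in>UNIV. pr (k - h) (y h)))" for y
      unfolding smash_mult_apply mult_sum by (rule sum.swap)
    then have "restrict n a (\<lambda>q. lact (inner_bimodule S) s (f q)) x =
        tens_map R (\<lambda>s. s a) (\<lambda>y. \<Sum>k\<in>UNIV. s k \<cdot>\<^bsub>R\<^esub> (\<Sum>h\<in>UNIV. pr (k - h) (y h))) (f (\<lambda>_. x))"
      using True by (simp add: dual_restrict_def tens_map_compose[OF lin_ev lin_sum])
    also have "\<dots> = (\<Sum>k\<in>UNIV. tens_map R (\<lambda>s. s a) (\<lambda>y. s k \<cdot>\<^bsub>R\<^esub> (\<Sum>h\<in>UNIV. pr (k - h) (y h))) (f (\<lambda>_. x)))"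
      by (rule tens_map_sum_right[OF algebra_smash alg lk lin_ev dual_mem[OF f]])
    finally show ?thesis
      by (simp only: sum_fun restrict_idem_inner[OF True] inner_simps tens_map_compose[OF lin(2,3)])
  qed (simp add: dual_restrict_def sum_fun)
qed

text \<open>For x of degree c, x # 1 is the sum of the x # p_h, and x # p_h = p_(c+h) (x # p_h) p_h.
  In the image of such a summand the left coefficient at a therefore has degree c + h - a, while p_k
  leaves the component of degree k - h of the right coefficient. The degree condition becomes (k -
  h) - c + (c + h - a) = k - a for every h.\<close>

lemma restrict_G_degree:
  assumes f: "f \<in> dual_module S (SP n)"
  shows "has_G_degree R (G_part D) (G_part (gr n))
    (restrict n a (\<lambda>q. lact (inner_bimodule S) (pt k (alg_one R)) (f q))) (k - a)"
  unfolding has_G_degree_def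
proof (intro allI image_subsetI)
  interpret M: gbimod_loc R D "P n" "gr n" by (rule gb)
  note fh = f[unfolded dual_module_def, THEN CollectD, THEN conjunct1]
  fix c x assume xc: "x \<in> G_part (gr n) c"
  let ?K = "add_subgroup hull {tensor R x y |x y u v. x \<in> G_part D u \<and> y \<in> G_part D v \<and> v - c + u = k - a}"
  have x: "x \<in> carrier (P n)"
    by (rule direct_sum_subset[OF M.dGM xc])
  note px = M.pt_mem[OF x]
  have fpx: "f (pt h x) = tens_map S (\<lambda>s. pt (c + h) (alg_one R) \<cdot>\<^bsub>S\<^esub> s) (\<lambda>s. s \<cdot>\<^bsub>S\<^esub> pt h (alg_one R)) (f (pt h x))" for h
  proof -
    have "lact M.Q (pt (c + h) (alg_one R)) (ract M.Q (pt h x) (pt h (alg_one R))) = pt h x"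
      using px[of h] M.mp_hom[OF xc] x
      by (simp add: M.ract_idem M.Q_simps(1) pt_apply M.lact_pt_pt lact_one[OF M.lM])
    then have "f (pt h x) = lact (outer_bimodule S) (pt (c + h) (alg_one R))
        (ract (outer_bimodule S) (f (pt h x)) (pt h (alg_one R)))"
      using bimod_homD(3)[OF fh M.ract_Q_closed[OF px]] bimod_homD(4)[OF fh px] by metis
    then show ?thesis
      by (simp add: tens_map_compose[OF sm.lin(3,2)])
  qed
  have "f (\<lambda>_. x) = f (\<Sum>h\<in>UNIV. pt h x)"
    by (simp add: sum_pt[of "\<lambda>_. x"])
  also have "\<dots> = (\<Sum>h\<in>UNIV. f (pt h x))"
    by (rule additive_on_sum[OF M.Q_subgroup bimod_homD(2)[OF fh] px])
  finally have fx: "f (\<lambda>_. x) = (\<Sum>h\<in>UNIV. f (pt h x))" .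
  let ?u = "\<lambda>h s. pr (c + h - a) (s a)" and ?v = "\<lambda>h s. pr (k - h) (s h)"
  have lu: "alg_linear S R (?u h)" and lv: "alg_linear S R (?v h)" for h
    by (rule alg_linear_compose[OF lin_ev pr_linear])+
  have "tens_map R (\<lambda>s. s a) (\<lambda>s. \<Sum>h\<in>UNIV. pr (k - h) (s h)) (f (pt h x)) = tens_map R (?u h) (?v h) (f (pt h x))" for h
  proof -
    have "(\<Sum>h'\<in>UNIV. pr (k - h') ((s \<cdot>\<^bsub>S\<^esub> pt h (alg_one R)) h')) = ?v h s" for s
    proof -
      have "(\<Sum>h'\<in>UNIV. pr (k - h') (pt h (s h) h')) = (\<Sum>h'\<in>UNIV. if h' = h then pr (k - h') (s h) else 0)"
        by (intro sum.cong) (simp_all add: pt_apply)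
      then show ?thesis
        by (simp add: mult_idem)
    qed
    then have *: "tens_map R (\<lambda>s. s a) (\<lambda>s. \<Sum>h\<in>UNIV. pr (k - h) (s h))
        (tens_map S (\<lambda>s. pt (c + h) (alg_one R) \<cdot>\<^bsub>S\<^esub> s) (\<lambda>s. s \<cdot>\<^bsub>S\<^esub> pt h (alg_one R)) t) = tens_map R (?u h) (?v h) t" for t
      by (simp add: tens_map_compose[OF lin_ev lin_sum_pr] idem_mult)
    show ?thesis
      using *[of "f (pt h x)"] fpx[of h] by simp
  qed
  then have "restrict n a (\<lambda>q. lact (inner_bimodule S) (pt k (alg_one R)) (f q)) x =
      (\<Sum>h\<in>UNIV. tens_map R (?u h) (?v h) (f (pt h x)))"
    unfolding restrict_idem_inner[OF x] fx tens_map_sum by simp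
  also have "\<dots> \<in> ?K"
  proof (rule add_subgroup_sum[OF add_subgroup_hull])
    fix h
    show "tens_map R (?u h) (?v h) (f (pt h x)) \<in> ?K"
    proof (rule tensor_square_memI[where f = "tens_map R (?u h) (?v h)", OF additive_tens_map add_subgroup_hull _ dual_mem[OF f]])
      fix s t :: "'g \<Rightarrow> 'r"
      have "k - h - c + (c + h - a) = k - a"
        by (simp only: diff_conv_add_uminus add.assoc minus_add_cancel)
      then show "tens_map R (?u h) (?v h) (tensor S s t) \<in> ?K"
        unfolding tens_map_tensor[OF lu lv] using pr_mem by (intro hull_inc) blast
    qed
  qed
  finally show "restrict n a (\<lambda>q. lact (inner_bimodule S) (pt k (alg_one R)) (f q)) x \<in> ?K" .
qed

text \<open>A constant family has the numerical degree of its value, and evaluating or summing the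
  coefficients of an element of \<open>S\<close> preserves that degree.\<close>

lemma restrict_degree:
  assumes f: "has_degree S (smash_grading D) (smash_grading (gr n)) f m"
  shows "has_degree R (N_part D) (N_part (gr n)) (restrict n a f) m"
  unfolding has_degree_def
proof (intro allI image_subsetI)
  interpret M: gbimod_loc R D "P n" "gr n" by (rule gb)
  fix i x assume xi: "x \<in> N_part (gr n) i"
  have x: "x \<in> carrier (P n)"
    by (rule direct_sum_subset[OF M.dNM xi])
  have "(\<lambda>_. x) \<in> smash_grading (gr n) i"
    using xi by (simp add: smash_grading_def)
  then have fx: "f (\<lambda>_. x) \<in> tensor_degree S (smash_grading D) (int i + m)"
    using f by (auto simp: has_degree_def)
  have "tens_map R (\<lambda>s. s a) (\<lambda>s. \<Sum>h\<in>UNIV. s h) (f (\<lambda>_. x)) \<in> tensor_degree R (N_part D) (int i + m)"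
  proof (rule additive_on_hull_mem[where f = "tens_map R (\<lambda>s. s a) (\<lambda>s. \<Sum>h\<in>UNIV. s h)", OF additive_tens_map _ _
        fx[unfolded tensor_degree_def]])
    fix t assume "t \<in> {tensor S x y |x y ia j. x \<in> smash_grading D ia \<and> y \<in> smash_grading D j \<and> int ia + int j = int i + m}"
    then obtain s s' j j' where t: "t = tensor S s s'" and s: "s \<in> smash_grading D j" "s' \<in> smash_grading D j'"
      and j: "int j + int j' = int i + m"
      by blast
    have "s a \<in> N_part D j" "(\<Sum>h\<in>UNIV. s' h) \<in> N_part D j'"
      using s by (auto simp: smash_grading_def intro: add_subgroup_sum[OF direct_sum_add_subgroup[OF dN]])
    then show "tens_map R (\<lambda>s. s a) (\<lambda>s. \<Sum>h\<in>UNIV. s h) t \<in> tensor_degree R (N_part D) (int i + m)"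
      unfolding t tens_map_tensor[OF lin_ev lin_sum] tensor_degree_def
      using j by (intro hull_inc) blast
  qed (simp add: tensor_degree_def)
  then show "restrict n a f x \<in> tensor_degree R (N_part D) (int i + m)"
    using x by (simp add: dual_restrict_def)
qed

context
  fixes p \<phi>
  assumes \<phi>: "ext_iso R P \<delta> p \<phi>"
    and \<phi>G: "\<And>f g. f \<in> cocycles R P \<delta> p \<Longrightarrow> has_G_degree R (G_part D) (G_part (gr p)) f g \<Longrightarrow> \<phi> f \<in> G_part D g"
begin

lemma \<phi>_additive: "additive_on (cocycles R P \<delta> p) \<phi>"
  using \<phi> by (simp add: ext_iso_def additive_on_def)

lemma restrict_cocycle: "f \<in> cocycles S SP S\<delta> p \<Longrightarrow> restrict p a f \<in> cocycles R P \<delta> p"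
  and cocycle_dual: "f \<in> cocycles S SP S\<delta> p \<Longrightarrow> f \<in> dual_module S (SP p)"
  by (simp_all add: cocycles_restrict)

text \<open>The idempotent pieces of \<open>f\<close> add up to \<open>f\<close>, and by
  \<open>restrict_G_degree\<close> the k-th piece has degree k - a. Since \<open>\<phi>\<close>
  respects degrees, its values on the pieces are the homogeneous components of its value on the
  member at a. It is here that compatibility of \<open>\<phi>\<close> with the grading by the group
  enters.\<close>

lemma \<phi>_idem:
  assumes f: "f \<in> cocycles S SP S\<delta> p"
  shows "\<phi> (restrict p a (\<lambda>q. lact (inner_bimodule S) (pt k (alg_one R)) (f q))) = pr (k - a) (\<phi> (restrict p a f))"
proof -
  let ?e = "\<lambda>k. restrict p a (\<lambda>q. lact (inner_bimodule S) (pt k (alg_one R)) (f q))"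
  have ek: "?e k \<in> cocycles R P \<delta> p" for k
    by (rule restrict_cocycle[OF sm.inner_cocycle(1)[OF f]])
  have "\<phi> (?e k) \<in> G_part D (k - a)" for k
    by (rule \<phi>G[OF ek restrict_G_degree[OF cocycle_dual[OF f]]])
  then have pk: "pr (k - a) (\<phi> (?e k')) = (if k = k' then \<phi> (?e k') else 0)" for k'
    using pr_hom[of "\<phi> (?e k')" "k' - a" "k - a"] by simp
  have "f = (\<lambda>q. lact (inner_bimodule S) (alg_one S) (f q))"
    using sm.tens_map_id[OF sm.cocycle_mem[OF f]] by (simp add: sm.one_mult[unfolded smash_simps])
  then have "restrict p a f = restrict p a (\<lambda>q. lact (inner_bimodule S) (alg_one S) (f q))"
    by (rule arg_cong)
  also have "\<dots> = (\<Sum>k\<in>UNIV. (\<lambda>x. lact (inner_bimodule R) (alg_one R) (?e k x)))"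
    by (subst restrict_lact_inner[OF cocycle_dual[OF f]]) (simp only: smash_simps)
  also have "\<dots> = (\<Sum>k\<in>UNIV. ?e k)"
    using tens_map_id[OF cocycle_mem[OF ek]] by (intro sum.cong) (simp_all add: fun_eq_iff)
  finally have "\<phi> (restrict p a f) = (\<Sum>k\<in>UNIV. \<phi> (?e k))"
    using additive_on_sum[OF cocycles_subgroup \<phi>_additive, of UNIV ?e] ek by simp
  then show ?thesis
    by (simp only: pr_sum pk) simp
qed

text \<open>Linearity on either side turns into the product formula of \<open>S\<close>. For
  surjectivity cocycles over \<open>R\<close> with the prescribed values are assembled by
  \<open>lift\<close>; the kernel is compared member by member.\<close>

lemma smash_ext_iso: "ext_iso S SP S\<delta> p (\<lambda>f a. \<phi> (restrict p a f))"
proof (rule sm.ext_isoI)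
  let ?\<Phi> = "\<lambda>f a. \<phi> (restrict p a f)"
  show "?\<Phi> (f + g) = ?\<Phi> f + ?\<Phi> g" if "f \<in> cocycles S SP S\<delta> p" "g \<in> cocycles S SP S\<delta> p" for f g
    using \<phi>_additive restrict_cocycle that by (simp add: fun_eq_iff restrict_add additive_on_def)
  show "?\<Phi> (\<lambda>x. lact (inner_bimodule S) s (f x)) = s \<cdot>\<^bsub>S\<^esub> ?\<Phi> f" if f: "f \<in> cocycles S SP S\<delta> p" for s f
  proof
    fix a
    let ?e = "\<lambda>k. restrict p a (\<lambda>q. lact (inner_bimodule S) (pt k (alg_one R)) (f q))"
    have ek: "?e k \<in> cocycles R P \<delta> p" for k
      by (rule restrict_cocycle[OF sm.inner_cocycle(1)[OF f]])
    have "?\<Phi> (\<lambda>x. lact (inner_bimodule S) s (f x)) a = (\<Sum>k\<in>UNIV. \<phi> (\<lambda>x. lact (inner_bimodule R) (s k) (?e k x)))"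
      unfolding restrict_lact_inner[OF cocycle_dual[OF f], of a s]
      by (rule additive_on_sum[OF cocycles_subgroup \<phi>_additive]) (rule inner_cocycle(1)[OF ek])
    also have "\<dots> = (\<Sum>k\<in>UNIV. s k \<cdot>\<^bsub>R\<^esub> pr (k - a) (?\<Phi> f a))"
      by (simp only: ext_iso_inner(1)[OF \<phi> ek] \<phi>_idem[OF f])
    finally show "?\<Phi> (\<lambda>x. lact (inner_bimodule S) s (f x)) a = (s \<cdot>\<^bsub>S\<^esub> ?\<Phi> f) a"
      by (simp only: smash_mult_apply)
  qed
  show "?\<Phi> (\<lambda>x. ract (inner_bimodule S) (f x) t) = ?\<Phi> f \<cdot>\<^bsub>S\<^esub> t" if f: "f \<in> cocycles S SP S\<delta> p" for t f
  proof
    fix a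
    have "?\<Phi> (\<lambda>x. ract (inner_bimodule S) (f x) t) a =
        (\<Sum>g\<in>UNIV. \<phi> (\<lambda>x. ract (inner_bimodule R) (restrict p g f x) (pr (g - a) (t a))))"
      unfolding restrict_ract_inner[OF cocycle_dual[OF f]]
      by (rule additive_on_sum[OF cocycles_subgroup \<phi>_additive]) (rule inner_cocycle(2)[OF restrict_cocycle[OF f]])
    also have "\<dots> = (\<Sum>g\<in>UNIV. ?\<Phi> f g \<cdot>\<^bsub>R\<^esub> pr (g - a) (t a))"
      by (simp only: ext_iso_inner(2)[OF \<phi> restrict_cocycle[OF f]])
    finally show "?\<Phi> (\<lambda>x. ract (inner_bimodule S) (f x) t) a = (?\<Phi> f \<cdot>\<^bsub>S\<^esub> t) a"
      by (simp only: smash_mult_apply)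
  qed
  show "?\<Phi> ` cocycles S SP S\<delta> p = UNIV"
  proof (intro equalityI subsetI UNIV_I)
    fix s :: "'g \<Rightarrow> 'r"
    have "\<phi> ` cocycles R P \<delta> p = UNIV"
      using \<phi> by (simp add: ext_iso_def)
    then have "\<forall>a. \<exists>f. f \<in> cocycles R P \<delta> p \<and> \<phi> f = s a"
      by (metis UNIV_I imageE)
    then obtain F where F: "\<And>a. F a \<in> cocycles R P \<delta> p" "\<And>a. \<phi> (F a) = s a"
      by metis
    have Fd: "F a \<in> dual_module R (P p)" for a
      using F(1) by (simp add: cocycles_def)
    have "lift p F \<in> cocycles S SP S\<delta> p"
      by (simp add: cocycles_restrict lift_dual[OF Fd] restrict_lift[OF Fd] F(1))
    moreover have "?\<Phi> (lift p F) = s"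
      by (simp add: restrict_lift[OF Fd] F(2))
    ultimately show "s \<in> ?\<Phi> ` cocycles S SP S\<delta> p"
      by blast
  qed
  have cob: "f \<in> coboundaries R P \<delta> p \<longleftrightarrow> f \<in> cocycles R P \<delta> p \<and> \<phi> f = 0" for f
    using \<phi> by (auto simp: ext_iso_def)
  show "{f \<in> cocycles S SP S\<delta> p. ?\<Phi> f = 0} = coboundaries S SP S\<delta> p"
    by (auto simp: cocycles_restrict coboundaries_restrict cob fun_eq_iff[of ?\<Phi>] fun_eq_iff[of "\<lambda>a. \<phi> (restrict p a f)" for f])
qed

end

lemma smash_shifted:
  "(\<And>a. s a \<in> shifted (N_part D) l m) \<Longrightarrow> s \<in> shifted (smash_grading D) l m"
  by (auto simp: shifted_def smash_grading_def fun_eq_iff split: if_splits)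

end

section \<open>Change of the ambient type and the Calabi-Yau property\<close>

text \<open>The terms of the resolution of \<open>S\<close> are carried by \<open>'g \<Rightarrow> nat \<Rightarrow> ('k, 'r) tens\<close>, while
  \<open>calabi_yau\<close> asks for terms carried by \<open>nat \<Rightarrow> ('k, 'g \<Rightarrow> 'r) tens\<close>.\<close>

definition transport_bimod :: "('m \<Rightarrow> 'n) \<Rightarrow> ('b, 'm::ab_group_add) bimod \<Rightarrow> ('b, 'n::ab_group_add) bimod" where
  "transport_bimod \<theta> M =
     \<lparr>carrier = \<theta> ` carrier M, lact = (\<lambda>a y. \<theta> (lact M a (inv \<theta> y))), ract = (\<lambda>y a. \<theta> (ract M (inv \<theta> y) a))\<rparr>"

lemma transport_simps [simp]:
  "carrier (transport_bimod \<theta> M) = \<theta> ` carrier M"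
  "lact (transport_bimod \<theta> M) a y = \<theta> (lact M a (inv \<theta> y))"
  "ract (transport_bimod \<theta> M) y a = \<theta> (ract M (inv \<theta> y) a)"
  by (simp_all add: transport_bimod_def)

locale transport_loc = alg_loc A for A :: "('k::field, 'b::ab_group_add) alg" +
  fixes \<theta> :: "'m::ab_group_add \<Rightarrow> 'n::ab_group_add"
  assumes inj: "inj \<theta>" and add: "\<theta> (x + y) = \<theta> x + \<theta> y"
begin

abbreviation tr where "tr \<equiv> transport_bimod \<theta>"

lemma additive: "additive_on H \<theta>"
  by (simp add: additive_on_def add)

lemma \<theta>_zero [simp]: "\<theta> 0 = 0"
  by (rule additive_on_zero[OF add_subgroup_UNIV additive])

lemma \<theta>_eq [simp]: "\<theta> x = \<theta> y \<longleftrightarrow> x = y"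
  using inj by (simp add: inj_eq)

lemma inv_\<theta> [simp]: "inv \<theta> (\<theta> x) = x"
  using inj by simp

lemma inv_add: "inv \<theta> (\<theta> x + \<theta> y) = x + y"
  by (simp flip: add)

lemma transport_bimodule:
  assumes M: "bimodule A M"
  shows "bimodule A (tr M)"
proof -
  note lM = bimodule_lmod[OF M]
  have "\<theta> x - \<theta> y = \<theta> (x - y)" for x y
    using add[of "x - y" y] by (simp add: algebra_simps)
  then have sub: "add_subgroup (carrier (tr M))"
    using lmod_subgroup[OF lM] by (auto simp: add_subgroup_def image_iff intro!: bexI[of _ 0])
  show ?thesis
    by (intro bimoduleI left_moduleI sub)
      (auto simp: additive_on_def lact_closed[OF lM] ract_closed[OF M] lact_add[OF lM] ract_add[OF M] inv_add
        lact_add_left[OF lM] ract_add_right[OF M] lact_mult[OF lM] ract_mult[OF M] lact_one[OF lM] ract_one[OF M]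
        ract_lact[OF M] bimod_central[OF M] add[symmetric])
qed

lemma transport_hom: "bimod_hom M (tr M) \<theta>" "bimod_hom (tr M) M (inv \<theta>)"
  by (auto intro!: bimod_homI simp: additive_on_def add inv_add)

lemma transport_fin_gen: "bimodule A M \<Longrightarrow> fin_gen_bimodule M \<Longrightarrow> fin_gen_bimodule (tr M)"
  by (rule fin_gen_image[OF _ _ transport_hom(1) transport_bimodule]) auto

text \<open>Projectivity is witnessed by a basis inside the type of the module, so the basis moves
  along \<open>\<theta>\<close> together with the module; \<open>E\<close> and \<open>E'\<close>
  rename the coordinates.\<close>

lemma transport_projective:
  assumes M: "projective_bimodule A M"
  shows "projective_bimodule A (tr M)"
proof -
  obtain X :: "'m set" and \<iota> \<pi> where bM: "bimodule A M" and \<iota>: "bimod_hom M (free_bimodule A X) \<iota>"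
    and \<pi>: "bimod_hom (free_bimodule A X) M \<pi>" and \<pi>\<iota>: "\<And>x. x \<in> carrier M \<Longrightarrow> \<pi> (\<iota> x) = x"
    using M unfolding projective_bimodule_def by blast
  define E where "E v = (\<lambda>y. if y \<in> range \<theta> then v (inv \<theta> y) else 0)" for v :: "'m \<Rightarrow> ('k, 'b) tens"
  define E' where "E' v = (\<lambda>x. v (\<theta> x))" for v :: "'n \<Rightarrow> ('k, 'b) tens"
  have supp: "{y. E v y \<noteq> 0} = \<theta> ` {x. v x \<noteq> 0}" for v
    by (auto simp: E_def)
  have supp': "{x. E' v x \<noteq> 0} = \<theta> -` {y. v y \<noteq> 0}" for v
    by (auto simp: E'_def)
  have E: "bimod_hom (free_bimodule A X) (free_bimodule A (\<theta> ` X)) E"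
  proof (rule bimod_homI)
    show "E v \<in> carrier (free_bimodule A (\<theta> ` X))" if "v \<in> carrier (free_bimodule A X)" for v
      using that unfolding free_mem supp
      by (auto simp: E_def add_subgroup_zero[OF tensor_square_subgroup])
  qed (auto simp: additive_on_def E_def fun_eq_iff free_lact free_ract simp del: outer_simps,
      auto simp: tens_map_def)
  have E': "bimod_hom (free_bimodule A (\<theta> ` X)) (free_bimodule A X) E'"
  proof (rule bimod_homI)
    show "E' v \<in> carrier (free_bimodule A X)" if "v \<in> carrier (free_bimodule A (\<theta> ` X))" for v
      using that finite_vimageI[OF _ inj, of "{y. v y \<noteq> 0}"] unfolding free_mem supp'
      by (auto simp: E'_def)
  qed (auto simp: additive_on_def E'_def fun_eq_iff free_lact free_ract simp del: outer_simps)
  have E'E: "E' (E v) = v" for v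
    by (simp add: E_def E'_def)
  show ?thesis
    unfolding projective_bimodule_def
  proof (intro conjI exI)
    show "bimodule A (tr M)" by (rule transport_bimodule[OF bM])
    show "bimod_hom (tr M) (free_bimodule A (\<theta> ` X)) (\<lambda>y. E (\<iota> (inv \<theta> y)))"
      by (rule bimod_hom_compose[OF bimod_hom_compose[OF transport_hom(2) \<iota>] E])
    show "bimod_hom (free_bimodule A (\<theta> ` X)) (tr M) (\<lambda>v. \<theta> (\<pi> (E' v)))"
      by (rule bimod_hom_compose[OF bimod_hom_compose[OF E' \<pi>] transport_hom(1)])
    show "\<forall>y\<in>carrier (tr M). \<theta> (\<pi> (E' (E (\<iota> (inv \<theta> y))))) = y"
      by (auto simp: E'E \<pi>\<iota>)
  qed
qed

lemma transport_direct_sum: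
  assumes ds: "direct_sum V D"
  shows "direct_sum (\<theta> ` V) (\<lambda>i. \<theta> ` D i)"
proof -
  have diff: "\<theta> x - \<theta> y = \<theta> (x - y)" for x y
    using add[of "x - y" y] by (simp add: algebra_simps)
  have sub: "add_subgroup (\<theta> ` H)" if "add_subgroup H" for H
    using that by (auto simp: add_subgroup_def diff image_iff intro!: bexI[of _ 0])
  show ?thesis
  proof (rule direct_sumI(1)[where c = "\<lambda>i y. \<theta> (component D i (inv \<theta> y))"])
    show "add_subgroup (\<theta> ` D i)" for i by (rule sub[OF direct_sum_add_subgroup[OF ds]])
    show "add_subgroup (\<theta> ` V)" by (rule sub[OF direct_sum_carrier[OF ds]])
    show "\<theta> ` D i \<subseteq> \<theta> ` V" for i
      using direct_sum_subset[OF ds] by blast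
    have z: "\<theta> x \<noteq> 0 \<longleftrightarrow> x \<noteq> 0" for x
      using \<theta>_eq[of x 0] by simp
    fix i y
    show "(\<lambda>i. \<theta> (component D i (inv \<theta> y))) \<in> families (\<lambda>i. \<theta> ` D i)" if "y \<in> \<theta> ` V"
      using that component_families[OF ds] by (auto simp: families_def z)
    show "Sum_any (\<lambda>i. \<theta> (component D i (inv \<theta> y))) = y" if y: "y \<in> \<theta> ` V"
    proof -
      obtain x where x: "x \<in> V" "y = \<theta> x" using y by blast
      have "\<theta> (Sum_any (\<lambda>i. component D i x)) = Sum_any (\<lambda>i. \<theta> (component D i x))"
        by (rule additive_on_Sum_any[OF add_subgroup_UNIV additive]) (simp_all add: component_finite[OF ds x(1)])
      then show ?thesis
        unfolding x(2) inv_\<theta> Sum_any_component[OF ds x(1)] by (rule sym)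
    qed
    show "additive_on (\<theta> ` V) (\<lambda>y. \<theta> (component D i (inv \<theta> y)))" for i
      using component_additive[OF ds] by (auto simp: additive_on_def inv_add add)
    show "\<theta> (component D i (inv \<theta> y)) = (if i = j then y else 0)" if "y \<in> \<theta> ` D j" for i j y
      using that component_hom[OF ds] by auto
  qed
qed

text \<open>Cochains vanish off the carrier, so a cochain is carried over by extending it by 0 off
  the range of \<open>\<theta>\<close>.\<close>

definition push :: "('m \<Rightarrow> 'v::zero) \<Rightarrow> 'n \<Rightarrow> 'v" where
  "push f = (\<lambda>y. if y \<in> range \<theta> then f (inv \<theta> y) else 0)"

lemma push_\<theta> [simp]: "push f (\<theta> x) = f x"
  by (simp add: push_def)

lemma push_pull: "(\<And>y. y \<notin> range \<theta> \<Longrightarrow> f y = 0) \<Longrightarrow> push (\<lambda>x. f (\<theta> x)) = f"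
  by (auto simp: push_def fun_eq_iff)

lemma dual_transport: "dual_module A (tr M) = push ` dual_module A M"
proof (intro equalityI subsetI)
  fix f assume f: "f \<in> dual_module A (tr M)"
  have "(\<lambda>x. f (\<theta> x)) \<in> dual_module A M"
    using f bimod_hom_compose[OF transport_hom(1), of M _ f]
    by (auto simp: dual_module_def inj_image_mem_iff[OF inj])
  moreover have "push (\<lambda>x. f (\<theta> x)) = f"
    by (rule push_pull) (use f in \<open>auto simp: dual_module_def\<close>)
  ultimately show "f \<in> push ` dual_module A M"
    by (metis imageI)
next
  fix f assume "f \<in> push ` dual_module A M"
  then obtain g where g: "g \<in> dual_module A M" "f = push g" by blast
  have "bimod_hom (tr M) (outer_bimodule A) (push g)"
    using g(1) bimod_homD[of M "outer_bimodule A" g]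
    by (intro bimod_homI) (auto simp: dual_module_def additive_on_def simp flip: add)
  then show "f \<in> dual_module A (tr M)"
    using g by (auto simp: dual_module_def push_def)
qed

lemma push_zero: "push (0 :: 'm \<Rightarrow> 'v::zero) = 0"
  and push_eq_0: "push (f :: 'm \<Rightarrow> 'v::zero) = 0 \<longleftrightarrow> f = 0"
proof -
  show "push (0 :: 'm \<Rightarrow> 'v::zero) = 0"
    by (simp add: push_def fun_eq_iff)
  show "push f = 0 \<longleftrightarrow> f = 0"
  proof
    assume "push f = 0"
    then have "push f (\<theta> x) = 0" for x by simp
    then show "f = 0" by (simp add: fun_eq_iff)
  qed (simp add: push_def fun_eq_iff)
qed

lemma codifferential_transport:
  "codifferential (\<lambda>n. tr (P n)) (\<lambda>n y. \<theta> (\<delta> n (inv \<theta> y))) n (push f) = push (codifferential P \<delta> n f)"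
  by (auto simp: codifferential_def fun_eq_iff push_def)

lemma cocycles_transport:
  "cocycles A (\<lambda>n. tr (P n)) (\<lambda>n y. \<theta> (\<delta> n (inv \<theta> y))) n = push ` cocycles A P \<delta> n"
  by (auto simp: cocycles_def dual_transport codifferential_transport push_eq_0)

lemma coboundaries_transport:
  "coboundaries A (\<lambda>n. tr (P n)) (\<lambda>n y. \<theta> (\<delta> n (inv \<theta> y))) n = push ` coboundaries A P \<delta> n"
proof (cases n)
  case 0
  then show ?thesis by (simp add: coboundaries_def push_zero)
next
  case (Suc m)
  then show ?thesis
    by (simp add: coboundaries_def dual_transport image_image codifferential_transport)
qed

lemma transport_ext_iso:
  assumes \<phi>: "ext_iso A P \<delta> n \<phi>"
  shows "ext_iso A (\<lambda>n. tr (P n)) (\<lambda>n y. \<theta> (\<delta> n (inv \<theta> y))) n (\<lambda>f. \<phi> (\<lambda>x. f (\<theta> x)))"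
proof (rule ext_isoI)
  note \<phi>D = \<phi>[unfolded ext_iso_def]
  fix f a assume "f \<in> cocycles A (\<lambda>n. tr (P n)) (\<lambda>n y. \<theta> (\<delta> n (inv \<theta> y))) n"
  then obtain f' where f': "f' \<in> cocycles A P \<delta> n" "f = push f'"
    by (auto simp: cocycles_transport)
  show "\<phi> (\<lambda>x. lact (inner_bimodule A) a (f (\<theta> x))) = a \<cdot>\<^bsub>A\<^esub> \<phi> (\<lambda>x. f (\<theta> x))"
    "\<phi> (\<lambda>x. ract (inner_bimodule A) (f (\<theta> x)) a) = \<phi> (\<lambda>x. f (\<theta> x)) \<cdot>\<^bsub>A\<^esub> a"
    using ext_iso_inner[OF \<phi> f'(1)] by (simp_all add: f'(2) del: inner_simps)
  fix g assume "g \<in> cocycles A (\<lambda>n. tr (P n)) (\<lambda>n y. \<theta> (\<delta> n (inv \<theta> y))) n"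
  then obtain g' where g': "g' \<in> cocycles A P \<delta> n" "g = push g'"
    by (auto simp: cocycles_transport)
  have "(\<lambda>x. (f + g) (\<theta> x)) = f' + g'"
    by (simp add: fun_eq_iff f' g')
  then show "\<phi> (\<lambda>x. (f + g) (\<theta> x)) = \<phi> (\<lambda>x. f (\<theta> x)) + \<phi> (\<lambda>x. g (\<theta> x))"
    using \<phi>D f' g' by simp
next
  note \<phi>D = \<phi>[unfolded ext_iso_def]
  show "(\<lambda>f. \<phi> (\<lambda>x. f (\<theta> x))) ` cocycles A (\<lambda>n. tr (P n)) (\<lambda>n y. \<theta> (\<delta> n (inv \<theta> y))) n = UNIV"
    using \<phi>D by (simp add: cocycles_transport image_image)
  have "{f \<in> push ` cocycles A P \<delta> n. \<phi> (\<lambda>x. f (\<theta> x)) = 0} = push ` {f \<in> cocycles A P \<delta> n. \<phi> f = 0}"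
    by auto
  then show "{f \<in> cocycles A (\<lambda>n. tr (P n)) (\<lambda>n y. \<theta> (\<delta> n (inv \<theta> y))) n. \<phi> (\<lambda>x. f (\<theta> x)) = 0} =
      coboundaries A (\<lambda>n. tr (P n)) (\<lambda>n y. \<theta> (\<delta> n (inv \<theta> y))) n"
    using \<phi>D by (simp add: cocycles_transport coboundaries_transport)
qed

lemma transport_resolution:
  assumes res: "bimodule_resolution A P \<delta> \<epsilon>"
  shows "bimodule_resolution A (\<lambda>n. tr (P n)) (\<lambda>n y. \<theta> (\<delta> n (inv \<theta> y))) (\<lambda>y. \<epsilon> (inv \<theta> y))"
proof -
  note R = resolutionD[OF res]
  show ?thesis
    unfolding bimodule_resolution_def exact_over_def
  proof (intro conjI allI)
    fix n
    show "projective_bimodule A (tr (P n))" by (rule transport_projective[OF R(1)])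
    show "fin_gen_bimodule (tr (P n))" by (rule transport_fin_gen[OF R(2,3)])
    show "bimod_hom (tr (P (Suc n))) (tr (P n)) (\<lambda>y. \<theta> (\<delta> n (inv \<theta> y)))"
      by (rule bimod_hom_compose[OF bimod_hom_compose[OF transport_hom(2) R(4)] transport_hom(1)])
    show "bimod_hom (tr (P 0)) (regular_bimodule A) (\<lambda>y. \<epsilon> (inv \<theta> y))"
      by (rule bimod_hom_compose[OF transport_hom(2) R(5)])
    show "(\<lambda>y. \<epsilon> (inv \<theta> y)) ` carrier (tr (P 0)) = UNIV"
      using R(6) by (simp add: image_image)
    have im: "(\<lambda>y. \<theta> (\<delta> n (inv \<theta> y))) ` carrier (tr (P (Suc n))) = \<theta> ` cycles P \<delta> \<epsilon> n" for n
      using R(7)[of n] by (simp add: image_image flip: R(7))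
    have z: "\<theta> x = 0 \<longleftrightarrow> x = 0" for x
      using \<theta>_eq[of x 0] by simp
    show "(\<lambda>y. \<theta> (\<delta> 0 (inv \<theta> y))) ` carrier (tr (P 1)) = {y \<in> carrier (tr (P 0)). \<epsilon> (inv \<theta> y) = 0}"
      using im[of 0] by (auto simp: cycles_def)
    show "(\<lambda>y. \<theta> (\<delta> (Suc n) (inv \<theta> y))) ` carrier (tr (P (Suc (Suc n)))) =
        {y \<in> carrier (tr (P (Suc n))). \<theta> (\<delta> n (inv \<theta> y)) = 0}"
      unfolding im by (auto simp: cycles_def z)
  qed
qed

lemma transport_graded_resolution:
  assumes gres: "graded_bimodule_resolution A D P gr \<delta> \<epsilon>"
  shows "graded_bimodule_resolution A D (\<lambda>n. tr (P n)) (\<lambda>n i. \<theta> ` gr n i)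
    (\<lambda>n y. \<theta> (\<delta> n (inv \<theta> y))) (\<lambda>y. \<epsilon> (inv \<theta> y))"
proof -
  have res: "bimodule_resolution A P \<delta> \<epsilon>" and gr: "\<And>n. graded_bimodule A D (P n) (gr n)"
    and \<delta>gr: "\<And>n i. \<delta> n ` gr (Suc n) i \<subseteq> gr n i" and \<epsilon>gr: "\<And>i. \<epsilon> ` gr 0 i \<subseteq> D i"
    using gres by (auto simp: graded_bimodule_resolution_def)
  show ?thesis
    unfolding graded_bimodule_resolution_def
  proof (intro conjI allI)
    show "graded_bimodule A D (tr (P n)) (\<lambda>i. \<theta> ` gr n i)" for n
      using graded_bimoduleD[OF gr[of n]]
      by (intro graded_bimoduleI transport_bimodule) (auto simp: transport_direct_sum)
    show "(\<lambda>y. \<theta> (\<delta> n (inv \<theta> y))) ` \<theta> ` gr (Suc n) i \<subseteq> \<theta> ` gr n i" for n i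
      using \<delta>gr[of n i] by (auto simp: image_image)
    show "(\<lambda>y. \<epsilon> (inv \<theta> y)) ` \<theta> ` gr 0 i \<subseteq> D i" for i
      using \<epsilon>gr[of i] by (auto simp: image_image)
  qed (rule transport_resolution[OF res])
qed

end

text \<open>Both types consist of families of functionals. A pair of a group element and a number is
  coded by one number, and a functional on forms over \<open>R\<close> becomes one on forms over
  \<open>S\<close> by restricting forms to constant functions.\<close>

lemma additive_injection_exists:
  fixes R :: "('k::field, 'r::ab_group_add) alg"
  obtains \<theta> :: "('g::finite \<Rightarrow> nat \<Rightarrow> ('k, 'r) tens) \<Rightarrow> nat \<Rightarrow> ('k, 'g \<Rightarrow> 'r) tens"
  where "inj \<theta>" "\<And>x y. \<theta> (x + y) = \<theta> x + \<theta> y"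
proof -
  have "countable (UNIV :: ('g \<times> nat) set)"
    using countable_SIGMA[of "UNIV :: 'g set" "\<lambda>_. UNIV :: nat set"] by (simp add: countable_finite)
  then have "range (from_nat_into (UNIV :: ('g \<times> nat) set)) = UNIV"
    by (intro range_from_nat_into) simp_all
  then obtain dec :: "nat \<Rightarrow> 'g \<times> nat" where dec: "range dec = UNIV"
    by (rule that)
  define \<theta> :: "('g \<Rightarrow> nat \<Rightarrow> ('k, 'r) tens) \<Rightarrow> nat \<Rightarrow> ('k, 'g \<Rightarrow> 'r) tens" where
    "\<theta> F m \<beta> = F (fst (dec m)) (snd (dec m)) (\<lambda>x y. \<beta> (\<lambda>_. x) (\<lambda>_. y))" for F m \<beta>
  have "F g n \<beta> = F' g n \<beta>" if eq: "\<theta> F = \<theta> F'" for F F' g n \<beta>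
  proof -
    obtain m where m: "dec m = (g, n)"
      using dec by (metis UNIV_I imageE)
    \<comment> \<open>Every form over \<open>R\<close> is the restriction of some form over
      \<open>S\<close>: precompose it with evaluation at a fixed index.\<close>
    have "\<theta> F m (\<lambda>s t. \<beta> (s undefined) (t undefined)) = \<theta> F' m (\<lambda>s t. \<beta> (s undefined) (t undefined))"
      using eq by simp
    then show ?thesis by (simp add: \<theta>_def m)
  qed
  then have "inj \<theta>"
    by (auto simp: inj_def fun_eq_iff)
  moreover have "\<theta> (x + y) = \<theta> x + \<theta> y" for x y
    by (simp add: fun_eq_iff \<theta>_def)
  ultimately show ?thesis
    by (rule that)
qed

text \<open>Two resolutions of \<open>S\<close> are used. The smash product of the truncated
  resolution witnesses smoothness; cohomology is computed with the smash product of the given one,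
  for which \<open>\<phi>\<close> and its behaviour on degrees are known.\<close>

lemma (in smash_loc) calabi_yau_smash:
  assumes cy: "calabi_yau_G p R D"
  shows "calabi_yau p S (smash_grading D)"
proof -
  obtain P :: "nat \<Rightarrow> ('r, nat \<Rightarrow> ('k, 'r) tens) bimod" and gr \<delta> \<epsilon> l \<phi> where
    gres: "graded_bimodule_resolution R D P gr \<delta> \<epsilon>"
    and vanish: "\<forall>i. i \<noteq> p \<longrightarrow> cocycles R P \<delta> i = coboundaries R P \<delta> i"
    and \<phi>: "ext_iso R P \<delta> p \<phi>"
    and \<phi>N': "\<forall>f\<in>cocycles R P \<delta> p. \<forall>m. has_degree R (N_part D) (N_part (gr p)) f m \<longrightarrow> \<phi> f \<in> shifted (N_part D) l m"
    and \<phi>G': "\<forall>f\<in>cocycles R P \<delta> p. \<forall>g. has_G_degree R (G_part D) (G_part (gr p)) f g \<longrightarrow> \<phi> f \<in> G_part D g"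
    using cy unfolding calabi_yau_G_def by (elim conjE exE)
  have \<phi>N: "\<phi> f \<in> shifted (N_part D) l m"
    if "f \<in> cocycles R P \<delta> p" "has_degree R (N_part D) (N_part (gr p)) f m" for f m
    using \<phi>N' that by blast
  have \<phi>G: "\<phi> f \<in> G_part D g"
    if "f \<in> cocycles R P \<delta> p" "has_G_degree R (G_part D) (G_part (gr p)) f g" for f g
    using \<phi>G' that by blast
  obtain P' :: "nat \<Rightarrow> ('r, nat \<Rightarrow> ('k, 'r) tens) bimod" and \<delta>' \<epsilon>' N where
    res': "bimodule_resolution R P' \<delta>' \<epsilon>'" and N': "\<forall>n>N. carrier (P' n) = {0}"
    using cy unfolding calabi_yau_G_def homologically_smooth_def by (elim conjE exE)
  have N: "\<And>n. n > N \<Longrightarrow> carrier (P' n) = {0}"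
    using N' by simp
  obtain \<theta> :: "('g \<Rightarrow> nat \<Rightarrow> ('k, 'r) tens) \<Rightarrow> nat \<Rightarrow> ('k, 'g \<Rightarrow> 'r) tens"
    where \<theta>: "inj \<theta>" "\<And>x y. \<theta> (x + y) = \<theta> x + \<theta> y"
    using additive_injection_exists[where 'g = 'g] by metis
  interpret T: transport_loc S \<theta>
    by unfold_locales (fact \<theta>)+
  have "homologically_smooth S"
  proof -
    obtain Q :: "nat \<Rightarrow> ('r, nat \<Rightarrow> ('k, 'r) tens) bimod" and gr' d N'
      where Q: "graded_bimodule_resolution R D Q gr' d \<epsilon>" and N': "\<And>n. n > N' \<Longrightarrow> carrier (Q n) = {0}"
      using graded_truncation[OF gres res' N] by metis
    interpret Q: smash_res R D Q gr' d \<epsilon>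
      by unfold_locales (rule Q)
    have "bimodule_resolution S Q.SP Q.S\<delta> Q.S\<epsilon>"
      using Q.smash_resolution by (simp add: graded_bimodule_resolution_def)
    note T.transport_resolution[OF this]
    moreover have "carrier (T.tr (Q.SP n)) = {0}" if "n > N'" for n
    proof -
      have "carrier (Q.SP n) = {0}"
        using N'[OF that] by (auto simp: smash_bimod_simps fun_eq_iff[where 'a = 'g])
      then show ?thesis by simp
    qed
    ultimately show ?thesis
      unfolding homologically_smooth_def by blast
  qed
  moreover interpret P: smash_res R D P gr \<delta> \<epsilon>
    by unfold_locales (rule gres)
  note T.transport_graded_resolution[OF P.smash_resolution]
  moreover have eq: "cocycles S P.SP P.S\<delta> i = coboundaries S P.SP P.S\<delta> i" if "i \<noteq> p" for i
    using vanish that P.cocycles_restrict[of _ i] P.coboundaries_restrict[of _ i] by blast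
  have "cocycles S (\<lambda>n. T.tr (P.SP n)) (\<lambda>n y. \<theta> (P.S\<delta> n (inv \<theta> y))) i =
      coboundaries S (\<lambda>n. T.tr (P.SP n)) (\<lambda>n y. \<theta> (P.S\<delta> n (inv \<theta> y))) i" if "i \<noteq> p" for i
    by (simp only: eq[OF that] T.cocycles_transport[of P.SP P.S\<delta> i] T.coboundaries_transport[of P.SP P.S\<delta> i])
  moreover note T.transport_ext_iso[OF P.smash_ext_iso[OF \<phi> \<phi>G]]
  moreover have "(\<lambda>a. \<phi> (P.restrict p a (\<lambda>x. f (\<theta> x)))) \<in> shifted (smash_grading D) l m"
    if f: "f \<in> cocycles S (\<lambda>n. T.tr (P.SP n)) (\<lambda>n y. \<theta> (P.S\<delta> n (inv \<theta> y))) p"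
      and deg: "has_degree S (smash_grading D) (\<lambda>i. \<theta> ` smash_grading (gr p) i) f m" for f m
  proof (rule P.smash_shifted)
    fix a
    obtain f' where f': "f' \<in> cocycles S P.SP P.S\<delta> p" "f = T.push f'"
      using f unfolding T.cocycles_transport[of P.SP P.S\<delta> p] by blast
    have "has_degree S (smash_grading D) (smash_grading (gr p)) f' m"
      using deg by (simp add: has_degree_def f'(2) image_image)
    from \<phi>N[OF P.restrict_cocycle[OF \<phi> \<phi>G f'(1)] P.restrict_degree[OF this]]
    show "\<phi> (P.restrict p a (\<lambda>x. f (\<theta> x))) \<in> shifted (N_part D) l m"
      by (simp add: f'(2))
  qed
  ultimately show ?thesis
    unfolding calabi_yau_def using graded_smash by blast
qed

section \<open>Induced left modules\<close>

text \<open>\<open>induced_lmod\<close> is \<open>S \<otimes>\<^sub>R M\<close>; no grading on \<open>M\<close> is needed.\<close>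

definition induced_lmod ::
    "(nat \<times> 'g::{finite, group_add} \<Rightarrow> 'r::ab_group_add set) \<Rightarrow> ('r, 'x \<Rightarrow> 'r) lmod \<Rightarrow> ('g \<Rightarrow> 'r, 'x \<Rightarrow> 'g \<Rightarrow> 'r) lmod" where
  "induced_lmod D M =
     \<lparr>carrier = {q. \<forall>h. (\<lambda>n. q n h) \<in> carrier M},
      lact = (\<lambda>s q n h. (\<Sum>g\<in>UNIV. lact M (component (G_part D) (h - g) (s g)) (\<lambda>n. q n g)) n)\<rparr>"

locale ind_loc = smash_loc R D
  for R :: "('k::field, 'r::ab_group_add) alg"
    and D :: "nat \<times> 'g::{finite, group_add} \<Rightarrow> 'r set" +
  fixes M :: "('r, 'x \<Rightarrow> 'r) lmod"
  assumes lM: "left_module R M"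
begin

abbreviation I where "I \<equiv> induced_lmod D M"

text \<open>The slice \<open>\<lambda>n. q n h\<close> is the coefficient m_h when an element is
  written as the sum of p_h \<otimes> m_h. Since r p_g is the sum over h of p_h r_(h-g), a scalar
  acts through its components of degree h - g.\<close>

lemma I_simps:
  "q \<in> carrier I \<longleftrightarrow> (\<forall>h. (\<lambda>n. q n h) \<in> carrier M)"
  "(\<lambda>n. lact I s q n h) = (\<Sum>g\<in>UNIV. lact M (pr (h - g) (s g)) (\<lambda>n. q n g))"
  by (simp_all add: induced_lmod_def pr_def)

lemma curry_ext: "(\<And>h. (\<lambda>n. q n h) = (\<lambda>n. q' n h)) \<Longrightarrow> q = q'" for q q' :: "'x \<Rightarrow> 'g \<Rightarrow> 'r"
  by (simp add: fun_eq_iff)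

lemma subI: "add_subgroup (carrier I)"
  unfolding add_subgroup_def
proof (intro conjI ballI)
  have "(\<lambda>n. (0 :: 'x \<Rightarrow> 'g \<Rightarrow> 'r) n h) = 0" for h
    by (simp add: fun_eq_iff)
  then show "0 \<in> carrier I"
    using add_subgroup_zero[OF lmod_subgroup[OF lM]] by (simp only: I_simps(1)) simp
  fix q q' assume q: "q \<in> carrier I" "q' \<in> carrier I"
  have "(\<lambda>n. (q - q') n h) = (\<lambda>n. q n h) - (\<lambda>n. q' n h)" for h
    by (simp add: fun_eq_iff)
  then show "q - q' \<in> carrier I"
    using q add_subgroup_diff[OF lmod_subgroup[OF lM]] by (simp only: I_simps(1)) blast
qed

lemma split_pr: "pr (h - g) (r \<cdot>\<^bsub>R\<^esub> pr (g' - g) x) = pr (h - g') r \<cdot>\<^bsub>R\<^esub> pr (g' - g) x"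
  by (simp add: pr_mult_pr diff_diff_eq2 diff_add_eq)

lemma left_module_I: "left_module S I"
proof (rule left_moduleI[OF subI])
  fix q s t assume "q \<in> carrier I"
  then have q: "(\<lambda>n. q n h) \<in> carrier M" for h by (simp add: I_simps)
  show "lact I s q \<in> carrier I"
    using q by (auto simp: I_simps intro!: add_subgroup_sum[OF lmod_subgroup[OF lM]] lact_closed[OF lM])
  show "lact I (s \<cdot>\<^bsub>S\<^esub> t) q = lact I s (lact I t q)"
  proof (rule curry_ext)
    fix h
    have "(\<lambda>n. lact I (s \<cdot>\<^bsub>S\<^esub> t) q n h) =
        (\<Sum>g\<in>UNIV. \<Sum>g'\<in>UNIV. lact M (pr (h - g') (s g')) (lact M (pr (g' - g) (t g)) (\<lambda>n. q n g)))"
      using q by (simp add: I_simps smash_mult_apply pr_sum split_pr lact_sum_left[OF lM] lact_mult[OF lM])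
    also have "\<dots> = (\<lambda>n. lact I s (lact I t q) n h)"
      using q by (subst sum.swap) (simp add: I_simps lact_sum[OF lM] lact_closed[OF lM])
    finally show "(\<lambda>n. lact I (s \<cdot>\<^bsub>S\<^esub> t) q n h) = (\<lambda>n. lact I s (lact I t q) n h)" .
  qed
  show "lact I (alg_one S) q = q"
  proof (rule curry_ext)
    fix h
    have "(\<lambda>n. lact I (alg_one S) q n h) = (\<Sum>g\<in>UNIV. if g = h then (\<lambda>n. q n g) else 0)"
      unfolding I_simps using q
      by (intro sum.cong refl) (simp only: smash_simps pr_one right_minus_eq if_distrib[of "\<lambda>r. lact M r _"]
          lact_one[OF lM] lact_zero_left[OF lM] eq_commute[of h] cong: if_cong)
    then show "(\<lambda>n. lact I (alg_one S) q n h) = (\<lambda>n. q n h)"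
      by (simp only: sum.delta finite UNIV_I if_True)
  qed
  show "additive_on UNIV (\<lambda>s. lact I s q)"
    unfolding additive_on_def
  proof (intro ballI, rule curry_ext)
    fix s t :: "'g \<Rightarrow> 'r" and h
    have "(\<lambda>n. lact I (s + t) q n h) = (\<lambda>n. lact I s q n h) + (\<lambda>n. lact I t q n h)"
      unfolding I_simps using q by (simp add: pr_add lact_add_left[OF lM] sum.distrib)
    then show "(\<lambda>n. lact I (s + t) q n h) = (\<lambda>n. (lact I s q + lact I t q) n h)"
      by (simp add: fun_eq_iff)
  qed
next
  show "additive_on (carrier I) (lact I s)" for s
    unfolding additive_on_def
  proof (intro ballI, rule curry_ext)
    fix q q' :: "'x \<Rightarrow> 'g \<Rightarrow> 'r" and h assume "q \<in> carrier I" "q' \<in> carrier I"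
    then have q: "(\<lambda>n. q n h) \<in> carrier M" "(\<lambda>n. q' n h) \<in> carrier M" for h by (simp_all add: I_simps)
    have e: "(\<lambda>n. (q + q') n g) = (\<lambda>n. q n g) + (\<lambda>n. q' n g)" for g
      by (simp add: fun_eq_iff)
    have "(\<lambda>n. lact I s (q + q') n h) = (\<lambda>n. lact I s q n h) + (\<lambda>n. lact I s q' n h)"
      unfolding I_simps e using q by (simp add: lact_add[OF lM] sum.distrib)
    then show "(\<lambda>n. lact I s (q + q') n h) = (\<lambda>n. (lact I s q + lact I s q') n h)"
      by (simp add: fun_eq_iff)
  qed
qed

text \<open>Swapping the two arguments identifies the carrier with the functions from the group to
  \<open>carrier M\<close>, for which the decomposition is already known.\<close>

lemma induced_direct_sum:
  assumes gr: "direct_sum (carrier M) gr"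
  shows "direct_sum (carrier I) (\<lambda>i. {q. \<forall>h. (\<lambda>n. q n h) \<in> gr i})"
proof -
  let ?fl = "\<lambda>(q :: 'g \<Rightarrow> 'x \<Rightarrow> 'r) n h. q h n"
  interpret F: transport_loc R ?fl
    by unfold_locales (auto simp: inj_def fun_eq_iff)
  have im: "?fl ` {q. \<forall>h. q h \<in> V} = {q. \<forall>h. (\<lambda>n. q n h) \<in> V}" for V
  proof (intro equalityI subsetI)
    fix q :: "'x \<Rightarrow> 'g \<Rightarrow> 'r" assume "q \<in> {q. \<forall>h. (\<lambda>n. q n h) \<in> V}"
    then show "q \<in> ?fl ` {q. \<forall>h. q h \<in> V}"
      by (intro image_eqI[of _ _ "\<lambda>h n. q n h"]) auto
  qed auto
  have "carrier I = {q. \<forall>h. (\<lambda>n. q n h) \<in> carrier M}"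
    by (auto simp: I_simps)
  then show ?thesis
    using F.transport_direct_sum[OF direct_sum_fun(1)[OF gr]] unfolding im by simp
qed

lemma induced_graded:
  assumes gr: "graded_left_module R (N_part D) M gr"
  shows "graded_left_module S (smash_grading D) I (\<lambda>i. {q. \<forall>h. (\<lambda>n. q n h) \<in> gr i})"
  unfolding graded_left_module_def
proof (intro conjI allI ballI left_module_I)
  have dsM: "direct_sum (carrier M) gr"
    and act: "a \<in> N_part D i \<Longrightarrow> x \<in> gr j \<Longrightarrow> lact M a x \<in> gr (i + j)" for a x i j
    using gr by (auto simp: graded_left_module_def)
  show "direct_sum (carrier I) (\<lambda>i. {q. \<forall>h. (\<lambda>n. q n h) \<in> gr i})"
    by (rule induced_direct_sum[OF dsM])
  fix i j s and q :: "'x \<Rightarrow> 'g \<Rightarrow> 'r" assume "s \<in> smash_grading D i" "q \<in> {q. \<forall>h. (\<lambda>n. q n h) \<in> gr j}"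
  then show "lact I s q \<in> {q. \<forall>h. (\<lambda>n. q n h) \<in> gr (i + j)}"
    by (auto simp: I_simps smash_grading_def
        intro!: add_subgroup_sum[OF direct_sum_add_subgroup[OF dsM]] act pr_N_part)
qed

text \<open>The element p_h \<otimes> y of the induced module.\<close>

definition ipt :: "'g \<Rightarrow> ('x \<Rightarrow> 'r) \<Rightarrow> 'x \<Rightarrow> 'g \<Rightarrow> 'r" where
  "ipt h y = (\<lambda>n g. if g = h then y n else 0)"

lemma ipt_curry: "(\<lambda>n. ipt h y n g) = (if g = h then y else 0)"
  by (auto simp: ipt_def fun_eq_iff)

text \<open>For r of degree u one has r p_(-u+h) = p_h r, so this scalar takes p_(-u+h) \<otimes> x
  to p_h \<otimes> r x.\<close>

lemma ipt_act:
  assumes x: "x \<in> carrier M"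
  shows "lact I (pt (- u + h) (pr u r)) (ipt (- u + h) x) = ipt h (lact M (pr u r) x)"
proof (rule curry_ext)
  fix h'
  let ?g = "- u + h"
  have "(\<lambda>n. lact I (pt ?g (pr u r)) (ipt ?g x) n h') =
      (\<Sum>g\<in>UNIV. if g = ?g then lact M (pr (h' - g) (pr u r)) x else 0)"
    unfolding I_simps ipt_curry using x
    by (intro sum.cong refl) (simp add: pt_apply lact_zero[OF lM])
  also have "\<dots> = lact M (pr (h' - ?g) (pr u r)) x"
    by (simp only: sum.delta finite UNIV_I if_True)
  also have "\<dots> = (if h' = h then lact M (pr u r) x else 0)"
  proof -
    have "h' - ?g = u \<longleftrightarrow> h' = h"
      by (metis add_minus_cancel diff_add_cancel diff_eq_eq)
    then show ?thesis
      using x by (simp add: pr_pr lact_zero_left[OF lM])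
  qed
  finally show "(\<lambda>n. lact I (pt ?g (pr u r)) (ipt ?g x) n h') = (\<lambda>n. ipt h (lact M (pr u r) x) n h')"
    by (simp only: ipt_curry)
qed

text \<open>An element p_h \<otimes> a x splits along the components of a; the part of degree u is
  reached from the generator p_(-u+h) \<otimes> x.\<close>

lemma induced_generated:
  assumes gen: "generated_in M X" and X: "add_subgroup X" "X \<subseteq> carrier M"
  shows "generated_in I {q. \<forall>h. (\<lambda>n. q n h) \<in> X}"
proof -
  let ?X = "{q. \<forall>h. (\<lambda>n. q n h) \<in> X}"
  let ?H = "add_subgroup hull {lact I a x |a x. x \<in> ?X}"
  have genM: "carrier M = add_subgroup hull {lact M a x |a x. x \<in> X}"
    using gen by (simp add: generated_in_def)
  have ia: "additive_on H (ipt h)" for H h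
    by (auto simp: additive_on_def ipt_def fun_eq_iff)
  have ipt: "ipt h y \<in> ?H" if "y \<in> carrier M" for h y
  proof (rule additive_on_hull_mem[where f = "ipt h", OF ia add_subgroup_hull _ that[unfolded genM]])
    fix y assume "y \<in> {lact M a x |a x. x \<in> X}"
    then obtain a x where y: "y = lact M a x" and x: "x \<in> X" by blast
    then have xM: "x \<in> carrier M" using X by blast
    have "y = (\<Sum>u\<in>UNIV. lact M (pr u a) x)"
      using xM by (simp add: y lact_sum_left[OF lM, symmetric])
    then have "ipt h y = (\<Sum>u\<in>UNIV. ipt h (lact M (pr u a) x))"
      using additive_on_sum[OF add_subgroup_UNIV ia, of UNIV "\<lambda>u. lact M (pr u a) x" h] by simp
    also have "\<dots> \<in> ?H"
    proof (rule add_subgroup_sum[OF add_subgroup_hull])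
      fix u
      have "ipt (- u + h) x \<in> ?X"
        using x add_subgroup_zero[OF X(1)] by (simp add: ipt_curry)
      then show "ipt h (lact M (pr u a) x) \<in> ?H"
        unfolding ipt_act[OF xM, symmetric] by (intro hull_inc) blast
    qed
    finally show "ipt h y \<in> ?H" .
  qed
  have "carrier I = ?H"
  proof
    show "carrier I \<subseteq> ?H"
    proof
      fix q assume q: "q \<in> carrier I"
      have "q = (\<Sum>h\<in>UNIV. ipt h (\<lambda>n. q n h))"
        by (simp add: fun_eq_iff sum_fun ipt_def)
      also have "\<dots> \<in> ?H"
        using q by (intro add_subgroup_sum[OF add_subgroup_hull] ipt) (simp add: I_simps)
      finally show "q \<in> ?H" .
    qed
    have "?X \<subseteq> carrier I"
      using X(2) by (simp add: I_simps(1) subset_iff)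
    then show "?H \<subseteq> carrier I"
      by (intro hull_minimal subI) (auto intro: lact_closed[OF left_module_I])
  qed
  then show ?thesis by (simp add: generated_in_def)
qed

end

section \<open>Coefficients on the left and induced free modules\<close>

context smash_loc
begin

text \<open>\<open>sig s h\<close> is the coefficient of \<open>p\<^sub>h\<close> when \<open>s\<close> is written with the factors from \<open>kG\<^sup>*\<close> on the left.\<close>

definition sig :: "('g \<Rightarrow> 'r) \<Rightarrow> 'g \<Rightarrow> 'r" where
  "sig s h = (\<Sum>g\<in>UNIV. pr (h - g) (s g))"

text \<open>Back to coefficients on the right: an element r of degree h - g satisfies p_h r = r
  p_g.\<close>

definition sig_inv :: "('g \<Rightarrow> 'r) \<Rightarrow> 'g \<Rightarrow> 'r" where
  "sig_inv t g = (\<Sum>h\<in>UNIV. pr (h - g) (t h))"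

lemma sig_inv_sig: "sig_inv (sig s) = s" and sig_sig_inv: "sig (sig_inv t) = t"
proof -
  have "(\<Sum>h\<in>UNIV. pr (h - g) (\<Sum>g'\<in>UNIV. pr (h - g') (s g'))) = s g" for g
    using sum_shift(1)[of "\<lambda>h. pr h (s g)" g] by (simp add: pr_sum pr_pr)
  then show "sig_inv (sig s) = s"
    by (simp add: fun_eq_iff sig_def sig_inv_def)
  have "(\<Sum>g\<in>UNIV. pr (h - g) (\<Sum>h'\<in>UNIV. pr (h' - g) (t h'))) = t h" for h
    using sum_shift(2)[of "\<lambda>g. pr g (t h)" h] by (simp add: pr_sum pr_pr)
  then show "sig (sig_inv t) = t"
    by (simp add: fun_eq_iff sig_def sig_inv_def)
qed

lemma sig_add: "sig (s + t) h = sig s h + sig t h"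
  and sig_inv_add: "sig_inv (s + t) = sig_inv s + sig_inv t"
  and sig_zero: "sig 0 h = 0" and sig_inv_zero: "sig_inv 0 = 0"
  by (simp_all add: sig_def sig_inv_def fun_eq_iff pr_add sum.distrib)

text \<open>With coefficients written on the right of the idempotents, left multiplication in
  \<open>S\<close> takes the form of the action on an induced module: \<open>S\<close> is induced
  from \<open>R\<close>.\<close>

lemma sig_mult: "sig (s \<cdot>\<^bsub>S\<^esub> t) h = (\<Sum>g\<in>UNIV. pr (h - g) (s g) \<cdot>\<^bsub>R\<^esub> sig t g)"
proof -
  have "sig (s \<cdot>\<^bsub>S\<^esub> t) h = (\<Sum>g'\<in>UNIV. \<Sum>g\<in>UNIV. pr (h - g) (s g) \<cdot>\<^bsub>R\<^esub> pr (g - g') (t g'))"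
    by (simp add: sig_def smash_mult_apply pr_sum pr_mult_pr diff_diff_eq2 diff_add_eq)
  also have "\<dots> = (\<Sum>g\<in>UNIV. \<Sum>g'\<in>UNIV. pr (h - g) (s g) \<cdot>\<^bsub>R\<^esub> pr (g - g') (t g'))"
    by (rule sum.swap)
  finally show ?thesis
    by (simp add: sig_def mult_sum)
qed

lemma sig_inv_mult: "sig_inv (\<lambda>h. \<Sum>g\<in>UNIV. pr (h - g) (s g) \<cdot>\<^bsub>R\<^esub> t g) = s \<cdot>\<^bsub>S\<^esub> sig_inv t"
proof -
  have "sig (s \<cdot>\<^bsub>S\<^esub> sig_inv t) = (\<lambda>h. \<Sum>g\<in>UNIV. pr (h - g) (s g) \<cdot>\<^bsub>R\<^esub> t g)"
    by (simp add: fun_eq_iff sig_mult sig_sig_inv)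
  then show ?thesis
    using sig_inv_sig by metis
qed

end

context ind_loc
begin

lemma induced_hom:
  assumes N: "left_module R N" and f: "lmod_hom M N f"
  shows "lmod_hom I (induced_lmod D N) (\<lambda>q n h. f (\<lambda>n. q n h) n)"
proof -
  interpret N: ind_loc R D N
    by unfold_locales (rule N)
  note F = lmod_homD[OF f]
  have "(\<lambda>q n h. f (\<lambda>n. q n h) n) (lact I s q) = lact N.I s ((\<lambda>q n h. f (\<lambda>n. q n h) n) q)"
    if "q \<in> carrier I" for s q
  proof (rule N.curry_ext)
    fix h
    have q: "(\<lambda>n. q n h) \<in> carrier M" for h using that by (simp add: I_simps)
    show "(\<lambda>n. f (\<lambda>n. lact I s q n h) n) = (\<lambda>n. lact N.I s (\<lambda>n h. f (\<lambda>n. q n h) n) n h)"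
      unfolding I_simps N.I_simps
      using q by (simp add: additive_on_sum[OF lmod_subgroup[OF lM] F(2)] lact_closed[OF lM] F(3))
  qed
  moreover have "f (\<lambda>n. (q + q') n h) = f (\<lambda>n. q n h) + f (\<lambda>n. q' n h)"
    if "q \<in> carrier I" "q' \<in> carrier I" for q q' h
  proof -
    have "(\<lambda>n. (q + q') n h) = (\<lambda>n. q n h) + (\<lambda>n. q' n h)" by (simp add: fun_eq_iff)
    then show ?thesis
      using that F(2) by (simp only: additive_on_def I_simps(1))
  qed
  ultimately show ?thesis
    using F(1) by (auto simp: lmod_hom_def I_simps(1) N.I_simps(1) fun_eq_iff)
qed

text \<open>In each coordinate \<open>sig\<close> identifies \<open>S\<close> with the module
  induced from \<open>R\<close>, so inducing a free module gives a free module on the same basis,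
  and a split embedding of \<open>M\<close> into a free module induces one of
  \<open>I\<close>.\<close>

lemma induced_projective:
  assumes P: "projective_left_module R M"
  shows "projective_left_module S I"
proof -
  obtain X :: "('x \<Rightarrow> 'r) set" and \<iota> \<pi> where \<iota>: "lmod_hom M (free_left_module R X) \<iota>"
    and \<pi>: "lmod_hom (free_left_module R X) M \<pi>" and \<pi>\<iota>: "\<And>x. x \<in> carrier M \<Longrightarrow> \<pi> (\<iota> x) = x"
    using P unfolding projective_left_module_def by blast
  note \<iota>D = lmod_homD[OF \<iota>] and \<pi>D = lmod_homD[OF \<pi>]
  \<comment> \<open>The basis has to lie in the type of \<open>I\<close>. Functions constant in the
    group embed \<open>X\<close> there, and \<open>ux\<close> reads such a function back at an
    arbitrary index.\<close>
  define cx :: "('x \<Rightarrow> 'r) \<Rightarrow> 'x \<Rightarrow> 'g \<Rightarrow> 'r" where "cx x = (\<lambda>n _. x n)" for x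
  define ux :: "('x \<Rightarrow> 'g \<Rightarrow> 'r) \<Rightarrow> 'x \<Rightarrow> 'r" where "ux z = (\<lambda>n. z n undefined)" for z
  have ucx: "ux (cx x) = x" for x by (simp add: ux_def cx_def)
  have free: "v \<in> carrier (free_left_module B Y) \<longleftrightarrow> finite {x. v x \<noteq> 0} \<and> {x. v x \<noteq> 0} \<subseteq> Y"
    "lact (free_left_module B Y) a v = (\<lambda>x. a \<cdot>\<^bsub>B\<^esub> v x)" for B :: "('k, 'c::ab_group_add) alg" and Y :: "'y set" and v a
    by (simp_all add: free_left_module_def)
  have \<iota>x: "\<iota> (x + y) z = \<iota> x z + \<iota> y z" if "x \<in> carrier M" "y \<in> carrier M" for x y z
    using \<iota>D(2) that by (simp add: additive_on_def)
  define J where "J q z = (if z \<in> cx ` X then sig_inv (\<lambda>g. \<iota> (\<lambda>n. q n g) (ux z)) else 0)" for q z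
  define K where "K v = (\<lambda>n h. \<pi> (\<lambda>x. sig (v (cx x)) h) n)" for v
  have w: "(\<lambda>x. sig (v (cx x)) h) \<in> carrier (free_left_module R X)"
    if "v \<in> carrier (free_left_module S (cx ` X))" for v h
  proof -
    have s: "{x. sig (v (cx x)) h \<noteq> 0} \<subseteq> ux ` {z. v z \<noteq> 0}"
    proof
      fix x assume "x \<in> {x. sig (v (cx x)) h \<noteq> 0}"
      then have "v (cx x) \<noteq> 0" using sig_zero by force
      then show "x \<in> ux ` {z. v z \<noteq> 0}"
        by (intro image_eqI[of _ _ "cx x"]) (simp_all add: ucx)
    qed
    have v: "{z. v z \<noteq> 0} \<subseteq> cx ` X" "finite {z. v z \<noteq> 0}"
      using that by (simp_all add: free)
    have "ux ` {z. v z \<noteq> 0} \<subseteq> X"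
      using image_mono[OF v(1), of ux] by (simp add: image_image ucx)
    then show ?thesis
      unfolding free using s finite_imageI[OF v(2), of ux] by (meson finite_subset subset_trans)
  qed
  have J: "lmod_hom I (free_left_module S (cx ` X)) J"
    unfolding lmod_hom_def
  proof (intro conjI ballI allI image_subsetI)
    fix q assume "q \<in> carrier I"
    then have q: "(\<lambda>n. q n h) \<in> carrier M" for h by (simp add: I_simps)
    have z: "J q z = 0" if "\<forall>g. \<iota> (\<lambda>n. q n g) (ux z) = 0" for z
      using that sig_inv_zero by (simp add: J_def zero_fun_def)
    have "{z. J q z \<noteq> 0} \<subseteq> cx ` (\<Union>g. {x. \<iota> (\<lambda>n. q n g) x \<noteq> 0})"
    proof
      fix z assume "z \<in> {z. J q z \<noteq> 0}"
      then have nz: "J q z \<noteq> 0" by simp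
      then have "z \<in> cx ` X" by (auto simp: J_def split: if_splits)
      then have "z = cx (ux z)" by (auto simp: ucx)
      moreover obtain g where "\<iota> (\<lambda>n. q n g) (ux z) \<noteq> 0"
        using nz z by blast
      ultimately show "z \<in> cx ` (\<Union>g. {x. \<iota> (\<lambda>n. q n g) x \<noteq> 0})"
        by blast
    qed
    moreover have "finite (\<Union>g. {x. \<iota> (\<lambda>n. q n g) x \<noteq> 0})"
      using \<iota>D(1)[OF q] by (simp add: free)
    ultimately have "finite {z. J q z \<noteq> 0}"
      by (meson finite_imageI finite_subset)
    then show "J q \<in> carrier (free_left_module S (cx ` X))"
      by (auto simp: free J_def split: if_splits)
    fix s
    show "J (lact I s q) = lact (free_left_module S (cx ` X)) s (J q)"
    proof
      fix z
      have "\<iota> (\<lambda>n. lact I s q n g) (ux z) = (\<Sum>h\<in>UNIV. pr (g - h) (s h) \<cdot>\<^bsub>R\<^esub> \<iota> (\<lambda>n. q n h) (ux z))" for g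
        unfolding I_simps using q
        by (simp add: additive_on_sum[OF lmod_subgroup[OF lM] \<iota>D(2)] lact_closed[OF lM] \<iota>D(3) sum_fun free)
      then show "J (lact I s q) z = lact (free_left_module S (cx ` X)) s (J q) z"
        by (simp only: J_def free sig_inv_mult sm.mult_zero split: if_split) simp
    qed
    fix q' assume "q' \<in> carrier I"
    then have q': "(\<lambda>n. q' n h) \<in> carrier M" for h by (simp add: I_simps)
    have e: "(\<lambda>n. (q + q') n g) = (\<lambda>n. q n g) + (\<lambda>n. q' n g)" for g
      by (simp add: fun_eq_iff)
    have "(\<lambda>g. \<iota> (\<lambda>n. (q + q') n g) (ux z)) = (\<lambda>g. \<iota> (\<lambda>n. q n g) (ux z)) + (\<lambda>g. \<iota> (\<lambda>n. q' n g) (ux z))" for z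
      unfolding e using q q' by (simp add: \<iota>x fun_eq_iff)
    then show "J (q + q') = J q + J q'"
      by (intro ext[of "J (q + q')"]) (simp only: J_def plus_fun_apply sig_inv_add split: if_split, simp)
  qed
  have K: "lmod_hom (free_left_module S (cx ` X)) I K"
    unfolding lmod_hom_def
  proof (intro conjI ballI allI image_subsetI)
    fix v assume v: "v \<in> carrier (free_left_module S (cx ` X))"
    show "K v \<in> carrier I"
      using \<pi>D(1)[OF w[OF v]] by (simp add: I_simps K_def)
    fix s
    have fsub: "add_subgroup (carrier (free_left_module R X))"
      unfolding add_subgroup_def
    proof (intro conjI ballI)
      fix v w assume vw: "v \<in> carrier (free_left_module R X)" "w \<in> carrier (free_left_module R X)"
      have "{x. (v - w) x \<noteq> 0} \<subseteq> {x. v x \<noteq> 0} \<union> {x. w x \<noteq> 0}" by auto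
      then show "v - w \<in> carrier (free_left_module R X)"
        using vw unfolding free by (meson Un_least finite_Un finite_subset subset_trans)
    qed (simp add: free)
    have lf: "lact (free_left_module R X) a u \<in> carrier (free_left_module R X)" if "u \<in> carrier (free_left_module R X)" for a u
    proof -
      have "{x. a \<cdot>\<^bsub>R\<^esub> u x \<noteq> 0} \<subseteq> {x. u x \<noteq> 0}" by auto
      then show ?thesis using that unfolding free by (meson finite_subset subset_trans)
    qed
    show "K (lact (free_left_module S (cx ` X)) s v) = lact I s (K v)"
    proof (rule curry_ext)
      fix h
      have e: "(\<lambda>x. sig (s \<cdot>\<^bsub>S\<^esub> v (cx x)) h) =
          (\<Sum>g\<in>UNIV. lact (free_left_module R X) (pr (h - g) (s g)) (\<lambda>x. sig (v (cx x)) g))"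
        by (simp add: fun_eq_iff sum_fun free sig_mult)
      have "\<pi> (\<lambda>x. sig (s \<cdot>\<^bsub>S\<^esub> v (cx x)) h) = (\<Sum>g\<in>UNIV. lact M (pr (h - g) (s g)) (\<pi> (\<lambda>x. sig (v (cx x)) g)))"
        unfolding e using w[OF v] by (simp add: additive_on_sum[OF fsub \<pi>D(2)] lf \<pi>D(3))
      then show "(\<lambda>n. K (lact (free_left_module S (cx ` X)) s v) n h) = (\<lambda>n. lact I s (K v) n h)"
        unfolding I_simps by (simp add: K_def free)
    qed
    fix v' assume v': "v' \<in> carrier (free_left_module S (cx ` X))"
    have "(\<lambda>x. sig ((v + v') (cx x)) h) = (\<lambda>x. sig (v (cx x)) h) + (\<lambda>x. sig (v' (cx x)) h)" for h
      unfolding plus_fun_apply sig_add by (simp add: fun_eq_iff)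
    then have "\<pi> (\<lambda>x. sig ((v + v') (cx x)) h) = \<pi> (\<lambda>x. sig (v (cx x)) h) + \<pi> (\<lambda>x. sig (v' (cx x)) h)" for h
      using \<pi>D(2) w[OF v] w[OF v'] by (simp only: additive_on_def)
    then show "K (v + v') = K v + K v'"
      unfolding K_def by (simp add: fun_eq_iff)
  qed
  have "K (J q) = q" if "q \<in> carrier I" for q
  proof (rule curry_ext)
    fix h
    have q: "(\<lambda>n. q n h) \<in> carrier M" for h using that by (simp add: I_simps)
    have "sig (J q (cx x)) h = \<iota> (\<lambda>n. q n h) x" for x
    proof (cases "x \<in> X")
      case True
      then show ?thesis by (simp add: J_def ucx sig_sig_inv)
    next
      case False
      then have "cx x \<notin> cx ` X" using ucx by (metis imageE)
      moreover have "\<iota> (\<lambda>n. q n h) x = 0"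
        using \<iota>D(1)[OF q] False by (auto simp: free)
      ultimately show ?thesis by (simp only: J_def if_False sig_zero)
    qed
    then show "(\<lambda>n. K (J q) n h) = (\<lambda>n. q n h)"
      using \<pi>\<iota>[OF q] by (simp add: K_def)
  qed
  then show ?thesis
    unfolding projective_left_module_def using left_module_I J K by blast
qed

end


section \<open>The Koszul resolution\<close>

lemma curry_image:
  "(\<lambda>q n h. f (\<lambda>n. q n h) n) ` {q. \<forall>h. (\<lambda>n. q n h) \<in> A} = {q. \<forall>h. (\<lambda>n. q n h) \<in> f ` A}"
  for f :: "('x \<Rightarrow> 'r) \<Rightarrow> 'y \<Rightarrow> 'r"
proof (intro equalityI subsetI)
  fix q :: "'y \<Rightarrow> 'h \<Rightarrow> 'r" assume "q \<in> {q. \<forall>h. (\<lambda>n. q n h) \<in> f ` A}"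
  then have "\<forall>h. \<exists>x. x \<in> A \<and> (\<lambda>n. q n h) = f x" by blast
  then obtain p where p: "\<And>h. p h \<in> A" "\<And>h. (\<lambda>n. q n h) = f (p h)" by metis
  have "q n h = f (p h) n" for n h
    using p(2)[of h] by (rule fun_cong)
  then show "q \<in> (\<lambda>q n h. f (\<lambda>n. q n h) n) ` {q. \<forall>h. (\<lambda>n. q n h) \<in> A}"
    using p(1) by (intro image_eqI[of _ _ "\<lambda>n h. p h n"]) (simp_all add: fun_eq_iff)
qed auto

context smash_loc
begin

lemma induced_carrier: "carrier (induced_lmod D M) = {q. \<forall>h. (\<lambda>n. q n h) \<in> carrier M}"
  by (simp add: induced_lmod_def)

lemma pr_component_0: "component (N_part D) 0 (pr u r) = pr u (component (N_part D) 0 r)"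
proof -
  have "pr u ` N_part D n \<subseteq> N_part D n" for n
    using pr_N_part by blast
  then show ?thesis
    by (intro component_natural[OF dN dN pr_additive _ UNIV_I, symmetric])
qed

text \<open>The terms come from the preceding section. What remains is the augmentation, taken
  coefficientwise: the module induced from k consists of the functions from the group to k, and it
  is the trivial module of \<open>S\<close> because scalars have trivial degree in the
  group.\<close>

lemma koszul_resolution:
  assumes N0: "N_part D 0 = range (\<lambda>c. alg_scale R c (alg_one R))"
    and ex: "\<exists>(P :: nat \<Rightarrow> ('r, nat \<Rightarrow> 'r) lmod) gr \<delta> \<epsilon>.
        (\<forall>n. projective_left_module R (P n) \<and> graded_left_module R (N_part D) (P n) (gr n) \<and>
             generated_in (P n) (gr n (koszul_degree d n)) \<and>
             lmod_hom (P (Suc n)) (P n) (\<delta> n) \<and>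
             (\<forall>i. \<delta> n ` gr (Suc n) i \<subseteq> gr n i)) \<and>
        lmod_hom (P 0) (trivial_module R (N_part D)) \<epsilon> \<and>
        (\<forall>i. \<epsilon> ` gr 0 i \<subseteq> (if i = 0 then N_part D 0 else {0})) \<and>
        exact_over (\<lambda>n. carrier (P n)) \<delta> \<epsilon> (N_part D 0)"
  shows "\<exists>(P :: nat \<Rightarrow> ('g \<Rightarrow> 'r, nat \<Rightarrow> 'g \<Rightarrow> 'r) lmod) gr \<delta> \<epsilon>.
        (\<forall>n. projective_left_module S (P n) \<and> graded_left_module S (smash_grading D) (P n) (gr n) \<and>
             generated_in (P n) (gr n (koszul_degree d n)) \<and>
             lmod_hom (P (Suc n)) (P n) (\<delta> n) \<and>
             (\<forall>i. \<delta> n ` gr (Suc n) i \<subseteq> gr n i)) \<and>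
        lmod_hom (P 0) (trivial_module S (smash_grading D)) \<epsilon> \<and>
        (\<forall>i. \<epsilon> ` gr 0 i \<subseteq> (if i = 0 then smash_grading D 0 else {0})) \<and>
        exact_over (\<lambda>n. carrier (P n)) \<delta> \<epsilon> (smash_grading D 0)"
proof -
  obtain P :: "nat \<Rightarrow> ('r, nat \<Rightarrow> 'r) lmod" and gr \<delta> \<epsilon> where
    P: "\<forall>n. projective_left_module R (P n) \<and> graded_left_module R (N_part D) (P n) (gr n) \<and>
             generated_in (P n) (gr n (koszul_degree d n)) \<and>
             lmod_hom (P (Suc n)) (P n) (\<delta> n) \<and>
             (\<forall>i. \<delta> n ` gr (Suc n) i \<subseteq> gr n i)"
    and \<epsilon>: "lmod_hom (P 0) (trivial_module R (N_part D)) \<epsilon>"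
    and \<epsilon>gr: "\<forall>i. \<epsilon> ` gr 0 i \<subseteq> (if i = 0 then N_part D 0 else {0})"
    and exact: "exact_over (\<lambda>n. carrier (P n)) \<delta> \<epsilon> (N_part D 0)"
    using ex by (elim exE conjE)
  have lP: "left_module R (P n)" for n
    using P by (simp add: projective_left_module_def)
  have I: "ind_loc R D (P n)" for n
    by unfold_locales (rule lP)
  have dsP: "direct_sum (carrier (P n)) (gr n)" for n
    using P by (simp add: graded_left_module_def)
  let ?P = "\<lambda>n. induced_lmod D (P n)" and ?gr = "\<lambda>n i. {q. \<forall>h::'g. (\<lambda>m. q m h) \<in> gr n i}"
  let ?\<delta> = "\<lambda>n (q :: nat \<Rightarrow> 'g \<Rightarrow> 'r) m h. \<delta> n (\<lambda>m. q m h) m" and ?\<epsilon> = "\<lambda>(q :: nat \<Rightarrow> 'g \<Rightarrow> 'r) h. \<epsilon> (\<lambda>m. q m h)"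
  show ?thesis
  proof (intro exI conjI allI)
    fix n
    show "projective_left_module S (?P n)"
      using P by (intro ind_loc.induced_projective[OF I]) blast
    show "graded_left_module S (smash_grading D) (?P n) (?gr n)"
      using P by (intro ind_loc.induced_graded[OF I]) blast
    show "generated_in (?P n) (?gr n (koszul_degree d n))"
      using P by (intro ind_loc.induced_generated[OF I] direct_sum_add_subgroup[OF dsP])
        (auto intro: direct_sum_subset[OF dsP])
    show "lmod_hom (?P (Suc n)) (?P n) (?\<delta> n)"
      using P by (intro ind_loc.induced_hom[OF I lP]) blast
    fix i
    have "\<delta> n ` gr (Suc n) i \<subseteq> gr n i" using P by blast
    then show "?\<delta> n ` ?gr (Suc n) i \<subseteq> ?gr n i"
      unfolding curry_image by blast
  next
    note E = lmod_homD[OF \<epsilon>]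
    have tr: "carrier (trivial_module A E) = E 0" "lact (trivial_module A E) a x = component E 0 a \<cdot>\<^bsub>A\<^esub> x"
      for A :: "('k, 'c::ab_group_add) alg" and E a x
      by (simp_all add: trivial_module_def)
    have comp0: "component (smash_grading D) 0 s h = component (N_part D) 0 (s h)" for s h
      using direct_sum_fun(2)[OF dN, of s 0] by (simp add: smash_grading_def[abs_def])
    \<comment> \<open>Degree 0 consists of scalars, which are homogeneous for the identity of the
      group; so p_g acts on them as 1 or 0.\<close>
    have pr0: "pr g x = (if g = 0 then x else 0)" if "x \<in> N_part D 0" for g x
      using that by (auto simp: N0 pr_scale pr_one)
    have e0: "component (N_part D) 0 r \<in> N_part D 0" for r
      by (rule component_in[OF dN UNIV_I])
    show "lmod_hom (?P 0) (trivial_module S (smash_grading D)) ?\<epsilon>"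
      unfolding lmod_hom_def
    proof (intro conjI ballI allI image_subsetI)
      fix q assume "q \<in> carrier (?P 0)"
      then have q: "(\<lambda>m. q m h) \<in> carrier (P 0)" for h by (simp add: induced_carrier)
      have eq: "\<epsilon> (\<lambda>m. q m h) \<in> N_part D 0" for h
        using E(1)[OF q] by (simp add: tr)
      then show "?\<epsilon> q \<in> carrier (trivial_module S (smash_grading D))"
        by (simp add: tr smash_grading_def)
      fix s
      show "?\<epsilon> (lact (?P 0) s q) = lact (trivial_module S (smash_grading D)) s (?\<epsilon> q)"
      proof
        fix h
        have "\<epsilon> (\<lambda>m. lact (?P 0) s q m h) = (\<Sum>g\<in>UNIV. component (N_part D) 0 (pr (h - g) (s g)) \<cdot>\<^bsub>R\<^esub> \<epsilon> (\<lambda>m. q m g))"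
          unfolding ind_loc.I_simps(2)[OF I] using q
          by (simp add: additive_on_sum[OF lmod_subgroup[OF lP] E(2)] lact_closed[OF lP] E(3) tr)
        \<comment> \<open>Both action formulas reduce to this term: only g = h survives, with the
          degree 0 part of the scalar.\<close>
        also have "\<dots> = (\<Sum>g\<in>UNIV. if g = h then component (N_part D) 0 (s g) \<cdot>\<^bsub>R\<^esub> \<epsilon> (\<lambda>m. q m g) else 0)"
          by (intro sum.cong refl) (simp add: pr_component_0 pr0[OF e0])
        also have "\<dots> = (\<Sum>g\<in>UNIV. component (smash_grading D) 0 s g \<cdot>\<^bsub>R\<^esub> pr (g - h) (\<epsilon> (\<lambda>m. q m h)))"
          by (intro sum.cong refl) (simp add: comp0 pr0[OF eq])
        finally show "?\<epsilon> (lact (?P 0) s q) h = lact (trivial_module S (smash_grading D)) s (?\<epsilon> q) h"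
          by (simp add: tr smash_mult_apply)
      qed
      fix q' assume "q' \<in> carrier (?P 0)"
      then have q': "(\<lambda>m. q' m h) \<in> carrier (P 0)" for h by (simp add: induced_carrier)
      have "(\<lambda>m. (q + q') m h) = (\<lambda>m. q m h) + (\<lambda>m. q' m h)" for h
        by (simp add: fun_eq_iff)
      then have "\<epsilon> (\<lambda>m. (q + q') m h) = \<epsilon> (\<lambda>m. q m h) + \<epsilon> (\<lambda>m. q' m h)" for h
        using E(2) q q' by (simp only: additive_on_def)
      then show "?\<epsilon> (q + q') = ?\<epsilon> q + ?\<epsilon> q'"
        by (simp add: fun_eq_iff)
    qed
    have im\<epsilon>: "?\<epsilon> ` {q. \<forall>h. (\<lambda>m. q m h) \<in> A} = {s. \<forall>h. s h \<in> \<epsilon> ` A}" for A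
    proof (intro equalityI subsetI)
      fix s assume "s \<in> {s. \<forall>h::'g. s h \<in> \<epsilon> ` A}"
      then have "\<forall>h. \<exists>x. x \<in> A \<and> s h = \<epsilon> x" by blast
      then obtain p where p: "\<And>h. p h \<in> A" "\<And>h. s h = \<epsilon> (p h)" by metis
      then show "s \<in> ?\<epsilon> ` {q. \<forall>h. (\<lambda>m. q m h) \<in> A}"
        by (intro image_eqI[of _ _ "\<lambda>n h. p h n"]) (simp_all add: fun_eq_iff)
    qed auto
    show "?\<epsilon> ` ?gr 0 i \<subseteq> (if i = 0 then smash_grading D 0 else {0})" for i
    proof
      fix s assume "s \<in> ?\<epsilon> ` ?gr 0 i"
      then have s: "s h \<in> (if i = 0 then N_part D 0 else {0})" for h
        unfolding im\<epsilon> using \<epsilon>gr[rule_format, of i] by blast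
      show "s \<in> (if i = 0 then smash_grading D 0 else {0})"
        using s by (cases "i = 0") (simp_all add: smash_grading_def fun_eq_iff)
    qed
    have ex0: "\<epsilon> ` carrier (P 0) = N_part D 0" "\<delta> 0 ` carrier (P 1) = {x \<in> carrier (P 0). \<epsilon> x = 0}"
      and exS: "\<delta> (Suc n) ` carrier (P (Suc (Suc n))) = {x \<in> carrier (P (Suc n)). \<delta> n x = 0}" for n
      using exact by (simp_all add: exact_over_def)
    have z: "(?\<delta> n q = 0) = (\<forall>h. \<delta> n (\<lambda>m. q m h) = 0)" for n q
      by (auto simp: fun_eq_iff)
    show "exact_over (\<lambda>n. carrier (?P n)) ?\<delta> ?\<epsilon> (smash_grading D 0)"
      unfolding exact_over_def
    proof (intro conjI allI)
      show "?\<epsilon> ` carrier (?P 0) = smash_grading D 0"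
        unfolding induced_carrier im\<epsilon> ex0 by (simp add: smash_grading_def)
      show "?\<delta> 0 ` carrier (?P 1) = {q \<in> carrier (?P 0). ?\<epsilon> q = 0}"
        unfolding induced_carrier curry_image ex0 by (auto simp: fun_eq_iff)
      show "?\<delta> (Suc n) ` carrier (?P (Suc (Suc n))) = {q \<in> carrier (?P (Suc n)). ?\<delta> n q = 0}" for n
        unfolding induced_carrier curry_image exS z by auto
    qed
  qed
qed


section \<open>Degree zero, finiteness and generation\<close>

text \<open>The degree 0 part of \<open>S\<close> is the algebra of functions from the group to k
  with pointwise product. A left ideal consists of all such functions supported on the set
  \<open>T\<close> of those g with p_g in the ideal; the functions vanishing on \<open>T\<close>
  form a complement.\<close>

lemma smash_semisimple:
  assumes N0: "N_part D 0 = range (\<lambda>c. alg_scale R c (alg_one R))"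
  shows "semisimple_subring S (smash_grading D 0)"
  unfolding semisimple_subring_def
proof (intro allI impI)
  fix L assume L: "left_ideal_in S (smash_grading D 0) L"
  let ?e = "\<lambda>g. pt g (alg_one R)"
  define T where "T = {g. ?e g \<in> L}"
  let ?L' = "{s \<in> smash_grading D 0. \<forall>g\<in>T. s g = 0}"
  have pr0: "pr g x = (if g = 0 then x else 0)" if "x \<in> N_part D 0" for g x
    using that by (auto simp: N0 pr_scale pr_one)
  have mult: "(s \<cdot>\<^bsub>S\<^esub> t) h = s h \<cdot>\<^bsub>R\<^esub> t h" if "t \<in> smash_grading D 0" for s t h
  proof -
    have "(s \<cdot>\<^bsub>S\<^esub> t) h = (\<Sum>g\<in>UNIV. if g = h then s g \<cdot>\<^bsub>R\<^esub> t h else 0)"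
      unfolding smash_mult_apply using that
      by (intro sum.cong refl) (simp add: pr0 smash_grading_def)
    then show ?thesis by simp
  qed
  note subN = direct_sum_add_subgroup[OF dN]
  have pt0: "pt g x \<in> smash_grading D 0" if "x \<in> N_part D 0" for g x
    using that by (simp add: smash_grading_def pt_apply add_subgroup_zero[OF subN])
  have one0: "alg_scale R c (alg_one R) \<in> N_part D 0" for c
    by (auto simp: N0)
  have LD: "L \<subseteq> smash_grading D 0" "add_subgroup L" "\<And>a x. a \<in> smash_grading D 0 \<Longrightarrow> x \<in> L \<Longrightarrow> a \<cdot>\<^bsub>S\<^esub> x \<in> L"
    using L by (auto simp: left_ideal_in_def)
  have LT: "g \<in> T" if "x \<in> L" "x g \<noteq> 0" for x g
  proof -
    have "x g \<in> N_part D 0" using that(1) LD(1) by (auto simp: smash_grading_def)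
    then obtain c where c: "x g = alg_scale R c (alg_one R)"
      by (auto simp: N0)
    then have "c \<noteq> 0" using that(2) by auto
    \<comment> \<open>Multiplying by the inverse of a nonzero value at g isolates the idempotent p_g
      inside the ideal.\<close>
    have "pt g (alg_scale R (inverse c) (alg_one R)) \<cdot>\<^bsub>S\<^esub> x = ?e g"
      using that(1) LD(1) \<open>c \<noteq> 0\<close> by (auto simp: fun_eq_iff mult pt_apply c scale_mult)
    then show "g \<in> T"
      using LD(3)[OF pt0[OF one0] that(1), of g "inverse c"] by (simp add: T_def)
  qed
  have TL: "pt g x \<in> L" if "g \<in> T" "x \<in> N_part D 0" for g x
  proof -
    have "pt g x \<cdot>\<^bsub>S\<^esub> ?e g = pt g x"
      by (simp add: mult_idem pt_apply)
    then show ?thesis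
      using LD(3)[OF pt0[OF that(2)], of "?e g" g] that(1) by (simp add: T_def)
  qed
  show "\<exists>L'. left_ideal_in S (smash_grading D 0) L' \<and> L \<inter> L' = {0} \<and> {x + y |x y. x \<in> L \<and> y \<in> L'} = smash_grading D 0"
  proof (intro exI conjI)
    have sg: "add_subgroup (smash_grading D 0)"
      by (rule direct_sum_add_subgroup[of UNIV]) (use graded_smash in \<open>simp add: graded_algebra_def\<close>)
    then show "left_ideal_in S (smash_grading D 0) ?L'"
      using graded_smash unfolding graded_algebra_def
      by (auto simp: left_ideal_in_def add_subgroup_def mult)
        (metis add_0)
    have "x = 0" if "x \<in> L" "x \<in> ?L'" for x
      using LT[OF that(1)] that(2) by (auto simp: fun_eq_iff)
    then show "L \<inter> ?L' = {0}"
      using add_subgroup_zero[OF LD(2)] add_subgroup_zero[OF sg] by auto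
    show "{x + y |x y. x \<in> L \<and> y \<in> ?L'} = smash_grading D 0"
    proof (intro equalityI subsetI)
      fix s assume "s \<in> {x + y |x y. x \<in> L \<and> y \<in> ?L'}"
      then show "s \<in> smash_grading D 0"
        using LD(1) add_subgroup_add[OF sg] by auto
    next
      fix s assume s: "s \<in> smash_grading D 0"
      let ?x = "\<Sum>g\<in>T. pt g (s g)" and ?y = "\<lambda>g. if g \<in> T then 0 else s g"
      have "?x \<in> L"
        using s by (intro add_subgroup_sum[OF LD(2)] TL) (auto simp: smash_grading_def)
      moreover have "?y \<in> ?L'"
        using s add_subgroup_zero[OF subN] by (auto simp: smash_grading_def)
      moreover have "s = ?x + ?y"
        by (auto simp: fun_eq_iff sum_fun pt_apply)
      ultimately show "s \<in> {x + y |x y. x \<in> L \<and> y \<in> ?L'}"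
        by blast
    qed
  qed
qed

lemma smash_finite_dim:
  assumes "finite_dim R (N_part D n)"
  shows "finite_dim S (smash_grading D n)"
proof -
  obtain X where X: "finite X" "N_part D n = vs.span X"
    using assms by (auto simp: finite_dim_def)
  let ?X = "(\<Union>g. pt g ` X) :: ('g \<Rightarrow> 'r) set"
  have "pt g x \<in> sm.vs.span ?X" if "x \<in> vs.span X" for g x
    using that
  proof (induction rule: vs.span_induct_alt)
    case base
    have "pt g 0 = (0 :: 'g \<Rightarrow> 'r)" by (simp add: fun_eq_iff pt_apply)
    then show ?case using sm.vs.span_zero by metis
  next
    case (step c x y)
    have eq: "pt g (alg_scale R c x + y) = alg_scale S c (pt g x) + pt g y"
      by (auto simp: fun_eq_iff pt_apply)
    have "pt g x \<in> sm.vs.span ?X"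
      using step(1) by (intro sm.vs.span_base) blast
    then show ?case
      unfolding eq using step(2) by (intro sm.vs.span_add sm.vs.span_scale)
  qed
  then have "(\<Sum>g\<in>UNIV. pt g (s g)) \<in> sm.vs.span ?X" if "s \<in> smash_grading D n" for s
    using that by (intro sm.vs.span_sum) (auto simp: smash_grading_def X(2))
  then have "smash_grading D n \<subseteq> sm.vs.span ?X"
    by (simp add: sum_pt subset_iff)
  moreover have "sm.vs.span ?X \<subseteq> smash_grading D n"
  proof (rule sm.vs.span_minimal)
    have "x \<in> N_part D n" if "x \<in> X" for x
      using that X(2) by (simp add: vs.span_base)
    then show "?X \<subseteq> smash_grading D n"
      by (auto simp: smash_grading_def pt_apply add_subgroup_zero[OF direct_sum_add_subgroup[OF dN]])
    show "sm.vs.subspace (smash_grading D n)"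
      using graded_smash unfolding graded_algebra_def by blast
  qed
  ultimately show ?thesis
    using X(1) unfolding finite_dim_def by (intro exI[of _ ?X]) auto
qed

text \<open>The identity a b # p_g = (a # 1)(b # p_g) carries products of homogeneous elements over
  to \<open>S\<close>.\<close>

lemma smash_products_generate:
  assumes gen: "N_part D (i + j) = add_subgroup hull {a \<cdot>\<^bsub>R\<^esub> b |a b. a \<in> N_part D i \<and> b \<in> N_part D j}"
  shows "smash_grading D (i + j) = add_subgroup hull {a \<cdot>\<^bsub>S\<^esub> b |a b. a \<in> smash_grading D i \<and> b \<in> smash_grading D j}"
    (is "_ = ?H")
proof (intro equalityI subsetI)
  note subN = direct_sum_add_subgroup[OF dN]
  have "pt g x \<in> ?H" if "x \<in> N_part D (i + j)" for g x
  proof (rule additive_on_hull_mem[where f = "pt g", OF _ add_subgroup_hull _ that[unfolded gen]])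
    fix x assume "x \<in> {a \<cdot>\<^bsub>R\<^esub> b |a b. a \<in> N_part D i \<and> b \<in> N_part D j}"
    then obtain a b where x: "x = a \<cdot>\<^bsub>R\<^esub> b" and ab: "a \<in> N_part D i" "b \<in> N_part D j" by blast
    have "pt g x = (\<lambda>_. a) \<cdot>\<^bsub>S\<^esub> pt g b"
      by (simp add: cst_mult x fun_eq_iff pt_apply)
    moreover have "(\<lambda>_. a) \<in> smash_grading D i" "pt g b \<in> smash_grading D j"
      using ab by (simp_all add: smash_grading_def pt_apply add_subgroup_zero[OF subN])
    ultimately show "pt g x \<in> ?H"
      by (intro hull_inc) blast
  qed (auto simp: additive_on_def pt_def fun_eq_iff)
  then have "(\<Sum>g\<in>UNIV. pt g (s g)) \<in> ?H" if "s \<in> smash_grading D (i + j)" for s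
    using that by (intro add_subgroup_sum[OF add_subgroup_hull]) (simp add: smash_grading_def)
  then show "s \<in> ?H" if "s \<in> smash_grading D (i + j)" for s
    using that by (simp add: sum_pt)
  have "direct_sum UNIV (smash_grading D)"
    and mult: "\<And>a b. a \<in> smash_grading D i \<Longrightarrow> b \<in> smash_grading D j \<Longrightarrow> a \<cdot>\<^bsub>S\<^esub> b \<in> smash_grading D (i + j)"
    using graded_smash unfolding graded_algebra_def by blast+
  then have "?H \<subseteq> smash_grading D (i + j)"
    by (intro hull_minimal direct_sum_add_subgroup) auto
  then show "s \<in> ?H \<Longrightarrow> s \<in> smash_grading D (i + j)" for s
    by blast
qed

end

section \<open>Presentations by the tensor algebra\<close>

definition word_map ::
    "('k::field, 'b::ab_group_add) alg \<Rightarrow> (nat \<Rightarrow> 'b set) \<Rightarrow> ('a \<Rightarrow> 'b) \<Rightarrow> ('k, 'a) word_tens \<Rightarrow> ('k, 'b) word_tens" where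
  "word_map A D f t = (\<lambda>\<beta>. if word_form A D \<beta> then t (\<lambda>w. \<beta> (map f w)) else 0)"

text \<open>These conditions make the pullback of a word form along a map of letters again a word
  form, so that the map induces one of tensor algebras.\<close>

definition letter_hom ::
    "('k::field, 'a::ab_group_add) alg \<Rightarrow> (nat \<Rightarrow> 'a set) \<Rightarrow> ('k, 'b::ab_group_add) alg \<Rightarrow> (nat \<Rightarrow> 'b set)
      \<Rightarrow> ('a \<Rightarrow> 'b) \<Rightarrow> bool" where
  "letter_hom A D B E f \<longleftrightarrow>
     (\<forall>i\<in>{0, 1}. \<forall>x\<in>D i. f x \<in> E i \<and> (\<forall>y\<in>D i. \<forall>c. f (alg_scale A c x + y) = alg_scale B c (f x) + f y)) \<and>
     (\<forall>a\<in>D 0. \<forall>x\<in>D 0 \<union> D 1. f (a \<cdot>\<^bsub>A\<^esub> x) = f a \<cdot>\<^bsub>B\<^esub> f x \<and> f (x \<cdot>\<^bsub>A\<^esub> a) = f x \<cdot>\<^bsub>B\<^esub> f a) \<and>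
     f (alg_one A) = alg_one B"

lemma word_formD:
  assumes "word_form A D \<beta>"
  shows "i \<in> {0, 1} \<Longrightarrow> x \<in> D i \<Longrightarrow> y \<in> D i \<Longrightarrow>
      \<beta> (u @ [alg_scale A c x + y] @ v) = c * \<beta> (u @ [x] @ v) + \<beta> (u @ [y] @ v)"
    and "a \<in> D 0 \<Longrightarrow> x \<in> D 0 \<union> D 1 \<Longrightarrow> \<beta> (u @ [a, x] @ v) = \<beta> (u @ [a \<cdot>\<^bsub>A\<^esub> x] @ v)"
    and "a \<in> D 0 \<Longrightarrow> x \<in> D 0 \<union> D 1 \<Longrightarrow> \<beta> (u @ [x, a] @ v) = \<beta> (u @ [x \<cdot>\<^bsub>A\<^esub> a] @ v)"
    and "\<beta> (u @ [alg_one A] @ v) = \<beta> (u @ v)"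
  using assms unfolding word_form_def by blast+

lemma word_formI:
  assumes "\<And>u v i x y c. i \<in> {0, 1} \<Longrightarrow> x \<in> D i \<Longrightarrow> y \<in> D i \<Longrightarrow>
      \<beta> (u @ [alg_scale A c x + y] @ v) = c * \<beta> (u @ [x] @ v) + \<beta> (u @ [y] @ v)"
    and "\<And>u v a x. a \<in> D 0 \<Longrightarrow> x \<in> D 0 \<union> D 1 \<Longrightarrow> \<beta> (u @ [a, x] @ v) = \<beta> (u @ [a \<cdot>\<^bsub>A\<^esub> x] @ v)"
    and "\<And>u v a x. a \<in> D 0 \<Longrightarrow> x \<in> D 0 \<union> D 1 \<Longrightarrow> \<beta> (u @ [x, a] @ v) = \<beta> (u @ [x \<cdot>\<^bsub>A\<^esub> a] @ v)"
    and "\<And>u v. \<beta> (u @ [alg_one A] @ v) = \<beta> (u @ v)"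
  shows "word_form A D \<beta>"
  unfolding word_form_def by (intro conjI allI ballI assms)

lemma word_form_shift:
  assumes "word_form A D \<beta>"
  shows "word_form A D (\<lambda>v. \<beta> (u @ v))" "word_form A D (\<lambda>u. \<beta> (u @ v))"
proof -
  show "word_form A D (\<lambda>v. \<beta> (u @ v))"
  proof (rule word_formI)
    fix u' v'
    show "\<beta> (u @ u' @ [alg_scale A c x + y] @ v') = c * \<beta> (u @ u' @ [x] @ v') + \<beta> (u @ u' @ [y] @ v')"
      if "i \<in> {0, 1}" "x \<in> D i" "y \<in> D i" for i x y c
      using word_formD(1)[OF assms that, of "u @ u'" c v'] by simp
    show "\<beta> (u @ u' @ [a, x] @ v') = \<beta> (u @ u' @ [a \<cdot>\<^bsub>A\<^esub> x] @ v')"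
      "\<beta> (u @ u' @ [x, a] @ v') = \<beta> (u @ u' @ [x \<cdot>\<^bsub>A\<^esub> a] @ v')" if "a \<in> D 0" "x \<in> D 0 \<union> D 1" for a x
      using word_formD(2,3)[OF assms that, of "u @ u'" v'] by simp_all
    show "\<beta> (u @ u' @ [alg_one A] @ v') = \<beta> (u @ u' @ v')"
      using word_formD(4)[OF assms, of "u @ u'" v'] by simp
  qed
  show "word_form A D (\<lambda>u. \<beta> (u @ v))"
  proof (rule word_formI)
    fix u' v'
    show "\<beta> ((u' @ [alg_scale A c x + y] @ v') @ v) = c * \<beta> ((u' @ [x] @ v') @ v) + \<beta> ((u' @ [y] @ v') @ v)"
      if "i \<in> {0, 1}" "x \<in> D i" "y \<in> D i" for i x y c
      using word_formD(1)[OF assms that, of u' c "v' @ v"] by simp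
    show "\<beta> ((u' @ [a, x] @ v') @ v) = \<beta> ((u' @ [a \<cdot>\<^bsub>A\<^esub> x] @ v') @ v)"
      "\<beta> ((u' @ [x, a] @ v') @ v) = \<beta> ((u' @ [x \<cdot>\<^bsub>A\<^esub> a] @ v') @ v)" if "a \<in> D 0" "x \<in> D 0 \<union> D 1" for a x
      using word_formD(2,3)[OF assms that, of u' "v' @ v"] by simp_all
    show "\<beta> ((u' @ [alg_one A] @ v') @ v) = \<beta> ((u' @ v') @ v)"
      using word_formD(4)[OF assms, of u' "v' @ v"] by simp
  qed
qed

lemma word_form_comb:
  assumes \<beta>: "word_form A D \<beta>" and \<gamma>: "word_form A D \<gamma>"
  shows "word_form A D (\<lambda>w. \<beta> w + k * \<gamma> w)"
proof (rule word_formI)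
  fix u v
  show "\<beta> (u @ [alg_scale A c x + y] @ v) + k * \<gamma> (u @ [alg_scale A c x + y] @ v) =
      c * (\<beta> (u @ [x] @ v) + k * \<gamma> (u @ [x] @ v)) + (\<beta> (u @ [y] @ v) + k * \<gamma> (u @ [y] @ v))"
    if "i \<in> {0, 1}" "x \<in> D i" "y \<in> D i" for i x y c
    unfolding word_formD(1)[OF \<beta> that] word_formD(1)[OF \<gamma> that] by (simp only: distrib_left ac_simps)
  show "\<beta> (u @ [a, x] @ v) + k * \<gamma> (u @ [a, x] @ v) = \<beta> (u @ [a \<cdot>\<^bsub>A\<^esub> x] @ v) + k * \<gamma> (u @ [a \<cdot>\<^bsub>A\<^esub> x] @ v)"
    if "a \<in> D 0" "x \<in> D 0 \<union> D 1" for a x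
    unfolding word_formD(2)[OF \<beta> that] word_formD(2)[OF \<gamma> that] ..
  show "\<beta> (u @ [x, a] @ v) + k * \<gamma> (u @ [x, a] @ v) = \<beta> (u @ [x \<cdot>\<^bsub>A\<^esub> a] @ v) + k * \<gamma> (u @ [x \<cdot>\<^bsub>A\<^esub> a] @ v)"
    if "a \<in> D 0" "x \<in> D 0 \<union> D 1" for a x
    unfolding word_formD(3)[OF \<beta> that] word_formD(3)[OF \<gamma> that] ..
  show "\<beta> (u @ [alg_one A] @ v) + k * \<gamma> (u @ [alg_one A] @ v) = \<beta> (u @ v) + k * \<gamma> (u @ v)"
    unfolding word_formD(4)[OF \<beta>] word_formD(4)[OF \<gamma>] ..
qed

lemma word_form_diff:
  assumes "word_form A D \<beta>" "word_form A D \<gamma>"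
  shows "word_form A D (\<lambda>w. \<beta> w - \<gamma> w)" "word_form A D (\<lambda>w. \<beta> w + \<gamma> w)"
  using word_form_comb[OF assms, of "- 1"] word_form_comb[OF assms, of 1] by simp_all

lemma word_form_zero: "word_form A D (\<lambda>w. 0)"
  by (simp add: word_form_def)

lemma word_form_map:
  assumes f: "letter_hom A D B E f" and \<beta>: "word_form B E \<beta>"
  shows "word_form A D (\<lambda>w. \<beta> (map f w))"
proof (rule word_formI)
  note F = f[unfolded letter_hom_def]
  fix u v
  show "\<beta> (map f (u @ [alg_scale A c x + y] @ v)) = c * \<beta> (map f (u @ [x] @ v)) + \<beta> (map f (u @ [y] @ v))"
    if "i \<in> {0, 1}" "x \<in> D i" "y \<in> D i" for i x y c
    using word_formD(1)[OF \<beta>, of i "f x" "f y" "map f u" c "map f v"] that F by auto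
  show "\<beta> (map f (u @ [a, x] @ v)) = \<beta> (map f (u @ [a \<cdot>\<^bsub>A\<^esub> x] @ v))"
    "\<beta> (map f (u @ [x, a] @ v)) = \<beta> (map f (u @ [x \<cdot>\<^bsub>A\<^esub> a] @ v))" if "a \<in> D 0" "x \<in> D 0 \<union> D 1" for a x
    using word_formD(2,3)[OF \<beta>, of "f a" "f x" "map f u" "map f v"] that F by auto
  show "\<beta> (map f (u @ [alg_one A] @ v)) = \<beta> (map f (u @ v))"
    using word_formD(4)[OF \<beta>, of "map f u" "map f v"] F by simp
qed

lemma word_map_word:
  assumes "letter_hom A D B E f"
  shows "word_map B E f (word_tensor A D w) = word_tensor B E (map f w)"
  using word_form_map[OF assms] by (auto simp: word_map_def word_tensor_def fun_eq_iff)

lemma word_map_add: "additive_on H (word_map A D f)"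
  by (auto simp: additive_on_def word_map_def fun_eq_iff)

section \<open>The ring structure of the tensor algebra\<close>

locale tens_alg = alg_loc A for A :: "('k::field, 'b::ab_group_add) alg" +
  fixes D :: "nat \<Rightarrow> 'b set"
  assumes gr: "graded_algebra A D"
begin

abbreviation wt where "wt \<equiv> word_tensor A D"
abbreviation T where "T \<equiv> tensor_algebra A D"
abbreviation tm (infixl \<open>\<odot>\<close> 70) where "s \<odot> t \<equiv> tensor_algebra_mult A D s t"

lemma dsD: "direct_sum UNIV D"
  and D_scale: "x \<in> D i \<Longrightarrow> alg_scale A c x \<in> D i"
  and one_D: "alg_one A \<in> D 0"
  and mult_D: "a \<in> D i \<Longrightarrow> b \<in> D j \<Longrightarrow> a \<cdot>\<^bsub>A\<^esub> b \<in> D (i + j)"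
  using gr unfolding graded_algebra_def vs.subspace_def by blast+

lemmas subD = direct_sum_add_subgroup[OF dsD]

lemma T_subgroup: "add_subgroup T"
  by (simp add: tensor_algebra_def)

lemma wt_T: "w \<in> lists (D 0 \<union> D 1) \<Longrightarrow> wt w \<in> T"
  unfolding tensor_algebra_def by (rule hull_inc) blast

lemma T_induct [consumes 1, case_names zero diff word]:
  assumes "t \<in> T" "P 0" "\<And>s t. s \<in> T \<Longrightarrow> t \<in> T \<Longrightarrow> P s \<Longrightarrow> P t \<Longrightarrow> P (s - t)"
    "\<And>w. w \<in> lists (D 0 \<union> D 1) \<Longrightarrow> P (wt w)"
  shows "P t"
  using assms(1) unfolding tensor_algebra_def
proof (induction t rule: hull_induct_diff)
  case zero
  show ?case by (rule assms(2))
next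
  case (diff s t)
  then show ?case by (rule assms(3)[unfolded tensor_algebra_def])
next
  case (base t)
  then show ?case using assms(4) by blast
qed

lemma wt_linear: "i \<in> {0, 1} \<Longrightarrow> x \<in> D i \<Longrightarrow> y \<in> D i \<Longrightarrow>
      wt (u @ [alg_scale A c x + y] @ v) = (\<lambda>\<beta>. c * wt (u @ [x] @ v) \<beta>) + wt (u @ [y] @ v)"
  and wt_left: "a \<in> D 0 \<Longrightarrow> x \<in> D 0 \<union> D 1 \<Longrightarrow> wt (u @ [a, x] @ v) = wt (u @ [a \<cdot>\<^bsub>A\<^esub> x] @ v)"
  and wt_right: "a \<in> D 0 \<Longrightarrow> x \<in> D 0 \<union> D 1 \<Longrightarrow> wt (u @ [x, a] @ v) = wt (u @ [x \<cdot>\<^bsub>A\<^esub> a] @ v)"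
  and wt_one: "wt (u @ [alg_one A] @ v) = wt (u @ v)"
proof -
  assume i: "i \<in> {0, 1}" "x \<in> D i" "y \<in> D i"
  show "wt (u @ [alg_scale A c x + y] @ v) = (\<lambda>\<beta>. c * wt (u @ [x] @ v) \<beta>) + wt (u @ [y] @ v)"
  proof
    fix \<beta>
    show "wt (u @ [alg_scale A c x + y] @ v) \<beta> = ((\<lambda>\<beta>. c * wt (u @ [x] @ v) \<beta>) + wt (u @ [y] @ v)) \<beta>"
      using word_formD(1)[of A D \<beta> i x y u c v] i by (simp add: word_tensor_def)
  qed
next
  assume ax: "a \<in> D 0" "x \<in> D 0 \<union> D 1"
  show "wt (u @ [a, x] @ v) = wt (u @ [a \<cdot>\<^bsub>A\<^esub> x] @ v)" "wt (u @ [x, a] @ v) = wt (u @ [x \<cdot>\<^bsub>A\<^esub> a] @ v)"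
    using word_formD(2,3)[of A D _ a x u v] ax by (simp_all add: word_tensor_def fun_eq_iff)
next
  show "wt (u @ [alg_one A] @ v) = wt (u @ v)"
    using word_formD(4)[of A D _ u v] by (simp add: word_tensor_def fun_eq_iff)
qed

lemma wt_add:
  assumes "i \<in> {0, 1}" "x \<in> D i" "y \<in> D i"
  shows "wt (u @ [x + y] @ v) = wt (u @ [x] @ v) + wt (u @ [y] @ v)"
  using wt_linear[OF assms, of u 1 v] by simp

lemma wt_zero: "wt (u @ [0] @ v) = 0"
  using wt_add[of 0 0 0 u v] add_subgroup_zero[OF subD, of 0] by simp

lemma wt_sum:
  assumes "i \<in> {0, 1}" "\<And>j. j \<in> I \<Longrightarrow> f j \<in> D i"
  shows "wt (u @ [sum f I] @ v) = (\<Sum>j\<in>I. wt (u @ [f j] @ v))"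
proof (rule additive_on_sum[OF subD, of i "\<lambda>x. wt (u @ [x] @ v)"])
  show "additive_on (D i) (\<lambda>x. wt (u @ [x] @ v))"
    unfolding additive_on_def using wt_add[OF assms(1)] by blast
qed (rule assms(2))

lemma wt_scale: "i \<in> {0, 1} \<Longrightarrow> x \<in> D i \<Longrightarrow> wt [alg_scale A c x] = (\<lambda>\<beta>. c * wt [x] \<beta>)"
  using wt_linear[of i x 0 "[]" c "[]"] wt_zero[of "[]" "[]"] add_subgroup_zero[OF subD, of i] by simp

lemma wt_mult: "wt u \<odot> wt v = wt (u @ v)"
  by (auto simp: tensor_algebra_mult_def word_tensor_def fun_eq_iff word_form_shift)

text \<open>The product applies the left factor to the function obtained by letting the right factor
  act on the tail of a word. For elements of the tensor algebra this function is again a word form;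
  associativity and additivity in the right factor rest on it.\<close>

lemma T_form:
  assumes "t \<in> T" "word_form A D \<beta>"
  shows "word_form A D (\<lambda>u. t (\<lambda>v. \<beta> (u @ v)))"
  using assms(1)
proof (induction rule: T_induct)
  case zero
  show ?case by (simp add: word_form_zero)
next
  case (diff s t)
  then show ?case by (simp add: word_form_diff)
next
  case (word w)
  show ?case
    using assms(2) by (simp add: word_tensor_def word_form_shift)
qed

lemma T_additive:
  assumes "t \<in> T" "word_form A D \<beta>" "word_form A D \<gamma>"
  shows "t (\<lambda>w. \<beta> w + \<gamma> w) = t \<beta> + t \<gamma>"
  using assms(1)
  by (induction rule: T_induct) (simp_all add: word_tensor_def word_form_diff assms(2,3))

lemma tm_add_left: "additive_on H (\<lambda>s. s \<odot> t)"
  by (auto simp: additive_on_def tensor_algebra_mult_def fun_eq_iff)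

lemma tm_add_right: "s \<in> T \<Longrightarrow> additive_on T (\<lambda>t. s \<odot> t)"
  unfolding additive_on_def
proof (intro ballI ext)
  fix t t' \<beta> assume s: "s \<in> T" and t: "t \<in> T" "t' \<in> T"
  show "(s \<odot> (t + t')) \<beta> = (s \<odot> t + s \<odot> t') \<beta>"
    using T_additive[OF s T_form[OF t(1)] T_form[OF t(2)], of \<beta> \<beta>] by (simp add: tensor_algebra_mult_def)
qed

lemma tm_zero: "0 \<odot> t = 0" "s \<in> T \<Longrightarrow> s \<odot> 0 = 0"
  by (rule additive_on_zero[OF add_subgroup_UNIV tm_add_left], rule additive_on_zero[OF T_subgroup tm_add_right])

lemma tm_diff: "(s - s') \<odot> t = s \<odot> t - s' \<odot> t" "s \<in> T \<Longrightarrow> t \<in> T \<Longrightarrow> t' \<in> T \<Longrightarrow> s \<odot> (t - t') = s \<odot> t - s \<odot> t'"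
  by (rule additive_on_diff[OF add_subgroup_UNIV tm_add_left], auto intro: additive_on_diff[OF T_subgroup tm_add_right])

lemma tm_sum: "(\<Sum>i\<in>I. f i) \<odot> t = (\<Sum>i\<in>I. f i \<odot> t)"
  "s \<in> T \<Longrightarrow> (\<And>i. i \<in> I \<Longrightarrow> f i \<in> T) \<Longrightarrow> s \<odot> (\<Sum>i\<in>I. f i) = (\<Sum>i\<in>I. s \<odot> f i)"
  by (rule additive_on_sum[OF add_subgroup_UNIV tm_add_left UNIV_I], rule additive_on_sum[OF T_subgroup tm_add_right])

lemma tm_closed:
  assumes s: "s \<in> T" and t: "t \<in> T"
  shows "s \<odot> t \<in> T"
  using s
proof (induction rule: T_induct)
  case zero
  show ?case by (simp only: tm_zero add_subgroup_zero[OF T_subgroup])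
next
  case (diff s s')
  then show ?case by (simp only: tm_diff add_subgroup_diff[OF T_subgroup])
next
  case (word u)
  show ?case
    using t
  proof (induction rule: T_induct)
    case zero
    show ?case by (simp only: tm_zero(2)[OF wt_T[OF word]] add_subgroup_zero[OF T_subgroup])
  next
    case (diff t t')
    then show ?case by (simp only: tm_diff(2)[OF wt_T[OF word]] add_subgroup_diff[OF T_subgroup])
  next
    case (word w)
    then show ?case using \<open>u \<in> lists (D 0 \<union> D 1)\<close> by (simp only: wt_mult) (simp add: wt_T)
  qed
qed

lemma tm_assoc: "r \<in> T \<Longrightarrow> s \<odot> t \<odot> r = s \<odot> (t \<odot> r)"
  by (rule ext) (simp add: tensor_algebra_mult_def T_form word_form_shift)

lemma tm_one:
  assumes "t \<in> T"
  shows "wt [] \<odot> t = t" "t \<odot> wt [] = t"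
  using assms
proof (induction rule: T_induct)
  have e: "wt [] \<in> T" by (simp add: wt_T)
  case (diff s t)
  {
    case 1
    show ?case using diff by (simp only: tm_diff(2)[OF e])
  next
    case 2
    show ?case using diff by (simp only: tm_diff(1))
  }
qed (auto simp: wt_mult tm_zero wt_T)

section \<open>The product map of the tensor algebra\<close>

fun wprod :: "'b list \<Rightarrow> 'b" where
  "wprod [] = alg_one A"
| "wprod (x # w) = x \<cdot>\<^bsub>A\<^esub> wprod w"

lemma wprod_append: "wprod (u @ v) = wprod u \<cdot>\<^bsub>A\<^esub> wprod v"
  by (induction u) (simp_all add: mult_assoc)

text \<open>The linear extension of \<open>wprod\<close>. Elements of the tensor algebra are
  functionals, so the image is recovered by its coordinates: each coordinate of the product of a
  word is itself a word form.\<close>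

definition mu :: "('k, 'b) word_tens \<Rightarrow> 'b" where
  "mu t = Sum_any (\<lambda>b. alg_scale A (t (\<lambda>w. coord b (wprod w))) b)"

lemma wprod_form: "word_form A D (\<lambda>w. coord b (wprod w))"
proof (rule word_formI)
  have lin: "coord b (alg_scale A c x + y) = c * coord b x + coord b y" for c x y
    using coord_linear[of b] by (simp add: Vector_Spaces.linear_iff)
  fix u v x y c
  show "coord b (wprod (u @ [alg_scale A c x + y] @ v)) = c * coord b (wprod (u @ [x] @ v)) + coord b (wprod (u @ [y] @ v))"
    by (simp add: wprod_append distrib_left distrib_right scale_mult mult_scale lin)
qed (simp_all add: wprod_append mult_assoc)

lemma mu_finite: "t \<in> T \<Longrightarrow> finite {b. t (\<lambda>w. coord b (wprod w)) \<noteq> 0}"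
proof (induction t rule: T_induct)
  case (diff s t)
  then show ?case
    using finite_support_diff[of "\<lambda>b. s (\<lambda>w. coord b (wprod w))" "\<lambda>b. t (\<lambda>w. coord b (wprod w))"] by simp
qed (auto simp: word_tensor_def wprod_form coord_finite)

lemma mu_finite':
  assumes "t \<in> T"
  shows "finite {b. alg_scale A (t (\<lambda>w. coord b (wprod w))) b \<noteq> 0}"
  by (rule finite_subset[OF _ mu_finite[OF assms]]) auto

lemma mu_additive: "additive_on T mu"
  unfolding additive_on_def
proof (intro ballI)
  fix s t assume "s \<in> T" "t \<in> T"
  from Sum_any.distrib[OF mu_finite'[OF this(1)] mu_finite'[OF this(2)]]
  show "mu (s + t) = mu s + mu t" by (simp add: mu_def vs.scale_left_distrib)
qed

lemma mu_word: "mu (wt w) = wprod w"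
proof -
  have "mu (wt w) = (\<Sum>b | coord b (wprod w) \<noteq> 0. alg_scale A (coord b (wprod w)) b)"
    unfolding mu_def by (rule Sum_any.expand_superset[THEN trans])
      (auto simp: coord_finite word_tensor_def wprod_form)
  then show ?thesis by (simp add: coord_sum)
qed

lemma mu_scale:
  assumes "t \<in> T"
  shows "mu (\<lambda>\<beta>. c * t \<beta>) = alg_scale A c (mu t)"
proof -
  have "alg_scale A c (mu t) = Sum_any (\<lambda>b. alg_scale A c (alg_scale A (t (\<lambda>w. coord b (wprod w))) b))"
    unfolding mu_def
    by (rule additive_on_Sum_any[OF add_subgroup_UNIV _ UNIV_I mu_finite'[OF assms]])
      (simp add: additive_on_def vs.scale_right_distrib)
  then show ?thesis by (simp add: mu_def)
qed

lemma mu_zero: "mu 0 = 0" and mu_diff: "s \<in> T \<Longrightarrow> t \<in> T \<Longrightarrow> mu (s - t) = mu s - mu t"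
  and mu_sum: "(\<And>i. i \<in> I \<Longrightarrow> f i \<in> T) \<Longrightarrow> mu (\<Sum>i\<in>I. f i) = (\<Sum>i\<in>I. mu (f i))"
  by (rule additive_on_zero[OF T_subgroup mu_additive], rule additive_on_diff[OF T_subgroup mu_additive],
      assumption+, rule additive_on_sum[OF T_subgroup mu_additive])

lemma mu_mult:
  assumes s: "s \<in> T" and t: "t \<in> T"
  shows "mu (s \<odot> t) = mu s \<cdot>\<^bsub>A\<^esub> mu t"
  using s
proof (induction rule: T_induct)
  case zero
  show ?case by (simp only: tm_zero mu_zero zero_mult)
next
  case (diff s s')
  then show ?case
    by (simp only: tm_diff mu_diff tm_closed t additive_on_diff[OF add_subgroup_UNIV additive_mult_left UNIV_I UNIV_I])
next
  case (word u)
  note u = wt_T[OF word]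
  show ?case
    using t
  proof (induction rule: T_induct)
    case zero
    show ?case by (simp only: tm_zero(2)[OF u] mu_zero mult_zero)
  next
    case (diff t t')
    then show ?case
      by (simp only: tm_diff(2)[OF u] mu_diff tm_closed u additive_on_diff[OF add_subgroup_UNIV additive_mult_right UNIV_I UNIV_I])
  next
    case (word w)
    show ?case by (simp only: wt_mult mu_word wprod_append)
  qed
qed

section \<open>Tensor powers and ideals\<close>

abbreviation TP where "TP \<equiv> tensor_power A D"
abbreviation ideal where "ideal \<equiv> tensor_algebra_ideal A D"

lemma TP_gen: "a \<in> D 0 \<Longrightarrow> w \<in> lists (D 1) \<Longrightarrow> wt (a # w) \<in> TP (length w)"
  unfolding tensor_power_def by (rule hull_inc) blast

lemma TP_T: "TP n \<subseteq> T"
  unfolding tensor_power_def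
proof (rule hull_minimal[where S = add_subgroup, OF _ T_subgroup])
  have "wt (a # w) \<in> T" if "a \<in> D 0" "w \<in> lists (D 1)" for a w
    by (rule wt_T) (use that in \<open>auto simp: in_lists_conv_set\<close>)
  then show "{wt (a # w) |a w. a \<in> D 0 \<and> w \<in> lists (D 1) \<and> length w = n} \<subseteq> T" by blast
qed

lemma wprod_D: "w \<in> lists (D 1) \<Longrightarrow> wprod w \<in> D (length w)"
  by (induction w) (use mult_D[of _ 1] in \<open>auto simp: one_D\<close>)

lemma mu_TP: "mu ` TP n \<subseteq> D n"
proof
  fix x assume "x \<in> mu ` TP n"
  then obtain t where t: "t \<in> TP n" "x = mu t" by blast
  have "mu t \<in> D n"
  proof (rule additive_on_hull_mem[where f = mu, OF _ subD _ t(1)[unfolded tensor_power_def]])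
    show "additive_on (add_subgroup hull {wt (a # w) |a w. a \<in> D 0 \<and> w \<in> lists (D 1) \<and> length w = n}) mu"
      by (rule additive_on_subset[OF mu_additive TP_T[unfolded tensor_power_def]])
    fix s assume "s \<in> {wt (a # w) |a w. a \<in> D 0 \<and> w \<in> lists (D 1) \<and> length w = n}"
    then obtain a w where aw: "s = wt (a # w)" "a \<in> D 0" "w \<in> lists (D 1)" "length w = n" by blast
    then show "mu s \<in> D n"
      using mult_D[OF aw(2) wprod_D[OF aw(3)]] by (simp add: mu_word)
  qed
  then show "x \<in> D n" by (simp add: t(2))
qed

text \<open>A letter of degree 0 is absorbed into its neighbour, and a leading 1 is inserted before
  a letter of degree 1. Hence every word belongs to some tensor power.\<close>

lemma word_normal_form:
  "w \<in> lists (D 0 \<union> D 1) \<Longrightarrow> \<exists>a\<in>D 0. \<exists>w'\<in>lists (D 1). wt w = wt (a # w')"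
proof (induction w)
  case Nil
  show ?case
    using one_D wt_one[of "[]" "[]"] by (intro bexI[of _ "alg_one A"] bexI[of _ "[]"]) simp_all
next
  case (Cons x w)
  then obtain a w' where aw: "a \<in> D 0" "w' \<in> lists (D 1)" "wt w = wt (a # w')" by auto
  have x: "x \<in> D 0 \<union> D 1" using Cons.prems by simp
  have "wt (x # w) = wt [x] \<odot> wt w" by (simp add: wt_mult)
  also have "\<dots> = wt (x # a # w')" by (simp add: wt_mult aw(3))
  also have "\<dots> = wt ((x \<cdot>\<^bsub>A\<^esub> a) # w')"
    using wt_right[OF aw(1) x, of "[]" w'] by simp
  finally have e: "wt (x # w) = wt ((x \<cdot>\<^bsub>A\<^esub> a) # w')" .
  show ?case
  proof (cases "x \<in> D 0")
    case True
    then show ?thesis using e aw mult_D[of x 0 a 0] by auto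
  next
    case False
    then have "x \<cdot>\<^bsub>A\<^esub> a \<in> D 1" using x mult_D[of x 1 a 0] aw(1) by auto
    moreover have "wt ((x \<cdot>\<^bsub>A\<^esub> a) # w') = wt (alg_one A # (x \<cdot>\<^bsub>A\<^esub> a) # w')"
      using wt_one[of "[]" "(x \<cdot>\<^bsub>A\<^esub> a) # w'"] by simp
    ultimately show ?thesis
      using e aw(2) one_D by (intro bexI[of _ "alg_one A"] bexI[of _ "(x \<cdot>\<^bsub>A\<^esub> a) # w'"]) auto
  qed
qed

lemma ideal_subgroup: "add_subgroup (ideal X)"
  by (simp add: tensor_algebra_ideal_def)

lemma ideal_gen: "s \<in> T \<Longrightarrow> x \<in> X \<Longrightarrow> t \<in> T \<Longrightarrow> s \<odot> x \<odot> t \<in> ideal X"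
  unfolding tensor_algebra_ideal_def by (rule hull_inc) blast

lemma ideal_inc:
  assumes "X \<subseteq> T" "x \<in> X" shows "x \<in> ideal X"
proof -
  have "x \<in> T" using assms by blast
  then show ?thesis
    using ideal_gen[OF wt_T assms(2) wt_T, of "[]" "[]"] by (simp add: tm_one)
qed

lemma ideal_right:
  assumes X: "X \<subseteq> T" and y: "y \<in> ideal X" and r: "r \<in> T"
  shows "y \<odot> r \<in> ideal X"
proof (rule additive_on_hull_mem[where f = "\<lambda>y. y \<odot> r", OF tm_add_left ideal_subgroup _ y[unfolded tensor_algebra_ideal_def]])
  fix y assume "y \<in> {s \<odot> x \<odot> t |s x t. s \<in> T \<and> x \<in> X \<and> t \<in> T}"
  then obtain s x t where y: "y = s \<odot> x \<odot> t" "s \<in> T" "x \<in> X" "t \<in> T" by blast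
  then show "y \<odot> r \<in> ideal X"
    using ideal_gen[OF y(2,3) tm_closed[OF y(4) r]] by (simp add: tm_assoc[OF r])
qed

lemma mu_ideal:
  assumes X: "X \<subseteq> T" and mu: "\<And>x. x \<in> X \<Longrightarrow> mu x = 0"
  shows "ideal X \<subseteq> {t \<in> T. mu t = 0}"
  unfolding tensor_algebra_ideal_def
proof (rule hull_minimal)
  show "add_subgroup {t \<in> T. mu t = 0}"
    unfolding add_subgroup_def
    by (auto simp: mu_zero mu_diff add_subgroup_zero[OF T_subgroup] add_subgroup_diff[OF T_subgroup])
  show "{s \<odot> x \<odot> t |s x t. s \<in> T \<and> x \<in> X \<and> t \<in> T} \<subseteq> {t \<in> T. mu t = 0}"
    using X mu by (auto simp: mu_mult tm_closed subset_iff)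
qed

end

lemma
  assumes A: "tens_alg A D" and B: "tens_alg B E" and f: "letter_hom A D B E f"
  shows word_map_T: "t \<in> tensor_algebra A D \<Longrightarrow> word_map B E f t \<in> tensor_algebra B E"
    and word_map_mult: "t \<in> tensor_algebra A D \<Longrightarrow>
      word_map B E f (tensor_algebra_mult A D s t) = tensor_algebra_mult B E (word_map B E f s) (word_map B E f t)"
    and word_map_TP: "word_map B E f ` tensor_power A D n \<subseteq> tensor_power B E n"
proof -
  interpret A: tens_alg A D by (rule A)
  interpret B: tens_alg B E by (rule B)
  have fD: "f x \<in> E i" if "i \<in> {0, 1}" "x \<in> D i" for i x
    using f that by (auto simp: letter_hom_def)
  show T: "word_map B E f t \<in> B.T" if "t \<in> A.T" for t
  proof (rule additive_on_hull_mem[where f = "word_map B E f", OF word_map_add B.T_subgroup _ that[unfolded tensor_algebra_def]])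
    fix s assume "s \<in> {A.wt w |w. w \<in> lists (D 0 \<union> D 1)}"
    then obtain w where w: "s = A.wt w" "w \<in> lists (D 0 \<union> D 1)" by blast
    have "map f w \<in> lists (E 0 \<union> E 1)"
      using w(2) fD by (force simp: in_lists_conv_set)
    then show "word_map B E f s \<in> B.T"
      by (simp add: w(1) word_map_word[OF f] B.wt_T)
  qed
  show "word_map B E f ` A.TP n \<subseteq> B.TP n"
  proof (rule image_subsetI)
    fix t assume t: "t \<in> A.TP n"
    show "word_map B E f t \<in> B.TP n"
    proof (rule additive_on_hull_mem[where f = "word_map B E f", OF word_map_add _ _ t[unfolded tensor_power_def]])
      fix s assume "s \<in> {A.wt (a # w) |a w. a \<in> D 0 \<and> w \<in> lists (D 1) \<and> length w = n}"
      then obtain a w where aw: "s = A.wt (a # w)" "a \<in> D 0" "w \<in> lists (D 1)" "length w = n" by blast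
      have "map f w \<in> lists (E 1)"
        using aw(3) fD by (auto simp: in_lists_conv_set)
      then show "word_map B E f s \<in> B.TP n"
        using B.TP_gen[of "f a" "map f w"] fD[of 0 a] aw by (simp add: word_map_word[OF f])
    qed (simp add: tensor_power_def)
  qed
  show "word_map B E f (tensor_algebra_mult A D s t) = tensor_algebra_mult B E (word_map B E f s) (word_map B E f t)"
    if t: "t \<in> A.T"
  proof
    fix \<beta>
    show "word_map B E f (tensor_algebra_mult A D s t) \<beta> =
        tensor_algebra_mult B E (word_map B E f s) (word_map B E f t) \<beta>"
    proof (cases "word_form B E \<beta>")
      case True
      have "word_form B E (\<lambda>u. word_map B E f t (\<lambda>v. \<beta> (u @ v)))"
        by (rule B.T_form[OF T[OF t] True])
      then show ?thesis
        using True by (simp add: tensor_algebra_mult_def word_map_def word_form_map[OF f] word_form_shift)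
    qed (simp add: tensor_algebra_mult_def word_map_def)
  qed
qed

lemma additive_on_image_subgroup:
  assumes "add_subgroup H" "additive_on H f"
  shows "add_subgroup (f ` H)"
  unfolding add_subgroup_def
proof (intro conjI ballI)
  show "0 \<in> f ` H"
    using additive_on_zero[OF assms] add_subgroup_zero[OF assms(1)] by (metis image_eqI)
  fix x y assume "x \<in> f ` H" "y \<in> f ` H"
  then obtain u v where "u \<in> H" "v \<in> H" "x = f u" "y = f v" by blast
  then show "x - y \<in> f ` H"
    using additive_on_diff[OF assms] add_subgroup_diff[OF assms(1)] by (metis image_eqI)
qed

lemma word_map_ideal:
  assumes A: "tens_alg A D" and B: "tens_alg B E" and f: "letter_hom A D B E f"
    and X: "X \<subseteq> tensor_algebra A D" and t: "t \<in> tensor_algebra_ideal A D X"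
  shows "word_map B E f t \<in> tensor_algebra_ideal B E (word_map B E f ` X)"
proof (rule additive_on_hull_mem[where f = "word_map B E f", OF word_map_add _ _ t[unfolded tensor_algebra_ideal_def]])
  interpret A: tens_alg A D by (rule A)
  interpret B: tens_alg B E by (rule B)
  show "add_subgroup (B.ideal (word_map B E f ` X))"
    by (rule B.ideal_subgroup)
  fix y assume "y \<in> {A.tm (A.tm s x) u |s x u. s \<in> A.T \<and> x \<in> X \<and> u \<in> A.T}"
  then obtain s x u where y: "y = A.tm (A.tm s x) u" "s \<in> A.T" "x \<in> X" "u \<in> A.T" by blast
  then have x: "x \<in> A.T" using X by blast
  show "word_map B E f y \<in> B.ideal (word_map B E f ` X)"
    unfolding y(1) word_map_mult[OF A B f y(4)] word_map_mult[OF A B f x]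
    by (rule B.ideal_gen[OF word_map_T[OF A B f y(2)] imageI[OF y(3)] word_map_T[OF A B f y(4)]])
qed

section \<open>Normalising the presentation\<close>

context tens_alg
begin

text \<open>Any surjection \<open>\<phi>\<close> from the tensor algebra can be replaced by the product \<open>mu\<close>, since \<open>\<phi>\<close> is \<open>mu\<close>
  after the endomorphism \<open>F\<close> of the tensor algebra that applies \<open>\<phi>\<close> to every letter, and \<open>F\<close> is onto.\<close>

definition presented :: "nat \<Rightarrow> ('k, 'b) word_tens set \<Rightarrow> bool" where
  "presented d X \<longleftrightarrow> X \<subseteq> TP d \<and> mu ` T = UNIV \<and> {t \<in> T. mu t = 0} = ideal X"

lemma TP_letter: "i \<in> {0, 1} \<Longrightarrow> x \<in> D i \<Longrightarrow> wt [x] \<in> TP i"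
  using TP_gen[of x "[]"] TP_gen[OF one_D, of "[x]"] wt_one[of "[]" "[x]"] by auto

lemma TP_subgroup: "add_subgroup (TP n)"
  by (simp add: tensor_power_def)

context
  fixes \<phi> :: "('k, 'b) word_tens \<Rightarrow> 'b"
  assumes \<phi>: "\<And>s t. s \<in> T \<Longrightarrow> t \<in> T \<Longrightarrow> \<phi> (s + t) = \<phi> s + \<phi> t \<and> \<phi> (s \<odot> t) = \<phi> s \<cdot>\<^bsub>A\<^esub> \<phi> t"
    and scale: "\<And>c t. t \<in> T \<Longrightarrow> \<phi> (\<lambda>\<beta>. c * t \<beta>) = alg_scale A c (\<phi> t)"
    and one: "\<phi> (wt []) = alg_one A"
    and deg: "\<And>n. \<phi> ` TP n \<subseteq> D n"
begin

lemma hom_additive: "additive_on T \<phi>"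
  using \<phi> by (simp add: additive_on_def)

text \<open>Since \<open>\<phi>\<close> preserves degrees it sends letters to letters of the same
  degree, which is what permits applying it letter by letter.\<close>

lemma hom_letter: "letter_hom A D A D (\<lambda>x. \<phi> (wt [x]))"
proof -
  have i01: "a \<in> D 0 \<union> D 1" if "a \<in> D 0" for a using that by simp
  have T1: "wt [x] \<in> T" if "x \<in> D 0 \<union> D 1" for x
    by (rule wt_T) (use that in simp)
  have m: "\<phi> (wt [a, x]) = \<phi> (wt [a]) \<cdot>\<^bsub>A\<^esub> \<phi> (wt [x])" if "a \<in> D 0 \<union> D 1" "x \<in> D 0 \<union> D 1" for a x
    using \<phi>[OF T1[OF that(1)] T1[OF that(2)]] by (simp add: wt_mult)
  have 1: "\<phi> (wt [x]) \<in> D i" if "i \<in> {0, 1}" "x \<in> D i" for i x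
    using TP_letter[OF that] deg by blast
  have 2: "\<phi> (wt [alg_scale A c x + y]) = alg_scale A c (\<phi> (wt [x])) + \<phi> (wt [y])"
    if i: "i \<in> {0, 1}" "x \<in> D i" "y \<in> D i" for i x y c
  proof -
    have xy: "x \<in> D 0 \<union> D 1" "y \<in> D 0 \<union> D 1" "alg_scale A c x \<in> D 0 \<union> D 1"
      using i D_scale[of x i c] by auto
    have "wt [alg_scale A c x + y] = wt [alg_scale A c x] + wt [y]"
      using wt_add[OF i(1) D_scale[OF i(2)] i(3), of "[]" c "[]"] by simp
    then show ?thesis
      using \<phi>[OF T1[OF xy(3)] T1[OF xy(2)]] scale[OF T1[OF xy(1)], of c] by (simp add: wt_scale[OF i(1,2)])
  qed
  have 3: "\<phi> (wt [a \<cdot>\<^bsub>A\<^esub> x]) = \<phi> (wt [a]) \<cdot>\<^bsub>A\<^esub> \<phi> (wt [x])"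
    "\<phi> (wt [x \<cdot>\<^bsub>A\<^esub> a]) = \<phi> (wt [x]) \<cdot>\<^bsub>A\<^esub> \<phi> (wt [a])" if "a \<in> D 0" "x \<in> D 0 \<union> D 1" for a x
    using wt_left[OF that, of "[]" "[]"] wt_right[OF that, of "[]" "[]"] m[OF i01[OF that(1)] that(2)]
      m[OF that(2) i01[OF that(1)]] by simp_all
  have 4: "\<phi> (wt [alg_one A]) = alg_one A"
    using wt_one[of "[]" "[]"] one by simp
  show ?thesis
    unfolding letter_hom_def by (intro conjI ballI allI 4; rule 1 2 3; assumption)
qed

abbreviation F where "F \<equiv> word_map A D (\<lambda>x. \<phi> (wt [x]))"

lemmas F_T = word_map_T[OF tens_alg_axioms tens_alg_axioms hom_letter]
  and F_TP = word_map_TP[OF tens_alg_axioms tens_alg_axioms hom_letter]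
  and F_ideal = word_map_ideal[OF tens_alg_axioms tens_alg_axioms hom_letter]

lemma hom_word: "w \<in> lists (D 0 \<union> D 1) \<Longrightarrow> \<phi> (wt w) = wprod (map (\<lambda>x. \<phi> (wt [x])) w)"
proof (induction w)
  case (Cons x w)
  have x: "wt [x] \<in> T" "wt w \<in> T" by (rule wt_T, use Cons.prems in simp)+
  have "\<phi> (wt (x # w)) = \<phi> (wt [x] \<odot> wt w)" by (simp add: wt_mult)
  then show ?case using Cons \<phi>[OF x] by simp
qed (simp add: one)

lemma mu_F: "t \<in> T \<Longrightarrow> mu (F t) = \<phi> t"
proof (induction t rule: T_induct)
  case zero
  show ?case
    by (simp only: additive_on_zero[OF add_subgroup_UNIV word_map_add] mu_zero additive_on_zero[OF T_subgroup hom_additive])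
next
  case (diff s t)
  then show ?case
    by (simp only: additive_on_diff[OF add_subgroup_UNIV word_map_add UNIV_I UNIV_I] mu_diff F_T
        additive_on_diff[OF T_subgroup hom_additive])
next
  case (word w)
  then show ?case by (simp add: word_map_word[OF hom_letter] mu_word hom_word)
qed

text \<open>Every word lies in one tensor power and \<open>\<phi>\<close> respects degrees, so the
  components of a value of \<open>\<phi>\<close> are again values, taken on single tensor
  powers.\<close>

lemma hom_component: "t \<in> T \<Longrightarrow> \<exists>s\<in>TP i. component D i (\<phi> t) = \<phi> s"
proof (induction t rule: T_induct)
  case zero
  have "component D i (\<phi> 0) = \<phi> 0"
    by (simp only: additive_on_zero[OF T_subgroup hom_additive] additive_on_zero[OF add_subgroup_UNIV component_additive[OF dsD]])
  then show ?case using add_subgroup_zero[OF TP_subgroup] by blast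
next
  case (diff s t)
  then obtain s' t' where s': "s' \<in> TP i" "component D i (\<phi> s) = \<phi> s'"
    and t': "t' \<in> TP i" "component D i (\<phi> t) = \<phi> t'" by blast
  have "component D i (\<phi> (s - t)) = \<phi> (s' - t')"
    by (simp only: additive_on_diff[OF T_subgroup hom_additive] diff(1,2) TP_T[THEN subsetD, OF s'(1)]
        TP_T[THEN subsetD, OF t'(1)] additive_on_diff[OF add_subgroup_UNIV component_additive[OF dsD] UNIV_I UNIV_I] s' t')
  then show ?case using add_subgroup_diff[OF TP_subgroup s'(1) t'(1)] by blast
next
  case (word w)
  obtain a w' where aw: "a \<in> D 0" "w' \<in> lists (D 1)" "wt w = wt (a # w')"
    using word_normal_form[OF word] by blast
  have *: "wt w \<in> TP (length w')" unfolding aw(3) by (rule TP_gen[OF aw(1,2)])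
  then have "\<phi> (wt w) \<in> D (length w')" using deg by blast
  then have c: "component D i (\<phi> (wt w)) = (if i = length w' then \<phi> (wt w) else 0)"
    by (rule component_hom[OF dsD])
  show ?case
  proof (cases "i = length w'")
    case True
    then show ?thesis using c * by auto
  next
    case False
    then have "component D i (\<phi> (wt w)) = \<phi> 0"
      unfolding c by (simp only: if_False additive_on_zero[OF T_subgroup hom_additive])
    then show ?thesis using add_subgroup_zero[OF TP_subgroup] by blast
  qed
qed

text \<open>A tensor power with at most one factor consists of sums of one-letter words, so
  surjectivity of \<open>\<phi>\<close> in degrees 0 and 1 is surjectivity on letters.\<close>

lemma hom_letters_onto:
  assumes onto: "\<phi> ` T = UNIV" and i: "i \<in> {0, 1}"
  shows "D i \<subseteq> (\<lambda>x. \<phi> (wt [x])) ` D i"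
proof
  fix y assume y: "y \<in> D i"
  have f: "additive_on (D i) (\<lambda>x. \<phi> (wt [x]))"
    unfolding additive_on_def
  proof (intro ballI)
    fix x z assume "x \<in> D i" "z \<in> D i"
    then show "\<phi> (wt [x + z]) = \<phi> (wt [x]) + \<phi> (wt [z])"
      using hom_letter i unfolding letter_hom_def by (metis vs.scale_one)
  qed
  obtain t where t: "t \<in> T" "y = \<phi> t" using onto by (metis UNIV_I image_iff)
  then obtain s where s: "s \<in> TP i" "y = \<phi> s"
    using hom_component[OF t(1), of i] component_hom[OF dsD y, of i] by auto
  have "\<phi> s \<in> (\<lambda>x. \<phi> (wt [x])) ` D i"
  proof (rule additive_on_hull_mem[where f = \<phi>, OF _ additive_on_image_subgroup[OF subD f] _ s(1)[unfolded tensor_power_def]])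
    show "additive_on (add_subgroup hull {wt (a # w) |a w. a \<in> D 0 \<and> w \<in> lists (D 1) \<and> length w = i}) \<phi>"
      by (rule additive_on_subset[OF hom_additive TP_T[unfolded tensor_power_def]])
    fix r assume "r \<in> {wt (a # w) |a w. a \<in> D 0 \<and> w \<in> lists (D 1) \<and> length w = i}"
    then obtain a w where r: "r = wt (a # w)" "a \<in> D 0" "w \<in> lists (D 1)" "length w = i" by blast
    have "\<exists>x\<in>D i. r = wt [x]"
    proof (cases "i = 0")
      case True
      then show ?thesis using r by auto
    next
      case False
      then have "length w = 1" using i r(4) by simp
      then obtain x where w: "w = [x]" by (auto simp: length_Suc_conv)
      then have x: "x \<in> D 1" and "i = 1" using r by auto
      then have "r = wt [a \<cdot>\<^bsub>A\<^esub> x]"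
        using wt_left[OF r(2), of x "[]" "[]"] by (simp add: r(1) w)
      then show ?thesis using mult_D[OF r(2) x] \<open>i = 1\<close> by auto
    qed
    then show "\<phi> r \<in> (\<lambda>x. \<phi> (wt [x])) ` D i" by auto
  qed
  then show "y \<in> (\<lambda>x. \<phi> (wt [x])) ` D i" by (simp add: s(2))
qed

lemma F_onto:
  assumes onto: "\<phi> ` T = UNIV"
  shows "T \<subseteq> F ` T"
proof -
  have "wt w \<in> F ` T" if w: "w \<in> lists (D 0 \<union> D 1)" for w
  proof -
    have "D 0 \<union> D 1 \<subseteq> (\<lambda>x. \<phi> (wt [x])) ` (D 0 \<union> D 1)"
      using hom_letters_onto[OF onto, of 0] hom_letters_onto[OF onto, of 1] by blast
    then have "lists (D 0 \<union> D 1) \<subseteq> map (\<lambda>x. \<phi> (wt [x])) ` lists (D 0 \<union> D 1)"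
      by (subst lists_image[symmetric]) (rule lists_mono)
    then obtain v where "v \<in> lists (D 0 \<union> D 1)" "w = map (\<lambda>x. \<phi> (wt [x])) v" using w by blast
    then have "wt w = F (wt v)" "wt v \<in> T" by (simp_all add: word_map_word[OF hom_letter] wt_T)
    then show ?thesis by blast
  qed
  then have "{wt w |w. w \<in> lists (D 0 \<union> D 1)} \<subseteq> F ` T" by blast
  then show ?thesis
    unfolding tensor_algebra_def[of A D, THEN eq_reflection]
    by (rule hull_minimal[where S = add_subgroup])
      (rule additive_on_image_subgroup[OF add_subgroup_hull word_map_add])
qed

text \<open>As \<open>mu\<close> after \<open>F\<close> is \<open>\<phi>\<close> and
  \<open>F\<close> is onto, the kernel of \<open>mu\<close> is the image of the kernel of
  \<open>\<phi>\<close>; and \<open>F\<close> carries the ideal of \<open>X\<close> into the ideal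
  of the image of \<open>X\<close>.\<close>

lemma presented_image:
  assumes X: "X \<subseteq> TP d" and onto: "\<phi> ` T = UNIV" and ker: "{t \<in> T. \<phi> t = 0} = ideal X"
  shows "presented d (F ` X)"
  unfolding presented_def
proof (intro conjI)
  have XT: "X \<subseteq> T" using X TP_T by blast
  show FX: "F ` X \<subseteq> TP d" using image_mono[OF X] F_TP by (rule subset_trans)
  have "\<phi> ` T \<subseteq> mu ` T"
  proof (rule image_subsetI)
    fix t assume "t \<in> T"
    then show "\<phi> t \<in> mu ` T" using mu_F[symmetric] F_T by (metis imageI)
  qed
  then show "mu ` T = UNIV" by (simp only: onto top.extremum_unique)
  have "ideal (F ` X) \<subseteq> {t \<in> T. mu t = 0}"
  proof (rule mu_ideal)
    show "F ` X \<subseteq> T" using FX TP_T by (rule subset_trans)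
    fix y assume "y \<in> F ` X"
    then obtain x where x: "x \<in> X" "y = F x" by blast
    then have "x \<in> {t \<in> T. \<phi> t = 0}" unfolding ker using ideal_inc[OF XT] by simp
    then show "mu y = 0" using mu_F by (simp add: x(2))
  qed
  moreover have "t \<in> ideal (F ` X)" if t: "t \<in> T" "mu t = 0" for t
  proof -
    obtain s where s: "s \<in> T" "t = F s" using F_onto[OF onto] t(1) by blast
    then have "\<phi> s = 0" using mu_F t(2) by simp
    then have "s \<in> ideal X" using s(1) ker by blast
    then show ?thesis unfolding s(2) by (rule F_ideal[OF XT])
  qed
  ultimately show "{t \<in> T. mu t = 0} = ideal (F ` X)" by blast
qed

end

text \<open>The existentially quantified surjection is traded for the fixed map \<open>mu\<close>,
  so a presentation is just a set of relations and can be moved to \<open>S\<close> as a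
  set.\<close>

lemma homogeneous_iff_presented:
  "homogeneous d A D \<longleftrightarrow>
     semisimple_subring A (D 0) \<and> (\<forall>i. finite_dim A (D i)) \<and>
     (\<forall>i j. D (i + j) = add_subgroup hull {a \<cdot>\<^bsub>A\<^esub> b |a b. a \<in> D i \<and> b \<in> D j}) \<and>
     2 \<le> d \<and> (\<exists>X. presented d X)" (is "_ \<longleftrightarrow> ?r")
proof
  assume H: "homogeneous d A D"
  then obtain X \<phi> where X: "X \<subseteq> TP d"
    and \<phi>: "\<forall>s\<in>T. \<forall>t\<in>T. \<phi> (s + t) = \<phi> s + \<phi> t \<and> \<phi> (s \<odot> t) = \<phi> s \<cdot>\<^bsub>A\<^esub> \<phi> t"
      "\<forall>c. \<forall>t\<in>T. \<phi> (\<lambda>\<beta>. c * t \<beta>) = alg_scale A c (\<phi> t)"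
      "\<phi> (wt []) = alg_one A" "\<forall>n. \<phi> ` TP n \<subseteq> D n"
    and o: "\<phi> ` T = UNIV" "{t \<in> T. \<phi> t = 0} = ideal X"
    unfolding homogeneous_def by (elim exE conjE)
  have "presented d (word_map A D (\<lambda>x. \<phi> (wt [x])) ` X)"
    by (rule presented_image[OF _ _ _ _ X o])
      (rule \<phi>(1)[rule_format] \<phi>(2)[rule_format] \<phi>(3) \<phi>(4)[rule_format]; assumption)+
  then have "\<exists>X. presented d X" by (rule exI)
  then show ?r using H unfolding homogeneous_def by (elim conjE) (intro conjI)
next
  assume r: ?r
  then obtain X where X: "X \<subseteq> TP d" "mu ` T = UNIV" "{t \<in> T. mu t = 0} = ideal X"
    unfolding presented_def by blast
  have 1: "\<forall>s\<in>T. \<forall>t\<in>T. mu (s + t) = mu s + mu t \<and> mu (s \<odot> t) = mu s \<cdot>\<^bsub>A\<^esub> mu t"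
    using mu_additive mu_mult by (simp only: additive_on_def) simp
  have 2: "\<forall>c. \<forall>t\<in>T. mu (\<lambda>\<beta>. c * t \<beta>) = alg_scale A c (mu t)" using mu_scale by simp
  have 3: "mu (wt []) = alg_one A" by (simp add: mu_word)
  have 4: "\<forall>n. mu ` TP n \<subseteq> D n" using mu_TP by simp
  have "\<exists>X \<phi>. X \<subseteq> TP d \<and> (\<forall>s\<in>T. \<forall>t\<in>T. \<phi> (s + t) = \<phi> s + \<phi> t \<and> \<phi> (s \<odot> t) = \<phi> s \<cdot>\<^bsub>A\<^esub> \<phi> t) \<and>
      (\<forall>c. \<forall>t\<in>T. \<phi> (\<lambda>\<beta>. c * t \<beta>) = alg_scale A c (\<phi> t)) \<and> \<phi> (wt []) = alg_one A \<and>
      (\<forall>n. \<phi> ` TP n \<subseteq> D n) \<and> \<phi> ` T = UNIV \<and> {t \<in> T. \<phi> t = 0} = ideal X"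
    by (intro exI conjI) (rule X 1 2 3 4)+
  with r gr show "homogeneous d A D"
    unfolding homogeneous_def by (elim conjE) (intro conjI)
qed

end

section \<open>The tensor algebra of \<open>S\<close> over that of \<open>R\<close>\<close>

context smash_loc
begin

context
  assumes grN: "graded_algebra R (N_part D)"
begin

interpretation TR: tens_alg R "N_part D"
  by unfold_locales (rule grN)

interpretation TS: tens_alg S "smash_grading D"
  by unfold_locales (rule graded_smash)

lemma letter_hom_cst: "letter_hom R (N_part D) S (smash_grading D) (\<lambda>r _. r)"
  by (auto simp: letter_hom_def smash_grading_def cst_mult_cst fun_eq_iff)

abbreviation J :: "('k, 'r) word_tens \<Rightarrow> ('k, 'g \<Rightarrow> 'r) word_tens" where
  "J \<equiv> word_map S (smash_grading D) (\<lambda>r _. r)"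

abbreviation e :: "'g \<Rightarrow> ('k, 'g \<Rightarrow> 'r) word_tens" where
  "e h \<equiv> TS.wt [pt h (alg_one R)]"

lemmas J_T = word_map_T[OF TR.tens_alg_axioms TS.tens_alg_axioms letter_hom_cst]
  and J_TP = word_map_TP[OF TR.tens_alg_axioms TS.tens_alg_axioms letter_hom_cst]
  and J_ideal = word_map_ideal[OF TR.tens_alg_axioms TS.tens_alg_axioms letter_hom_cst]
  and J_mult = word_map_mult[OF TR.tens_alg_axioms TS.tens_alg_axioms letter_hom_cst]
  and J_word = word_map_word[OF letter_hom_cst]

lemma pt_grading: "x \<in> N_part D n \<Longrightarrow> pt h x \<in> smash_grading D n"
  using add_subgroup_zero[OF direct_sum_add_subgroup[OF dN]] by (simp add: smash_grading_def pt_apply)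

lemma e_T: "e h \<in> TS.T"
  by (rule TS.wt_T) (simp add: pt_grading[OF TR.one_D])

lemma wprod_cst: "TS.wprod (map (\<lambda>r _. r) w) = (\<lambda>_. TR.wprod w)"
  by (induction w) (simp_all add: cst_mult_cst)

lemma mu_J: "t \<in> TR.T \<Longrightarrow> TS.mu (J t) = (\<lambda>_. TR.mu t)"
proof (induction t rule: TR.T_induct)
  case zero
  show ?case
    unfolding additive_on_zero[OF add_subgroup_UNIV word_map_add] TS.mu_zero TR.mu_zero by (rule zero_fun_def)
next
  case (diff s t)
  show ?case
    unfolding additive_on_diff[OF add_subgroup_UNIV word_map_add UNIV_I UNIV_I]
      TS.mu_diff[OF J_T[OF diff(1)] J_T[OF diff(2)]] TR.mu_diff[OF diff(1,2)] diff(3,4)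
    by (rule fun_diff_def)
next
  case (word w)
  show ?case by (simp only: J_word TS.mu_word TR.mu_word wprod_cst)
qed

text \<open>\<open>J\<close> comes from r \<mapsto> r # 1 on letters and \<open>e h\<close> is the
  one-letter word p_h. The idempotents are placed on the right so that membership of each
  coefficient in the ideal passes to the whole sum.\<close>

definition right_span :: "('k, 'g \<Rightarrow> 'r) word_tens set" where
  "right_span = {\<Sum>h\<in>UNIV. TS.tm (J (t h)) (e h) |t. \<forall>h. t h \<in> TR.T}"

lemma right_span_subgroup: "add_subgroup right_span"
  unfolding add_subgroup_def
proof (intro conjI ballI)
  have "(\<Sum>h\<in>UNIV. TS.tm (J 0) (e h)) = 0"
    by (simp only: additive_on_zero[OF add_subgroup_UNIV word_map_add] TS.tm_zero sum.neutral_const)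
  then show "0 \<in> right_span"
    using add_subgroup_zero[OF TR.T_subgroup] unfolding right_span_def by force
  fix x y assume "x \<in> right_span" "y \<in> right_span"
  then obtain s t where s: "\<forall>h. s h \<in> TR.T" "x = (\<Sum>h\<in>UNIV. TS.tm (J (s h)) (e h))"
    and t: "\<forall>h. t h \<in> TR.T" "y = (\<Sum>h\<in>UNIV. TS.tm (J (t h)) (e h))"
    unfolding right_span_def by blast
  have "x - y = (\<Sum>h\<in>UNIV. TS.tm (J (s h - t h)) (e h))"
    unfolding s(2) t(2) sum_subtractf[symmetric]
    by (simp only: additive_on_diff[OF add_subgroup_UNIV word_map_add UNIV_I UNIV_I] TS.tm_diff)
  moreover have "\<forall>h. s h - t h \<in> TR.T"
    using s(1) t(1) add_subgroup_diff[OF TR.T_subgroup] by blast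
  ultimately show "x - y \<in> right_span"
    unfolding right_span_def by (intro CollectI exI[of _ "\<lambda>h. s h - t h"] conjI)
qed

lemma J_e_span:
  assumes "t \<in> TR.T"
  shows "TS.tm (J t) (e h) \<in> right_span"
proof -
  have "(\<Sum>k\<in>UNIV. TS.tm (J (if k = h then t else 0)) (e k)) = (\<Sum>k\<in>UNIV. if k = h then TS.tm (J t) (e k) else 0)"
  proof (rule sum.cong[OF refl])
    fix k
    show "TS.tm (J (if k = h then t else 0)) (e k) = (if k = h then TS.tm (J t) (e k) else 0)"
      by (cases "k = h") (simp_all only: simp_thms if_True if_False additive_on_zero[OF add_subgroup_UNIV word_map_add] TS.tm_zero)
  qed
  also have "\<dots> = TS.tm (J t) (e h)" by (subst sum.delta) simp_all
  finally have "TS.tm (J t) (e h) = (\<Sum>k\<in>UNIV. TS.tm (J (if k = h then t else 0)) (e k))" by (rule sym)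
  moreover have "\<forall>k. (if k = h then t else 0) \<in> TR.T"
    using assms add_subgroup_zero[OF TR.T_subgroup] by simp
  ultimately show ?thesis
    unfolding right_span_def by (intro CollectI exI[of _ "\<lambda>k. if k = h then t else 0"] conjI)
qed

lemma right_span_J:
  assumes s: "s \<in> TR.T" and y: "y \<in> right_span"
  shows "TS.tm (J s) y \<in> right_span"
proof -
  obtain t where t: "\<forall>h. t h \<in> TR.T" "y = (\<Sum>h\<in>UNIV. TS.tm (J (t h)) (e h))"
    using y unfolding right_span_def by blast
  have "TS.tm (J s) y = (\<Sum>h\<in>UNIV. TS.tm (J s) (TS.tm (J (t h)) (e h)))"
    unfolding t(2) by (rule TS.tm_sum(2)[OF J_T[OF s]]) (simp only: TS.tm_closed J_T t(1) e_T)
  also have "\<dots> = (\<Sum>h\<in>UNIV. TS.tm (J (TR.tm s (t h))) (e h))"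
    using t(1) by (simp only: J_mult TS.tm_assoc[OF e_T])
  finally show ?thesis
    using add_subgroup_sum[OF right_span_subgroup] J_e_span TR.tm_closed[OF s] t(1) by (metis (no_types, lifting))
qed

text \<open>The commutation rule inside the tensor algebra: an idempotent is a letter of degree 0,
  so it may be merged with its neighbour, multiplied out in \<open>S\<close>, and split off on the
  other side.\<close>

lemma e_J:
  assumes i: "i \<in> {0, 1}" and b: "b \<in> N_part D i"
  shows "TS.tm (e g) (J (TR.wt [b])) = (\<Sum>k\<in>UNIV. TS.tm (J (TR.wt [pr (g - k) b])) (e k))"
proof -
  have b': "(\<lambda>_. b) \<in> smash_grading D 0 \<union> smash_grading D 1" using i b by (auto simp: smash_grading_def)
  have e0: "pt k (alg_one R) \<in> smash_grading D 0" for k by (rule pt_grading[OF TR.one_D])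
  have "TS.tm (e g) (J (TR.wt [b])) = TS.wt [pt g (alg_one R), \<lambda>_. b]"
    by (simp add: J_word TS.wt_mult)
  also have "\<dots> = TS.wt [pt g (alg_one R) \<cdot>\<^bsub>S\<^esub> (\<lambda>_. b)]"
    using TS.wt_left[OF e0 b', of "[]" g "[]"] by simp
  also have "pt g (alg_one R) \<cdot>\<^bsub>S\<^esub> (\<lambda>_. b) = (\<Sum>k\<in>UNIV. pt k (pr (g - k) b))"
    by (simp only: idem_mult sum_pt)
  also have "TS.wt [\<dots>] = (\<Sum>k\<in>UNIV. TS.wt [pt k (pr (g - k) b)])"
    using TS.wt_sum[OF i, of UNIV "\<lambda>k. pt k (pr (g - k) b)" "[]" "[]"] pt_grading[OF pr_N_part[OF b]] by simp
  also have "\<dots> = (\<Sum>k\<in>UNIV. TS.tm (J (TR.wt [pr (g - k) b])) (e k))"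
  proof (rule sum.cong[OF refl])
    fix k
    have c: "(\<lambda>_. pr (g - k) b) \<in> smash_grading D 0 \<union> smash_grading D 1"
      using i pr_N_part[OF b] by (auto simp: smash_grading_def)
    show "TS.wt [pt k (pr (g - k) b)] = TS.tm (J (TR.wt [pr (g - k) b])) (e k)"
      using TS.wt_right[OF e0 c, of "[]" k "[]"] by (simp add: J_word TS.wt_mult cst_mult_idem)
  qed
  finally show ?thesis .
qed

text \<open>The left idempotent moves through the word letter by letter and changes on the way,
  hence the generalisation over g. When it arrives at p_h the result is p_h or 0.\<close>

lemma e_J_e: "w \<in> lists (N_part D 0 \<union> N_part D 1) \<Longrightarrow> TS.tm (TS.tm (e g) (J (TR.wt w))) (e h) \<in> right_span"
proof (induction w arbitrary: g)
  case Nil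
  have e0: "pt k (alg_one R) \<in> smash_grading D 0" for k by (rule pt_grading[OF TR.one_D])
  then have e01: "pt k (alg_one R) \<in> smash_grading D 0 \<union> smash_grading D 1" for k by simp
  have "TS.tm (TS.tm (e g) (J (TR.wt []))) (e h) = TS.wt [pt g (alg_one R), pt h (alg_one R)]"
    by (simp add: J_word TS.wt_mult)
  also have "\<dots> = TS.wt [pt h (pt g (alg_one R) h)]"
    using TS.wt_left[OF e0 e01, of "[]" g h "[]"] by (simp add: mult_idem)
  also have "\<dots> = (if g = h then TS.tm (J (TR.wt [])) (e h) else 0)"
    using TS.wt_zero[of "[]" "[]"] by (simp add: pt_apply J_word TS.wt_mult pt_def flip: zero_fun_def)
  finally show ?case
    using J_e_span[OF TR.wt_T[OF lists.Nil]] add_subgroup_zero[OF right_span_subgroup] by simp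
next
  case (Cons b w)
  then have b: "b \<in> N_part D 0 \<union> N_part D 1" by simp
  have w: "TR.wt w \<in> TR.T" by (rule TR.wt_T) (use Cons.prems in simp)
  from b obtain i where i: "i \<in> {0, 1}" "b \<in> N_part D i" by blast
  have JT: "J (TR.wt [pr k b]) \<in> TS.T" "TR.wt [pr k b] \<in> TR.T" for k
    using i pr_N_part[OF i(2), of k] by (auto intro!: J_T TR.wt_T)
  have "J (TR.wt (b # w)) = TS.tm (J (TR.wt [b])) (J (TR.wt w))"
    by (simp add: J_word TS.wt_mult)
  then have "TS.tm (TS.tm (e g) (J (TR.wt (b # w)))) (e h) =
      TS.tm (TS.tm (e g) (J (TR.wt [b]))) (TS.tm (J (TR.wt w)) (e h))"
    by (simp only: TS.tm_assoc TS.tm_closed J_T[OF w] e_T)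
  also have "\<dots> = (\<Sum>k\<in>UNIV. TS.tm (J (TR.wt [pr (g - k) b])) (TS.tm (TS.tm (e k) (J (TR.wt w))) (e h)))"
    unfolding e_J[OF i] TS.tm_sum(1) by (simp only: TS.tm_assoc TS.tm_closed J_T[OF w] e_T)
  finally show ?case
    using Cons by (simp only:) (intro add_subgroup_sum[OF right_span_subgroup] right_span_J JT, simp)
qed

lemma e_span:
  assumes y: "y \<in> right_span"
  shows "TS.tm (e g) y \<in> right_span"
proof -
  obtain t where t: "\<forall>h. t h \<in> TR.T" "y = (\<Sum>h\<in>UNIV. TS.tm (J (t h)) (e h))"
    using y unfolding right_span_def by blast
  have *: "TS.tm (TS.tm (e g) (J s)) (e h) \<in> right_span" if "s \<in> TR.T" for s h
    using that
  proof (induction rule: TR.T_induct)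
    case zero
    show ?case
      by (simp only: additive_on_zero[OF add_subgroup_UNIV word_map_add] TS.tm_zero TS.tm_zero(2)[OF e_T]
          add_subgroup_zero[OF right_span_subgroup])
  next
    case (diff r s)
    then show ?case
      by (simp only: additive_on_diff[OF add_subgroup_UNIV word_map_add UNIV_I UNIV_I] TS.tm_diff(2)[OF e_T]
          J_T TS.tm_diff(1) add_subgroup_diff[OF right_span_subgroup])
  next
    case (word w)
    then show ?case by (rule e_J_e)
  qed
  have "TS.tm (e g) y = (\<Sum>h\<in>UNIV. TS.tm (e g) (TS.tm (J (t h)) (e h)))"
    unfolding t(2) by (rule TS.tm_sum(2)[OF e_T]) (simp only: TS.tm_closed J_T t(1) e_T)
  also have "\<dots> = (\<Sum>h\<in>UNIV. TS.tm (TS.tm (e g) (J (t h))) (e h))"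
    by (simp only: TS.tm_assoc[OF e_T])
  finally show ?thesis
    using t(1) by (simp only:) (intro add_subgroup_sum[OF right_span_subgroup] *, simp)
qed

lemma wt_letter_smash:
  assumes i: "i \<in> {0, 1}" and s: "s \<in> smash_grading D i"
  shows "TS.wt [s] = (\<Sum>g\<in>UNIV. TS.tm (J (TR.wt [s g])) (e g))"
proof -
  have sg: "s g \<in> N_part D i" for g using s by (simp add: smash_grading_def)
  have "TS.wt [\<Sum>g\<in>UNIV. pt g (s g)] = (\<Sum>g\<in>UNIV. TS.wt [pt g (s g)])"
    using TS.wt_sum[OF i, of UNIV "\<lambda>g. pt g (s g)" "[]" "[]"] pt_grading[OF sg] by simp
  moreover have "TS.wt [pt g (s g)] = TS.tm (J (TR.wt [s g])) (e g)" for g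
  proof -
    have "(\<lambda>_. s g) \<in> smash_grading D 0 \<union> smash_grading D 1"
      using i sg[of g] by (auto simp: smash_grading_def)
    then show ?thesis
      using TS.wt_right[OF pt_grading[OF TR.one_D], of "\<lambda>_. s g" "[]" g "[]"]
      by (simp add: J_word TS.wt_mult cst_mult_idem)
  qed
  ultimately show ?thesis by (simp only: sum_pt)
qed

lemma T_smash: "TS.T = right_span"
proof
  have "TS.wt w \<in> right_span" if "w \<in> lists (smash_grading D 0 \<union> smash_grading D 1)" for w
    using that
  proof (induction rule: lists.induct)
    case Nil
    have "TS.wt [] = TS.wt [alg_one S]" using TS.wt_one[of "[]" "[]"] by simp
    also have "\<dots> = (\<Sum>g\<in>UNIV. TS.tm (J (TR.wt [alg_one S g])) (e g))"
      by (rule wt_letter_smash[of 0]) (simp, rule TS.one_D)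
    finally show ?case
      using TR.one_D
      by (simp only:) (intro add_subgroup_sum[OF right_span_subgroup] J_e_span TR.wt_T, simp)
  next
    case (Cons s w)
    then obtain i where i: "i \<in> {0, 1}" "s \<in> smash_grading D i" by auto
    have w: "TS.wt w \<in> TS.T" by (rule TS.wt_T[OF Cons.hyps(2)])
    have "TS.wt (s # w) = TS.tm (TS.wt [s]) (TS.wt w)" by (simp add: TS.wt_mult)
    also have "\<dots> = (\<Sum>g\<in>UNIV. TS.tm (J (TR.wt [s g])) (TS.tm (e g) (TS.wt w)))"
      unfolding wt_letter_smash[OF i] TS.tm_sum(1) by (simp only: TS.tm_assoc w)
    finally have sum: "TS.wt (s # w) = (\<Sum>g\<in>UNIV. TS.tm (J (TR.wt [s g])) (TS.tm (e g) (TS.wt w)))" .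
    have "TR.wt [s g] \<in> TR.T" for g
      by (rule TR.wt_T) (use i in \<open>auto simp: smash_grading_def\<close>)
    then show ?case
      unfolding sum by (intro add_subgroup_sum[OF right_span_subgroup] right_span_J e_span Cons.IH)
  qed
  then have "{TS.wt w |w. w \<in> lists (smash_grading D 0 \<union> smash_grading D 1)} \<subseteq> right_span" by blast
  then show "TS.T \<subseteq> right_span"
    unfolding tensor_algebra_def[of S, THEN eq_reflection]
    by (rule hull_minimal[where S = add_subgroup]) (rule right_span_subgroup)
  show "right_span \<subseteq> TS.T"
  proof
    fix x assume "x \<in> right_span"
    then obtain t where t: "\<forall>h. t h \<in> TR.T" "x = (\<Sum>h\<in>UNIV. TS.tm (J (t h)) (e h))"
      unfolding right_span_def by blast
    show "x \<in> TS.T"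
      unfolding t(2) by (rule add_subgroup_sum[OF TS.T_subgroup]) (simp only: TS.tm_closed J_T t(1) e_T)
  qed
qed

text \<open>The value of \<open>mu\<close> has the products of the single \<open>t h\<close> as its
  coefficients, so surjectivity and kernel of the product map of \<open>S\<close> are read off
  coefficient by coefficient.\<close>

lemma mu_right_span:
  assumes "\<forall>h. t h \<in> TR.T"
  shows "TS.mu (\<Sum>h\<in>UNIV. TS.tm (J (t h)) (e h)) = (\<lambda>h. TR.mu (t h))"
proof -
  have "TS.mu (\<Sum>h\<in>UNIV. TS.tm (J (t h)) (e h)) = (\<Sum>h\<in>UNIV. TS.mu (TS.tm (J (t h)) (e h)))"
    by (rule TS.mu_sum) (simp only: TS.tm_closed J_T assms e_T)
  also have "\<dots> = (\<Sum>h\<in>UNIV. pt h (TR.mu (t h)))"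
  proof (rule sum.cong[OF refl])
    fix h
    have "TS.mu (e h) = pt h (alg_one R)" by (simp add: TS.mu_word del: smash_simps)
    then show "TS.mu (TS.tm (J (t h)) (e h)) = pt h (TR.mu (t h))"
      using assms by (simp add: TS.mu_mult J_T e_T mu_J cst_mult_idem)
  qed
  finally show ?thesis by (simp only: sum_pt)
qed

text \<open>If a sum of terms t_h p_h has product 0, each t_h has product 0 over \<open>R\<close>
  and so lies in the ideal of \<open>X\<close>. Its image lies in the ideal generated by the images
  of \<open>X\<close>, and stays there under multiplication by p_h on the right.\<close>

lemma presented_smash:
  assumes P: "TR.presented d X"
  shows "TS.presented d (J ` X)"
  unfolding TS.presented_def
proof (intro conjI)
  have X: "X \<subseteq> TR.TP d" and onto: "TR.mu ` TR.T = UNIV" and ker: "{t \<in> TR.T. TR.mu t = 0} = TR.ideal X"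
    using P unfolding TR.presented_def by blast+
  have XT: "X \<subseteq> TR.T" using X TR.TP_T by (rule subset_trans)
  show JX: "J ` X \<subseteq> TS.TP d" using image_mono[OF X] J_TP by (rule subset_trans)
  have JXT: "J ` X \<subseteq> TS.T" using JX TS.TP_T by (rule subset_trans)
  have "s \<in> TS.mu ` TS.T" for s
  proof -
    have "\<forall>h. \<exists>t\<in>TR.T. s h = TR.mu t" using onto by (metis UNIV_I image_iff)
    then obtain t where t: "\<forall>h. t h \<in> TR.T" "\<forall>h. s h = TR.mu (t h)" by metis
    have "s = TS.mu (\<Sum>h\<in>UNIV. TS.tm (J (t h)) (e h))"
      unfolding mu_right_span[OF t(1)] by (rule ext) (simp only: t(2))
    moreover have "(\<Sum>h\<in>UNIV. TS.tm (J (t h)) (e h)) \<in> TS.T"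
      unfolding T_smash right_span_def using t(1) by blast
    ultimately show ?thesis by blast
  qed
  then show "TS.mu ` TS.T = UNIV" by blast
  have "TS.ideal (J ` X) \<subseteq> {t \<in> TS.T. TS.mu t = 0}"
  proof (rule TS.mu_ideal[OF JXT])
    fix y assume "y \<in> J ` X"
    then obtain x where x: "x \<in> X" "y = J x" by blast
    then have "x \<in> {t \<in> TR.T. TR.mu t = 0}" unfolding ker using TR.ideal_inc[OF XT] by simp
    then show "TS.mu y = 0" by (simp only: x(2) mu_J mem_Collect_eq zero_fun_def)
  qed
  moreover have "t \<in> TS.ideal (J ` X)" if t: "t \<in> TS.T" "TS.mu t = 0" for t
  proof -
    obtain u where u: "\<forall>h. u h \<in> TR.T" "t = (\<Sum>h\<in>UNIV. TS.tm (J (u h)) (e h))"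
      using t(1) unfolding T_smash right_span_def by blast
    have "TR.mu (u h) = 0" for h
      using t(2) unfolding u(2) mu_right_span[OF u(1)] by (simp add: fun_eq_iff)
    then have "u h \<in> TR.ideal X" for h using u(1) ker by blast
    then have "J (u h) \<in> TS.ideal (J ` X)" for h by (rule J_ideal[OF XT])
    then have "TS.tm (J (u h)) (e h) \<in> TS.ideal (J ` X)" for h
      by (rule TS.ideal_right[OF JXT _ e_T])
    then show ?thesis unfolding u(2) by (intro add_subgroup_sum[OF TS.ideal_subgroup])
  qed
  ultimately show "{t \<in> TS.T. TS.mu t = 0} = TS.ideal (J ` X)" by blast
qed

end

lemma homogeneous_smash:
  assumes N0: "N_part D 0 = range (\<lambda>c. alg_scale R c (alg_one R))" and H: "homogeneous d R (N_part D)"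
  shows "homogeneous d S (smash_grading D)"
proof -
  have grN: "graded_algebra R (N_part D)" using H by (simp add: homogeneous_def)
  interpret TR: tens_alg R "N_part D" by unfold_locales (rule grN)
  interpret TS: tens_alg S "smash_grading D" by unfold_locales (rule graded_smash)
  show ?thesis
    unfolding TS.homogeneous_iff_presented
  proof (intro conjI allI)
    note h = H[unfolded TR.homogeneous_iff_presented]
    show "semisimple_subring S (smash_grading D 0)" by (rule smash_semisimple[OF N0])
    show "finite_dim S (smash_grading D i)" for i by (rule smash_finite_dim) (use h in simp)
    show "smash_grading D (i + j) = add_subgroup hull {a \<cdot>\<^bsub>S\<^esub> b |a b. a \<in> smash_grading D i \<and> b \<in> smash_grading D j}" for i j
      by (rule smash_products_generate) (rule h[THEN conjunct2, THEN conjunct2, THEN conjunct1, rule_format])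
    show "2 \<le> d" using h by (elim conjE)
    obtain X where "TR.presented d X" using h by (elim conjE exE)
    then have "TS.presented d (J ` X)" by (rule presented_smash[OF grN])
    then show "\<exists>X. TS.presented d X" by (rule exI)
  qed
qed

end

theorem corollary3p4:
  fixes R :: "('k::{alg_closed_field, field_char_0}, 'r::ab_group_add) alg"
    and D :: "nat \<times> 'g::{finite, group_add} \<Rightarrow> 'r set"
    and d p :: nat
  assumes "graded_algebra R D"
    and "alg_one R \<noteq> 0"
    and "D (0, 0) = range (\<lambda>c. alg_scale R c (alg_one R))"
    and "\<And>g. g \<noteq> 0 \<Longrightarrow> D (0, g) = {0}"
    and "\<And>i. finite_dim R (N_part D i)"
    and "koszul d R (N_part D)"
    and "calabi_yau_G p R D"
  shows "koszul d (smash R D) (smash_grading D) \<and> calabi_yau p (smash R D) (smash_grading D)"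
proof -
  interpret smash_loc R D by unfold_locales (rule assms(1))
  \<comment> \<open>Away from the identity these spaces are 0, so the part of numerical degree 0
    consists of the scalars.\<close>
  have "D (0, g) \<subseteq> D (0, 0)" for g
    using assms(4)[of g] add_subgroup_zero[OF direct_sum_add_subgroup[OF ds], of "(0, 0)"] by (cases "g = 0") auto
  then have "(\<Union>g. D (0, g)) = D (0, 0)" by blast
  moreover have "add_subgroup hull D (0, 0) = D (0, 0)"
    by (rule hull_same) (rule direct_sum_add_subgroup[OF ds])
  ultimately have N0: "N_part D 0 = range (\<lambda>c. alg_scale R c (alg_one R))"
    by (simp add: N_part_hull[OF ds] assms(3))
  have "homogeneous d S (smash_grading D)"
    using assms(6) by (intro homogeneous_smash[OF N0]) (simp add: koszul_def)
  moreover note koszul_resolution[OF N0 assms(6)[unfolded koszul_def, THEN conjunct2]]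
  ultimately have "koszul d S (smash_grading D)" unfolding koszul_def by (rule conjI)
  then show ?thesis using calabi_yau_smash[OF assms(7)] by (rule conjI)
qed

end
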